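(* Let $T=(\mathbb R/\mathbb Z)^{2n}$ with $B+i\omega=\sum_{j,k}\tau_{jk}\,dr_j\wedge d\theta_k$. Let $L,L'$ be linear Lagrangian branes in $(T,B+i\omega)$ which are mirror to line bundles $\mathcal L,\mathcal L'$ on the mirror complex torus $E$, and let $\boldsymbol L,\boldsymbol L'$ be their lifts in the twisted doubling torus. Suppose $\mathcal L'\otimes\mathcal L^{-1}$ is ample. Then the "u-part" Floer cohomology $HF_u^*(\boldsymbol L,\boldsymbol L')$ is isomorphic to $HF^*(L,L')$. Moreover, for two such pairs $L,L'$ and $L',L''$ (so that $\mathcal L'\otimes\mathcal L^{-1}$ and $\mathcal L''\otimes\mathcal L'^{-1}$ are both ample), there are isomorphisms $HF^*(L,L')\cong HF_u^*(\boldsymbol L,\boldsymbol L')$, $HF^*(L',L'')\cong HF_u^*(\boldsymbol L',\boldsymbol L'')$ and $HF^*(L,L'')\cong HF_u^*(\boldsymbol L,\boldsymbol L'')$ making the following diagram commute: $$\begin{array}{ccc}HF^*(L',L'')\otimes HF^*(L,L')&\xrightarrow{\ \mu^2\ }&HF^*(L,L'')\\ \downarrow\cong&&\downarrow\cong\\ HF_u^*(\boldsymbol L',\boldsymbol L'')\otimes HF_u^*(\boldsymbol L,\boldsymbol L')&\xrightarrow{\ \mu^2_u\ }&HF_u^*(\boldsymbol L,\boldsymbol L'').\end{array}$$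
   Context: **Setting.** $\tau\in M_{n\times n}(\mathbb C)$ with $\operatorname{Im}\tau$ invertible and $\tau$ invertible (equivalently $\mathrm{Id}+(\omega^{-1}B)^2$ is invertible, a standing assumption). $V=\mathbb R^{2n}$, $\Lambda=\mathbb Z^{2n}$, $T=V/\Lambda$ with coordinates $(r,\theta)$, fibred by the tori $\{r\}\times T^n_\theta$. The mirror is $E=\mathbb C^n/(\mathbb Z^n+\tau^T\mathbb Z^n)$ with coordinate $z=\tau^Tr-\phi$, parametrizing fibres with connection $d+2\pi i\,\phi\,d\theta$. 2-forms are also viewed as maps $u\mapsto\iota_u$. **Branes.** A linear Lagrangian brane in a linear torus with form $B+i\omega$ is a linear Lagrangian submanifold with a complex line bundle and unitary connection $\nabla$ of curvature $-2\pi iF$ with $F=-B|_L$. The branes mirror to line bundles are those supported on $L=\{\theta=-Dr+c\}$ with $D\in M_n(\mathbb Z)$, $c\in(\mathbb R/\mathbb Z)^n$, such that $\operatorname{Im}\tau\,D$ is symmetric and $\operatorname{Re}\tau\,D-D^T\operatorname{Re}\tau^T$ is an integer matrix, with such a connection. The fibre of the mirror line bundle at $z$ is $CF^*(L_z,L)$, where $L_z$ is the fibre brane corresponding to $z$; its first Chern class is represented by $\frac i2\sum_{j,k}\big((\operatorname{Im}\tau)^{-1}D^T\big)_{jk}dz_j\wedge d\bar z_k$. Hence for $L=\{\theta=-Dr+c\}$, $L'=\{\theta=-D'r+c'\}$, the bundle $\mathcal L'\otimes\mathcal L^{-1}$ is ample iff the symmetric matrix $\operatorname{Im}\tau\,(D'-D)$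 is positive definite. **Twisted doubling torus.** $T^\vee=V^\vee/\Lambda^\vee$ with $\Lambda^\vee=\mathrm{Hom}(\Lambda,\mathbb Z)$; $T\times T^\vee$ carries the symplectic form $$\Omega=\tfrac12\begin{pmatrix}\omega+B\omega^{-1}B&B\omega^{-1}\\-\omega^{-1}B&-\omega^{-1}\end{pmatrix},$$ i.e. $\Omega(u_1+f_1,u_2+f_2)=\frac12\big[\omega(u_1,u_2)+(f_1+Bu_1)\big(\omega^{-1}(f_2+Bu_2)\big)\big]$ for $u_i\in V$, $f_i\in V^\vee$, and the B-field $\sigma_0=\sum_j\frac12dx_j\wedge d\hat x_j$ ($x_j$ coordinates on $T$, $\hat x_j$ dual coordinates). **Lift.** For a brane $(L,\nabla)$ fix $\xi:H_1(L;\mathbb Z)\to\mathbb Z/2$ with $\xi(\gamma+\gamma')-\xi(\gamma)-\xi(\gamma')=c_1(\nabla)(\gamma\wedge\gamma')\bmod 2$. The lift is $$\boldsymbol L=\{(x,\hat x):x\in L,\ e^{2\pi i\hat x(\gamma)}=(-1)^{\xi(\gamma)}hol_\nabla(\gamma_x)\ \ \forall\gamma\in\pi_1(L,x)\},$$ with $\gamma_x$ the linear loop through $x$ in class $\gamma$, equipped with the connection $\pi_T^*\nabla$ (the pullback under $\pi_T:T\times T^\vee\to T$). It is a linear Lagrangian brane in $(T\times T^\vee,\sigma_0+i\Omega)$. (For a connection $d+A$, parallel transport along a path is multiplication by $e^{-\int A}$.) **Floer cohomology and product.** For transverse linear Lagrangian branes $(L,\nabla),(L',\nabla')$ in a linear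 torus $W/\Gamma$ with form $B+i\omega$, $HF^*(L,L')=CF^*(L,L')=\bigoplus_{x\in L\cap L'}\mathrm{Hom}(\mathcal E_x,\mathcal E'_x)$, where $\mathcal E,\mathcal E'$ are the line bundles of the branes (the differential vanishes). For pairwise transverse $L,L',L''$, the product $\mu^2:HF^*(L',L'')\otimes HF^*(L,L')\to HF^*(L,L'')$ counts flat triangles: for $a\in\mathrm{Hom}(\mathcal E_x,\mathcal E'_x)$ and $b\in\mathrm{Hom}(\mathcal E'_y,\mathcal E''_y)$, $$\mu^2(b,a)=\sum_\triangle e^{2\pi i\int_\triangle(B+i\omega)}\;P''_{q\to w}\circ b\circ P'_{p\to q}\circ a\circ P_{w\to p},$$ the sum running over flat triangles in $W$ modulo $\Gamma$ with vertices $p,q,w$ lying over $x\in L\cap L'$, $y\in L'\cap L''$ and a point of $L\cap L''$, with edge $wp$ on a lift of $L$, $pq$ on a lift of $L'$, $qw$ on a lift of $L''$. Here $\int_\triangle(B+i\omega)=\frac12(B+i\omega)(q-p,w-p)$ and $P,P',P''$ are parallel transports along the edges. This applies both to $(T,B+i\omega)$ and to $(T\times T^\vee,\sigma_0+i\Omega)$. **u-part.** Let $L=\{\theta=-Dr+c\}$, $L'=\{\theta=-D'r+c'\}$ be transverse. Then $L\cap L'$ is indexed by $k\in\mathbb Z^n/(D'-D)\mathbb Z^n$, and the points of $\boldsymbol L\cap\boldsymbol L'$ lying over the $k$-th point $x_k$ are indexed by $l\in\mathbb Z^n/(D'-D)^T\mathbb Z^n$. Choosing a generator $s_k$ of $\mathrm{Hom}(\mathcal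 E_{x_k},\mathcal E'_{x_k})$, let $s_{k,l}\in HF^*(\boldsymbol L,\boldsymbol L')$ be the generator at the $(k,l)$-th point given by the same element $s_k$ (the lifted bundles are pulled back from $T$). Define $$HF_u^*(\boldsymbol L,\boldsymbol L')=\mathrm{span}_{\mathbb C}\Big\{\sum_ls_{k,l}\Big\}_k\subset HF^*(\boldsymbol L,\boldsymbol L'),$$ $$\Pi_T:HF^*(\boldsymbol L,\boldsymbol L')\to HF_u^*(\boldsymbol L,\boldsymbol L'),\qquad s_{k,h}\mapsto\frac1{|\det(D'-D)|}\sum_ls_{k,l},$$ and $\mu^2_u(x\otimes y)=\Pi_T(\mu^2(x,y))$ for $x\in HF_u^*(\boldsymbol L',\boldsymbol L'')$, $y\in HF_u^*(\boldsymbol L,\boldsymbol L')$, where $\mu^2$ is the Floer product in $T\times T^\vee$.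
   Formalization: The product diagram is proved for every choice of the signs ξ for which μ²_u is not identically zero, and for some choice of ξ for every triple of branes; for arbitrary fixed ξ it fails when n≥2, since a theta-constant factor in μ²_u can vanish. *)

theory Defs
  imports "HOL-Analysis.Analysis" "HOL-Library.Function_Algebras"
begin

section \<open>Linear tori\<close>

text \<open>A linear torus is \<open>W/\<Gamma>\<close> with \<open>W\<close> a Euclidean space and \<open>\<Gamma>\<close> the lattice of vectors with integral
  coordinates. Subsets of the torus are represented by their preimages in \<open>W\<close>, and points of the torus
  by cosets of \<open>\<Gamma>\<close>. On a product type, \<open>\<Gamma>\<close> is the product of the lattices.\<close>

definition int_lattice :: "'w::euclidean_space set"
  where "int_lattice = {x. \<forall>b\<in>Basis. x \<bullet> b \<in> \<int>}"

definition tpoint :: "'w::euclidean_space \<Rightarrow> 'w set"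
  where "tpoint x = {x + \<gamma> | \<gamma>. \<gamma> \<in> int_lattice}"

definition tangent :: "'w::euclidean_space set \<Rightarrow> 'w set"
  where "tangent S = {v. \<forall>p\<in>S. \<forall>t. p + t *\<^sub>R v \<in> S}"

text \<open>\<open>\<Phi>\<close> is the translation-invariant form \<open>B + i\<omega>\<close>. The condition \<open>span (U \<inter> int_lattice) = U\<close> says that
  the image of \<open>p + U\<close> in the torus is a closed submanifold.\<close>

definition linear_lagrangian :: "('w::euclidean_space \<Rightarrow> 'w \<Rightarrow> complex) \<Rightarrow> 'w set \<Rightarrow> bool"
  where "linear_lagrangian \<Phi> S \<longleftrightarrow>
    (\<exists>p U. subspace U \<and> span (U \<inter> int_lattice) = U \<and> 2 * dim U = DIM('w)
      \<and> (\<forall>u\<in>U. \<forall>v\<in>U. Im (\<Phi> u v) = 0)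
      \<and> S = {p + u + \<gamma> | u \<gamma>. u \<in> U \<and> \<gamma> \<in> int_lattice})"


section \<open>Line bundles with unitary connection\<close>

text \<open>The components of the preimage \<open>S\<close> of a linear submanifold are affine spaces, so every Hermitian
  line bundle on the submanifold is the quotient of \<open>S \<times> \<complex>\<close> by an action
  \<open>\<gamma> \<cdot> (p, z) = (p + \<gamma>, m \<gamma> p * z)\<close> of the lattice. A unitary connection on it is
  \<open>d + A\<close> with an imaginary one-form \<open>A\<close> on \<open>S\<close> for which the action is parallel, that is,
  \<open>A (p + \<gamma>) = A p - d (m \<gamma>) / m \<gamma>\<close>. Here \<open>A p v\<close> and \<open>m \<gamma> p\<close> are relevant only for \<open>p \<in> S\<close>,
  \<open>v \<in> tangent S\<close> and \<open>\<gamma> \<in> int_lattice\<close>.\<close>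

text \<open>All iterated directional derivatives along \<open>S\<close> exist and are continuous; \<open>F vs\<close> is the derivative
  in the directions \<open>vs\<close>.\<close>

definition smooth_along :: "'w::euclidean_space set \<Rightarrow> ('w \<Rightarrow> complex) \<Rightarrow> bool"
  where "smooth_along S f \<longleftrightarrow>
    (\<exists>F. (\<forall>p\<in>S. F [] p = f p) \<and>
      (\<forall>vs. continuous_on S (F vs) \<and>
        (\<forall>v\<in>tangent S. \<forall>p\<in>S. ((\<lambda>t. F vs (p + t *\<^sub>R v)) has_vector_derivative F (v # vs) p) (at 0))))"

definition unitary_line_bundle ::
    "'w::euclidean_space set \<Rightarrow> ('w \<Rightarrow> 'w \<Rightarrow> complex) \<Rightarrow> ('w \<Rightarrow> 'w \<Rightarrow> complex) \<Rightarrow> bool"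
  where "unitary_line_bundle S A m \<longleftrightarrow>
    (\<forall>\<gamma>\<in>int_lattice. smooth_along S (m \<gamma>) \<and> (\<forall>p\<in>S. cmod (m \<gamma> p) = 1)) \<and>
    (\<forall>\<gamma>\<in>int_lattice. \<forall>\<gamma>'\<in>int_lattice. \<forall>p\<in>S. m (\<gamma> + \<gamma>') p = m \<gamma> (p + \<gamma>') * m \<gamma>' p) \<and>
    (\<forall>v\<in>tangent S. smooth_along S (\<lambda>p. A p v)) \<and>
    (\<forall>p\<in>S. \<forall>u\<in>tangent S. \<forall>v\<in>tangent S. A p (u + v) = A p u + A p v) \<and>
    (\<forall>p\<in>S. \<forall>v\<in>tangent S. \<forall>t. A p (t *\<^sub>R v) = of_real t * A p v) \<and>
    (\<forall>p\<in>S. \<forall>v\<in>tangent S. Re (A p v) = 0) \<and>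
    (\<forall>\<gamma>\<in>int_lattice. \<forall>p\<in>S. \<forall>v\<in>tangent S.
      ((\<lambda>t. m \<gamma> (p + t *\<^sub>R v)) has_vector_derivative (A p v - A (p + \<gamma>) v) * m \<gamma> p) (at 0))"

definition curvature :: "('w::euclidean_space \<Rightarrow> 'w \<Rightarrow> complex) \<Rightarrow> 'w \<Rightarrow> 'w \<Rightarrow> 'w \<Rightarrow> complex"
  where "curvature A p u v =
    vector_derivative (\<lambda>t. A (p + t *\<^sub>R u) v) (at 0) - vector_derivative (\<lambda>t. A (p + t *\<^sub>R v) u) (at 0)"


section \<open>Branes\<close>

record 'w brane =
  supp :: "'w set"
  conn :: "'w \<Rightarrow> 'w \<Rightarrow> complex"
  mult :: "'w \<Rightarrow> 'w \<Rightarrow> complex"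

definition brane_F :: "('w \<Rightarrow> 'w \<Rightarrow> complex) \<Rightarrow> 'w \<Rightarrow> 'w \<Rightarrow> real"
  where "brane_F \<Phi> u v = - Re (\<Phi> u v)"

definition linear_lagrangian_brane ::
    "('w::euclidean_space \<Rightarrow> 'w \<Rightarrow> complex) \<Rightarrow> 'w brane \<Rightarrow> bool"
  where "linear_lagrangian_brane \<Phi> L \<longleftrightarrow>
    linear_lagrangian \<Phi> (supp L) \<and> unitary_line_bundle (supp L) (conn L) (mult L) \<and>
    (\<forall>p\<in>supp L. \<forall>u\<in>tangent (supp L). \<forall>v\<in>tangent (supp L).
      curvature (conn L) p u v = - 2 * of_real pi * \<i> * of_real (brane_F \<Phi> u v))"

definition transport :: "'w::euclidean_space brane \<Rightarrow> 'w \<Rightarrow> 'w \<Rightarrow> complex"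
  where "transport L p q = exp (- integral {0..1} (\<lambda>t. conn L (p + t *\<^sub>R (q - p)) (q - p)))"

definition H1 :: "'w::euclidean_space brane \<Rightarrow> 'w set"
  where "H1 L = int_lattice \<inter> tangent (supp L)"

text \<open>Holonomy along the linear loop in class \<open>\<gamma>\<close> through the point represented by \<open>p\<close>: transport from
  the fibre at \<open>p\<close> to the fibre at \<open>p + \<gamma>\<close>, which is identified with the fibre at \<open>p\<close> by \<open>mult L \<gamma> p\<close>.\<close>

definition hol :: "'w::euclidean_space brane \<Rightarrow> 'w \<Rightarrow> 'w \<Rightarrow> complex"
  where "hol L p \<gamma> = transport L p (p + \<gamma>) / mult L \<gamma> p"


section \<open>Floer cohomology of transverse branes\<close>

text \<open>An element of \<open>\<Oplus>\<^sub>x Hom(E\<^sub>x, E'\<^sub>x)\<close> is given by its values in the trivialisations at all \<open>p\<close> lying over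
  intersection points; the equivariance condition says that the values at \<open>p\<close> and \<open>p + \<gamma>\<close> are
  the same homomorphism. Outside of the intersection the value is 0 by convention.\<close>

definition HF :: "'w::euclidean_space brane \<Rightarrow> 'w brane \<Rightarrow> ('w \<Rightarrow> complex) set"
  where "HF L L' = {h. (\<forall>p. p \<notin> supp L \<inter> supp L' \<longrightarrow> h p = 0) \<and>
    (\<forall>p\<in>supp L \<inter> supp L'. \<forall>\<gamma>\<in>int_lattice. h (p + \<gamma>) * mult L \<gamma> p = mult L' \<gamma> p * h p)}"

definition int_points :: "'w::euclidean_space brane \<Rightarrow> 'w brane \<Rightarrow> 'w set set"
  where "int_points L L' = tpoint ` (supp L \<inter> supp L')"

text \<open>The summand \<open>Hom(E\<^sub>x, E'\<^sub>x)\<close> for \<open>x = X\<close>.\<close>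

definition HF_at :: "'w::euclidean_space brane \<Rightarrow> 'w brane \<Rightarrow> 'w set \<Rightarrow> ('w \<Rightarrow> complex) set"
  where "HF_at L L' X = {h \<in> HF L L'. \<forall>p. h p \<noteq> 0 \<longrightarrow> tpoint p = X}"

text \<open>A class modulo \<open>\<Gamma>\<close> of flat triangles whose last vertex lies over the point represented by \<open>w\<close> has
  exactly one member whose last vertex is \<open>w\<close>. An edge lies on a lift of \<open>L\<close>, i.e. on a component of
  \<open>supp L\<close>, iff it is contained in \<open>supp L\<close>.\<close>

definition triangles :: "'w::euclidean_space brane \<Rightarrow> 'w brane \<Rightarrow> 'w brane \<Rightarrow> 'w \<Rightarrow> ('w \<times> 'w) set"
  where "triangles L L' L'' w = {(p, q). closed_segment w p \<subseteq> supp L \<and>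
    closed_segment p q \<subseteq> supp L' \<and> closed_segment q w \<subseteq> supp L''}"

definition mu2 :: "('w::euclidean_space \<Rightarrow> 'w \<Rightarrow> complex) \<Rightarrow> 'w brane \<Rightarrow> 'w brane \<Rightarrow> 'w brane \<Rightarrow>
    ('w \<Rightarrow> complex) \<Rightarrow> ('w \<Rightarrow> complex) \<Rightarrow> 'w \<Rightarrow> complex"
  where "mu2 \<Phi> L L' L'' b a w =
    (\<Sum>\<^sub>\<infinity>(p, q)\<in>triangles L L' L'' w.
      exp (2 * of_real pi * \<i> * (\<Phi> (q - p) (w - p) / 2)) *
      transport L'' q w * b q * transport L' p q * a p * transport L w p)"


section \<open>Complex vector spaces of functions\<close>

definition cscale :: "complex \<Rightarrow> ('w \<Rightarrow> complex) \<Rightarrow> 'w \<Rightarrow> complex"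
  where "cscale c h = (\<lambda>x. c * h x)"

global_interpretation cfun: vector_space cscale
  by standard (auto simp: cscale_def fun_eq_iff algebra_simps)

definition linear_iso ::
    "(('v \<Rightarrow> complex) \<Rightarrow> 'w \<Rightarrow> complex) \<Rightarrow> ('v \<Rightarrow> complex) set \<Rightarrow> ('w \<Rightarrow> complex) set \<Rightarrow> bool"
  where "linear_iso f X Y \<longleftrightarrow> bij_betw f X Y \<and>
    (\<forall>g\<in>X. \<forall>h\<in>X. f (g + h) = f g + f h) \<and> (\<forall>c. \<forall>h\<in>X. f (cscale c h) = cscale c (f h))"


section \<open>The torus, its mirror and the twisted doubling torus\<close>

text \<open>Elements of \<open>V\<close> are pairs \<open>(r, \<theta>)\<close>. The dual space of \<open>V\<close> is identified with \<open>V\<close> by the dual coordinates,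
  i.e. the covector \<open>f\<close> is \<open>v \<mapsto> f \<bullet> v\<close>; its lattice \<open>Hom(\<Lambda>, \<int>)\<close> then is \<open>int_lattice\<close>.\<close>

type_synonym 'n V = "(real^'n) \<times> (real^'n)"

definition Re_mat :: "complex^'n^'n \<Rightarrow> real^'n^'n"
  where "Re_mat \<tau> = (\<chi> i j. Re (\<tau> $ i $ j))"

definition Im_mat :: "complex^'n^'n \<Rightarrow> real^'n^'n"
  where "Im_mat \<tau> = (\<chi> i j. Im (\<tau> $ i $ j))"

definition real_mat :: "int^'n^'n \<Rightarrow> real^'n^'n"
  where "real_mat D = (\<chi> i j. real_of_int (D $ i $ j))"

text \<open>\<open>\<Sum>\<^sub>j\<^sub>k \<tau>\<^sub>j\<^sub>k dr\<^sub>j \<and> d\<theta>\<^sub>k\<close>\<close>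

definition torus_form :: "complex^'n^'n \<Rightarrow> 'n::finite V \<Rightarrow> 'n V \<Rightarrow> complex"
  where "torus_form \<tau> u v = (\<Sum>j\<in>UNIV. \<Sum>k\<in>UNIV.
    \<tau> $ j $ k * of_real (fst u $ j * snd v $ k - fst v $ j * snd u $ k))"

definition contract :: "('w::euclidean_space \<Rightarrow> 'w \<Rightarrow> real) \<Rightarrow> 'w \<Rightarrow> 'w"
  where "contract \<beta> u = (\<Sum>b\<in>Basis. \<beta> u b *\<^sub>R b)"

definition doubled_Omega :: "complex^'n^'n \<Rightarrow> 'n::finite V \<times> 'n V \<Rightarrow> 'n V \<times> 'n V \<Rightarrow> real"
  where "doubled_Omega \<tau> x y =
    (let B = (\<lambda>u v. Re (torus_form \<tau> u v)); \<omega> = (\<lambda>u v. Im (torus_form \<tau> u v)) in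
      (\<omega> (fst x) (fst y) +
        (snd x + contract B (fst x)) \<bullet> inv (contract \<omega>) (snd y + contract B (fst y))) / 2)"

definition sigma0 :: "'v::real_inner \<times> 'v \<Rightarrow> 'v \<times> 'v \<Rightarrow> real"
  where "sigma0 x y = (fst x \<bullet> snd y - fst y \<bullet> snd x) / 2"

definition doubled_form :: "complex^'n^'n \<Rightarrow> 'n::finite V \<times> 'n V \<Rightarrow> 'n V \<times> 'n V \<Rightarrow> complex"
  where "doubled_form \<tau> x y = of_real (sigma0 x y) + \<i> * of_real (doubled_Omega \<tau> x y)"

text \<open>The branes supported on \<open>\<theta> = - D r + c\<close> which are mirror to line bundles; \<open>c\<close> represents a point of
  \<open>(\<real>/\<int>)\<^sup>n\<close>.\<close>

definition mirror_brane :: "complex^'n^'n \<Rightarrow> int^'n^'n \<Rightarrow> real^'n \<Rightarrow> 'n::finite V brane \<Rightarrow> bool"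
  where "mirror_brane \<tau> D c L \<longleftrightarrow>
    linear_lagrangian_brane (torus_form \<tau>) L \<and>
    supp L = {(r, \<theta>). \<theta> + real_mat D *v r - c \<in> int_lattice} \<and>
    transpose (Im_mat \<tau> ** real_mat D) = Im_mat \<tau> ** real_mat D \<and>
    (\<forall>i j. (Re_mat \<tau> ** real_mat D - transpose (real_mat D) ** transpose (Re_mat \<tau>)) $ i $ j \<in> \<int>)"

text \<open>The invariant form \<open>i/2 \<Sum>\<^sub>j\<^sub>k ((Im \<tau>)\<^sup>-\<^sup>1 D\<^sup>T)\<^sub>j\<^sub>k dz\<^sub>j \<and> d\<zbar>\<^sub>k\<close> representing the first Chern class of
  the mirror line bundle, and ampleness of \<open>\<L>' \<otimes> \<L>\<^sup>-\<^sup>1\<close>: the form of type (1,1) representing its first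
  Chern class is positive.\<close>

definition mirror_chern_form ::
    "complex^'n^'n \<Rightarrow> int^'n^'n \<Rightarrow> complex^'n::finite \<Rightarrow> complex^'n \<Rightarrow> complex"
  where "mirror_chern_form \<tau> D u v = \<i> / 2 * (\<Sum>j\<in>UNIV. \<Sum>k\<in>UNIV.
    of_real ((matrix_inv (Im_mat \<tau>) ** transpose (real_mat D)) $ j $ k) *
      (u $ j * cnj (v $ k) - v $ j * cnj (u $ k)))"

definition ample_quotient :: "complex^'n^'n \<Rightarrow> int^'n^'n \<Rightarrow> int^'n::finite^'n \<Rightarrow> bool"
  where "ample_quotient \<tau> D D' \<longleftrightarrow>
    (\<forall>v. v \<noteq> 0 \<longrightarrow> 0 < Re (mirror_chern_form \<tau> D' v (\<i> *s v) - mirror_chern_form \<tau> D v (\<i> *s v)))"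

text \<open>Equivalently, the symmetric matrix \<open>Im \<tau> (D' - D)\<close> is positive definite.\<close>

lemma mirror_chern_form_diag:
  "Re (mirror_chern_form \<tau> D v (\<i> *s v)) =
    (\<chi> j. Re (v $ j)) \<bullet> ((matrix_inv (Im_mat \<tau>) ** transpose (real_mat D)) *v (\<chi> j. Re (v $ j))) +
    (\<chi> j. Im (v $ j)) \<bullet> ((matrix_inv (Im_mat \<tau>) ** transpose (real_mat D)) *v (\<chi> j. Im (v $ j)))"
proof -
  define H where "H = matrix_inv (Im_mat \<tau>) ** transpose (real_mat D)"
  have "Re (mirror_chern_form \<tau> D v (\<i> *s v)) =
    (\<Sum>j\<in>UNIV. \<Sum>k\<in>UNIV. H $ j $ k * (Re (v$j) * Re (v$k) + Im (v$j) * Im (v$k)))"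
    unfolding mirror_chern_form_def H_def[symmetric] sum_distrib_left
    by (simp add: algebra_simps sum_distrib_left) 
  also have "\<dots> = (\<chi> j. Re (v $ j)) \<bullet> (H *v (\<chi> j. Re (v $ j))) + (\<chi> j. Im (v $ j)) \<bullet> (H *v (\<chi> j. Im (v $ j)))"
    by (simp add: inner_vec_def matrix_vector_mult_def sum_distrib_left sum.distrib algebra_simps)
  finally show ?thesis unfolding H_def .
qed

lemma matrix_diff_ldistrib:
  fixes A :: "real^'n^'m"
  shows "A ** (B - C) = A ** B - A ** C"
  by (simp add: matrix_matrix_mult_def vec_eq_iff right_diff_distrib sum_subtractf)

lemma ample_quotient_iff:
  fixes \<tau> :: "complex^'n::finite^'n"
  assumes inv: "invertible (Im_mat \<tau>)"
    and sym: "transpose (Im_mat \<tau> ** real_mat D) = Im_mat \<tau> ** real_mat D"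
      "transpose (Im_mat \<tau> ** real_mat D') = Im_mat \<tau> ** real_mat D'"
  shows "ample_quotient \<tau> D D' \<longleftrightarrow>
    (\<forall>x. x \<noteq> 0 \<longrightarrow> 0 < x \<bullet> ((Im_mat \<tau> ** (real_mat D' - real_mat D)) *v x))"
proof -
  define M where "M = Im_mat \<tau>"
  define N where "N = matrix_inv M"
  define E where "E = real_mat D' - real_mat D"
  define Q where "Q x = x \<bullet> ((N ** transpose E) *v x)" for x :: "real^'n"
  have NM: "N ** M = mat 1" "M ** N = mat 1"
    using someI_ex[of "\<lambda>N. M ** N = mat 1 \<and> N ** M = mat 1"] inv
    unfolding N_def matrix_inv_def M_def invertible_def by blast+
  have tE: "transpose E = transpose (real_mat D') - transpose (real_mat D)"
    by (simp add: E_def transpose_def vec_eq_iff)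
  have "transpose (M ** E) = M ** E"
    using sym by (simp add: M_def[symmetric] E_def matrix_diff_ldistrib transpose_def vec_eq_iff)
  then have "transpose E ** transpose M = M ** E" by (simp add: matrix_transpose_mul)
  then have "transpose E ** transpose M ** transpose N = M ** E ** transpose N" by simp
  moreover have tMN: "transpose M ** transpose N = mat 1"
    by (metis NM(1) matrix_transpose_mul transpose_mat)
  ultimately have tE2: "transpose E = M ** E ** transpose N"
    by (simp add: matrix_mul_assoc[symmetric])
  have Q: "Q x = (transpose N *v x) \<bullet> ((M ** E) *v (transpose N *v x))" for x
  proof -
    have "Q x = x \<bullet> (N *v ((M ** E) *v (transpose N *v x)))"
      unfolding Q_def tE2 by (simp only: matrix_vector_mul_assoc matrix_mul_assoc)
    then show ?thesis by (simp only: dot_lmul_matrix[symmetric] transpose_matrix_vector)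
  qed
  have diff: "Re (mirror_chern_form \<tau> D' v (\<i> *s v) - mirror_chern_form \<tau> D v (\<i> *s v)) =
      Q (\<chi> j. Re (v $ j)) + Q (\<chi> j. Im (v $ j))" for v
    unfolding minus_complex.sel mirror_chern_form_diag Q_def tE M_def[symmetric] N_def[symmetric]
    by (simp add: matrix_diff_ldistrib matrix_vector_mult_diff_rdistrib inner_diff_right)
  have "ample_quotient \<tau> D D' \<longleftrightarrow> (\<forall>x. x \<noteq> 0 \<longrightarrow> 0 < Q x)"
  proof
    assume a: "ample_quotient \<tau> D D'"
    show "\<forall>x. x \<noteq> 0 \<longrightarrow> 0 < Q x"
    proof (intro allI impI)
      fix x :: "real^'n" assume "x \<noteq> 0"
      define v :: "complex^'n" where "v = (\<chi> j. of_real (x $ j))"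
      have "v \<noteq> 0" using \<open>x \<noteq> 0\<close> by (auto simp: v_def vec_eq_iff)
      moreover have "(\<chi> j. Re (v $ j)) = x" "(\<chi> j. Im (v $ j)) = 0" by (auto simp: v_def vec_eq_iff)
      moreover have "Q 0 = 0" by (simp add: Q_def)
      ultimately show "0 < Q x" using a diff[of v] unfolding ample_quotient_def by (metis add.right_neutral)
    qed
  next
    assume p: "\<forall>x. x \<noteq> 0 \<longrightarrow> 0 < Q x"
    have nn: "0 \<le> Q x" for x using p by (cases "x = 0") (auto simp: Q_def less_imp_le)
    show "ample_quotient \<tau> D D'"
      unfolding ample_quotient_def diff
    proof (intro allI impI)
      fix v :: "complex^'n" assume "v \<noteq> 0"
      then have "(\<chi> j. Re (v $ j)) \<noteq> 0 \<or> (\<chi> j. Im (v $ j)) \<noteq> 0"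
        by (auto simp: vec_eq_iff complex_eq_iff)
      then show "0 < Q (\<chi> j. Re (v $ j)) + Q (\<chi> j. Im (v $ j))"
        using p nn by (metis add_pos_nonneg add_nonneg_pos)
    qed
  qed
  also have "\<dots> \<longleftrightarrow> (\<forall>y. y \<noteq> 0 \<longrightarrow> 0 < y \<bullet> ((M ** E) *v y))"
  proof
    assume p: "\<forall>x. x \<noteq> 0 \<longrightarrow> 0 < Q x"
    show "\<forall>y. y \<noteq> 0 \<longrightarrow> 0 < y \<bullet> ((M ** E) *v y)"
    proof (intro allI impI)
      fix y :: "real^'n" assume "y \<noteq> 0"
      have y: "transpose N *v (transpose M *v y) = y"
        by (metis NM(2) matrix_transpose_mul matrix_vector_mul_assoc matrix_vector_mul_lid transpose_mat)
      then have "transpose M *v y \<noteq> 0" using \<open>y \<noteq> 0\<close> by (metis matrix_vector_mult_0_right)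
      then show "0 < y \<bullet> ((M ** E) *v y)" using p Q[of "transpose M *v y"] y by metis
    qed
  next
    assume p: "\<forall>y. y \<noteq> 0 \<longrightarrow> 0 < y \<bullet> ((M ** E) *v y)"
    show "\<forall>x. x \<noteq> 0 \<longrightarrow> 0 < Q x"
    proof (intro allI impI)
      fix x :: "real^'n" assume "x \<noteq> 0"
      have "transpose M *v (transpose N *v x) = x"
        by (simp only: matrix_vector_mul_assoc tMN matrix_vector_mul_lid)
      then have "transpose N *v x \<noteq> 0" using \<open>x \<noteq> 0\<close> by (metis matrix_vector_mult_0_right)
      then show "0 < Q x" using p Q by metis
    qed
  qed
  finally show ?thesis by (simp add: M_def E_def)
qed


section \<open>Lifts and the u-part\<close>

text \<open>\<open>\<xi>\<close> takes values in \<open>\<int>\<close>, but only its parity is relevant. The number \<open>brane_F \<Phi> \<gamma> \<gamma>'\<close> is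
  \<open>c\<^sub>1(\<nabla>)(\<gamma> \<and> \<gamma>')\<close>, since the first Chern form of a connection is \<open>i/(2\<pi>)\<close> times its curvature.\<close>

definition lift_sign :: "('w::euclidean_space \<Rightarrow> 'w \<Rightarrow> complex) \<Rightarrow> 'w brane \<Rightarrow> ('w \<Rightarrow> int) \<Rightarrow> bool"
  where "lift_sign \<Phi> L \<xi> \<longleftrightarrow> (\<forall>\<gamma>\<in>H1 L. \<forall>\<gamma>'\<in>H1 L. \<exists>k::int.
    of_int (\<xi> (\<gamma> + \<gamma>') - \<xi> \<gamma> - \<xi> \<gamma>') = brane_F \<Phi> \<gamma> \<gamma>' + 2 * of_int k)"

definition lift :: "('v::euclidean_space \<Rightarrow> int) \<Rightarrow> 'v brane \<Rightarrow> ('v \<times> 'v) brane"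
  where "lift \<xi> L = \<lparr>
    supp = {(x, x'). x \<in> supp L \<and>
      (\<forall>\<gamma>\<in>H1 L. exp (2 * of_real pi * \<i> * of_real (x' \<bullet> \<gamma>)) = (-1) powi \<xi> \<gamma> * hol L x \<gamma>)},
    conn = (\<lambda>x v. conn L (fst x) (fst v)),
    mult = (\<lambda>\<gamma> x. mult L (fst \<gamma>) (fst x))\<rparr>"

definition points_over ::
    "('v::euclidean_space \<times> 'v) brane \<Rightarrow> ('v \<times> 'v) brane \<Rightarrow> 'v set \<Rightarrow> ('v \<times> 'v) set set"
  where "points_over M M' X = {Y \<in> int_points M M'. fst ` Y = X}"

text \<open>For \<open>s\<close> in the summand at the \<open>k\<close>-th point and \<open>Y\<close> the \<open>(k,l)\<close>-th point, \<open>gen_at Y s\<close> is the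
  element given by \<open>s\<close> at \<open>Y\<close>; for \<open>s = s\<^sub>k\<close> it is \<open>s\<^sub>k\<^sub>,\<^sub>l\<close>. Conversely, \<open>coeff_at Y h\<close> is the
  element \<open>s\<close> for which the component of \<open>h\<close> at \<open>Y\<close> is \<open>gen_at Y s\<close>.\<close>

definition gen_at :: "('v::euclidean_space \<times> 'v) set \<Rightarrow> ('v \<Rightarrow> complex) \<Rightarrow> 'v \<times> 'v \<Rightarrow> complex"
  where "gen_at Y s = (\<lambda>x. if tpoint x = Y then s (fst x) else 0)"

definition coeff_at :: "('v::euclidean_space \<times> 'v) set \<Rightarrow> ('v \<times> 'v \<Rightarrow> complex) \<Rightarrow> 'v \<Rightarrow> complex"
  where "coeff_at Y h = (\<lambda>p. if p \<in> fst ` Y then h (p, SOME p'. (p, p') \<in> Y) else 0)"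

definition HF_u :: "'v::euclidean_space brane \<Rightarrow> 'v brane \<Rightarrow> ('v \<times> 'v) brane \<Rightarrow> ('v \<times> 'v) brane \<Rightarrow>
    ('v \<times> 'v \<Rightarrow> complex) set"
  where "HF_u L L' M M' = cfun.span
    {\<Sum>Y\<in>points_over M M' X. gen_at Y s | X s. X \<in> int_points L L' \<and> s \<in> HF_at L L' X}"

definition Pi_T :: "int^'n^'n \<Rightarrow> int^'n::finite^'n \<Rightarrow> ('n V \<times> 'n V) brane \<Rightarrow> ('n V \<times> 'n V) brane \<Rightarrow>
    ('n V \<times> 'n V \<Rightarrow> complex) \<Rightarrow> 'n V \<times> 'n V \<Rightarrow> complex"
  where "Pi_T D D' M M' h = (\<Sum>Y\<in>int_points M M'.
    cscale (1 / of_int \<bar>det (D' - D)\<bar>) (\<Sum>Z\<in>points_over M M' (fst ` Y). gen_at Z (coeff_at Y h)))"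

text \<open>The product of \<open>HF_u\<close>-classes of \<open>(M', M'')\<close> and \<open>(M, M')\<close>; \<open>D\<close> and \<open>D''\<close> belong to \<open>M\<close> and \<open>M''\<close>.
  Compared with the product on \<open>T\<close> it contains a theta constant as a factor, which depends on \<open>\<tau>\<close> and
  the signs \<open>\<xi>\<close> used in the lifts. In dimension \<open>n \<ge> 2\<close> this factor vanishes for some \<open>\<tau>\<close> and \<open>\<xi>\<close>, and
  then \<open>mu2_u\<close> is identically 0.\<close>

definition mu2_u :: "complex^'n^'n \<Rightarrow> int^'n^'n \<Rightarrow> int^'n::finite^'n \<Rightarrow> ('n V \<times> 'n V) brane \<Rightarrow>
    ('n V \<times> 'n V) brane \<Rightarrow> ('n V \<times> 'n V) brane \<Rightarrow>
    ('n V \<times> 'n V \<Rightarrow> complex) \<Rightarrow> ('n V \<times> 'n V \<Rightarrow> complex) \<Rightarrow> 'n V \<times> 'n V \<Rightarrow> complex"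
  where "mu2_u \<tau> D D'' M M' M'' x y = Pi_T D D'' M M'' (mu2 (doubled_form \<tau>) M M' M'' x y)"

text \<open>\<open>f\<close>, \<open>g\<close>, \<open>h\<close> are the vertical isomorphisms for \<open>(L, L')\<close>, \<open>(L', L'')\<close>, \<open>(L, L'')\<close>. Maps out of a
  tensor product are treated as functions of two arguments.\<close>

definition products_correspond :: "complex^'n^'n \<Rightarrow> int^'n^'n \<Rightarrow> int^'n::finite^'n \<Rightarrow>
    'n V brane \<Rightarrow> 'n V brane \<Rightarrow> 'n V brane \<Rightarrow>
    ('n V \<times> 'n V) brane \<Rightarrow> ('n V \<times> 'n V) brane \<Rightarrow> ('n V \<times> 'n V) brane \<Rightarrow> bool"
  where "products_correspond \<tau> D D'' L L' L'' M M' M'' \<longleftrightarrow>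
    (\<exists>f g h. linear_iso f (HF L L') (HF_u L L' M M') \<and>
      linear_iso g (HF L' L'') (HF_u L' L'' M' M'') \<and>
      linear_iso h (HF L L'') (HF_u L L'' M M'') \<and>
      (\<forall>b\<in>HF L' L''. \<forall>a\<in>HF L L'.
        h (mu2 (torus_form \<tau>) L L' L'' b a) = mu2_u \<tau> D D'' M M' M'' (g b) (f a)))"

end

theory Submission
  imports Defs "HOL-Complex_Analysis.Cauchy_Integral_Formula"
begin

text \<open>The element of \<open>HF\<close> of two lifted branes which repeats an element \<open>h\<close> of \<open>HF L L'\<close> at all points of the
fibres is the pullback of \<open>h\<close> under the projection to \<open>T\<close>. Pullback is an isomorphism onto the u-part
(lemma \<open>linear_iso_pullback\<close>), and what has to be compared is the product of two pullbacks with the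
pullback of the product. Write \<open>A\<close>, \<open>A'\<close>, \<open>A''\<close> for the matrices of the branes, \<open>E = A' - A\<close> and
\<open>E' = A'' - A'\<close>; ampleness says that \<open>P = Im \<tau> E\<close> and \<open>P' = Im \<tau> E'\<close> are positive definite.

Triangles. A triangle in \<open>T\<close> is given by its last vertex \<open>w\<close> and by vectors \<open>r\<close>, \<open>s\<close> with \<open>E r = E' s\<close>:
its edges are the vectors of the three graphs over \<open>r\<close>, \<open>- (r + s)\<close> and \<open>s\<close>. An edge on a lifted brane is
determined by its projection up to a covector that vanishes on the brane. Closing up the
triangle leaves one free vector \<open>\<zeta>\<close>, and the condition that the middle edge lies on the lift of \<open>L'\<close>, not
only on a parallel plane, confines \<open>\<zeta>\<close> to a coset of the integral vectors (\<open>lift_tri_bij\<close>, \<open>dual_coset_eq\<close>).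
With \<open>\<rho> = r + s\<close> and \<open>H = P\<^sup>-\<^sup>1 + P'\<^sup>-\<^sup>1\<close>, twice the symplectic area is \<open>\<rho> \<bullet> H\<^sup>-\<^sup>1 \<rho>\<close> in \<open>T\<close>, and
\<open>(\<rho> \<bullet> H\<^sup>-\<^sup>1 \<rho> + \<zeta> \<bullet> H \<zeta>) / 2\<close> in the doubling torus, where the B-field contributes the additional term
\<open>- \<zeta> \<bullet> \<rho>\<close> (\<open>area_torus\<close>, \<open>area_doubled\<close>).

Poisson summation. The sum over \<open>\<zeta>\<close> is a Gaussian sum over a coset. Poisson summation turns it into
a sum over integral vectors \<open>m\<close>, with \<open>m\<close> entering through a character of the coset and through the Gaussian
\<open>exp (- \<pi>/2 (\<rho> + 2 m) \<bullet> H\<^sup>-\<^sup>1 (\<rho> + 2 m))\<close>. By the parallelogram law, the product of this Gaussian with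
\<open>exp (- \<pi>/2 \<rho> \<bullet> H\<^sup>-\<^sup>1 \<rho>)\<close> is \<open>exp (- \<pi> (\<rho> + m) \<bullet> H\<^sup>-\<^sup>1 (\<rho> + m))\<close> up to a factor that depends on \<open>m\<close> only: the
weight of a triangle in \<open>T\<close> whose parameter \<open>\<rho>\<close> has been translated by \<open>m\<close> (\<open>mu2_doubled_poisson\<close>).

Averaging. Every \<open>m\<close> is \<open>g + s\<close> for a unique pair with \<open>E g = E' s\<close>. The summand of \<open>m\<close> depends on the
point of the fibre by a character, which is trivial exactly if \<open>g\<close> and \<open>s\<close> are integral
(\<open>character_sum_over_fibre\<close>); so these \<open>m\<close> are all that is left after applying \<open>\<Pi>\<^sub>T\<close>. If \<open>g\<close> and \<open>s\<close> are
integral, then lengthening the edges of a triangle by the graph vectors over \<open>g\<close>, \<open>- (g + s)\<close>, \<open>s\<close> gives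
another triangle with the same last vertex, and the summand of \<open>m\<close> is the contribution of this triangle
to the product in \<open>T\<close>, times a constant that depends on \<open>(g, s)\<close> only (\<open>shift_term\<close>). As such a translation
permutes the triangles, the product of the pullbacks is the pullback of the product times a theta
constant, the sum of these constants over all \<open>(g, s)\<close> (\<open>product_identity\<close>). If the theta constant does not
vanish, it is absorbed into the third isomorphism; if it vanishes, so does the product on the u-part.

Signs. Some choice of signs makes the theta constant nonzero. A change of the signs twists its
summands \<open>c k\<close> by characters with values \<open>1\<close> and \<open>- 1\<close>. The summands satisfy \<open>c (k + l) c (k - l) = d k d l\<close>,
the addition formula of theta functions. If all twisted sums vanished, then so would the sums over the
classes modulo \<open>2\<close>, hence the square of the Fourier series with coefficients \<open>d k\<close>, although \<open>d 0\<close> is not \<open>0\<close>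
(\<open>theta_constant_nonzero\<close>).\<close>

section \<open>Integer points and Gaussian sums\<close>

lemma int_lattice_0 [simp]: "0 \<in> int_lattice"
  by (simp add: int_lattice_def)

lemma int_lattice_add [intro]: "x \<in> int_lattice \<Longrightarrow> y \<in> int_lattice \<Longrightarrow> x + y \<in> int_lattice"
  by (auto simp: int_lattice_def inner_add_left)

lemma int_lattice_minus [simp]: "- x \<in> int_lattice \<longleftrightarrow> x \<in> int_lattice"
  by (auto simp: int_lattice_def)

lemma int_lattice_diff [intro]: "x \<in> int_lattice \<Longrightarrow> y \<in> int_lattice \<Longrightarrow> x - y \<in> int_lattice"
  by (auto simp: int_lattice_def inner_diff_left)

lemma int_lattice_Basis [simp]: "b \<in> Basis \<Longrightarrow> b \<in> int_lattice"
  by (auto simp: int_lattice_def inner_Basis)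

lemma int_lattice_scaleR: "k \<in> \<int> \<Longrightarrow> x \<in> int_lattice \<Longrightarrow> k *\<^sub>R x \<in> int_lattice"
  by (auto simp: int_lattice_def)

lemma int_lattice_inner: "x \<in> int_lattice \<Longrightarrow> y \<in> int_lattice \<Longrightarrow> x \<bullet> y \<in> \<int>"
  by (subst euclidean_inner) (auto simp: int_lattice_def intro!: Ints_sum)

lemma exp_abs_summable_on_Ints:
  assumes "0 < (c::real)"
  shows "(\<lambda>k::real. exp (- c * \<bar>k\<bar>)) summable_on \<int>"
proof -
  have geo: "(\<lambda>n::nat. exp (- c * real n)) summable_on UNIV"
  proof (rule summable_nonneg_imp_summable_on)
    have "summable (\<lambda>n. exp (- c) ^ n)" using assms by (intro summable_geometric) auto
    then show "summable (\<lambda>n. exp (- c * real n))"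
      by (simp add: exp_of_nat_mult[symmetric] mult.commute)
  qed auto
  have "(\<lambda>k::real. exp (- c * \<bar>k\<bar>)) summable_on (real ` UNIV)"
    using geo by (subst summable_on_reindex) (auto simp: o_def)
  moreover have "(\<lambda>k::real. exp (- c * \<bar>k\<bar>)) summable_on ((\<lambda>n. - real n) ` UNIV)"
    using geo by (subst summable_on_reindex) (auto simp: o_def inj_on_def)
  ultimately have "(\<lambda>k::real. exp (- c * \<bar>k\<bar>)) summable_on (real ` UNIV \<union> (\<lambda>n. - real n) ` UNIV)"
    by (rule summable_on_union)
  moreover have "\<int> \<subseteq> real ` UNIV \<union> (\<lambda>n. - real n) ` UNIV"
  proof
    fix x :: real assume "x \<in> \<int>"
    then obtain k where k: "x = of_int k" by (auto elim: Ints_cases)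
    show "x \<in> real ` UNIV \<union> (\<lambda>n. - real n) ` UNIV"
    proof (cases "k \<ge> 0")
      case True
      then have "x = real (nat k)" using k by simp
      then show ?thesis by blast
    next
      case False
      then have "x = - real (nat (- k))" using k by simp
      then show ?thesis by blast
    qed
  qed
  ultimately show ?thesis by (rule summable_on_subset)
qed

text \<open>The exponential of the \<open>l\<^sup>1\<close>-norm is a product over the coordinates, so the sum is a product of geometric series.\<close>

lemma exp_l1_summable_on_int_lattice:
  assumes "0 < (c::real)"
  shows "(\<lambda>g::'w::euclidean_space. exp (- c * (\<Sum>b\<in>Basis. \<bar>g \<bullet> b\<bar>))) summable_on int_lattice"
proof -
  let ?h = "\<lambda>(f::'w \<Rightarrow> real). \<Sum>b\<in>Basis. f b *\<^sub>R b"
  have cn: "countable (\<int> :: real set)" unfolding Ints_def by auto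
  have "Infinite_Set_Sum.abs_summable_on (\<lambda>f. \<Prod>b\<in>(Basis::'w set). exp (- c * \<bar>f b\<bar>)) (PiE Basis (\<lambda>_. \<int>))"
    using exp_abs_summable_on_Ints[OF assms]
    by (intro abs_summable_on_prod_PiE) (auto simp: cn abs_summable_equivalent[symmetric])
  then have "(\<lambda>f. \<Prod>b\<in>(Basis::'w set). exp (- c * \<bar>f b\<bar>)) summable_on (PiE Basis (\<lambda>_. \<int>))"
    by (simp add: abs_summable_equivalent[symmetric] prod_nonneg)
  moreover have "(\<Prod>b\<in>(Basis::'w set). exp (- c * \<bar>f b\<bar>)) = exp (- c * (\<Sum>b\<in>Basis. \<bar>?h f \<bullet> b\<bar>))" for f
    by (simp add: exp_sum[symmetric] sum_distrib_left inner_sum_left_Basis)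
  ultimately have s: "((\<lambda>g::'w. exp (- c * (\<Sum>b\<in>Basis. \<bar>g \<bullet> b\<bar>))) \<circ> ?h) summable_on (PiE Basis (\<lambda>_. \<int>))"
    by (simp add: o_def)
  have inj: "inj_on ?h (PiE Basis (\<lambda>_. \<int>))"
  proof (rule inj_onI)
    fix f g assume f: "f \<in> PiE Basis (\<lambda>_. \<int>)" and g: "g \<in> PiE Basis (\<lambda>_. \<int>)" and eq: "?h f = ?h g"
    show "f = g"
    proof (rule PiE_ext[OF f g])
      fix b :: 'w assume "b \<in> Basis"
      then show "f b = g b" using arg_cong[OF eq, of "\<lambda>x. x \<bullet> b"] by (simp add: inner_sum_left_Basis)
    qed
  qed
  have "(\<lambda>g::'w. exp (- c * (\<Sum>b\<in>Basis. \<bar>g \<bullet> b\<bar>))) summable_on (?h ` (PiE Basis (\<lambda>_. \<int>)))"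
    using s by (subst summable_on_reindex[OF inj])
  moreover have "int_lattice \<subseteq> ?h ` (PiE Basis (\<lambda>_. \<int>))"
  proof
    fix g :: 'w assume g: "g \<in> int_lattice"
    have "g = ?h (restrict (\<lambda>b. g \<bullet> b) Basis)" by (simp add: euclidean_representation)
    moreover have "restrict (\<lambda>b. g \<bullet> b) Basis \<in> PiE Basis (\<lambda>_. \<int>)" using g by (auto simp: int_lattice_def)
    ultimately show "g \<in> ?h ` (PiE Basis (\<lambda>_. \<int>))" by blast
  qed
  ultimately show ?thesis by (rule summable_on_subset)
qed

text \<open>Completing the square absorbs the linear term, and \<open>norm (x + g)\<close> differs from \<open>norm g\<close> by at most \<open>R\<close>. A
majorant that serves all \<open>x\<close> in a ball and all exponential factors of bounded rate gives the uniform
convergence which is behind continuity and holomorphy of theta series.\<close>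

lemma gaussian_majorant:
  assumes "0 < (\<delta>::real)"
  obtains M :: "'w::euclidean_space \<Rightarrow> real" where "M summable_on int_lattice"
    "\<And>x g. norm x \<le> R \<Longrightarrow> exp (- \<delta> * (norm (x + g))\<^sup>2 + R * norm (x + g)) \<le> M g"
proof -
  \<comment> \<open>the maximum of \<open>(R + 1) * t - \<delta> * t\<^sup>2\<close>; the excess \<open>t\<close> over the term \<open>R * t\<close> pays for the decay of \<open>M\<close>\<close>
  define C where "C = (R + 1)\<^sup>2 / (4 * \<delta>)"
  define c where "c = 1 / real (DIM('w))"
  define M where "M g = exp (C + R) * exp (- c * (\<Sum>b\<in>Basis. \<bar>g \<bullet> b\<bar>))" for g :: 'w
  have "M summable_on int_lattice"
    unfolding M_def by (intro summable_on_cmult_right exp_l1_summable_on_int_lattice) (simp add: c_def)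
  moreover have "exp (- \<delta> * (norm (x + g))\<^sup>2 + R * norm (x + g)) \<le> M g" if "norm x \<le> R" for x g
  proof -
    let ?t = "norm (x + g)"
    have "0 \<le> \<delta> * (?t - (R + 1) / (2 * \<delta>))\<^sup>2" using assms by simp
    also have "\<dots> = \<delta> * ?t\<^sup>2 - (R + 1) * ?t + C"
      using assms by (simp add: C_def power2_eq_square field_simps)
    finally have 1: "- \<delta> * ?t\<^sup>2 + R * ?t \<le> C - ?t" by (simp add: algebra_simps)
    have 2: "norm g \<le> ?t + R" using norm_triangle_ineq4[of "x + g" x] that by simp
    have "(\<Sum>b\<in>Basis. \<bar>g \<bullet> b\<bar>) \<le> (\<Sum>b\<in>(Basis::'w set). norm g)"
      by (intro sum_mono Basis_le_norm)
    then have "c * (\<Sum>b\<in>Basis. \<bar>g \<bullet> b\<bar>) \<le> norm g" by (simp add: c_def field_simps)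
    then have "- \<delta> * ?t\<^sup>2 + R * ?t \<le> (C + R) + (- c * (\<Sum>b\<in>Basis. \<bar>g \<bullet> b\<bar>))" using 1 2 by simp
    then show ?thesis unfolding M_def exp_add[symmetric] by simp
  qed
  ultimately show ?thesis by (rule that)
qed

text \<open>The function \<open>h\<close> embeds the index set into a coset of the lattice, where Gaussians are summable.\<close>

lemma gaussian_summable_on_coset:
  fixes h :: "'i \<Rightarrow> 'w::euclidean_space"
  assumes \<delta>: "0 < (\<delta>::real)" and inj: "inj_on h A" and h: "\<And>a a'. a \<in> A \<Longrightarrow> a' \<in> A \<Longrightarrow> h a - h a' \<in> int_lattice"
    and f: "\<And>a. a \<in> A \<Longrightarrow> norm (f a) \<le> K * exp (- \<delta> * (norm (h a))\<^sup>2)"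
  shows "(\<lambda>a. norm (f a)) summable_on A"
proof (cases "A = {}")
  case False
  then obtain a0 where a0: "a0 \<in> A" by auto
  define x where "x = h a0"
  obtain M :: "'w \<Rightarrow> real" where M: "M summable_on int_lattice"
    "\<And>y g. norm y \<le> norm x \<Longrightarrow> exp (- \<delta> * (norm (y + g))\<^sup>2 + norm x * norm (y + g)) \<le> M g"
    using gaussian_majorant[OF \<delta>, of "norm x"] by metis
  have "inj_on (\<lambda>a. h a - x) A" using inj by (auto simp: inj_on_def)
  moreover have "M summable_on ((\<lambda>a. h a - x) ` A)"
    by (rule summable_on_subset[OF M(1)]) (auto simp: x_def h a0)
  ultimately have s: "(\<lambda>a. M (h a - x)) summable_on A" by (simp add: summable_on_reindex o_def)
  show ?thesis
  proof (rule Infinite_Sum.abs_summable_on_comparison_test')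
    show "(\<lambda>a. \<bar>K\<bar> * M (h a - x)) summable_on A" by (intro summable_on_cmult_right s)
    fix a assume a: "a \<in> A"
    have "exp (- \<delta> * (norm (h a))\<^sup>2) \<le> exp (- \<delta> * (norm (h a))\<^sup>2 + norm x * norm (h a))" by simp
    also have "\<dots> \<le> M (h a - x)" using M(2)[of x "h a - x"] by simp
    finally show "norm (f a) \<le> \<bar>K\<bar> * M (h a - x)"
      using f[OF a] by (smt (verit) exp_gt_zero mult_mono mult_right_mono abs_ge_zero)
  qed
qed simp

text \<open>The sum is periodic in \<open>x\<close>, so that it suffices to treat the unit cube.\<close>

lemma gaussian_coset_sum_bounded:
  assumes \<delta>: "0 < (\<delta>::real)"
  obtains K where "\<And>x::'w::euclidean_space. (\<Sum>\<^sub>\<infinity>g\<in>int_lattice. exp (- \<delta> * (norm (x + g))\<^sup>2)) \<le> K"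
proof -
  define R where "R = real (DIM('w))"
  obtain M :: "'w \<Rightarrow> real" where M: "M summable_on int_lattice"
    "\<And>y g. norm y \<le> R \<Longrightarrow> exp (- \<delta> * (norm (y + g))\<^sup>2 + R * norm (y + g)) \<le> M g"
    using gaussian_majorant[OF \<delta>, of R] by metis
  show ?thesis
  proof (rule that)
    fix x :: 'w
    define k where "k = (\<Sum>b\<in>Basis. of_int \<lfloor>x \<bullet> b\<rfloor> *\<^sub>R b)"
    have kb: "k \<bullet> b = of_int \<lfloor>x \<bullet> b\<rfloor>" if "b \<in> Basis" for b using that by (simp add: k_def inner_sum_left_Basis)
    have k: "k \<in> int_lattice" by (auto simp: int_lattice_def kb)
    define y where "y = x - k"
    have "norm y \<le> (\<Sum>b\<in>Basis. \<bar>y \<bullet> b\<bar>)" by (rule norm_le_l1)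
    also have "\<dots> \<le> (\<Sum>b\<in>(Basis::'w set). 1)"
      by (intro sum_mono) (use kb in \<open>auto simp: y_def inner_diff_left abs_le_iff; linarith\<close>)
    finally have y: "norm y \<le> R" by (simp add: R_def)
    have "(\<Sum>\<^sub>\<infinity>g\<in>int_lattice. exp (- \<delta> * (norm (x + g))\<^sup>2)) = (\<Sum>\<^sub>\<infinity>g\<in>int_lattice. exp (- \<delta> * (norm (y + g))\<^sup>2))"
      by (rule infsum_reindex_bij_witness[of _ "\<lambda>g. g - k" "\<lambda>g. g + k"]) (use k in \<open>auto simp: y_def algebra_simps\<close>)
    also have "\<dots> \<le> infsum M int_lattice"
    proof (rule infsum_mono)
      show le: "exp (- \<delta> * (norm (y + g))\<^sup>2) \<le> M g" for g
      proof -
        have "0 \<le> R * norm (y + g)" by (simp add: R_def)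
        then show ?thesis using M(2)[OF y, of g] by (smt (verit) exp_le_cancel_iff)
      qed
      show "(\<lambda>g. exp (- \<delta> * (norm (y + g))\<^sup>2)) summable_on int_lattice"
        by (rule abs_summable_summable, rule Infinite_Sum.abs_summable_on_comparison_test'[OF M(1)]) (use le in auto)
    qed (rule M(1))
    finally show "(\<Sum>\<^sub>\<infinity>g\<in>int_lattice. exp (- \<delta> * (norm (x + g))\<^sup>2)) \<le> infsum M int_lattice" .
  qed
qed

text \<open>The constant is the minimum of the form on the unit sphere.\<close>

lemma positive_definite_bound:
  fixes H :: "'w::euclidean_space \<Rightarrow> 'w"
  assumes "linear H" "\<And>x. x \<noteq> 0 \<Longrightarrow> 0 < x \<bullet> H x"
  obtains \<delta> where "0 < \<delta>" "\<And>x. \<delta> * (norm x)\<^sup>2 \<le> x \<bullet> H x"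
proof -
  have c: "continuous_on (sphere 0 1) (\<lambda>x. x \<bullet> H x)"
    using assms(1) by (intro continuous_intros linear_continuous_on linear_conv_bounded_linear[THEN iffD1])
  obtain b :: 'w where "b \<in> Basis" by (rule nonempty_Basis[THEN ex_in_conv[THEN iffD2], THEN exE]) 
  then have "sphere 0 (1::real) \<noteq> ({} :: 'w set)" by (auto intro!: exI[of _ b])
  then obtain x0 where x0: "x0 \<in> sphere 0 1" "\<And>x. x \<in> sphere 0 1 \<Longrightarrow> x0 \<bullet> H x0 \<le> x \<bullet> H x"
    using continuous_attains_inf[OF compact_sphere _ c] by blast
  show ?thesis
  proof (rule that)
    show "0 < x0 \<bullet> H x0" using x0(1) by (intro assms(2)) auto
    fix x show "(x0 \<bullet> H x0) * (norm x)\<^sup>2 \<le> x \<bullet> H x"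
    proof (cases "x = 0")
      case False
      then have "x0 \<bullet> H x0 \<le> (x /\<^sub>R norm x) \<bullet> H (x /\<^sub>R norm x)" by (intro x0(2)) auto
      also have "\<dots> = (x \<bullet> H x) / (norm x)\<^sup>2"
        using linear_scale[OF assms(1)] by (simp add: power2_eq_square divide_inverse)
      finally show ?thesis using False by (simp add: field_simps)
    qed (simp add: linear_0[OF assms(1)])
  qed
qed

section \<open>Fourier series of periodic functions\<close>

definition lattice_periodic :: "('w::euclidean_space \<Rightarrow> 'b) \<Rightarrow> bool"
  where "lattice_periodic f \<longleftrightarrow> (\<forall>x. \<forall>z\<in>int_lattice. f (x + z) = f x)"

lemma lattice_periodicD: "lattice_periodic f \<Longrightarrow> z \<in> int_lattice \<Longrightarrow> f (x + z) = f x"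
  by (simp add: lattice_periodic_def)

lemma lattice_periodic_shift: "lattice_periodic f \<Longrightarrow> lattice_periodic (\<lambda>x. f (x + y))"
  unfolding lattice_periodic_def by (metis add.assoc add.commute)

text \<open>The part of the translated cube which leaves the unit cube is moved back by the period \<open>b\<close>.\<close>

lemma integral_cube_shift_Basis:
  fixes f :: "'w::euclidean_space \<Rightarrow> complex"
  assumes cont: "continuous_on UNIV f" and per: "lattice_periodic f" and b: "b \<in> Basis" and t: "0 \<le> t" "t \<le> 1"
  shows "integral (cbox 0 One) (\<lambda>x. f (x + t *\<^sub>R b)) = integral (cbox 0 One) f"
proof -
  have int: "f integrable_on cbox u v" for u v
    by (intro integrable_continuous continuous_on_subset[OF cont]) auto
  have bb: "(t *\<^sub>R b) \<bullet> i = (if i = b then t else 0)" "b \<bullet> i = (if i = b then 1 else 0)" if "i \<in> Basis" for i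
    using that b by (auto simp: inner_Basis)
  have s: "cbox (t *\<^sub>R b) (One + t *\<^sub>R b) \<inter> {x. x \<bullet> b \<le> 1} = cbox (t *\<^sub>R b) One"
    "cbox (t *\<^sub>R b) (One + t *\<^sub>R b) \<inter> {x. x \<bullet> b \<ge> 1} = cbox b (One + t *\<^sub>R b)"
    "cbox 0 One \<inter> {x. x \<bullet> b \<le> t} = cbox 0 (One + t *\<^sub>R b - b)"
    "cbox 0 One \<inter> {x. x \<bullet> b \<ge> t} = cbox (t *\<^sub>R b) One"
    using b t by (auto simp: mem_box inner_add_left inner_diff_left bb split: if_splits; fastforce)+
  have "integral (cbox 0 One) (\<lambda>x. f (x + t *\<^sub>R b)) = integral (cbox (t *\<^sub>R b) (One + t *\<^sub>R b)) f"
    using integral_shift_cbox[of "t *\<^sub>R b" "t *\<^sub>R b" "One + t *\<^sub>R b" f] by simp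
  also have "\<dots> = integral (cbox (t *\<^sub>R b) One) f + integral (cbox b (One + t *\<^sub>R b)) f"
    by (subst integral_split[OF int b, of _ _ 1]) (simp add: s)
  also have "integral (cbox b (One + t *\<^sub>R b)) f = integral (cbox 0 (One + t *\<^sub>R b - b)) (\<lambda>x. f (x + b))"
    using integral_shift_cbox[of b b "One + t *\<^sub>R b" f] by simp
  also have "(\<lambda>x. f (x + b)) = f" using per b by (auto simp: lattice_periodic_def)
  also have "integral (cbox (t *\<^sub>R b) One) f + integral (cbox 0 (One + t *\<^sub>R b - b)) f = integral (cbox 0 One) f"
    by (subst integral_split[OF int b, of 0 One t]) (simp add: s)
  finally show ?thesis .
qed

lemma integral_cube_shift:
  fixes f :: "'w::euclidean_space \<Rightarrow> complex"
  assumes cont: "continuous_on UNIV f" and per: "lattice_periodic f"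
  shows "integral (cbox 0 One) (\<lambda>x. f (x + y)) = integral (cbox 0 One) f"
proof -
  have "integral (cbox 0 One) (\<lambda>x. f (x + (\<Sum>b\<in>B. (y \<bullet> b) *\<^sub>R b))) = integral (cbox 0 One) f"
    if "finite B" "B \<subseteq> Basis" for B
    using that
  proof (induction B)
    case (insert b B)
    let ?v = "\<Sum>b\<in>B. (y \<bullet> b) *\<^sub>R b"
    define f' where "f' x = f (x + ?v)" for x
    have per': "lattice_periodic f'" unfolding f'_def by (rule lattice_periodic_shift[OF per])
    have cont': "continuous_on UNIV f'" unfolding f'_def
      by (intro continuous_on_compose2[OF cont] continuous_intros) auto
    have b: "b \<in> Basis" using insert by auto
    have "f (x + (\<Sum>b\<in>insert b B. (y \<bullet> b) *\<^sub>R b)) = f' (x + frac (y \<bullet> b) *\<^sub>R b)" for x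
    proof -
      have "f' (x + frac (y \<bullet> b) *\<^sub>R b) = f' (x + frac (y \<bullet> b) *\<^sub>R b + of_int \<lfloor>y \<bullet> b\<rfloor> *\<^sub>R b)"
        by (rule lattice_periodicD[OF per', symmetric]) (auto intro!: int_lattice_scaleR simp: b)
      also have "\<dots> = f' (x + (y \<bullet> b) *\<^sub>R b)" by (simp add: frac_def algebra_simps)
      finally show ?thesis using insert by (simp add: f'_def algebra_simps)
    qed
    then have "integral (cbox 0 One) (\<lambda>x. f (x + (\<Sum>b\<in>insert b B. (y \<bullet> b) *\<^sub>R b))) = integral (cbox 0 One) f'"
      using integral_cube_shift_Basis[OF cont' per' b, of "frac (y \<bullet> b)"] by (simp add: less_imp_le[OF frac_lt_1])
    also have "\<dots> = integral (cbox 0 One) f" using insert unfolding f'_def by simp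
    finally show ?case .
  qed simp
  from this[OF finite_Basis subset_refl] show ?thesis by (simp add: euclidean_representation)
qed

definition character :: "'w::euclidean_space \<Rightarrow> 'w \<Rightarrow> complex"
  where "character m x = exp (2 * of_real pi * \<i> * of_real (m \<bullet> x))"

lemma character_0 [simp]: "character 0 x = 1" "character m 0 = 1"
  by (simp_all add: character_def)

lemma character_add: "character (m + n) x = character m x * character n x"
  "character m (x + y) = character m x * character m y"
  by (simp_all add: character_def inner_add_left inner_add_right distrib_left exp_add)

lemma character_minus: "character (- m) x = inverse (character m x)" "character m (- x) = inverse (character m x)"
  by (simp_all add: character_def exp_minus)

lemma character_diff: "character (m - n) x = character m x / character n x"
  "character m (x - y) = character m x / character m y"
  by (simp_all add: character_def inner_diff_left inner_diff_right right_diff_distrib exp_diff)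

lemma norm_character [simp]: "norm (character m x) = 1"
  by (simp add: character_def norm_exp_eq_Re)

lemma character_nz [simp]: "character m x \<noteq> 0"
  by (simp add: character_def)

lemma exp_2pi_i_eq_1_iff: "exp (2 * of_real pi * \<i> * of_real x) = 1 \<longleftrightarrow> x \<in> \<int>"
proof -
  have "exp (2 * of_real pi * \<i> * of_real x) = 1 \<longleftrightarrow> (\<exists>n::int. 2 * pi * x = 2 * of_int n * pi)"
    by (simp add: exp_eq_1)
  also have "\<dots> \<longleftrightarrow> x \<in> \<int>"
    by (auto elim!: Ints_cases) 
  finally show ?thesis .
qed

lemma character_eq_1_iff: "character m x = 1 \<longleftrightarrow> m \<bullet> x \<in> \<int>"
  unfolding character_def by (rule exp_2pi_i_eq_1_iff)

lemma character_lattice [simp]: "m \<in> int_lattice \<Longrightarrow> x \<in> int_lattice \<Longrightarrow> character m x = 1"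
  by (simp add: character_eq_1_iff int_lattice_inner)

lemma lattice_periodic_character: "m \<in> int_lattice \<Longrightarrow> lattice_periodic (character m)"
  by (simp add: lattice_periodic_def character_add)

lemma continuous_on_character [continuous_intros]:
  "continuous_on A f \<Longrightarrow> continuous_on A (\<lambda>x. character m (f x))"
  unfolding character_def by (intro continuous_intros)

lemma integral_character:
  assumes "m \<in> int_lattice"
  shows "integral (cbox 0 One) (character m :: 'w::euclidean_space \<Rightarrow> complex) = (if m = 0 then 1 else 0)"
proof (cases "m = 0")
  case True
  have "integral (cbox 0 (One::'w)) (character (0::'w)) = integral (cbox 0 (One::'w)) (\<lambda>_. 1 :: complex)"
    by (intro integral_cong) simp
  then show ?thesis using True by simp
next
  case False
  define I where "I = integral (cbox 0 One) (character m)"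
  \<comment> \<open>translation by \<open>y\<close> multiplies the character by \<open>- 1\<close>\<close>
  define y where "y = m /\<^sub>R (2 * (m \<bullet> m))"
  have "integral (cbox 0 One) (\<lambda>x. character m (x + y)) = I" unfolding I_def
    by (intro integral_cube_shift lattice_periodic_character assms continuous_intros)
  moreover have "integral (cbox 0 One) (\<lambda>x. character m (x + y)) = character m y * I"
    unfolding I_def character_add by (simp add: mult.commute)
  moreover have "m \<bullet> y = 1 / 2" using False by (simp add: y_def field_simps)
  then have "character m y = exp (of_real pi * \<i>)"
    unfolding character_def by (simp only: mult.commute) simp
  then have "character m y = -1" by simp
  ultimately have "I = 0" by simp
  then show ?thesis using False by (simp add: I_def)
qed

text \<open>The series converges uniformly by the Weierstrass test, so it may be integrated term by term.\<close>

lemma fourier_coefficient_of_series: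
  fixes c :: "'w::euclidean_space \<Rightarrow> complex"
  assumes c: "(\<lambda>k. norm (c k)) summable_on A" and A: "A \<subseteq> int_lattice" and m: "m \<in> int_lattice"
  shows "continuous_on UNIV (\<lambda>x. \<Sum>\<^sub>\<infinity>k\<in>A. c k * character k x)"
    and "lattice_periodic (\<lambda>x. \<Sum>\<^sub>\<infinity>k\<in>A. c k * character k x)"
    and "integral (cbox 0 One) (\<lambda>x. (\<Sum>\<^sub>\<infinity>k\<in>A. c k * character k x) * character (- m) x) =
      (if m \<in> A then c m else 0)"
proof -
  have u: "uniform_limit UNIV (\<lambda>F x. \<Sum>k\<in>F. c k * character k x)
      (\<lambda>x. \<Sum>\<^sub>\<infinity>k\<in>A. c k * character k x) (finite_subsets_at_top A)"
    by (rule Weierstrass_m_test_general[OF _ c]) (simp add: norm_mult)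
  show cont: "continuous_on UNIV (\<lambda>x. \<Sum>\<^sub>\<infinity>k\<in>A. c k * character k x)"
    by (rule uniform_limit_theorem[OF _ u]) (auto intro!: always_eventually continuous_intros)
  show "lattice_periodic (\<lambda>x. \<Sum>\<^sub>\<infinity>k\<in>A. c k * character k x)"
    unfolding lattice_periodic_def using A by (auto intro!: infsum_cong simp: character_add subset_iff)
  let ?g = "\<lambda>x. \<Sum>\<^sub>\<infinity>k\<in>A. c k * character (k - m) x"
  have g: "(\<Sum>\<^sub>\<infinity>k\<in>A. c k * character k x) * character (- m) x = ?g x" for x
    by (subst infsum_cmult_left'[symmetric]) (simp add: character_diff character_minus field_simps)
  have "uniform_limit (cbox 0 One) (\<lambda>F x. \<Sum>k\<in>F. c k * character (k - m) x)
      ?g (finite_subsets_at_top A)"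
    by (rule Weierstrass_m_test_general[OF _ c]) (simp add: norm_mult)
  then obtain I J where I: "\<And>F. ((\<lambda>x. \<Sum>k\<in>F. c k * character (k - m) x) has_integral I F) (cbox 0 One)"
    and J: "(?g has_integral J) (cbox 0 One)" and lim: "(I \<longlongrightarrow> J) (finite_subsets_at_top A)"
    by (rule uniform_limit_integral_cbox) (auto intro!: continuous_intros)
  have IF: "I F = (\<Sum>k\<in>F. if k = m then c m else 0)" if "finite F" "F \<subseteq> A" for F
  proof -
    have "I F = integral (cbox 0 One) (\<lambda>x. \<Sum>k\<in>F. c k * character (k - m) x)"
      using I[of F] by (simp add: integral_unique)
    also have "\<dots> = (\<Sum>k\<in>F. integral (cbox 0 One) (\<lambda>x. c k * character (k - m) x))"
      using that by (intro integral_sum integrable_continuous continuous_intros) auto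
    also have "\<dots> = (\<Sum>k\<in>F. c k * integral (cbox 0 One) (character (k - m)))" by simp
    also have "\<dots> = (\<Sum>k\<in>F. if k = m then c m else 0)"
    proof (rule sum.cong)
      fix k assume "k \<in> F"
      then have "k - m \<in> int_lattice" using that A m by auto
      then show "c k * integral (cbox 0 One) (character (k - m)) = (if k = m then c m else 0)"
        by (subst integral_character) auto
    qed simp
    finally show ?thesis .
  qed
  have "eventually (\<lambda>F. I F = (if m \<in> A then c m else 0)) (finite_subsets_at_top A)"
  proof (cases "m \<in> A")
    case True
    have "eventually (\<lambda>F. finite F \<and> {m} \<subseteq> F \<and> F \<subseteq> A) (finite_subsets_at_top A)"
      unfolding eventually_finite_subsets_at_top using True by (intro exI[of _ "{m}"]) auto
    then show ?thesis by eventually_elim (auto simp: IF True)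
  next
    case False
    have "eventually (\<lambda>F. finite F \<and> F \<subseteq> A) (finite_subsets_at_top A)"
      by (rule eventually_finite_subsets_at_top_weakI) auto
    then show ?thesis by eventually_elim (use False in \<open>auto simp: IF intro!: sum.neutral\<close>)
  qed
  then have "(I \<longlongrightarrow> (if m \<in> A then c m else 0)) (finite_subsets_at_top A)"
    by (simp add: tendsto_eventually)
  then have "J = (if m \<in> A then c m else 0)"
    using tendsto_unique[OF _ lim] by auto
  then show "integral (cbox 0 One) (\<lambda>x. (\<Sum>\<^sub>\<infinity>k\<in>A. c k * character k x) * character (- m) x) =
      (if m \<in> A then c m else 0)"
    unfolding g using J by (simp add: integral_unique)
qed

text \<open>A peak kernel argument. The trigonometric polynomial \<open>K\<close> takes values between \<open>0\<close> and \<open>1\<close>, and the value \<open>1\<close>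
only at the lattice points. As the integral of \<open>f K\<^sup>N\<close> vanishes for all \<open>N\<close>, a point \<open>0\<close> with \<open>Re (f 0) > 1 / 2\<close> is
impossible: for large \<open>N\<close> the integral over a neighbourhood of the lattice, where \<open>K\<close> is close to \<open>1\<close>, would
exceed that over the set where \<open>Re f \<le> 1 / 2\<close>, on which \<open>K\<close> is bounded by a constant less than \<open>1\<close>.\<close>

lemma fourier_coefficients_zero_at_0:
  fixes f :: "'w::euclidean_space \<Rightarrow> complex"
  assumes cont: "continuous_on UNIV f" and per: "lattice_periodic f"
    and z: "\<And>m. m \<in> int_lattice \<Longrightarrow> integral (cbox 0 One) (\<lambda>x. f x * character m x) = 0"
  shows "Re (f 0) \<le> 1 / 2"
proof (rule ccontr)
  assume big: "\<not> Re (f 0) \<le> 1 / 2"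
  define K where "K x = (\<Prod>b\<in>(Basis::'w set). (1 + cos (2 * pi * (x \<bullet> b))) / 2)" for x :: 'w
  have contK: "continuous_on A K" for A unfolding K_def by (intro continuous_intros) auto
  have K01: "0 \<le> K x" "K x \<le> 1" for x
  proof -
    have 0: "0 \<le> 1 + cos (2 * pi * (x \<bullet> b))" for b using cos_ge_minus_one[of "2 * pi * (x \<bullet> b)"] by linarith
    have 1: "cos (2 * pi * (x \<bullet> b)) \<le> 1" for b by simp
    show "0 \<le> K x" unfolding K_def by (intro prod_nonneg) (use 0 in auto)
    show "K x \<le> 1" unfolding K_def by (intro prod_le_1) (use 0 1 in \<open>auto\<close>)
  qed
  have K1: "x \<in> int_lattice" if "K x = 1" for x
  proof (rule ccontr)
    assume "x \<notin> int_lattice"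
    then obtain b where b: "b \<in> Basis" "x \<bullet> b \<notin> \<int>" by (auto simp: int_lattice_def)
    have 0: "0 \<le> 1 + cos (2 * pi * (x \<bullet> b))" for b using cos_ge_minus_one[of "2 * pi * (x \<bullet> b)"] by linarith
    have "cos (2 * pi * (x \<bullet> b)) \<noteq> 1"
    proof
      assume "cos (2 * pi * (x \<bullet> b)) = 1"
      then obtain n :: int where "2 * pi * (x \<bullet> b) = of_int n * 2 * pi" by (auto simp: cos_one_2pi_int)
      then have "x \<bullet> b = of_int n" by (simp add: field_simps)
      then show False using b by simp
    qed
    then have lt: "(1 + cos (2 * pi * (x \<bullet> b))) / 2 < 1" using cos_le_one[of "2 * pi * (x \<bullet> b)"] by (simp add: less_le)
    have "K x = (1 + cos (2 * pi * (x \<bullet> b))) / 2 * (\<Prod>b\<in>Basis - {b}. (1 + cos (2 * pi * (x \<bullet> b))) / 2)"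
      unfolding K_def using b by (simp add: prod.remove)
    also have "\<dots> \<le> (1 + cos (2 * pi * (x \<bullet> b))) / 2 * 1"
      using 0 by (intro mult_left_mono prod_le_1) auto
    finally show False using lt that by simp
  qed
  \<comment> \<open>multiplying by a factor of \<open>K\<close> shifts the frequencies, so all Fourier coefficients stay zero\<close>
  have tp: "integral (cbox 0 One) (\<lambda>x. f x * of_real (K x ^ N) * character m x) = 0" if "m \<in> int_lattice" for N m
  proof -
    define T where "T g \<longleftrightarrow> continuous_on UNIV g \<and> (\<forall>m\<in>int_lattice. integral (cbox 0 One) (\<lambda>x. f x * g x * character m x) = 0)"
      for g :: "'w \<Rightarrow> complex"
    have T1: "T (\<lambda>_. 1)" using z by (simp add: T_def)
    have Tb: "T (\<lambda>x. of_real ((1 + cos (2 * pi * (x \<bullet> b))) / 2) * g x)" if g: "T g" and b: "b \<in> Basis" for g and b :: 'w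
      unfolding T_def
    proof (intro conjI ballI)
      show "continuous_on UNIV (\<lambda>x. of_real ((1 + cos (2 * pi * (x \<bullet> b))) / 2) * g x)"
        using g unfolding T_def by (intro continuous_intros) auto
      fix m :: 'w assume m: "m \<in> int_lattice"
      have e: "(of_real ((1 + cos (2 * pi * (x \<bullet> b))) / 2) :: complex) = 1 / 2 + character b x / 4 + character (- b) x / 4" for x
      proof -
        have "(of_real (cos (2 * pi * (x \<bullet> b))) :: complex) = (character b x + character (- b) x) / 2"
          unfolding character_def by (simp add: cos_of_real[symmetric] cos_exp_eq inner_commute mult_ac del: cos_of_real)
        moreover have "(of_real ((1 + cos (2 * pi * (x \<bullet> b))) / 2) :: complex) =
            1 / 2 + of_real (cos (2 * pi * (x \<bullet> b))) / 2"
          by (simp only: of_real_divide of_real_add add_divide_distrib of_real_1 of_real_numeral)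
        ultimately show ?thesis by (simp only: add_divide_distrib divide_divide_eq_left) simp
      qed
      have i: "(\<lambda>x. c * (f x * g x * character n x)) integrable_on cbox 0 One" for c n
        using g unfolding T_def
        by (intro integrable_continuous continuous_intros continuous_on_subset[OF cont]) (auto intro: continuous_on_subset)
      have "integral (cbox 0 One) (\<lambda>x. f x * (of_real ((1 + cos (2 * pi * (x \<bullet> b))) / 2) * g x) * character m x) =
        integral (cbox 0 One) (\<lambda>x. 1 / 2 * (f x * g x * character m x) + (1 / 4 * (f x * g x * character (m + b) x)
          + 1 / 4 * (f x * g x * character (m - b) x)))"
        by (intro integral_cong, subst e) (simp add: character_add character_diff character_minus field_simps)
      also have "\<dots> = 1 / 2 * integral (cbox 0 One) (\<lambda>x. f x * g x * character m x) +
          (1 / 4 * integral (cbox 0 One) (\<lambda>x. f x * g x * character (m + b) x) +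
          1 / 4 * integral (cbox 0 One) (\<lambda>x. f x * g x * character (m - b) x))"
        by (simp only: integral_add[OF i integrable_add[OF i i]] integral_add[OF i i] integral_mult_right)
      also have "\<dots> = 0" using g m b unfolding T_def by (simp add: int_lattice_add int_lattice_diff)
      finally show "integral (cbox 0 One) (\<lambda>x. f x * (of_real ((1 + cos (2 * pi * (x \<bullet> b))) / 2) * g x) * character m x) = 0" .
    qed
    have TB: "T (\<lambda>x. of_real (\<Prod>b\<in>B. (1 + cos (2 * pi * (x \<bullet> b))) / 2) * g x)"
      if "finite B" "B \<subseteq> Basis" "T g" for B :: "'w set" and g
      using that
    proof (induction B)
      case (insert b B)
      have "T (\<lambda>x. of_real ((1 + cos (2 * pi * (x \<bullet> b))) / 2) * (of_real (\<Prod>b\<in>B. (1 + cos (2 * pi * (x \<bullet> b))) / 2) * g x))"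
        using insert by (intro Tb) auto
      then show ?case using insert by (simp add: mult.assoc)
    qed simp
    have "T (\<lambda>x. of_real (K x ^ N))"
    proof (induction N)
      case (Suc N)
      from TB[OF finite_Basis subset_refl Suc] show ?case by (simp add: K_def)
    qed (use T1 in simp)
    then show ?thesis using that by (simp add: T_def)
  qed
  have intRe: "integral (cbox 0 One) (\<lambda>x. Re (f x) * K x ^ N) = 0" for N
  proof -
    have "(\<lambda>x. f x * of_real (K x ^ N)) integrable_on cbox 0 One"
      by (intro integrable_continuous continuous_intros contK continuous_on_subset[OF cont]) auto
    then have "Re (integral (cbox 0 One) (\<lambda>x. f x * of_real (K x ^ N))) = integral (cbox 0 One) (\<lambda>x. Re (f x * of_real (K x ^ N)))"
      using integral_linear[OF _ bounded_linear_Re, of "\<lambda>x. f x * of_real (K x ^ N)" "cbox 0 One"] by (simp add: o_def)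
    then show ?thesis using tp[of 0 N] by simp
  qed
  define C where "C = cbox 0 (One::'w) \<inter> {x. Re (f x) \<le> 1 / 2}"
  have cRe: "continuous_on UNIV (\<lambda>x. Re (f x))" by (intro continuous_intros cont)
  have "closed {x. Re (f x) \<le> 1 / 2}" by (rule closed_Collect_le[OF cRe continuous_on_const])
  then have compC: "compact C" unfolding C_def by (intro compact_Int_closed compact_cbox)
  have KC: "K x < 1" if "x \<in> C" for x
  proof (rule ccontr)
    assume "\<not> K x < 1"
    then have "x \<in> int_lattice" using K01(2)[of x] K1[of x] by linarith
    then have "f x = f 0" using per lattice_periodicD[of f x 0] by simp
    then show False using that big by (simp add: C_def)
  qed
  obtain \<rho> where \<rho>: "0 < \<rho>" "\<rho> < 1" "\<And>x. x \<in> C \<Longrightarrow> K x \<le> \<rho>"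
  proof (cases "C = {}")
    case True
    then show ?thesis using that[of "1/2"] by auto
  next
    case False
    obtain x0 where x0: "x0 \<in> C" "\<And>x. x \<in> C \<Longrightarrow> K x \<le> K x0"
      using continuous_attains_sup[OF compC False contK] by blast
    show ?thesis
    proof (rule that[of "max (1/2) (K x0)"])
      show "K x \<le> max (1/2) (K x0)" if "x \<in> C" for x using x0(2)[OF that] by simp
    qed (use KC[OF x0(1)] in auto)
  qed
  define \<rho>' where "\<rho>' = (1 + \<rho>) / 2"
  have \<rho>': "\<rho> < \<rho>'" "\<rho>' < 1" "0 < \<rho>'" using \<rho> by (auto simp: \<rho>'_def)
  have op: "open ({x. 1 / 2 < Re (f x)} \<inter> {x. \<rho>' < K x})"
    by (intro open_Int open_Collect_less cRe contK continuous_on_const)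
  have "0 \<in> {x. 1 / 2 < Re (f x)} \<inter> {x. \<rho>' < K x}" using big \<rho>' by (simp add: K_def)
  then obtain r where r: "r > 0" "cball 0 r \<subseteq> {x. 1 / 2 < Re (f x)} \<inter> {x. \<rho>' < K x}"
    using op open_contains_cball by blast
  \<comment> \<open>a cube of this side length at the corner \<open>0\<close> is contained in the ball of radius \<open>r\<close>\<close>
  define s where "s = min 1 (r / real (DIM('w)))"
  have s: "0 < s" "s \<le> 1" using r by (auto simp: s_def)
  define Q where "Q = cbox 0 (s *\<^sub>R (One::'w))"
  have Q1: "Q \<subseteq> cbox 0 One" using s by (fastforce simp: Q_def mem_box)
  have Q2: "1 / 2 < Re (f x)" "\<rho>' < K x" if "x \<in> Q" for x
  proof -
    have "norm x \<le> (\<Sum>b\<in>Basis. \<bar>x \<bullet> b\<bar>)" by (rule norm_le_l1)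
    also have "\<dots> \<le> (\<Sum>b\<in>(Basis::'w set). s)" using that by (intro sum_mono) (auto simp: Q_def mem_box)
    also have "\<dots> \<le> r" by (simp add: s_def field_simps min_def)
    finally show "1 / 2 < Re (f x)" "\<rho>' < K x" using r(2) by (auto simp: subset_iff)
  qed
  have "bounded (f ` cbox 0 One)"
    by (intro compact_imp_bounded compact_continuous_image continuous_on_subset[OF cont]) auto
  then obtain B where B: "\<And>x. x \<in> cbox 0 One \<Longrightarrow> norm (f x) \<le> B" "0 < B" unfolding bounded_pos by auto
  have key: "1 / 2 * \<rho>' ^ N * measure lborel Q \<le> B * \<rho> ^ N" for N
  proof -
    have hi: "((\<lambda>x. (if x \<in> Q then 1 / 2 * \<rho>' ^ N else 0) - B * \<rho> ^ N) has_integral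
        (1 / 2 * \<rho>' ^ N * measure lborel Q - B * \<rho> ^ N)) (cbox 0 One)"
    proof (rule has_integral_diff)
      have "((\<lambda>x. 1 / 2 * \<rho>' ^ N) has_integral (1 / 2 * \<rho>' ^ N * measure lborel Q)) Q"
        unfolding Q_def using has_integral_const[of "1 / 2 * \<rho>' ^ N" 0 "s *\<^sub>R (One::'w)"] by (simp add: mult.commute)
      then show "((\<lambda>x. if x \<in> Q then 1 / 2 * \<rho>' ^ N else 0) has_integral 1 / 2 * \<rho>' ^ N * measure lborel Q) (cbox 0 One)"
        using Q1 by (simp add: has_integral_restrict)
      show "((\<lambda>x. B * \<rho> ^ N) has_integral B * \<rho> ^ N) (cbox 0 (One::'w))"
        using has_integral_const[of "B * \<rho> ^ N" 0 "One::'w"] by simp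
    qed
    have "integral (cbox 0 One) (\<lambda>x. (if x \<in> Q then 1 / 2 * \<rho>' ^ N else 0) - B * \<rho> ^ N) \<le>
        integral (cbox 0 One) (\<lambda>x. Re (f x) * K x ^ N)"
    proof (rule integral_le)
      show "(\<lambda>x. (if x \<in> Q then 1 / 2 * \<rho>' ^ N else 0) - B * \<rho> ^ N) integrable_on cbox 0 One"
        using hi by blast
      show "(\<lambda>x. Re (f x) * K x ^ N) integrable_on cbox 0 One"
        by (intro integrable_continuous continuous_intros contK continuous_on_subset[OF cont]) auto
      fix x :: 'w assume x: "x \<in> cbox 0 One"
      have p: "0 \<le> B * \<rho> ^ N" using B \<rho> by simp
      show "(if x \<in> Q then 1 / 2 * \<rho>' ^ N else 0) - B * \<rho> ^ N \<le> Re (f x) * K x ^ N"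
      proof (cases "x \<in> Q")
        case True
        have "1 / 2 * \<rho>' ^ N \<le> Re (f x) * K x ^ N"
          using Q2[OF True] \<rho>' by (intro mult_mono power_mono) auto
        then show ?thesis using True p by simp
      next
        case False
        show ?thesis
        proof (cases "Re (f x) \<le> 1 / 2")
          case True
          then have "K x \<le> \<rho>" using x by (intro \<rho>) (simp add: C_def)
          then have "K x ^ N \<le> \<rho> ^ N" using K01 by (intro power_mono) auto
          moreover have "- B \<le> Re (f x)" using B(1)[OF x] abs_Re_le_cmod[of "f x"] by linarith
          moreover have "0 \<le> K x ^ N" using K01 by simp
          ultimately have "- B * \<rho> ^ N \<le> Re (f x) * K x ^ N"
            using B(2) by (smt (verit) mult_left_mono mult_right_mono mult_minus_left)
          then show ?thesis using False by simp
        next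
          case F: False
          then have "0 \<le> Re (f x) * K x ^ N" using K01 by simp
          then show ?thesis using False p by simp
        qed
      qed
    qed
    also have "\<dots> = 0" by (rule intRe)
    finally have "integral (cbox 0 One) (\<lambda>x. (if x \<in> Q then 1 / 2 * \<rho>' ^ N else 0) - B * \<rho> ^ N) \<le> 0" .
    then show ?thesis using hi by (simp add: integral_unique)
  qed
  have Qp: "0 < measure lborel Q"
    using s by (simp add: Q_def content_cbox_if box_eq_empty prod_pos)
  have "(\<lambda>N. (\<rho> / \<rho>') ^ N) \<longlonglongrightarrow> 0" using \<rho> \<rho>' by (intro LIMSEQ_realpow_zero) auto
  moreover have "0 < measure lborel Q / (2 * B)" using Qp B by simp
  ultimately have "eventually (\<lambda>N. (\<rho> / \<rho>') ^ N < measure lborel Q / (2 * B)) sequentially"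
    by (rule order_tendstoD(2))
  then obtain N where N: "(\<rho> / \<rho>') ^ N < measure lborel Q / (2 * B)" by (auto simp: eventually_sequentially)
  have "measure lborel Q / (2 * B) \<le> (\<rho> / \<rho>') ^ N"
    using key[of N] B(2) \<rho>' by (simp add: field_simps power_divide)
  with N show False by simp
qed

text \<open>Translating and rescaling \<open>f\<close> moves the point \<open>x\<close> to \<open>0\<close> and its value to \<open>1\<close>, which contradicts the bound
of \<open>1 / 2\<close>.\<close>

theorem fourier_uniqueness:
  fixes f :: "'w::euclidean_space \<Rightarrow> complex"
  assumes cont: "continuous_on UNIV f" and per: "lattice_periodic f"
    and z: "\<And>m. m \<in> int_lattice \<Longrightarrow> integral (cbox 0 One) (\<lambda>x. f x * character (- m) x) = 0"
  shows "f x = 0"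
proof (rule ccontr)
  assume nz: "f x \<noteq> 0"
  define g where "g y = f (y + x) / f x" for y
  have "Re (g 0) \<le> 1 / 2"
  proof (rule fourier_coefficients_zero_at_0)
    show "continuous_on UNIV g" unfolding g_def
      using nz by (intro continuous_intros continuous_on_compose2[OF cont]) auto
    show "lattice_periodic g" using lattice_periodic_shift[OF per, of x] by (simp add: g_def lattice_periodic_def)
    fix m :: 'w assume m: "m \<in> int_lattice"
    define h where "h y = f y * character m y" for y
    have "continuous_on UNIV h" unfolding h_def by (intro continuous_intros cont)
    moreover have "lattice_periodic h" using per m by (simp add: h_def lattice_periodic_def character_add)
    ultimately have "integral (cbox 0 One) (\<lambda>y. h (y + x)) = integral (cbox 0 One) h" by (rule integral_cube_shift)
    also have "\<dots> = 0" using z[of "- m"] m by (simp add: h_def[abs_def])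
    finally have "integral (cbox 0 One) (\<lambda>y. h (y + x) * (1 / (f x * character m x))) = 0" by simp
    moreover have "h (y + x) * (1 / (f x * character m x)) = g y * character m y" for y
      by (simp add: h_def g_def character_add field_simps)
    ultimately show "integral (cbox 0 One) (\<lambda>y. g y * character m y) = 0" by (simp only:)
  qed
  then show False using nz by (simp add: g_def)
qed

section \<open>Poisson summation for Gaussians\<close>

text \<open>The Gaussian has the quadratic form \<open>x \<bullet> H x\<close>, its Fourier transform that of the inverse map \<open>Hi\<close>.\<close>

locale gaussian =
  fixes H Hi :: "'w::euclidean_space \<Rightarrow> 'w"
  assumes lin: "linear H" and lin_inv: "linear Hi" and H_Hi: "\<And>v. H (Hi v) = v"
    and sym: "\<And>x y. x \<bullet> H y = H x \<bullet> y" and pos: "\<And>x. x \<noteq> 0 \<Longrightarrow> 0 < x \<bullet> H x"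
begin

text \<open>For \<open>\<zeta> = - \<i>\<close> this is a Gaussian times a character. The parameter \<open>\<zeta>\<close> interpolates between it and real
exponents, which are obtained from the pure Gaussian by a translation of \<open>y\<close>.\<close>

definition bump :: "'w \<Rightarrow> complex \<Rightarrow> 'w \<Rightarrow> complex"
  where "bump v \<zeta> y = exp (- of_real (pi / 2 * (y \<bullet> H y)) + of_real (pi * (y \<bullet> v)) * \<zeta>)"

definition periodized :: "'w \<Rightarrow> complex \<Rightarrow> 'w \<Rightarrow> complex"
  where "periodized v \<zeta> x = (\<Sum>\<^sub>\<infinity>z\<in>int_lattice. bump v \<zeta> (x + z))"

text \<open>This is the integral of the bump over the whole space, decomposed into translates of the unit cube.\<close>

definition transform :: "'w \<Rightarrow> complex \<Rightarrow> complex"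
  where "transform v \<zeta> = integral (cbox 0 One) (periodized v \<zeta>)"

lemma cont_H: "continuous_on A H"
  using lin by (simp add: linear_continuous_on linear_conv_bounded_linear)

lemma bump_majorant:
  obtains M where "M summable_on int_lattice"
    "\<And>\<zeta> x z. norm \<zeta> \<le> R \<Longrightarrow> norm x \<le> R \<Longrightarrow> norm (bump v \<zeta> (x + z)) \<le> M z"
proof -
  obtain \<delta> where \<delta>: "0 < \<delta>" "\<And>x. \<delta> * (norm x)\<^sup>2 \<le> x \<bullet> H x"
    using positive_definite_bound[OF lin pos] by blast
  define R' where "R' = max R (pi * norm v * R)"
  obtain M :: "'w \<Rightarrow> real" where M: "M summable_on int_lattice"
    "\<And>x g. norm x \<le> R' \<Longrightarrow> exp (- (pi / 2 * \<delta>) * (norm (x + g))\<^sup>2 + R' * norm (x + g)) \<le> M g"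
    using gaussian_majorant[of "pi / 2 * \<delta>" R'] \<delta> by auto
  show ?thesis
  proof (rule that[OF M(1)])
    fix \<zeta> :: complex and x z assume \<zeta>: "norm \<zeta> \<le> R" and x: "norm (x::'w) \<le> R"
    let ?y = "x + z"
    have "norm (bump v \<zeta> ?y) = exp (- (pi / 2 * (?y \<bullet> H ?y)) + pi * (?y \<bullet> v) * Re \<zeta>)"
      by (simp add: bump_def norm_exp_eq_Re)
    also have "\<dots> \<le> exp (- (pi / 2 * \<delta>) * (norm ?y)\<^sup>2 + R' * norm ?y)"
    proof -
      have "pi * (?y \<bullet> v) * Re \<zeta> \<le> \<bar>pi * (?y \<bullet> v) * Re \<zeta>\<bar>" by simp
      also have "\<dots> = pi * \<bar>?y \<bullet> v\<bar> * \<bar>Re \<zeta>\<bar>" by (simp add: abs_mult)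
      also have "\<dots> \<le> pi * (norm ?y * norm v) * R"
        using \<zeta> abs_Re_le_cmod[of \<zeta>] by (intro mult_mono mult_left_mono Cauchy_Schwarz_ineq2) auto
      also have "\<dots> = (pi * norm v * R) * norm ?y" by simp
      also have "\<dots> \<le> R' * norm ?y" by (intro mult_right_mono) (auto simp: R'_def)
      finally have "pi * (?y \<bullet> v) * Re \<zeta> \<le> R' * norm ?y" .
      moreover have "pi / 2 * (\<delta> * (norm ?y)\<^sup>2) \<le> pi / 2 * (?y \<bullet> H ?y)"
        by (rule mult_left_mono[OF \<delta>(2)]) simp
      ultimately show ?thesis unfolding exp_le_cancel_iff mult_minus_left mult.assoc by linarith
    qed
    also have "\<dots> \<le> M z" using x by (intro M(2)) (simp add: R'_def)
    finally show "norm (bump v \<zeta> ?y) \<le> M z" .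
  qed
qed

lemma bump_summable: "(\<lambda>z. norm (bump v \<zeta> (x + z))) summable_on int_lattice"
proof -
  obtain M where M: "M summable_on int_lattice"
    "\<And>\<zeta>' x' z. norm \<zeta>' \<le> max (norm \<zeta>) (norm x) \<Longrightarrow> norm x' \<le> max (norm \<zeta>) (norm x) \<Longrightarrow> norm (bump v \<zeta>' (x' + z)) \<le> M z"
    using bump_majorant[of "max (norm \<zeta>) (norm x)" v] by metis
  show ?thesis by (rule Infinite_Sum.abs_summable_on_comparison_test'[OF M(1)]) (auto intro: M)
qed

lemma continuous_bump:
  "continuous_on A f \<Longrightarrow> continuous_on A g \<Longrightarrow> continuous_on A (\<lambda>x. bump v (f x) (g x))"
  unfolding bump_def by (intro continuous_intros continuous_on_compose2[OF cont_H[of UNIV]]) auto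

lemma continuous_periodized: "continuous_on UNIV (periodized v \<zeta>)"
proof -
  have "continuous_on (ball 0 R) (periodized v \<zeta>)" for R
  proof -
    obtain M where M: "M summable_on int_lattice"
      "\<And>\<zeta>' x' z. norm \<zeta>' \<le> max (norm \<zeta>) R \<Longrightarrow> norm x' \<le> max (norm \<zeta>) R \<Longrightarrow> norm (bump v \<zeta>' (x' + z)) \<le> M z"
      using bump_majorant[of "max (norm \<zeta>) R" v] by metis
    have "uniform_limit (ball 0 R) (\<lambda>F x. \<Sum>z\<in>F. bump v \<zeta> (x + z))
      (periodized v \<zeta>) (finite_subsets_at_top int_lattice)"
      unfolding periodized_def[abs_def] by (rule Weierstrass_m_test_general[OF _ M(1)]) (auto intro!: M(2))
    then show ?thesis
      by (rule uniform_limit_theorem[rotated]) (auto intro!: always_eventually continuous_intros continuous_bump)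
  qed
  then have "continuous_on (\<Union>R\<in>UNIV. ball 0 R) (periodized v \<zeta>)"
    by (intro continuous_on_open_UN) auto
  moreover have "(\<Union>R\<in>UNIV. ball (0::'w) R) = UNIV"
    by (auto intro: gt_ex)
  ultimately show ?thesis by simp
qed

lemma lattice_periodic_periodized: "lattice_periodic (periodized v \<zeta>)"
  unfolding lattice_periodic_def periodized_def
proof (intro allI ballI)
  fix x k :: 'w assume k: "k \<in> int_lattice"
  show "(\<Sum>\<^sub>\<infinity>z\<in>int_lattice. bump v \<zeta> (x + k + z)) = (\<Sum>\<^sub>\<infinity>z\<in>int_lattice. bump v \<zeta> (x + z))"
    by (rule infsum_reindex_bij_witness[of _ "\<lambda>z. z - k" "\<lambda>z. z + k"]) (use k in \<open>auto simp: algebra_simps\<close>)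
qed

text \<open>Completing the square, a translation of the bump by \<open>h Hi v\<close> amounts to a translation of \<open>\<zeta>\<close> by \<open>h\<close>; and
translations do not change the integral of a periodic function over the cube.\<close>

lemma transform_shift:
  "transform v \<zeta> = exp (of_real (pi * h * (v \<bullet> Hi v)) * \<zeta> - of_real (pi / 2 * h\<^sup>2 * (v \<bullet> Hi v))) * transform v (\<zeta> - of_real h)"
proof -
  let ?w = "Hi v" and ?e = "exp (of_real (pi * h * (v \<bullet> Hi v)) * \<zeta> - of_real (pi / 2 * h\<^sup>2 * (v \<bullet> Hi v)))"
  have b: "bump v \<zeta> (y + h *\<^sub>R ?w) = ?e * bump v (\<zeta> - of_real h) y" for y
  proof -
    have "(y + h *\<^sub>R ?w) \<bullet> H (y + h *\<^sub>R ?w) = y \<bullet> H y + 2 * h * (y \<bullet> v) + h\<^sup>2 * (v \<bullet> ?w)"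
      using sym[of ?w y]
      by (simp add: linear_add[OF lin] linear_scale[OF lin] H_Hi inner_add_left inner_add_right inner_commute power2_eq_square algebra_simps)
    then show ?thesis unfolding bump_def exp_add[symmetric]
      by (simp add: inner_add_left inner_commute[of v] algebra_simps)
  qed
  have "transform v \<zeta> = integral (cbox 0 One) (\<lambda>x. periodized v \<zeta> (x + h *\<^sub>R ?w))"
    unfolding transform_def
    by (rule integral_cube_shift[OF continuous_periodized lattice_periodic_periodized, symmetric])
  also have "(\<lambda>x. periodized v \<zeta> (x + h *\<^sub>R ?w)) = (\<lambda>x. ?e * periodized v (\<zeta> - of_real h) x)"
  proof
    fix x
    have "periodized v \<zeta> (x + h *\<^sub>R ?w) = (\<Sum>\<^sub>\<infinity>z\<in>int_lattice. bump v \<zeta> ((x + z) + h *\<^sub>R ?w))"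
      by (simp add: periodized_def add_ac)
    also have "\<dots> = ?e * periodized v (\<zeta> - of_real h) x"
      unfolding b periodized_def by (rule infsum_cmult_right')
    finally show "periodized v \<zeta> (x + h *\<^sub>R ?w) = ?e * periodized v (\<zeta> - of_real h) x" .
  qed
  also have "integral (cbox 0 One) \<dots> = ?e * transform v (\<zeta> - of_real h)"
    unfolding transform_def by simp
  finally show ?thesis .
qed

text \<open>The integrals of the finite partial sums are holomorphic in \<open>\<zeta>\<close> and converge locally uniformly.\<close>

lemma holomorphic_transform: "transform v holomorphic_on UNIV"
proof -
  have "transform v holomorphic_on ball 0 R" for R
  proof -
    obtain M where M: "M summable_on int_lattice"
      "\<And>\<zeta> x z. norm \<zeta> \<le> max R (DIM('w)) \<Longrightarrow> norm x \<le> max R (DIM('w)) \<Longrightarrow> norm (bump v \<zeta> (x + z)) \<le> M z"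
      using bump_majorant[of "max R (DIM('w))" v] by metis
    have cube: "norm x \<le> max R (DIM('w))" if "x \<in> cbox 0 One" for x :: 'w
    proof -
      have "norm x \<le> (\<Sum>b\<in>Basis. \<bar>x \<bullet> b\<bar>)" by (rule norm_le_l1)
      also have "\<dots> \<le> (\<Sum>b\<in>(Basis::'w set). 1)" using that by (intro sum_mono) (auto simp: mem_box)
      finally show ?thesis by simp
    qed
    define JF where "JF F \<zeta> = integral (cbox 0 One) (\<lambda>x. \<Sum>z\<in>F. bump v \<zeta> (x + z))" for F \<zeta>
    have "uniform_limit (cball 0 R \<times> cbox 0 One) (\<lambda>F (\<zeta>, x). \<Sum>z\<in>F. bump v \<zeta> (x + z))
      (\<lambda>(\<zeta>, x). periodized v \<zeta> x) (finite_subsets_at_top int_lattice)"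
      unfolding periodized_def case_prod_unfold
      by (rule Weierstrass_m_test_general[OF _ M(1)]) (auto intro!: M(2) cube)
    then have "uniform_limit (cball 0 R) JF (transform v) (finite_subsets_at_top int_lattice)"
    proof (intro uniform_limitI)
      fix e :: real assume e: "e > 0"
      assume "uniform_limit (cball 0 R \<times> cbox 0 One) (\<lambda>F (\<zeta>, x). \<Sum>z\<in>F. bump v \<zeta> (x + z))
        (\<lambda>(\<zeta>, x). periodized v \<zeta> x) (finite_subsets_at_top int_lattice)"
      from uniform_limitD[OF this, of "e / 2"] e
      have "\<forall>\<^sub>F F in finite_subsets_at_top int_lattice. \<forall>(\<zeta>, x)\<in>cball 0 R \<times> cbox 0 One.
          dist (\<Sum>z\<in>F. bump v \<zeta> (x + z)) (periodized v \<zeta> x) < e / 2"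
        by (simp add: case_prod_unfold)
      then show "\<forall>\<^sub>F F in finite_subsets_at_top int_lattice. \<forall>\<zeta>\<in>cball 0 R. dist (JF F \<zeta>) (transform v \<zeta>) < e"
      proof eventually_elim
        case (elim F)
        show ?case
        proof
          fix \<zeta> :: complex assume \<zeta>: "\<zeta> \<in> cball 0 R"
          have i: "(\<lambda>x. \<Sum>z\<in>F. bump v \<zeta> (x + z)) integrable_on cbox 0 One"
            by (intro integrable_continuous continuous_intros continuous_bump)
          have j: "periodized v \<zeta> integrable_on cbox 0 One"
            by (intro integrable_continuous continuous_on_subset[OF continuous_periodized]) auto
          have "dist (JF F \<zeta>) (transform v \<zeta>) =
              norm (integral (cbox 0 One) (\<lambda>x. (\<Sum>z\<in>F. bump v \<zeta> (x + z)) - periodized v \<zeta> x))"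
            unfolding JF_def transform_def dist_norm by (subst integral_diff[OF i j]) simp
          also have "\<dots> \<le> e / 2 * measure lborel (cbox 0 (One::'w))"
            using elim \<zeta> e by (intro integrable_bound integrable_diff i j) (force simp: dist_norm less_imp_le)+
          also have "\<dots> < e" using e by simp
          finally show "dist (JF F \<zeta>) (transform v \<zeta>) < e" .
        qed
      qed
    qed
    moreover have "JF F holomorphic_on UNIV" for F
      unfolding JF_def
    proof (rule leibniz_rule_holomorphic)
      fix \<zeta> :: complex and x :: 'w
      show "((\<lambda>\<zeta>. \<Sum>z\<in>F. bump v \<zeta> (x + z)) has_field_derivative
          (\<Sum>z\<in>F. bump v \<zeta> (x + z) * of_real (pi * ((x + z) \<bullet> v)))) (at \<zeta> within UNIV)"
        unfolding bump_def by (auto intro!: derivative_eq_intros)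
      show "(\<lambda>x. \<Sum>z\<in>F. bump v \<zeta> (x + z)) integrable_on cbox 0 One"
        by (intro integrable_continuous continuous_intros continuous_bump)
      show "continuous_on (UNIV \<times> cbox 0 One) (\<lambda>(\<zeta>, x). \<Sum>z\<in>F. bump v \<zeta> (x + z) * of_real (pi * ((x + z) \<bullet> v)))"
        unfolding case_prod_unfold by (intro continuous_intros continuous_bump)
    qed auto
    then have "\<forall>\<^sub>F F in finite_subsets_at_top int_lattice. continuous_on (cball 0 R) (JF F) \<and> JF F holomorphic_on ball 0 R"
      by (intro always_eventually allI conjI) (auto intro: holomorphic_on_imp_continuous_on holomorphic_on_subset)
    ultimately show ?thesis using holomorphic_uniform_limit finite_subsets_at_top_neq_bot by metis
  qed
  then have "transform v holomorphic_on (\<Union>R\<in>UNIV. ball 0 R)"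
    by (intro holomorphic_on_UN_open) auto
  moreover have "(\<Union>R\<in>UNIV. ball (0::complex) R) = UNIV"
    by (auto intro: gt_ex)
  ultimately show ?thesis by simp
qed

text \<open>By \<open>transform_shift\<close>, the quotient of the two sides is invariant under real translations of \<open>\<zeta>\<close>. Being
holomorphic, it has derivative zero, so it is constant. This yields the Fourier transform of the Gaussian
without a diagonalization of \<open>H\<close>.\<close>

lemma transform_eq: "transform v \<zeta> = transform 0 0 * exp (of_real (pi / 2 * (v \<bullet> Hi v)) * \<zeta>\<^sup>2)"
proof -
  define N where "N \<zeta> = transform v \<zeta> * exp (- of_real (pi / 2 * (v \<bullet> Hi v)) * \<zeta>\<^sup>2)" for \<zeta>
  have shift: "N (\<zeta> + of_real h) = N \<zeta>" for \<zeta> h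
    unfolding N_def by (subst transform_shift[of _ _ h])
      (simp add: exp_add[symmetric] exp_diff[symmetric] power2_eq_square field_simps exp_minus[symmetric])
  have hol: "N holomorphic_on UNIV"
    unfolding N_def using holomorphic_transform by (intro holomorphic_intros) auto
  have "(N has_field_derivative 0) (at \<zeta>)" for \<zeta>
  proof -
    have d: "(N has_field_derivative deriv N \<zeta>) (at \<zeta>)"
      using hol by (auto intro: holomorphic_derivI)
    have "((\<lambda>t. \<zeta> + of_real t) has_vector_derivative 1) (at (0::real))"
      by (auto intro!: derivative_eq_intros simp: has_vector_derivative_def scaleR_conv_of_real)
    then have "((\<lambda>t::real. N (\<zeta> + of_real t)) has_vector_derivative (1 * deriv N \<zeta>)) (at 0)"
      using d by (intro field_vector_diff_chain_at[unfolded o_def]) auto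
    moreover have "((\<lambda>t::real. N (\<zeta> + of_real t)) has_vector_derivative 0) (at 0)"
      unfolding shift by (rule has_vector_derivative_const)
    ultimately have "deriv N \<zeta> = 0" using vector_derivative_unique_at by fastforce
    then show ?thesis using d by simp
  qed
  then have "N \<zeta> = N 0"
    using has_field_derivative_zero_constant[of UNIV N] by (metis UNIV_I convex_UNIV)
  moreover have "transform v 0 = transform 0 0"
    by (simp add: transform_def periodized_def[abs_def] bump_def)
  ultimately have "transform v \<zeta> * exp (- of_real (pi / 2 * (v \<bullet> Hi v)) * \<zeta>\<^sup>2) = transform 0 0"
    by (simp add: N_def)
  then show ?thesis by (simp add: exp_minus field_simps)
qed

lemma inv_pos:
  assumes "v \<noteq> 0"
  shows "0 < v \<bullet> Hi v"
proof -
  have "Hi v \<noteq> 0" using assms H_Hi[of v] linear_0[OF lin] by metis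
  then have "0 < Hi v \<bullet> H (Hi v)" by (rule pos)
  then show ?thesis by (simp add: H_Hi inner_commute)
qed

text \<open>As functions of \<open>x\<close>, both sides are continuous and periodic, and they have the same Fourier coefficients.
The constant \<open>\<kappa>\<close> is the integral of the Gaussian; it is not zero because the left hand side is positive
for \<open>x = \<rho> = 0\<close>.\<close>

theorem poisson_summation:
  obtains \<kappa> where "\<kappa> \<noteq> 0"
    "\<And>x \<rho>. (\<Sum>\<^sub>\<infinity>z\<in>int_lattice. exp (- of_real (pi / 2 * ((x + z) \<bullet> H (x + z))) - \<i> * of_real (pi * ((x + z) \<bullet> \<rho>)))) =
      \<kappa> * (\<Sum>\<^sub>\<infinity>m\<in>int_lattice. character m x * exp (- of_real (pi / 2 * ((\<rho> + 2 *\<^sub>R m) \<bullet> Hi (\<rho> + 2 *\<^sub>R m)))))"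
proof -
  obtain \<delta> where \<delta>: "0 < \<delta>" "\<And>x. \<delta> * (norm x)\<^sup>2 \<le> x \<bullet> Hi x"
    using positive_definite_bound[OF lin_inv inv_pos] by blast
  have lhs: "exp (- of_real (pi / 2 * ((x + z) \<bullet> H (x + z))) - \<i> * of_real (pi * ((x + z) \<bullet> \<rho>))) = bump \<rho> (- \<i>) (x + z)" for x z \<rho>
    by (simp add: bump_def mult_ac)
  have eq: "periodized \<rho> (- \<i>) x =
     transform 0 0 * (\<Sum>\<^sub>\<infinity>m\<in>int_lattice. character m x * exp (- of_real (pi / 2 * ((\<rho> + 2 *\<^sub>R m) \<bullet> Hi (\<rho> + 2 *\<^sub>R m)))))" for x \<rho>
  proof -
    define c where "c m = transform 0 0 * exp (- of_real (pi / 2 * ((\<rho> + 2 *\<^sub>R m) \<bullet> Hi (\<rho> + 2 *\<^sub>R m))))" for m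
    define S where "S x = (\<Sum>\<^sub>\<infinity>m\<in>int_lattice. c m * character m x)" for x
    have c: "(\<lambda>m. norm (c m)) summable_on int_lattice"
    proof (rule gaussian_summable_on_coset[of "pi / 2 * \<delta>" "\<lambda>m. \<rho> + 2 *\<^sub>R m"])
      show "norm (c m) \<le> norm (transform 0 0) * exp (- (pi / 2 * \<delta>) * (norm (\<rho> + 2 *\<^sub>R m))\<^sup>2)" for m
        using \<delta>(2)[of "\<rho> + 2 *\<^sub>R m"] by (simp add: c_def norm_mult norm_exp_eq_Re mult_left_mono)
    qed (use \<delta> in \<open>auto simp: inj_on_def scaleR_right_diff_distrib[symmetric] intro!: int_lattice_scaleR\<close>)
    have S: "continuous_on UNIV S" "lattice_periodic S"
      "\<And>m. m \<in> int_lattice \<Longrightarrow> integral (cbox 0 One) (\<lambda>x. S x * character (- m) x) = c m"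
      unfolding S_def using fourier_coefficient_of_series[OF c subset_refl int_lattice_0]
        fourier_coefficient_of_series(3)[OF c subset_refl] by auto
    have "periodized \<rho> (- \<i>) x - S x = 0"
    proof (rule fourier_uniqueness[where f = "\<lambda>x. periodized \<rho> (- \<i>) x - S x"])
      show "continuous_on UNIV (\<lambda>x. periodized \<rho> (- \<i>) x - S x)"
        by (intro continuous_intros S continuous_periodized)
      show "lattice_periodic (\<lambda>x. periodized \<rho> (- \<i>) x - S x)"
        using S(2) lattice_periodic_periodized by (simp add: lattice_periodic_def)
      fix m :: 'w assume m: "m \<in> int_lattice"
      \<comment> \<open>\<open>character (- m)\<close> has frequency \<open>2 \<pi>\<close> and the bump has \<open>\<pi>\<close>, hence the factor \<open>2\<close>\<close>
      have "periodized \<rho> (- \<i>) x * character (- m) x = periodized (\<rho> + 2 *\<^sub>R m) (- \<i>) x" for x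
      proof -
        have "bump \<rho> (- \<i>) (x + z) * character (- m) x = bump (\<rho> + 2 *\<^sub>R m) (- \<i>) (x + z)" if "z \<in> int_lattice" for z
        proof -
          have "character (- m) x = character (- m) (x + z)" using m that by (simp add: character_add)
          then show ?thesis
            by (simp add: bump_def character_def exp_add[symmetric] inner_add_right algebra_simps inner_commute[of m])
        qed
        then show ?thesis
          unfolding periodized_def by (subst infsum_cmult_left'[symmetric]) (auto intro!: infsum_cong)
      qed
      then have "integral (cbox 0 One) (\<lambda>x. periodized \<rho> (- \<i>) x * character (- m) x) = transform (\<rho> + 2 *\<^sub>R m) (- \<i>)"
        by (simp add: transform_def)
      also have "\<dots> = c m" by (subst transform_eq) (simp add: c_def)
      finally have P: "integral (cbox 0 One) (\<lambda>x. periodized \<rho> (- \<i>) x * character (- m) x) = c m" .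
      have "integral (cbox 0 One) (\<lambda>x. (periodized \<rho> (- \<i>) x - S x) * character (- m) x) =
        integral (cbox 0 One) (\<lambda>x. periodized \<rho> (- \<i>) x * character (- m) x) - integral (cbox 0 One) (\<lambda>x. S x * character (- m) x)"
        unfolding left_diff_distrib
        by (intro integral_diff integrable_continuous continuous_intros
            continuous_on_subset[OF S(1)] continuous_on_subset[OF continuous_periodized]) auto
      then show "integral (cbox 0 One) (\<lambda>x. (periodized \<rho> (- \<i>) x - S x) * character (- m) x) = 0"
        using P S(3)[OF m] by simp
    qed
    then show ?thesis by (simp add: S_def c_def infsum_cmult_right'[symmetric] mult_ac)
  qed
  show ?thesis
  proof (rule that)
    show "(\<Sum>\<^sub>\<infinity>z\<in>int_lattice. exp (- of_real (pi / 2 * ((x + z) \<bullet> H (x + z))) - \<i> * of_real (pi * ((x + z) \<bullet> \<rho>)))) =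
      transform 0 0 * (\<Sum>\<^sub>\<infinity>m\<in>int_lattice. character m x * exp (- of_real (pi / 2 * ((\<rho> + 2 *\<^sub>R m) \<bullet> Hi (\<rho> + 2 *\<^sub>R m)))))" for x \<rho>
      unfolding lhs using eq[of \<rho> x] by (simp only: periodized_def)
    show "transform 0 0 \<noteq> 0"
    proof
      assume "transform 0 0 = 0"
      then have z: "periodized 0 (- \<i>) 0 = 0" using eq[of 0 0] by simp
      have "bump 0 (- \<i>) z = of_real (exp (- (pi / 2 * (z \<bullet> H z))))" for z
        by (simp add: bump_def exp_of_real[symmetric])
      moreover have s: "(\<lambda>z. exp (- (pi / 2 * (z \<bullet> H z)))) summable_on int_lattice"
        using bump_summable[of 0 0 0] by (simp add: bump_def norm_exp_eq_Re)
      ultimately have "periodized 0 (- \<i>) 0 = of_real (\<Sum>\<^sub>\<infinity>z\<in>int_lattice. exp (- (pi / 2 * (z \<bullet> H z))))"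
        unfolding periodized_def by (simp only: add_0 infsumI[OF has_sum_of_real[OF has_sum_infsum[OF s]]])
      moreover from s
      have "exp (- (pi / 2 * (0 \<bullet> H 0))) \<le> (\<Sum>\<^sub>\<infinity>z\<in>int_lattice. exp (- (pi / 2 * (z \<bullet> H z))))"
        using finite_sum_le_infsum[of "\<lambda>z. exp (- (pi / 2 * (z \<bullet> H z)))" int_lattice "{0}"] by simp
      ultimately show False using z by simp
    qed
  qed
qed

end

section \<open>Theta constants with half-integral characteristics\<close>

lemma norm_summable_on_Sigma:
  fixes f :: "'a \<times> 'b \<Rightarrow> 'c::real_normed_vector"
  assumes "\<And>x. x \<in> A \<Longrightarrow> (\<lambda>y. norm (f (x, y))) summable_on B x"
    and "\<And>x. x \<in> A \<Longrightarrow> (\<Sum>\<^sub>\<infinity>y\<in>B x. norm (f (x, y))) \<le> h x" and "h summable_on A"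
  shows "(\<lambda>p. norm (f p)) summable_on Sigma A B"
  unfolding Infinite_Sum.abs_summable_on_Sigma_iff
proof (intro conjI ballI assms(1))
  show "(\<lambda>x. norm (\<Sum>\<^sub>\<infinity>y\<in>B x. norm (f (x, y)))) summable_on A"
    by (rule Infinite_Sum.abs_summable_on_comparison_test'[OF assms(3)]) (simp add: infsum_nonneg assms(2))
qed

lemma norm_summable_on_product:
  fixes f :: "'a \<Rightarrow> complex" and g :: "'b \<Rightarrow> complex"
  assumes "(\<lambda>k. norm (f k)) summable_on A" and "(\<lambda>l. norm (g l)) summable_on B"
  shows "(\<lambda>p. norm (f (fst p) * g (snd p))) summable_on A \<times> B"
  by (rule norm_summable_on_Sigma[where h = "\<lambda>k. norm (f k) * (\<Sum>\<^sub>\<infinity>l\<in>B. norm (g l))"])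
    (simp_all add: norm_mult infsum_cmult_right' summable_on_cmult_right summable_on_cmult_left assms)

lemma character_half:
  assumes "m \<bullet> b \<in> \<int>"
  shows "character (b /\<^sub>R 2) m = (if (m \<bullet> b) / 2 \<in> \<int> then 1 else -1)"
proof -
  obtain j :: int where j: "m \<bullet> b = of_int j" using assms by (auto elim: Ints_cases)
  have e: "character (b /\<^sub>R 2) m = exp (\<i> * of_real (pi * of_int j))"
    using j by (simp add: character_def inner_commute[of b] mult_ac)
  show ?thesis
  proof (cases "even j")
    case True
    then obtain i where "j = 2 * i" by auto
    then have "(m \<bullet> b) / 2 = of_int i" using j by simp
    moreover have "exp (\<i> * of_real (pi * of_int j)) = exp (2 * of_real pi * \<i> * of_real (of_int i))"
      using \<open>j = 2 * i\<close> by (simp add: mult_ac)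
    ultimately show ?thesis using exp_2pi_i_eq_1_iff[of "of_int i"] unfolding e by simp
  next
    case False
    then obtain i where i: "j = 2 * i + 1" by (auto elim: oddE)
    have "real_of_int j / 2 \<notin> \<int>"
    proof
      assume "real_of_int j / 2 \<in> \<int>"
      then obtain l where "real_of_int j / 2 = of_int l" by (auto elim: Ints_cases)
      then have "real_of_int j = of_int (2 * l)" by simp
      then have "j = 2 * l" by linarith
      then show False using False by simp
    qed
    moreover have "exp (\<i> * of_real (pi * of_int j)) = exp (2 * of_real pi * \<i> * of_real (of_int i)) * exp (of_real pi * \<i>)"
      unfolding exp_add[symmetric] by (simp add: i algebra_simps)
    then have "exp (\<i> * of_real (pi * of_int j)) = -1"
      using exp_2pi_i_eq_1_iff[of "of_int i"] by simp
    ultimately show ?thesis using j e by simp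
  qed
qed

text \<open>The characters of half-integral frequency take the values \<open>1\<close> and \<open>- 1\<close> on the lattice and separate the
classes modulo \<open>2\<close>. The indicator function of a class is therefore a combination of such characters, which
is built up by fixing the parity of one coordinate after the other.\<close>

lemma parity_class_sum_zero:
  fixes c :: "'w::euclidean_space \<Rightarrow> complex"
  assumes c: "(\<lambda>k. norm (c k)) summable_on \<Lambda>" and \<Lambda>: "\<Lambda> \<subseteq> int_lattice"
    and z: "\<And>\<epsilon>. \<epsilon> \<in> int_lattice \<Longrightarrow> (\<Sum>\<^sub>\<infinity>k\<in>\<Lambda>. character (\<epsilon> /\<^sub>R 2) k * c k) = 0"
    and k0: "k0 \<in> int_lattice"
  shows "(\<Sum>\<^sub>\<infinity>m\<in>{m \<in> \<Lambda>. (m - k0) /\<^sub>R 2 \<in> int_lattice}. c m) = 0"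
proof -
  define A where "A B = {m \<in> \<Lambda>. \<forall>b\<in>B. (m - k0) \<bullet> b / 2 \<in> \<int>}" for B :: "'w set"
  have "\<forall>\<epsilon>\<in>int_lattice. (\<Sum>\<^sub>\<infinity>m\<in>A B. character (\<epsilon> /\<^sub>R 2) m * c m) = 0" if "finite B" "B \<subseteq> Basis" for B
    using that
  proof (induction B)
    case empty
    have e: "A {} = \<Lambda>" by (auto simp: A_def)
    show ?case unfolding e by (intro ballI z)
  next
    case (insert b B)
    show ?case
    proof
      fix \<epsilon> :: 'w assume \<epsilon>: "\<epsilon> \<in> int_lattice"
      have b: "b \<in> Basis" using insert by simp
      have int: "(m - k0) \<bullet> b \<in> \<int>" if "m \<in> A B" for m
        using that \<Lambda> k0 b by (auto simp: A_def intro!: int_lattice_inner int_lattice_diff)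
      have eq: "1 / 2 * (character (\<epsilon> /\<^sub>R 2) m * c m) +
          character (b /\<^sub>R 2) (- k0) / 2 * (character ((\<epsilon> + b) /\<^sub>R 2) m * c m) =
          (1 + character (b /\<^sub>R 2) (- k0 + m)) / 2 * (character (\<epsilon> /\<^sub>R 2) m * c m)" for m
        unfolding scaleR_add_right character_add by (simp add: algebra_simps add_divide_distrib)
      have s: "(\<lambda>m. r * (character e m * c m)) summable_on A B" for e r
      proof (rule summable_on_cmult_right, rule abs_summable_summable)
        show "(\<lambda>m. norm (character e m * c m)) summable_on A B"
          using summable_on_subset[OF c, of "A B"] by (auto simp: A_def norm_mult)
      qed
      have "(\<Sum>\<^sub>\<infinity>m\<in>A (insert b B). character (\<epsilon> /\<^sub>R 2) m * c m) =
        (\<Sum>\<^sub>\<infinity>m\<in>A B. 1 / 2 * (character (\<epsilon> /\<^sub>R 2) m * c m) +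
          character (b /\<^sub>R 2) (- k0) / 2 * (character ((\<epsilon> + b) /\<^sub>R 2) m * c m))"
      proof (rule infsum_cong_neutral)
        fix m assume m: "m \<in> A (insert b B) \<inter> A B"
        have "character (b /\<^sub>R 2) (- k0 + m) = 1"
          using m int b by (subst character_half) (auto simp: A_def add.commute)
        then show "character (\<epsilon> /\<^sub>R 2) m * c m = 1 / 2 * (character (\<epsilon> /\<^sub>R 2) m * c m) +
          character (b /\<^sub>R 2) (- k0) / 2 * (character ((\<epsilon> + b) /\<^sub>R 2) m * c m)"
          unfolding eq by simp
      next
        fix m assume m: "m \<in> A B - A (insert b B)"
        have "character (b /\<^sub>R 2) (- k0 + m) = -1"
          using m int b by (subst character_half) (auto simp: A_def add.commute)
        then show "1 / 2 * (character (\<epsilon> /\<^sub>R 2) m * c m) +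
          character (b /\<^sub>R 2) (- k0) / 2 * (character ((\<epsilon> + b) /\<^sub>R 2) m * c m) = 0"
          unfolding eq by simp
      qed (auto simp: A_def)
      also have "\<dots> = 1 / 2 * (\<Sum>\<^sub>\<infinity>m\<in>A B. character (\<epsilon> /\<^sub>R 2) m * c m) +
          character (b /\<^sub>R 2) (- k0) / 2 * (\<Sum>\<^sub>\<infinity>m\<in>A B. character ((\<epsilon> + b) /\<^sub>R 2) m * c m)"
        by (simp only: infsum_add[OF s s] infsum_cmult_right')
      also have "\<dots> = 0" using insert \<epsilon> b by (simp add: int_lattice_add)
      finally show "(\<Sum>\<^sub>\<infinity>m\<in>A (insert b B). character (\<epsilon> /\<^sub>R 2) m * c m) = 0" .
    qed
  qed
  note this[OF finite_Basis subset_refl, THEN bspec, OF int_lattice_0]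
  moreover have "A Basis = {m \<in> \<Lambda>. (m - k0) /\<^sub>R 2 \<in> int_lattice}"
    by (auto simp: A_def int_lattice_def)
  ultimately show ?thesis by simp
qed

text \<open>These identities invert the substitution \<open>(k, l) \<mapsto> (k + l, k - l)\<close>.\<close>

lemma half_sum_diff:
  fixes k m :: "'w::euclidean_space"
  shows "((k + m) + (k - m)) /\<^sub>R 2 = k" "((k + m) - (k - m)) /\<^sub>R 2 = m"
    "(k + m) /\<^sub>R 2 + (k - m) /\<^sub>R 2 = k" "(k + m) /\<^sub>R 2 - (k - m) /\<^sub>R 2 = m"
    "((k - m) - (k + m)) /\<^sub>R 2 = - m" "(k + m) /\<^sub>R 2 = k - (k - m) /\<^sub>R 2"
    "(m - k) /\<^sub>R 2 = - ((k - m) /\<^sub>R 2)"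
  by (auto simp: euclidean_eq_iff[where 'a = 'w] inner_add_left inner_diff_left field_simps)

text \<open>If all twisted sums vanish, then so do the sums of \<open>c\<close> over the classes modulo \<open>2\<close>. Substituting
\<open>(k + l, k - l)\<close> for the indices, the square of the Fourier series with coefficients \<open>d\<close> becomes a sum of
products of \<open>c\<close>, in which the inner sum runs over one class. So the Fourier series is \<open>0\<close>, in contradiction to
\<open>d 0 \<noteq> 0\<close>.\<close>

theorem theta_constant_nonzero:
  fixes c d :: "'w::euclidean_space \<Rightarrow> complex"
  assumes \<Lambda>: "\<Lambda> \<subseteq> int_lattice" "0 \<in> \<Lambda>"
    and add: "\<And>k l. k \<in> \<Lambda> \<Longrightarrow> l \<in> \<Lambda> \<Longrightarrow> k + l \<in> \<Lambda>" and diff: "\<And>k l. k \<in> \<Lambda> \<Longrightarrow> l \<in> \<Lambda> \<Longrightarrow> k - l \<in> \<Lambda>"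
    and sat: "\<And>l. l \<in> int_lattice \<Longrightarrow> 2 *\<^sub>R l \<in> \<Lambda> \<Longrightarrow> l \<in> \<Lambda>"
    and c: "(\<lambda>k. norm (c k)) summable_on \<Lambda>" and d: "(\<lambda>k. norm (d k)) summable_on \<Lambda>"
    and cd: "\<And>k l. k \<in> \<Lambda> \<Longrightarrow> l \<in> \<Lambda> \<Longrightarrow> c (k + l) * c (k - l) = d k * d l" and d0: "d 0 \<noteq> 0"
  shows "\<exists>\<epsilon>\<in>int_lattice. (\<Sum>\<^sub>\<infinity>k\<in>\<Lambda>. character (\<epsilon> /\<^sub>R 2) k * c k) \<noteq> 0"
proof (rule ccontr)
  assume "\<not> ?thesis"
  then have zero: "\<And>\<epsilon>. \<epsilon> \<in> int_lattice \<Longrightarrow> (\<Sum>\<^sub>\<infinity>k\<in>\<Lambda>. character (\<epsilon> /\<^sub>R 2) k * c k) = 0" by blast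
  define P where "P g = {m \<in> \<Lambda>. (m - g) /\<^sub>R 2 \<in> int_lattice}" for g
  have Pz: "(\<Sum>\<^sub>\<infinity>m\<in>P g. c m) = 0" if "g \<in> \<Lambda>" for g
    using parity_class_sum_zero[OF c \<Lambda>(1) zero, of g] that \<Lambda>(1) by (auto simp: P_def)
  have D: "(\<Sum>\<^sub>\<infinity>k\<in>\<Lambda>. d k * character k x) = 0" for x
  proof -
    define g where "g k = d k * character k x" for k
    have gs: "(\<lambda>k. norm (g k)) summable_on \<Lambda>" using d by (simp add: g_def norm_mult)
    have s2: "(\<lambda>(k, l). g k * g l) summable_on \<Lambda> \<times> \<Lambda>"
      unfolding case_prod_unfold by (rule abs_summable_summable[OF norm_summable_on_product[OF gs gs]])
    have "(\<Sum>\<^sub>\<infinity>k\<in>\<Lambda>. g k) * (\<Sum>\<^sub>\<infinity>l\<in>\<Lambda>. g l) = (\<Sum>\<^sub>\<infinity>k\<in>\<Lambda>. \<Sum>\<^sub>\<infinity>l\<in>\<Lambda>. g k * g l)"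
      by (simp only: infsum_cmult_right' infsum_cmult_left')
    also have "\<dots> = (\<Sum>\<^sub>\<infinity>(k, l)\<in>\<Lambda> \<times> \<Lambda>. g k * g l)"
      by (rule infsum_Sigma'_banach[OF s2])
    \<comment> \<open>The image of the substitution consists of the pairs congruent modulo \<open>2\<close> in the ambient lattice;
    saturation of \<open>\<Lambda>\<close> puts half of their difference into \<open>\<Lambda>\<close>.\<close>
    also have "\<dots> = (\<Sum>\<^sub>\<infinity>(k, m)\<in>Sigma \<Lambda> P. (character k x * c k) * c m)"
    proof (rule infsum_reindex_bij_witness[of _ "\<lambda>(k, m). ((k + m) /\<^sub>R 2, (k - m) /\<^sub>R 2)" "\<lambda>(k, l). (k + l, k - l)"])
      fix p assume p: "p \<in> Sigma \<Lambda> P"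
      obtain k m where km: "p = (k, m)" "k \<in> \<Lambda>" "m \<in> \<Lambda>" "(m - k) /\<^sub>R 2 \<in> int_lattice"
        using p by (auto simp: P_def)
      have l: "(k - m) /\<^sub>R 2 \<in> int_lattice" using km(4) half_sum_diff(7)[of m k] int_lattice_minus by metis
      moreover have "2 *\<^sub>R ((k - m) /\<^sub>R 2) \<in> \<Lambda>" using diff km by simp
      ultimately have l2: "(k - m) /\<^sub>R 2 \<in> \<Lambda>" by (rule sat)
      have "(k + m) /\<^sub>R 2 \<in> \<Lambda>" using half_sum_diff(6)[of k m] diff[OF km(2) l2] by (simp only:)
      then show "(case p of (k, m) \<Rightarrow> ((k + m) /\<^sub>R 2, (k - m) /\<^sub>R 2)) \<in> \<Lambda> \<times> \<Lambda>"
        using l2 by (simp only: km(1) prod.case mem_Sigma_iff)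
      show "(case (case p of (k, m) \<Rightarrow> ((k + m) /\<^sub>R 2, (k - m) /\<^sub>R 2)) of (k, l) \<Rightarrow> (k + l, k - l)) = p"
        by (simp only: km(1) prod.case half_sum_diff(1-4))
    next
      fix p assume p: "p \<in> \<Lambda> \<times> \<Lambda>"
      obtain k l where kl: "p = (k, l)" "k \<in> \<Lambda>" "l \<in> \<Lambda>" using p by auto
      have "((k - l) - (k + l)) /\<^sub>R 2 \<in> int_lattice"
        unfolding half_sum_diff(5) using kl \<Lambda>(1) by auto
      then show "(case p of (k, l) \<Rightarrow> (k + l, k - l)) \<in> Sigma \<Lambda> P"
        using add[OF kl(2,3)] diff[OF kl(2,3)] by (simp only: kl(1) prod.case mem_Sigma_iff P_def mem_Collect_eq)
      show "(case (case p of (k, l) \<Rightarrow> (k + l, k - l)) of (k, m) \<Rightarrow> ((k + m) /\<^sub>R 2, (k - m) /\<^sub>R 2)) = p"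
        by (simp only: kl(1) prod.case half_sum_diff(1-4))
      show "(case (case p of (k, l) \<Rightarrow> (k + l, k - l)) of (k, m) \<Rightarrow> (character k x * c k) * c m) = (case p of (k, l) \<Rightarrow> g k * g l)"
        using cd[OF kl(2,3)] by (simp add: kl g_def character_add)
    qed
    also have "\<dots> = (\<Sum>\<^sub>\<infinity>k\<in>\<Lambda>. \<Sum>\<^sub>\<infinity>m\<in>P k. (character k x * c k) * c m)"
    proof (rule infsum_Sigma'_banach[symmetric])
      have "(\<lambda>k. norm (character k x * c k)) summable_on \<Lambda>" using c by (simp add: norm_mult)
      from abs_summable_summable[OF norm_summable_on_product[OF this c]]
      show "(\<lambda>(k, m). (character k x * c k) * c m) summable_on Sigma \<Lambda> P"
        unfolding case_prod_unfold by (rule summable_on_subset_banach) (auto simp: P_def)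
    qed
    also have "\<dots> = 0" unfolding infsum_cmult_right' by (rule infsum_0) (simp add: Pz)
    finally show ?thesis by (simp add: g_def)
  qed
  have "integral (cbox 0 One) (\<lambda>x. (\<Sum>\<^sub>\<infinity>k\<in>\<Lambda>. d k * character k x) * character (- 0) x) = d 0"
    using fourier_coefficient_of_series(3)[OF d \<Lambda>(1) int_lattice_0] \<Lambda>(2) by simp
  then show False using D d0 by simp
qed

section \<open>Parallel transport and holonomy on branes\<close>

lemma smooth_along_derivative:
  assumes "smooth_along S f"
  obtains D where "continuous_on S f" "\<And>v. continuous_on S (D v)"
    "\<And>v p. v \<in> tangent S \<Longrightarrow> p \<in> S \<Longrightarrow> ((\<lambda>t. f (p + t *\<^sub>R v)) has_vector_derivative D v p) (at 0)"
proof -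
  obtain F where F: "\<And>p. p \<in> S \<Longrightarrow> F [] p = f p" "\<And>vs. continuous_on S (F vs)"
    "\<And>vs v p. v \<in> tangent S \<Longrightarrow> p \<in> S \<Longrightarrow> ((\<lambda>t. F vs (p + t *\<^sub>R v)) has_vector_derivative F (v # vs) p) (at 0)"
    using assms unfolding smooth_along_def by blast
  show ?thesis
  proof (rule that[of "\<lambda>v. F [v]"])
    show "continuous_on S f" using F(2)[of "[]"] by (rule continuous_on_eq) (simp add: F(1))
    fix v p assume v: "v \<in> tangent S" and p: "p \<in> S"
    have "(\<lambda>t. F [] (p + t *\<^sub>R v)) = (\<lambda>t. f (p + t *\<^sub>R v))"
      using v p by (auto simp: tangent_def F(1))
    then show "((\<lambda>t. f (p + t *\<^sub>R v)) has_vector_derivative F [v] p) (at 0)"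
      using F(3)[OF v p, of "[]"] by simp
  qed (rule F(2))
qed

lemma has_vector_derivative_along_line:
  fixes p v :: "'w::real_normed_vector"
  assumes "((\<lambda>t. f ((p + t0 *\<^sub>R v) + t *\<^sub>R v)) has_vector_derivative d) (at 0)"
  shows "((\<lambda>t. f (p + t *\<^sub>R v)) has_vector_derivative d) (at t0)"
proof -
  have "((\<lambda>t. t - t0) has_vector_derivative 1) (at t0)"
    by (auto intro!: derivative_eq_intros)
  then have "((\<lambda>t. f ((p + t0 *\<^sub>R v) + t *\<^sub>R v)) \<circ> (\<lambda>t. t - t0) has_vector_derivative 1 *\<^sub>R d) (at t0)"
    by (rule vector_diff_chain_at) (use assms in simp)
  moreover have "(\<lambda>t. f ((p + t0 *\<^sub>R v) + t *\<^sub>R v)) \<circ> (\<lambda>t. t - t0) = (\<lambda>t. f (p + t *\<^sub>R v))"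
    by (auto simp: fun_eq_iff algebra_simps)
  ultimately show ?thesis by simp
qed

text \<open>The curvature is that of a brane with an arbitrary form in place of \<open>- B\<close>: Stokes' theorem only sees a
constant alternating form.\<close>

locale brane_calculus =
  fixes L :: "'w::euclidean_space brane" and F :: "'w \<Rightarrow> 'w \<Rightarrow> real"
  assumes line_bundle: "unitary_line_bundle (supp L) (conn L) (mult L)"
    and curv: "\<And>p u v. p \<in> supp L \<Longrightarrow> u \<in> tangent (supp L) \<Longrightarrow> v \<in> tangent (supp L) \<Longrightarrow>
      curvature (conn L) p u v = - 2 * of_real pi * \<i> * of_real (F u v)"
    and tangent_subspace: "subspace (tangent (supp L))"
    and supp_lattice: "\<And>p \<gamma>. p \<in> supp L \<Longrightarrow> \<gamma> \<in> int_lattice \<Longrightarrow> p + \<gamma> \<in> supp L"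
    and bilinear_F: "bilinear F" and alternating_F: "\<And>u v. F u v = - F v u"
begin

lemma F_self [simp]: "F u u = 0"
  using alternating_F[of u u] by simp

lemma supp_add: "p \<in> supp L \<Longrightarrow> v \<in> tangent (supp L) \<Longrightarrow> p + v \<in> supp L"
  unfolding tangent_def using scaleR_one[of v] by (metis (mono_tags, lifting) mem_Collect_eq)

lemma tangent_add: "u \<in> tangent (supp L) \<Longrightarrow> v \<in> tangent (supp L) \<Longrightarrow> u + v \<in> tangent (supp L)"
  and tangent_scaleR: "u \<in> tangent (supp L) \<Longrightarrow> t *\<^sub>R u \<in> tangent (supp L)"
  and tangent_minus: "u \<in> tangent (supp L) \<Longrightarrow> - u \<in> tangent (supp L)"
  using tangent_subspace by (auto simp: subspace_def subspace_neg)

lemma supp_line: "p \<in> supp L \<Longrightarrow> v \<in> tangent (supp L) \<Longrightarrow> p + t *\<^sub>R v \<in> supp L"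
  by (auto simp: tangent_def)

lemma conn_smooth: "v \<in> tangent (supp L) \<Longrightarrow> smooth_along (supp L) (\<lambda>p. conn L p v)"
  and conn_add: "p \<in> supp L \<Longrightarrow> u \<in> tangent (supp L) \<Longrightarrow> v \<in> tangent (supp L) \<Longrightarrow>
    conn L p (u + v) = conn L p u + conn L p v"
  and conn_scaleR: "p \<in> supp L \<Longrightarrow> v \<in> tangent (supp L) \<Longrightarrow> conn L p (t *\<^sub>R v) = of_real t * conn L p v"
  and conn_imaginary: "p \<in> supp L \<Longrightarrow> v \<in> tangent (supp L) \<Longrightarrow> Re (conn L p v) = 0"
  and mult_deriv: "\<gamma> \<in> int_lattice \<Longrightarrow> p \<in> supp L \<Longrightarrow> v \<in> tangent (supp L) \<Longrightarrow>
      ((\<lambda>t. mult L \<gamma> (p + t *\<^sub>R v)) has_vector_derivative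
        (conn L p v - conn L (p + \<gamma>) v) * mult L \<gamma> p) (at 0)"
  and mult_cocycle: "\<gamma> \<in> int_lattice \<Longrightarrow> \<gamma>' \<in> int_lattice \<Longrightarrow> p \<in> supp L \<Longrightarrow>
      mult L (\<gamma> + \<gamma>') p = mult L \<gamma> (p + \<gamma>') * mult L \<gamma>' p"
  and norm_mult_eq_1: "\<gamma> \<in> int_lattice \<Longrightarrow> p \<in> supp L \<Longrightarrow> norm (mult L \<gamma> p) = 1"
  using line_bundle unfolding unitary_line_bundle_def by blast+

lemma mult_nonzero: "\<gamma> \<in> int_lattice \<Longrightarrow> p \<in> supp L \<Longrightarrow> mult L \<gamma> p \<noteq> 0"
  using norm_mult_eq_1 by fastforce

lemma conn_continuous: "v \<in> tangent (supp L) \<Longrightarrow> continuous_on (supp L) (\<lambda>p. conn L p v)"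
  using smooth_along_derivative[OF conn_smooth] by metis

lemma transport_nonzero [simp]: "transport L p q \<noteq> 0"
  by (simp add: transport_def)

lemma transport_shift_eq: "transport L p (p + u) = exp (- integral {0..1} (\<lambda>t. conn L (p + t *\<^sub>R u) u))"
  by (simp add: transport_def)

lemma conn_line_continuous:
  assumes "p \<in> supp L" "u \<in> tangent (supp L)" "v \<in> tangent (supp L)"
  shows "continuous_on A (\<lambda>t. conn L (p + t *\<^sub>R u) v)"
  by (rule continuous_on_compose2[OF conn_continuous[OF assms(3)]])
    (auto intro!: continuous_intros supp_line assms)

lemma norm_transport:
  assumes p: "p \<in> supp L" and u: "u \<in> tangent (supp L)"
  shows "norm (transport L p (p + u)) = 1"
proof -
  have "(\<lambda>t. conn L (p + t *\<^sub>R u) u) integrable_on {0..1}"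
    by (intro integrable_continuous_real conn_line_continuous p u)
  then have "Re (integral {0..1} (\<lambda>t. conn L (p + t *\<^sub>R u) u)) = integral {0..1} (\<lambda>t. Re (conn L (p + t *\<^sub>R u) u))"
    using integral_linear[OF _ bounded_linear_Re] by (fastforce simp: o_def)
  also have "\<dots> = 0" by (simp add: conn_imaginary supp_line p u)
  finally show ?thesis by (simp add: transport_shift_eq norm_exp_eq_Re)
qed

text \<open>Stokes' theorem for a triangle. Let \<open>I t\<close> be the integral of the connection along the straight path from
\<open>p\<close> to \<open>p + u + t v\<close>. Because the curvature is constant, the derivative of \<open>I\<close> is the connection along the third
edge, minus half of the curvature of \<open>u\<close> and \<open>v\<close>.\<close>

lemma transport_triangle:
  assumes p: "p \<in> supp L" and u: "u \<in> tangent (supp L)" and v: "v \<in> tangent (supp L)"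
  shows "transport L p (p + u + v) =
    transport L p (p + u) * transport L (p + u) (p + u + v) * exp (- of_real pi * \<i> * of_real (F u v))"
proof -
  define K where "K = - 2 * of_real pi * \<i> * of_real (F u v)"
  define x where "x t s = p + s *\<^sub>R (u + t *\<^sub>R v)" for t s :: real
  have w: "u + t *\<^sub>R v \<in> tangent (supp L)" for t by (intro tangent_add tangent_scaleR u v)
  have x: "x t s \<in> supp L" for t s unfolding x_def by (intro supp_line p w)
  obtain Du where Du: "\<And>v. continuous_on (supp L) (Du v)"
    "\<And>v p. v \<in> tangent (supp L) \<Longrightarrow> p \<in> supp L \<Longrightarrow> ((\<lambda>t. conn L (p + t *\<^sub>R v) u) has_vector_derivative Du v p) (at 0)"
    using smooth_along_derivative[OF conn_smooth[OF u]] by metis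
  obtain Dv where Dv: "\<And>w. continuous_on (supp L) (Dv w)"
    "\<And>w p. w \<in> tangent (supp L) \<Longrightarrow> p \<in> supp L \<Longrightarrow> ((\<lambda>t. conn L (p + t *\<^sub>R w) v) has_vector_derivative Dv w p) (at 0)"
    using smooth_along_derivative[OF conn_smooth[OF v]] by metis
  define I where "I t = integral (cbox 0 1) (\<lambda>s. conn L (x t s) u + of_real t * conn L (x t s) v)" for t
  have I_eq: "I t = integral {0..1} (\<lambda>s. conn L (p + s *\<^sub>R (u + t *\<^sub>R v)) (u + t *\<^sub>R v))" for t
    unfolding I_def using conn_add[OF x u tangent_scaleR[OF v]] conn_scaleR[OF x v] by (simp add: x_def)
  \<comment> \<open>the curvature identity in the directions \<open>u + t v\<close> and \<open>v\<close>\<close>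
  have curvK: "Dv (u + t *\<^sub>R v) q - (Du v q + of_real t * Dv v q) = K" if q: "q \<in> supp L" for q t
  proof -
    have 1: "vector_derivative (\<lambda>s. conn L (q + s *\<^sub>R (u + t *\<^sub>R v)) v) (at 0) = Dv (u + t *\<^sub>R v) q"
      using Dv(2)[OF w q] by (rule vector_derivative_at)
    have "((\<lambda>s. conn L (q + s *\<^sub>R v) u + of_real t * conn L (q + s *\<^sub>R v) v) has_vector_derivative
        (Du v q + of_real t * Dv v q)) (at 0)"
      by (intro derivative_intros Du(2) Dv(2) v q has_vector_derivative_mult_right)
    moreover have "(\<lambda>s. conn L (q + s *\<^sub>R v) u + of_real t * conn L (q + s *\<^sub>R v) v) = (\<lambda>s. conn L (q + s *\<^sub>R v) (u + t *\<^sub>R v))"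
      using supp_line[OF q v] by (simp add: conn_add conn_scaleR u v tangent_scaleR)
    ultimately have 2: "vector_derivative (\<lambda>s. conn L (q + s *\<^sub>R v) (u + t *\<^sub>R v)) (at 0) = Du v q + of_real t * Dv v q"
      by (simp add: vector_derivative_at)
    have "F (u + t *\<^sub>R v) v = F u v"
      by (simp add: bilinear_ladd[OF bilinear_F] bilinear_lmul[OF bilinear_F])
    then show ?thesis using curv[OF q w v, of t] unfolding curvature_def 1 2 K_def by simp
  qed
  have cx: "continuous_on A (\<lambda>z. g (x (fst z) (snd z)))" if "continuous_on (supp L) g" for g :: "'w \<Rightarrow> complex" and A
    using that by (rule continuous_on_compose2) (auto intro!: continuous_intros x[unfolded x_def] simp: x_def[abs_def])
  have cx1: "continuous_on A (\<lambda>s. g (x t s))" if "continuous_on (supp L) g" for g :: "'w \<Rightarrow> complex" and A t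
    using that by (rule continuous_on_compose2) (auto intro!: continuous_intros x[unfolded x_def] simp: x_def[abs_def])
  have dI: "(I has_vector_derivative (conn L (p + u + t *\<^sub>R v) v - K / 2)) (at t within {0..1})" if t: "t \<in> {0..1}" for t
  proof -
    have "(I has_vector_derivative integral (cbox 0 1) (\<lambda>s. of_real s * Du v (x t s) + conn L (x t s) v + of_real t * (of_real s * Dv v (x t s))))
        (at t within {0..1})"
      unfolding I_def[abs_def]
    proof (rule leibniz_rule_vector_derivative)
      fix t s :: real
      have xs: "x t' s = (p + s *\<^sub>R u) + (s * t') *\<^sub>R v" for t' by (simp add: x_def algebra_simps)
      have st: "((\<lambda>t. s * t) has_vector_derivative s) (at t)" by (auto intro!: derivative_eq_intros)
      have ps: "p + s *\<^sub>R u \<in> supp L" by (intro supp_line p u)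
      have lu: "((\<lambda>r. conn L ((p + s *\<^sub>R u) + r *\<^sub>R v) u) has_vector_derivative Du v (x t s)) (at (s * t))"
        unfolding xs by (rule has_vector_derivative_along_line[where f = "\<lambda>q. conn L q u", OF Du(2)[OF v supp_line[OF ps v]]])
      have lv: "((\<lambda>r. conn L ((p + s *\<^sub>R u) + r *\<^sub>R v) v) has_vector_derivative Dv v (x t s)) (at (s * t))"
        unfolding xs by (rule has_vector_derivative_along_line[where f = "\<lambda>q. conn L q v", OF Dv(2)[OF v supp_line[OF ps v]]])
      have du: "((\<lambda>t. conn L (x t s) u) has_vector_derivative of_real s * Du v (x t s)) (at t within {0..1})"
        using vector_diff_chain_at[OF st lu] unfolding o_def xs scaleR_conv_of_real by (rule has_vector_derivative_at_within)
      have dv: "((\<lambda>t. conn L (x t s) v) has_vector_derivative of_real s * Dv v (x t s)) (at t within {0..1})"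
        using vector_diff_chain_at[OF st lv] unfolding o_def xs scaleR_conv_of_real by (rule has_vector_derivative_at_within)
      have dt: "((\<lambda>t. of_real t :: complex) has_vector_derivative 1) (at t within {0..1})"
        using has_vector_derivative_of_real[OF DERIV_ident] by simp
      show "((\<lambda>t. conn L (x t s) u + of_real t * conn L (x t s) v) has_vector_derivative
          of_real s * Du v (x t s) + conn L (x t s) v + of_real t * (of_real s * Dv v (x t s))) (at t within {0..1})"
        using has_vector_derivative_add[OF du has_vector_derivative_mult[OF dt dv]] by (simp add: algebra_simps)
    next
      show "(\<lambda>s. conn L (x t s) u + of_real t * conn L (x t s) v) integrable_on cbox 0 1" for t
        by (intro integrable_continuous continuous_intros cx1 conn_continuous u v)
      show "continuous_on ({0..1} \<times> cbox 0 1) (\<lambda>(t, s). of_real s * Du v (x t s) + conn L (x t s) v + of_real t * (of_real s * Dv v (x t s)))"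
        unfolding case_prod_unfold by (intro continuous_intros cx conn_continuous Du Dv v)
    qed (use t in auto)
    moreover have "((\<lambda>s. of_real s * Du v (x t s) + conn L (x t s) v + of_real t * (of_real s * Dv v (x t s))) has_integral
       (conn L (p + u + t *\<^sub>R v) v - K / 2)) {0..1}"
    proof -
      \<comment> \<open>an antiderivative in \<open>s\<close> of the integrand; the curvature identity trades derivatives along \<open>v\<close> for
        derivatives along the path\<close>
      have d: "((\<lambda>s. of_real s * conn L (x t s) v - of_real (s\<^sup>2) * (K / 2)) has_vector_derivative
          of_real s * Du v (x t s) + conn L (x t s) v + of_real t * (of_real s * Dv v (x t s))) (at s within {0..1})" for s
      proof -
        have l: "((\<lambda>s. conn L (x t s) v) has_vector_derivative Dv (u + t *\<^sub>R v) (x t s)) (at s within {0..1})"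
          unfolding x_def
          by (rule has_vector_derivative_at_within[OF has_vector_derivative_along_line[where f = "\<lambda>q. conn L q v", OF Dv(2)[OF w supp_line[OF p w]]]])
        have ds: "((\<lambda>s. of_real s :: complex) has_vector_derivative 1) (at s within {0..1})"
          using has_vector_derivative_of_real[OF DERIV_ident] by simp
        have ds2: "((\<lambda>s. of_real (s\<^sup>2) * (K / 2)) has_vector_derivative of_real s * K) (at s within {0..1})"
          using has_vector_derivative_mult_left[OF has_vector_derivative_mult[OF ds ds], of "K / 2"] by (simp add: power2_eq_square algebra_simps)
        have "((\<lambda>s. of_real s * conn L (x t s) v - of_real (s\<^sup>2) * (K / 2)) has_vector_derivative
          (of_real s * Dv (u + t *\<^sub>R v) (x t s) + 1 * conn L (x t s) v - of_real s * K)) (at s within {0..1})"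
          by (intro has_vector_derivative_diff has_vector_derivative_mult ds l ds2)
        moreover have "Dv (u + t *\<^sub>R v) (x t s) = K + (Du v (x t s) + of_real t * Dv v (x t s))"
          using curvK[OF x, of t t s] by (simp add: algebra_simps)
        ultimately show ?thesis by (simp add: algebra_simps)
      qed
      show ?thesis
        using fundamental_theorem_of_calculus[of 0 1, OF _ d] by (simp add: x_def algebra_simps)
    qed
    ultimately show ?thesis by (simp add: integral_unique)
  qed
  have gen: "- a = - b + - c + k" if "a - b = c - k" for a b c k :: complex
    using that by (simp add: algebra_simps)
  have "((\<lambda>t. conn L (p + u + t *\<^sub>R v) v - K / 2) has_integral (I 1 - I 0)) {0..1}"
    by (rule fundamental_theorem_of_calculus) (use dI in auto)
  moreover have "((\<lambda>t. conn L (p + u + t *\<^sub>R v) v - K / 2) has_integral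
      (integral {0..1} (\<lambda>t. conn L (p + u + t *\<^sub>R v) v) - K / 2)) {0..1}"
  proof (rule has_integral_diff)
    show "((\<lambda>t. conn L (p + u + t *\<^sub>R v) v) has_integral integral {0..1} (\<lambda>t. conn L (p + u + t *\<^sub>R v) v)) {0..1}"
      by (intro integrable_integral integrable_continuous_real conn_line_continuous supp_add p u v)
    show "((\<lambda>t::real. K / 2) has_integral K / 2) {0..1}"
      using has_integral_const_real[of "K / 2" 0 1] by simp
  qed
  ultimately have "I 1 - I 0 = integral {0..1} (\<lambda>t. conn L (p + u + t *\<^sub>R v) v) - K / 2"
    by (rule has_integral_unique)
  then have "- I 1 = - I 0 + - integral {0..1} (\<lambda>t. conn L (p + u + t *\<^sub>R v) v) + K / 2"
    by (rule gen)
  then have "exp (- I 1) = exp (- I 0) * exp (- integral {0..1} (\<lambda>t. conn L (p + u + t *\<^sub>R v) v)) * exp (K / 2)"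
    by (simp only: exp_add)
  moreover have "exp (- I 1) = transport L p (p + u + v)" "exp (- I 0) = transport L p (p + u)"
    using transport_shift_eq[of p "u + v"] transport_shift_eq[of p u] by (simp_all add: I_eq add.assoc)
  ultimately show ?thesis by (simp add: transport_shift_eq K_def mult.assoc)
qed

text \<open>The lattice acts by parallel isomorphisms: the quotient of the two sides has derivative zero along the
path.\<close>

lemma transport_parallel:
  assumes p: "p \<in> supp L" and u: "u \<in> tangent (supp L)" and \<gamma>: "\<gamma> \<in> int_lattice"
  shows "transport L (p + \<gamma>) (p + \<gamma> + u) * mult L \<gamma> p = mult L \<gamma> (p + u) * transport L p (p + u)"
proof -
  define g where "g t = conn L (p + t *\<^sub>R u) u - conn L (p + \<gamma> + t *\<^sub>R u) u" for t
  define G where "G t = integral {0..t} g" for t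
  have cg: "continuous_on A g" for A
    unfolding g_def[abs_def] by (intro continuous_intros conn_line_continuous supp_lattice p u \<gamma>)
  have dG: "(G has_vector_derivative g t) (at t within {0..1})" if "t \<in> {0..1}" for t
    unfolding G_def[abs_def] using integral_has_vector_derivative[OF cg that] .
  define c where "c t = mult L \<gamma> (p + t *\<^sub>R u)" for t
  have dc: "(c has_vector_derivative g t * c t) (at t within {0..1})" for t
  proof -
    have "((\<lambda>t. mult L \<gamma> (p + t *\<^sub>R u)) has_vector_derivative
        (conn L (p + t *\<^sub>R u) u - conn L (p + t *\<^sub>R u + \<gamma>) u) * mult L \<gamma> (p + t *\<^sub>R u)) (at t)"
      by (rule has_vector_derivative_along_line[OF mult_deriv[OF \<gamma> supp_line[OF p u] u]])
    from has_vector_derivative_at_within[OF this] show ?thesis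
      unfolding c_def[abs_def] g_def by (simp add: add_ac)
  qed
  have "((\<lambda>t. c t * exp (- G t)) has_vector_derivative 0) (at t within {0..1})" if t: "t \<in> {0..1}" for t
  proof -
    have "((\<lambda>t. - G t) has_vector_derivative - g t) (at t within {0..1})"
      by (intro has_vector_derivative_minus dG t)
    then have "((\<lambda>t. exp (- G t)) has_vector_derivative (- g t * exp (- G t))) (at t within {0..1})"
      using field_vector_diff_chain_within[of "\<lambda>t. - G t" "- g t" t "{0..1}" exp "exp (- G t)"]
      by (simp add: o_def DERIV_exp has_field_derivative_at_within)
    from has_vector_derivative_mult[OF dc this] show ?thesis by (simp add: algebra_simps)
  qed
  then obtain k where "\<And>t. t \<in> {0..1} \<Longrightarrow> c t * exp (- G t) = k"
    using has_vector_derivative_zero_constant[OF convex_real_interval(5), of 0 1 "\<lambda>t. c t * exp (- G t)"] by blast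
  from this[of 0] this[of 1] have "c 1 * exp (- G 1) = c 0 * exp (- G 0)" by simp
  then have "mult L \<gamma> (p + u) * exp (- G 1) = mult L \<gamma> p" by (simp add: c_def G_def)
  moreover have "G 1 = integral {0..1} (\<lambda>t. conn L (p + t *\<^sub>R u) u) - integral {0..1} (\<lambda>t. conn L (p + \<gamma> + t *\<^sub>R u) u)"
    unfolding G_def g_def[abs_def]
    by (intro integral_diff integrable_continuous_real conn_line_continuous supp_lattice p u \<gamma>)
  ultimately show ?thesis
    unfolding transport_shift_eq by (simp add: exp_minus exp_diff field_simps)
qed

lemma transport_self [simp]: "p \<in> supp L \<Longrightarrow> transport L p p = 1"
proof -
  assume p: "p \<in> supp L"
  have 0: "0 \<in> tangent (supp L)" using tangent_subspace by (simp add: subspace_def)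
  have "conn L p 0 = 0" using conn_scaleR[OF p 0, of 0] by simp
  then show ?thesis by (simp add: transport_def)
qed

lemma transport_back:
  assumes "p \<in> supp L" "u \<in> tangent (supp L)"
  shows "transport L p (p + u) * transport L (p + u) p = 1"
  using transport_triangle[OF assms tangent_minus[OF assms(2)]] assms
  by (simp add: bilinear_rneg[OF bilinear_F])

lemma H1_D: "\<gamma> \<in> H1 L \<Longrightarrow> \<gamma> \<in> int_lattice" "\<gamma> \<in> H1 L \<Longrightarrow> \<gamma> \<in> tangent (supp L)"
  by (auto simp: H1_def)

lemma transport_loop:
  assumes "p \<in> supp L" "\<gamma> \<in> H1 L"
  shows "transport L p (p + \<gamma>) = hol L p \<gamma> * mult L \<gamma> p"
  using assms by (simp add: hol_def mult_nonzero H1_D)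

lemma hol_nonzero: "p \<in> supp L \<Longrightarrow> \<gamma> \<in> H1 L \<Longrightarrow> hol L p \<gamma> \<noteq> 0"
  by (simp add: hol_def mult_nonzero H1_D)

lemma norm_hol: "p \<in> supp L \<Longrightarrow> \<gamma> \<in> H1 L \<Longrightarrow> norm (hol L p \<gamma>) = 1"
  by (simp add: hol_def norm_divide norm_transport norm_mult_eq_1 H1_D)

text \<open>The loops through \<open>p\<close> and \<open>p + v\<close> bound, together with the edge \<open>v\<close> and its translate, a parallelogram of
constant curvature; it is cut into two triangles.\<close>

lemma hol_move:
  assumes p: "p \<in> supp L" and v: "v \<in> tangent (supp L)" and \<gamma>: "\<gamma> \<in> H1 L"
  shows "hol L (p + v) \<gamma> = hol L p \<gamma> * exp (2 * of_real pi * \<i> * of_real (F v \<gamma>))"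
proof -
  let ?e = "exp (of_real pi * \<i> * of_real (F v \<gamma>))"
  have 1: "transport L p (p + v + \<gamma>) * ?e = transport L p (p + v) * transport L (p + v) (p + v + \<gamma>)"
    using transport_triangle[OF p v H1_D(2)[OF \<gamma>]] by (simp add: exp_minus field_simps)
  have 2: "transport L p (p + \<gamma> + v) = transport L p (p + \<gamma>) * transport L (p + \<gamma>) (p + \<gamma> + v) * ?e"
    using transport_triangle[OF p H1_D(2)[OF \<gamma>] v] alternating_F[of \<gamma> v] by simp
  have 3: "transport L (p + \<gamma>) (p + \<gamma> + v) = mult L \<gamma> (p + v) * transport L p (p + v) / mult L \<gamma> p"
    using transport_parallel[OF p v H1_D(1)[OF \<gamma>]] mult_nonzero[OF H1_D(1)[OF \<gamma>] p] by (simp add: field_simps)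
  have "transport L p (p + v) * transport L (p + v) (p + v + \<gamma>) = transport L p (p + \<gamma>) * transport L (p + \<gamma>) (p + \<gamma> + v) * (?e * ?e)"
    using 1 2 by (simp add: add_ac mult.assoc)
  then have "transport L p (p + v) * transport L (p + v) (p + v + \<gamma>) =
      transport L p (p + v) * (transport L p (p + \<gamma>) * mult L \<gamma> (p + v) / mult L \<gamma> p * (?e * ?e))"
    unfolding 3 by (simp only: divide_inverse mult_ac)
  then have "transport L (p + v) (p + v + \<gamma>) = transport L p (p + \<gamma>) * mult L \<gamma> (p + v) / mult L \<gamma> p * (?e * ?e)"
    by (simp only: mult_cancel_left transport_nonzero simp_thms)
  moreover have "?e * ?e = exp (2 * of_real pi * \<i> * of_real (F v \<gamma>))"
    by (simp add: exp_add[symmetric] algebra_simps)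
  ultimately show ?thesis
    using mult_nonzero[OF H1_D(1)[OF \<gamma>] p] mult_nonzero[OF H1_D(1)[OF \<gamma>] supp_add[OF p v]] by (simp add: hol_def)
qed

text \<open>Holonomy is a function on the torus, because the action of the lattice is parallel and abelian.\<close>

lemma hol_lattice:
  assumes p: "p \<in> supp L" and \<delta>: "\<delta> \<in> int_lattice" and \<gamma>: "\<gamma> \<in> H1 L"
  shows "hol L (p + \<delta>) \<gamma> = hol L p \<gamma>"
proof -
  note g = H1_D[OF \<gamma>]
  have 1: "transport L (p + \<delta>) (p + \<delta> + \<gamma>) * mult L \<delta> p = mult L \<delta> (p + \<gamma>) * transport L p (p + \<gamma>)"
    by (rule transport_parallel[OF p g(2) \<delta>])
  have 2: "mult L \<gamma> (p + \<delta>) * mult L \<delta> p = mult L \<delta> (p + \<gamma>) * mult L \<gamma> p"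
    using mult_cocycle[OF g(1) \<delta> p] mult_cocycle[OF \<delta> g(1) p] by (simp add: add.commute)
  have nz: "mult L \<gamma> (p + \<delta>) \<noteq> 0" "mult L \<delta> p \<noteq> 0" "mult L \<delta> (p + \<gamma>) \<noteq> 0" "mult L \<gamma> p \<noteq> 0"
    using g \<delta> p by (simp_all add: mult_nonzero supp_lattice)
  have gen: "a / f = e / b" if "a * c = d * e" "f * c = d * b" "f \<noteq> 0" "c \<noteq> 0" "b \<noteq> 0" for a b c d e f :: complex
  proof -
    have "(a * b) * c = (e * f) * c" using that(1,2) by algebra
    then show ?thesis using that by (simp add: field_simps)
  qed
  show ?thesis unfolding hol_def by (rule gen[OF 1 2 nz(1,2,4)])
qed

text \<open>The three loops are the edges of a triangle, up to a translation by a lattice vector.\<close>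

lemma hol_add:
  assumes p: "p \<in> supp L" and \<gamma>: "\<gamma> \<in> H1 L" and \<gamma>': "\<gamma>' \<in> H1 L"
  shows "hol L p (\<gamma> + \<gamma>') = hol L p \<gamma> * hol L p \<gamma>' * exp (- of_real pi * \<i> * of_real (F \<gamma> \<gamma>'))"
proof -
  note g = H1_D[OF \<gamma>] and g' = H1_D[OF \<gamma>']
  have p': "p + \<gamma> \<in> supp L" by (intro supp_lattice p g)
  have "transport L p (p + \<gamma> + \<gamma>') = transport L p (p + \<gamma>) * transport L (p + \<gamma>) (p + \<gamma> + \<gamma>') * exp (- of_real pi * \<i> * of_real (F \<gamma> \<gamma>'))"
    by (rule transport_triangle[OF p g(2) g'(2)])
  also have "\<dots> = hol L p \<gamma> * mult L \<gamma> p * (hol L p \<gamma>' * mult L \<gamma>' (p + \<gamma>)) * exp (- of_real pi * \<i> * of_real (F \<gamma> \<gamma>'))"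
    using transport_loop[OF p \<gamma>] transport_loop[OF p' \<gamma>'] hol_lattice[OF p g(1) \<gamma>'] by simp
  also have "\<dots> = hol L p \<gamma> * hol L p \<gamma>' * exp (- of_real pi * \<i> * of_real (F \<gamma> \<gamma>')) * mult L (\<gamma> + \<gamma>') p"
    using mult_cocycle[OF g'(1) g(1) p] by (simp add: add.commute mult_ac)
  finally show ?thesis
    using mult_nonzero[OF int_lattice_add[OF g(1) g'(1)] p] by (simp add: hol_def add.assoc)
qed

end

section \<open>Characters of the integer lattice\<close>

lemma int_lattice_vec_iff: "(x :: real^'n) \<in> int_lattice \<longleftrightarrow> (\<forall>i. x $ i \<in> \<int>)"
  by (auto simp: int_lattice_def Basis_vec_def inner_axis)

lemma int_lattice_Pair_iff: "(x, y) \<in> int_lattice \<longleftrightarrow> x \<in> int_lattice \<and> y \<in> int_lattice"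
  by (simp add: int_lattice_def Basis_prod_def ball_Un)

lemma int_lattice_prod_iff: "z \<in> int_lattice \<longleftrightarrow> fst z \<in> int_lattice \<and> snd z \<in> int_lattice"
  by (cases z) (simp add: int_lattice_Pair_iff)

text \<open>A nonzero coordinate can be scaled to lie strictly between \<open>0\<close> and \<open>1\<close>.\<close>

lemma int_lattice_segment_zero:
  fixes v :: "'w::euclidean_space"
  assumes "\<And>t. 0 \<le> t \<Longrightarrow> t \<le> 1 \<Longrightarrow> t *\<^sub>R v \<in> int_lattice"
  shows "v = 0"
proof (rule ccontr)
  assume "v \<noteq> 0"
  then obtain b where b: "b \<in> Basis" "v \<bullet> b \<noteq> 0" using euclidean_all_zero_iff by blast
  define k where "k = v \<bullet> b"
  define t where "t = min 1 (1 / (2 * \<bar>k\<bar>))"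
  have k: "k \<noteq> 0" using b by (simp add: k_def)
  have t: "0 < t" "t \<le> 1" using k by (auto simp: t_def)
  have "t * k \<in> \<int>" using assms[of t] t b by (auto simp: int_lattice_def k_def)
  moreover have "\<bar>t * k\<bar> \<le> 1 / 2"
  proof -
    have "t * \<bar>k\<bar> \<le> 1 / (2 * \<bar>k\<bar>) * \<bar>k\<bar>" by (intro mult_right_mono) (auto simp: t_def)
    then show ?thesis using k t by (simp add: abs_mult)
  qed
  moreover have "t * k \<noteq> 0" using k t by simp
  ultimately show False using Ints_nonzero_abs_ge1[of "t * k"] by linarith
qed

text \<open>The coordinates of \<open>\<kappa>\<close> are arguments of the values on the basis.\<close>

lemma character_of_lattice_hom:
  fixes h :: "'w::euclidean_space \<Rightarrow> complex"
  assumes add: "\<And>x y. x \<in> int_lattice \<Longrightarrow> y \<in> int_lattice \<Longrightarrow> h (x + y) = h x * h y"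
    and norm: "\<And>x. x \<in> int_lattice \<Longrightarrow> norm (h x) = 1"
  obtains \<kappa> where "\<And>x. x \<in> int_lattice \<Longrightarrow> h x = character \<kappa> x"
proof -
  define k where "k b = Arg (h b) / (2 * pi)" for b
  have k: "h b = exp (2 * of_real pi * \<i> * of_real (k b))" if "b \<in> Basis" for b
  proof -
    have n: "norm (h b) = 1" using norm that by simp
    then have "h b \<noteq> 0" by auto
    then show ?thesis using Arg_eq[of "h b"] n by (simp add: k_def mult_ac)
  qed
  define \<kappa> where "\<kappa> = (\<Sum>b\<in>Basis. k b *\<^sub>R b)"
  have \<kappa>: "h b = character \<kappa> b" if "b \<in> Basis" for b
    using that by (simp add: k character_def \<kappa>_def inner_sum_left_Basis)
  define \<phi> where "\<phi> x = h x / character \<kappa> x" for x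
  have \<phi>_add: "\<phi> (x + y) = \<phi> x * \<phi> y" if "x \<in> int_lattice" "y \<in> int_lattice" for x y
    using that by (simp add: \<phi>_def add character_add)
  have nz: "\<phi> x \<noteq> 0" if "x \<in> int_lattice" for x using norm[OF that] by (auto simp: \<phi>_def)
  have \<phi>0: "\<phi> 0 = 1" using \<phi>_add[of 0 0] nz[of 0] by simp
  have nat: "\<phi> (real n *\<^sub>R b) = 1" if b: "b \<in> Basis" for b n
  proof (induction n)
    case (Suc n)
    have "\<phi> (real n *\<^sub>R b + b) = 1"
      using Suc b by (subst \<phi>_add) (auto simp: \<phi>_def \<kappa> intro!: int_lattice_scaleR)
    then show ?case by (simp add: scaleR_left_distrib add.commute)
  qed (simp add: \<phi>0)
  have int: "\<phi> (k *\<^sub>R b) = 1" if b: "b \<in> Basis" and k: "k \<in> \<int>" for b k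
  proof -
    obtain j :: int where j: "k = of_int j" using k by (auto elim: Ints_cases)
    show ?thesis
    proof (cases "j \<ge> 0")
      case True
      then show ?thesis using nat[OF b, of "nat j"] j by simp
    next
      case False
      have "\<phi> (k *\<^sub>R b + real (nat (- j)) *\<^sub>R b) = \<phi> (k *\<^sub>R b) * 1"
        using b k by (subst \<phi>_add) (auto simp: nat intro!: int_lattice_scaleR)
      then show ?thesis using False j \<phi>0 by (simp flip: scaleR_left_distrib)
    qed
  qed
  have sum: "\<phi> (\<Sum>b\<in>B. (x \<bullet> b) *\<^sub>R b) = 1" if "finite B" "B \<subseteq> Basis" "x \<in> int_lattice" for B x
    using that
  proof (induction B)
    case (insert b B)
    have xi: "x \<bullet> c \<in> \<int>" if "c \<in> Basis" for c using insert.prems that by (auto simp: int_lattice_def)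
    have "(\<Sum>b\<in>B. (x \<bullet> b) *\<^sub>R b) \<bullet> c \<in> \<int>" if "c \<in> Basis" for c
      unfolding inner_sum_left using insert.prems that
      by (intro Ints_sum) (auto simp: inner_Basis subset_iff xi)
    then have "(\<Sum>b\<in>B. (x \<bullet> b) *\<^sub>R b) \<in> int_lattice" by (simp add: int_lattice_def)
    then show ?case
      using insert xi by (simp add: \<phi>_add int int_lattice_scaleR)
  qed (simp add: \<phi>0)
  show ?thesis
  proof (rule that)
    fix x :: 'w assume x: "x \<in> int_lattice"
    have "\<phi> x = 1" using sum[OF finite_Basis subset_refl x] by (simp add: euclidean_representation)
    then show "h x = character \<kappa> x" by (simp add: \<phi>_def)
  qed
qed

lemma tpoint_eq_iff: "tpoint x = tpoint y \<longleftrightarrow> x - y \<in> int_lattice"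
proof
  assume "tpoint x = tpoint y"
  moreover have "x \<in> tpoint x" by (auto simp: tpoint_def intro: exI[of _ 0])
  ultimately have "x \<in> tpoint y" by simp
  then show "x - y \<in> int_lattice" by (auto simp: tpoint_def)
next
  assume xy: "x - y \<in> int_lattice"
  have "x + \<gamma> = y + (x - y + \<gamma>)" "y + \<gamma> = x + (\<gamma> - (x - y))" for \<gamma> by auto
  then show "tpoint x = tpoint y" unfolding tpoint_def using xy
    by (auto; metis int_lattice_add int_lattice_diff)
qed

lemma tpoint_self [simp]: "x \<in> tpoint x"
  by (auto simp: tpoint_def intro: exI[of _ 0])

lemma mem_tpoint_iff: "y \<in> tpoint x \<longleftrightarrow> y - x \<in> int_lattice"
  by (auto simp: tpoint_def algebra_simps intro: exI[of _ "y - x"])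

lemma fst_tpoint: "fst ` tpoint z = tpoint (fst z)"
proof
  show "fst ` tpoint z \<subseteq> tpoint (fst z)"
    by (auto simp: mem_tpoint_iff int_lattice_prod_iff)
  show "tpoint (fst z) \<subseteq> fst ` tpoint z"
  proof
    fix y assume "y \<in> tpoint (fst z)"
    then have "(y, snd z) \<in> tpoint z" by (simp add: mem_tpoint_iff int_lattice_prod_iff)
    then show "y \<in> fst ` tpoint z" by force
  qed
qed

lemma finite_int_lattice_bounded: "finite {x \<in> int_lattice. norm (x :: 'w::euclidean_space) \<le> R}"
proof -
  define K where "K = {k :: int. \<bar>k\<bar> \<le> \<lceil>R\<rceil>}"
  have finK: "finite K"
  proof -
    have "K \<subseteq> {- \<lceil>R\<rceil>..\<lceil>R\<rceil>}" by (auto simp: K_def)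
    then show ?thesis by (rule finite_subset) simp
  qed
  have "{x \<in> int_lattice. norm (x :: 'w) \<le> R} \<subseteq> (\<lambda>f. \<Sum>b\<in>Basis. of_int (f b) *\<^sub>R b) ` (PiE Basis (\<lambda>_. K))"
  proof
    fix x :: 'w assume "x \<in> {x \<in> int_lattice. norm x \<le> R}"
    then have x: "\<And>b. b \<in> Basis \<Longrightarrow> x \<bullet> b \<in> \<int>" "norm x \<le> R" by (auto simp: int_lattice_def)
    have fl: "of_int \<lfloor>x \<bullet> b\<rfloor> = x \<bullet> b" if "b \<in> Basis" for b using x(1)[OF that] by (auto elim: Ints_cases)
    have "\<bar>\<lfloor>x \<bullet> b\<rfloor>\<bar> \<le> \<lceil>R\<rceil>" if "b \<in> Basis" for b
    proof -
      have "\<bar>x \<bullet> b\<bar> \<le> R" using Basis_le_norm[OF that, of x] x(2) by linarith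
      then have "real_of_int \<bar>\<lfloor>x \<bullet> b\<rfloor>\<bar> \<le> R" by (simp only: of_int_abs fl[OF that])
      then show ?thesis by linarith
    qed
    then have "restrict (\<lambda>b. \<lfloor>x \<bullet> b\<rfloor>) Basis \<in> PiE Basis (\<lambda>_. K)" by (auto simp: K_def)
    moreover have "x = (\<Sum>b\<in>Basis. of_int (restrict (\<lambda>b. \<lfloor>x \<bullet> b\<rfloor>) Basis b) *\<^sub>R b)"
      by (simp add: fl euclidean_representation)
    ultimately show "x \<in> (\<lambda>f. \<Sum>b\<in>Basis. of_int (f b) *\<^sub>R b) ` (PiE Basis (\<lambda>_. K))" by blast
  qed
  then show ?thesis by (rule finite_subset) (intro finite_imageI finite_PiE finite_Basis finK)
qed

text \<open>Used for sets cut out by integrality conditions, in particular for intersections of transverse branes.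
Each point has a representative in the unit cube, and \<open>T\<close> embeds these representatives into a bounded part
of a coset of the lattice.\<close>

lemma finite_tpoint_image:
  fixes T :: "'w::euclidean_space \<Rightarrow> 'v::euclidean_space"
  assumes T: "linear T" "inj T" and int: "\<And>\<gamma>. \<gamma> \<in> int_lattice \<Longrightarrow> T \<gamma> \<in> int_lattice"
    and S: "\<And>x y. x \<in> S \<Longrightarrow> y \<in> S \<Longrightarrow> T x - T y \<in> int_lattice"
  shows "finite (tpoint ` S)"
proof (cases "S = {}")
  case False
  then obtain x0 where x0: "x0 \<in> S" by auto
  define rep where "rep x = x - (\<Sum>b\<in>Basis. of_int \<lfloor>x \<bullet> b\<rfloor> *\<^sub>R b)" for x :: 'w
  have fl: "(\<Sum>b\<in>Basis. of_int \<lfloor>x \<bullet> b\<rfloor> *\<^sub>R b) \<in> int_lattice" for x :: 'w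
    by (auto simp: int_lattice_def inner_sum_left_Basis)
  have rep: "tpoint (rep x) = tpoint x" for x using fl[of x] by (simp add: tpoint_eq_iff rep_def)
  have bd: "norm (rep x) \<le> DIM('w)" for x
  proof -
    have "norm (rep x) \<le> (\<Sum>b\<in>Basis. \<bar>rep x \<bullet> b\<bar>)" by (rule norm_le_l1)
    also have "\<dots> \<le> (\<Sum>b\<in>(Basis::'w set). 1)"
      by (intro sum_mono) (auto simp: rep_def inner_diff_left inner_sum_left_Basis abs_le_iff; linarith)
    finally show ?thesis by simp
  qed
  obtain K where K: "\<And>x. norm (T x) \<le> norm x * K" using linear_conv_bounded_linear[THEN iffD1, OF T(1)] bounded_linear.bounded by blast
  have "(\<lambda>x. T (rep x) - T x0) ` S \<subseteq> {x \<in> int_lattice. norm x \<le> real (DIM('w)) * \<bar>K\<bar> + norm (T x0)}"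
  proof safe
    fix x assume x: "x \<in> S"
    have "T (rep x) - T x0 = (T x - T x0) - T (x - rep x)" by (simp add: linear_diff[OF T(1)])
    also have "\<dots> \<in> int_lattice" by (rule int_lattice_diff[OF S[OF x x0]]) (simp add: rep_def int fl)
    finally show "T (rep x) - T x0 \<in> int_lattice" .
    have "norm (T (rep x)) \<le> norm (rep x) * K" by (rule K)
    also have "\<dots> \<le> real (DIM('w)) * \<bar>K\<bar>" using bd[of x] by (smt (verit) mult_mono norm_ge_zero mult_left_mono)
    finally show "norm (T (rep x) - T x0) \<le> real (DIM('w)) * \<bar>K\<bar> + norm (T x0)"
      using norm_triangle_ineq4[of "T (rep x)" "T x0"] by linarith
  qed
  then have "finite ((\<lambda>x. T (rep x) - T x0) ` S)" using finite_int_lattice_bounded finite_subset by blast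
  then have "finite ((\<lambda>y. tpoint (inv T (y + T x0))) ` ((\<lambda>x. T (rep x) - T x0) ` S))" by (rule finite_imageI)
  moreover have "(\<lambda>y. tpoint (inv T (y + T x0))) ` ((\<lambda>x. T (rep x) - T x0) ` S) = tpoint ` S"
    unfolding image_image by (simp add: inv_f_f[OF T(2)] rep)
  ultimately show ?thesis by simp
qed simp

section \<open>Lifted branes\<close>

abbreviation minus_one_pow :: "int \<Rightarrow> complex"
  where "minus_one_pow k \<equiv> (-1) powi k"

lemma minus_one_pow_add: "minus_one_pow (j + k) = minus_one_pow j * minus_one_pow k"
  by (simp add: power_int_add)

lemma norm_minus_one_pow [simp]: "norm (minus_one_pow k) = 1"
  by (simp add: norm_power_int)

lemma minus_one_pow_double: "minus_one_pow (2 * k) = 1"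
  unfolding power_int_mult by simp

lemma minus_one_pow_eq_exp: "minus_one_pow k = exp (of_real pi * \<i> * of_int k)"
proof (cases "even k")
  case True
  then obtain j where "k = 2 * j" by auto
  then show ?thesis using exp_2pi_i_eq_1_iff[of "of_int j"] minus_one_pow_double[of j] by (simp add: mult_ac)
next
  case False
  then obtain j where k: "k = 2 * j + 1" by (auto elim: oddE)
  have "exp (of_real pi * \<i> * of_int k) = exp (2 * of_real pi * \<i> * of_real (of_int j)) * exp (of_real pi * \<i>)"
    unfolding exp_add[symmetric] by (simp add: k algebra_simps)
  moreover have "exp (2 * of_real pi * \<i> * of_real (of_int j)) = 1" using exp_2pi_i_eq_1_iff[of "of_int j"] by simp
  ultimately show ?thesis unfolding k minus_one_pow_add minus_one_pow_double by simp
qed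

lemma supp_lift: "(x, x') \<in> supp (lift \<xi> L) \<longleftrightarrow>
    x \<in> supp L \<and> (\<forall>\<gamma>\<in>H1 L. character x' \<gamma> = minus_one_pow (\<xi> \<gamma>) * hol L x \<gamma>)"
  by (simp add: lift_def character_def)

lemma conn_lift: "conn (lift \<xi> L) = (\<lambda>x v. conn L (fst x) (fst v))"
  and mult_lift: "mult (lift \<xi> L) = (\<lambda>\<gamma> x. mult L (fst \<gamma>) (fst x))"
  by (simp_all add: lift_def)

lemma transport_lift: "transport (lift \<xi> L) p q = transport L (fst p) (fst q)"
  by (simp add: transport_def conn_lift)

context brane_calculus
begin

text \<open>Along the segment, both sides of the condition that defines the lift vary by characters of time, the right
hand side by \<open>hol_move\<close>. They agree for all times exactly if the two frequencies are equal.\<close>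

lemma segment_in_lift_iff:
  assumes xx: "(x, x') \<in> supp (lift \<xi> L)"
    and seg: "closed_segment x y \<subseteq> supp L \<longleftrightarrow> y - x \<in> tangent (supp L)"
  shows "closed_segment (x, x') (y, y') \<subseteq> supp (lift \<xi> L) \<longleftrightarrow>
    y - x \<in> tangent (supp L) \<and> (\<forall>\<gamma>\<in>H1 L. (y' - x') \<bullet> \<gamma> = F (y - x) \<gamma>)"
proof -
  have x: "x \<in> supp L" and \<psi>: "\<And>\<gamma>. \<gamma> \<in> H1 L \<Longrightarrow> character x' \<gamma> = minus_one_pow (\<xi> \<gamma>) * hol L x \<gamma>"
    using xx by (auto simp: supp_lift)
  have pt: "(1 - t) *\<^sub>R (x, x') + t *\<^sub>R (y, y') = (x + t *\<^sub>R (y - x), x' + t *\<^sub>R (y' - x'))" for t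
    by (simp add: algebra_simps)
  have seg': "closed_segment (x, x') (y, y') = {(x + t *\<^sub>R (y - x), x' + t *\<^sub>R (y' - x')) | t. 0 \<le> t \<and> t \<le> 1}"
    unfolding closed_segment_def pt by auto
  have mem: "(x + t *\<^sub>R (y - x), x' + t *\<^sub>R (y' - x')) \<in> supp (lift \<xi> L) \<longleftrightarrow>
      (\<forall>\<gamma>\<in>H1 L. t * ((y' - x') \<bullet> \<gamma> - F (y - x) \<gamma>) \<in> \<int>)" if u: "y - x \<in> tangent (supp L)" for t
  proof -
    have "character (x' + t *\<^sub>R (y' - x')) \<gamma> = minus_one_pow (\<xi> \<gamma>) * hol L (x + t *\<^sub>R (y - x)) \<gamma> \<longleftrightarrow>
        t * ((y' - x') \<bullet> \<gamma> - F (y - x) \<gamma>) \<in> \<int>" if \<gamma>: "\<gamma> \<in> H1 L" for \<gamma>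
    proof -
      have h: "hol L (x + t *\<^sub>R (y - x)) \<gamma> = hol L x \<gamma> * exp (2 * of_real pi * \<i> * of_real (t * F (y - x) \<gamma>))"
        using hol_move[OF x tangent_scaleR[OF u] \<gamma>, of t] by (simp add: bilinear_lmul[OF bilinear_F])
      have "character (x' + t *\<^sub>R (y' - x')) \<gamma> = minus_one_pow (\<xi> \<gamma>) * hol L (x + t *\<^sub>R (y - x)) \<gamma> \<longleftrightarrow>
          minus_one_pow (\<xi> \<gamma>) * hol L x \<gamma> * character (t *\<^sub>R (y' - x')) \<gamma> =
          minus_one_pow (\<xi> \<gamma>) * hol L x \<gamma> * exp (2 * of_real pi * \<i> * of_real (t * F (y - x) \<gamma>))"
        unfolding character_add h \<psi>[OF \<gamma>] by (simp only: mult.assoc)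
      also have "\<dots> \<longleftrightarrow> character (t *\<^sub>R (y' - x')) \<gamma> / exp (2 * of_real pi * \<i> * of_real (t * F (y - x) \<gamma>)) = 1"
        using hol_nonzero[OF x \<gamma>] by simp
      also have "character (t *\<^sub>R (y' - x')) \<gamma> / exp (2 * of_real pi * \<i> * of_real (t * F (y - x) \<gamma>)) =
          exp (2 * of_real pi * \<i> * of_real (t * ((y' - x') \<bullet> \<gamma> - F (y - x) \<gamma>)))"
        unfolding character_def exp_diff[symmetric] by (simp add: right_diff_distrib)
      finally show ?thesis unfolding exp_2pi_i_eq_1_iff .
    qed
    then show ?thesis by (simp add: supp_lift supp_line[OF x u])
  qed
  show ?thesis
  proof (intro iffI conjI ballI)
    assume c: "closed_segment (x, x') (y, y') \<subseteq> supp (lift \<xi> L)"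
    then have "closed_segment x y \<subseteq> supp L"
      unfolding seg' closed_segment_def by (fastforce simp: supp_lift algebra_simps)
    then show u: "y - x \<in> tangent (supp L)" using seg by simp
    fix \<gamma> assume \<gamma>: "\<gamma> \<in> H1 L"
    have "t *\<^sub>R ((y' - x') \<bullet> \<gamma> - F (y - x) \<gamma>) \<in> int_lattice" if "0 \<le> t" "t \<le> 1" for t
    proof -
      have "(x + t *\<^sub>R (y - x), x' + t *\<^sub>R (y' - x')) \<in> supp (lift \<xi> L)" using c that unfolding seg' by blast
      then show ?thesis using mem[OF u, of t] \<gamma> by (simp add: int_lattice_def)
    qed
    from int_lattice_segment_zero[OF this] show "(y' - x') \<bullet> \<gamma> = F (y - x) \<gamma>" by simp
  next
    assume "y - x \<in> tangent (supp L) \<and> (\<forall>\<gamma>\<in>H1 L. (y' - x') \<bullet> \<gamma> = F (y - x) \<gamma>)"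
    then show "closed_segment (x, x') (y, y') \<subseteq> supp (lift \<xi> L)" unfolding seg' using mem by auto
  qed
qed

lemma supp_lift_lattice:
  assumes "z \<in> supp (lift \<xi> L)" "\<delta> \<in> int_lattice"
  shows "z + \<delta> \<in> supp (lift \<xi> L)"
proof -
  have "character (snd \<delta>) \<gamma> = 1" if "\<gamma> \<in> H1 L" for \<gamma>
    using H1_D[OF that] assms(2) by (simp add: int_lattice_prod_iff)
  then show ?thesis
    using assms supp_lift[of "fst z" "snd z" \<xi> L] supp_lift[of "fst z + fst \<delta>" "snd z + snd \<delta>" \<xi> L]
    by (cases z; cases \<delta>) (simp add: int_lattice_prod_iff supp_lattice hol_lattice character_add)
qed

end

locale signed_brane = brane_calculus L "brane_F \<Phi>" for \<Phi> :: "'w::euclidean_space \<Rightarrow> 'w \<Rightarrow> complex" and L +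
  fixes \<xi> :: "'w \<Rightarrow> int"
  assumes sign: "lift_sign \<Phi> L \<xi>"
begin

lemma H1_add: "\<gamma> \<in> H1 L \<Longrightarrow> \<gamma>' \<in> H1 L \<Longrightarrow> \<gamma> + \<gamma>' \<in> H1 L"
  by (simp add: H1_def int_lattice_add tangent_add)

text \<open>The form \<open>F\<close> takes integral values on \<open>H1 L\<close>, so the exponential is a sign. It is written in the form in
which curvature enters the transport.\<close>

lemma sign_add:
  assumes g: "\<gamma> \<in> H1 L" and g': "\<gamma>' \<in> H1 L"
  shows "minus_one_pow (\<xi> (\<gamma> + \<gamma>')) =
    minus_one_pow (\<xi> \<gamma>) * minus_one_pow (\<xi> \<gamma>') * exp (of_real pi * \<i> * of_real (brane_F \<Phi> \<gamma> \<gamma>'))"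
proof -
  obtain k :: int where k: "of_int (\<xi> (\<gamma> + \<gamma>') - \<xi> \<gamma> - \<xi> \<gamma>') = brane_F \<Phi> \<gamma> \<gamma>' + 2 * of_int k"
    using sign g g' unfolding lift_sign_def by blast
  define j where "j = \<xi> (\<gamma> + \<gamma>') - \<xi> \<gamma> - \<xi> \<gamma>' - 2 * k"
  have j: "brane_F \<Phi> \<gamma> \<gamma>' = of_int j" using k by (simp add: j_def)
  have e: "\<xi> (\<gamma> + \<gamma>') = \<xi> \<gamma> + \<xi> \<gamma>' + j + 2 * k" by (simp add: j_def)
  have "minus_one_pow (\<xi> (\<gamma> + \<gamma>')) = minus_one_pow (\<xi> \<gamma>) * minus_one_pow (\<xi> \<gamma>') * minus_one_pow j"
    unfolding e by (simp only: minus_one_pow_add minus_one_pow_double mult_1_right)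
  then show ?thesis unfolding minus_one_pow_eq_exp[of j] j by simp
qed

text \<open>The purpose of \<open>\<xi>\<close>: by itself the holonomy is multiplicative only up to a sign, which is the one
in \<open>sign_add\<close>.\<close>

lemma signed_hol_add:
  assumes x: "x \<in> supp L" and g: "\<gamma> \<in> H1 L" and g': "\<gamma>' \<in> H1 L"
  shows "minus_one_pow (\<xi> (\<gamma> + \<gamma>')) * hol L x (\<gamma> + \<gamma>') =
    (minus_one_pow (\<xi> \<gamma>) * hol L x \<gamma>) * (minus_one_pow (\<xi> \<gamma>') * hol L x \<gamma>')"
  unfolding hol_add[OF x g g'] sign_add[OF g g'] by (simp add: exp_minus field_simps)

end

section \<open>Branes mirror to line bundles, in coordinates\<close>

\<comment> \<open>otherwise the simplifier replaces transposed matrices by products of a vector with a matrix\<close>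
declare transpose_matrix_vector [simp del]

text \<open>The tangent vectors of \<open>\<theta> = - A r + c\<close>, parametrized by \<open>r\<close>.\<close>

definition graph_vec :: "real^'n^'n \<Rightarrow> real^'n \<Rightarrow> 'n::finite V"
  where "graph_vec A r = (r, - (A *v r))"

text \<open>The covectors which vanish on the graph, parametrized by their \<open>\<theta>\<close>-component.\<close>

definition conormal :: "real^'n^'n \<Rightarrow> real^'n \<Rightarrow> 'n::finite V"
  where "conormal A \<eta> = (transpose A *v \<eta>, \<eta>)"

text \<open>The restriction of a covector to the graph, written in the parameter \<open>r\<close>; see \<open>inner_graph_vec\<close>.\<close>

definition restrict_cov :: "real^'n^'n \<Rightarrow> 'n::finite V \<Rightarrow> real^'n"
  where "restrict_cov A y = fst y - transpose A *v snd y"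

lemma linear_graph_vec: "linear (graph_vec A)" 
  and linear_conormal: "linear (conormal A)" and linear_restrict_cov: "linear (restrict_cov A)"
  by (auto intro!: linearI simp: graph_vec_def conormal_def restrict_cov_def matrix_vector_right_distrib
      matrix_vector_mult_scaleR scaleR_diff_right)

lemmas graph_vec_simps [simp] = linear_0[OF linear_graph_vec] linear_add[OF linear_graph_vec]
  linear_diff[OF linear_graph_vec] linear_neg[OF linear_graph_vec]
lemmas conormal_simps [simp] = linear_0[OF linear_conormal] linear_add[OF linear_conormal]
  linear_diff[OF linear_conormal] linear_neg[OF linear_conormal]
lemmas restrict_cov_simps [simp] = linear_0[OF linear_restrict_cov] linear_add[OF linear_restrict_cov]
  linear_diff[OF linear_restrict_cov] linear_neg[OF linear_restrict_cov]

lemma fst_graph_vec [simp]: "fst (graph_vec A r) = r"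
  and snd_conormal [simp]: "snd (conormal A \<eta>) = \<eta>"
  by (simp_all add: graph_vec_def conormal_def)

lemma transpose_inner: "(transpose A *v x) \<bullet> y = x \<bullet> (A *v y)"
  for A :: "real^'n^'m"
  by (simp add: transpose_matrix_vector dot_lmul_matrix)

lemma inner_graph_vec: "y \<bullet> graph_vec A t = restrict_cov A y \<bullet> t"
  by (cases y) (simp add: graph_vec_def restrict_cov_def inner_diff_left transpose_inner)

lemma restrict_conormal: "restrict_cov A' (conormal A \<eta>) = - (transpose (A' - A) *v \<eta>)"
proof -
  have "transpose (A' - A) = transpose A' - transpose A" by (simp add: transpose_def vec_eq_iff)
  then show ?thesis by (simp add: restrict_cov_def conormal_def matrix_vector_mult_diff_rdistrib)
qed

lemma conormal_graph_vec: "conormal A \<eta> \<bullet> graph_vec A' t = - (\<eta> \<bullet> ((A' - A) *v t))"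
  by (simp add: inner_graph_vec restrict_conormal transpose_inner)

lemma restrict_cov_zeroD: "restrict_cov A y = 0 \<Longrightarrow> y = conormal A (snd y)"
  by (cases y) (simp add: restrict_cov_def conormal_def)

lemma inner_lattice_ext:
  fixes x y :: "'w::euclidean_space"
  assumes "\<And>t. t \<in> int_lattice \<Longrightarrow> x \<bullet> t = y \<bullet> t"
  shows "x = y"
  by (rule euclidean_eqI) (simp add: assms)

lemma inner_lattice_int:
  assumes "\<And>t. t \<in> int_lattice \<Longrightarrow> x \<bullet> t \<in> \<int>"
  shows "x \<in> int_lattice"
  unfolding int_lattice_def using assms by auto

lemma real_mat_lattice: "x \<in> int_lattice \<Longrightarrow> real_mat D *v x \<in> int_lattice"
  and transpose_real_mat_lattice: "x \<in> int_lattice \<Longrightarrow> transpose (real_mat D) *v x \<in> int_lattice"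
  by (auto simp: int_lattice_vec_iff matrix_vector_mult_def real_mat_def transpose_def intro!: Ints_sum Ints_mult)

lemma graph_vec_lattice_iff: "graph_vec (real_mat D) t \<in> int_lattice \<longleftrightarrow> t \<in> int_lattice"
  by (auto simp: graph_vec_def int_lattice_Pair_iff real_mat_lattice)

definition B_form :: "complex^'n^'n \<Rightarrow> 'n::finite V \<Rightarrow> 'n V \<Rightarrow> real"
  where "B_form \<tau> u v = Re (torus_form \<tau> u v)"

definition \<omega>_form :: "complex^'n^'n \<Rightarrow> 'n::finite V \<Rightarrow> 'n V \<Rightarrow> real"
  where "\<omega>_form \<tau> u v = Im (torus_form \<tau> u v)"

lemma B_form_eq: "B_form \<tau> u v = fst u \<bullet> (Re_mat \<tau> *v snd v) - fst v \<bullet> (Re_mat \<tau> *v snd u)"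
  and \<omega>_form_eq: "\<omega>_form \<tau> u v = fst u \<bullet> (Im_mat \<tau> *v snd v) - fst v \<bullet> (Im_mat \<tau> *v snd u)"
  by (simp_all add: B_form_def \<omega>_form_def torus_form_def inner_vec_def matrix_vector_mult_def Re_mat_def Im_mat_def
      sum_distrib_left sum_subtractf right_diff_distrib mult_ac)

lemma bilinear_B_form: "bilinear (B_form \<tau>)" and bilinear_\<omega>_form: "bilinear (\<omega>_form \<tau>)"
  unfolding bilinear_def
  by (auto intro!: linearI simp: B_form_eq \<omega>_form_eq inner_add_left inner_add_right matrix_vector_right_distrib
      matrix_vector_mult_scaleR algebra_simps)

lemma B_form_flip: "B_form \<tau> u v = - B_form \<tau> v u" and \<omega>_form_flip: "\<omega>_form \<tau> u v = - \<omega>_form \<tau> v u"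
  by (simp_all add: B_form_eq \<omega>_form_eq)

lemma brane_F_eq: "brane_F (torus_form \<tau>) u v = - B_form \<tau> u v"
  by (simp add: brane_F_def B_form_def)

lemma contract_inner:
  assumes "bilinear \<beta>"
  shows "contract \<beta> u \<bullet> v = \<beta> u v"
proof -
  have l: "linear (\<beta> u)" using assms by (simp add: bilinear_def)
  have "contract \<beta> u \<bullet> v = (\<Sum>b\<in>Basis. (v \<bullet> b) * \<beta> u b)"
    by (simp add: contract_def inner_sum_left inner_commute[of v] mult.commute)
  also have "\<dots> = \<beta> u (\<Sum>b\<in>Basis. (v \<bullet> b) *\<^sub>R b)" by (simp add: linear_sum[OF l] linear_scale[OF l])
  finally show ?thesis by (simp add: euclidean_representation)
qed

lemma linear_contract:
  assumes "bilinear \<beta>"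
  shows "linear (contract \<beta>)"
  by (rule linearI) (simp_all add: contract_def bilinear_ladd[OF assms] bilinear_lmul[OF assms] scaleR_add_left
      sum.distrib scaleR_sum_right)

lemma contract_\<omega>_form: "contract (\<omega>_form \<tau>) u = (- (Im_mat \<tau> *v snd u), transpose (Im_mat \<tau>) *v fst u)"
proof (rule euclidean_eqI)
  fix b :: "'a V"
  show "contract (\<omega>_form \<tau>) u \<bullet> b = (- (Im_mat \<tau> *v snd u), transpose (Im_mat \<tau>) *v fst u) \<bullet> b"
    unfolding contract_inner[OF bilinear_\<omega>_form] \<omega>_form_eq
    by (cases b) (simp add: transpose_inner inner_commute[of _ "Im_mat \<tau> *v snd u"])
qed

lemma mirror_brane_supp:
  assumes "mirror_brane \<tau> D c L"
  shows "p \<in> supp L \<longleftrightarrow> snd p + real_mat D *v fst p - c \<in> int_lattice"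
  using assms by (auto simp: mirror_brane_def case_prod_unfold)

lemma mirror_brane_supp_add:
  assumes "mirror_brane \<tau> D c L" "p \<in> supp L"
  shows "p + v \<in> supp L \<longleftrightarrow> snd v + real_mat D *v fst v \<in> int_lattice"
proof -
  let ?x = "snd p + real_mat D *v fst p - c" and ?y = "snd v + real_mat D *v fst v"
  have x: "?x \<in> int_lattice" using assms mirror_brane_supp by blast
  have e: "snd (p + v) + real_mat D *v fst (p + v) - c = ?x + ?y"
    by (simp add: matrix_vector_right_distrib algebra_simps)
  have "?x + ?y \<in> int_lattice \<longleftrightarrow> ?y \<in> int_lattice"
    using x int_lattice_add[OF x] int_lattice_diff[of "?x + ?y" ?x] by (metis add_diff_cancel_left')
  then show ?thesis unfolding mirror_brane_supp[OF assms(1), of "p + v"] e .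
qed

lemma mirror_brane_nonempty: "mirror_brane \<tau> D c L \<Longrightarrow> (0, c) \<in> supp L"
  by (simp add: mirror_brane_supp)

lemma graph_vec_range: "v \<in> range (graph_vec A) \<longleftrightarrow> snd v + A *v fst v = 0"
  by (cases v) (auto simp: graph_vec_def image_iff eq_neg_iff_add_eq_0)

text \<open>By \<open>int_lattice_segment_zero\<close>, the vector \<open>\<theta> + A r - c\<close> cannot vary inside the integral vectors.\<close>

lemma mirror_brane_segment:
  assumes mb: "mirror_brane \<tau> D c L" and p: "p \<in> supp L"
  shows "closed_segment p q \<subseteq> supp L \<longleftrightarrow> q - p \<in> range (graph_vec (real_mat D))"
proof -
  define v where "v = q - p"
  let ?y = "snd v + real_mat D *v fst v"
  have pt: "(1 - t) *\<^sub>R p + t *\<^sub>R q = p + t *\<^sub>R v" for t by (simp add: v_def algebra_simps)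
  have seg: "closed_segment p q = {p + t *\<^sub>R v | t. 0 \<le> t \<and> t \<le> 1}"
    unfolding closed_segment_def pt by auto
  have mem: "p + t *\<^sub>R v \<in> supp L \<longleftrightarrow> t *\<^sub>R ?y \<in> int_lattice" for t
    unfolding mirror_brane_supp_add[OF mb p] by (simp add: matrix_vector_mult_scaleR scaleR_add_right)
  show ?thesis
  proof
    assume "closed_segment p q \<subseteq> supp L"
    then have "t *\<^sub>R ?y \<in> int_lattice" if "0 \<le> t" "t \<le> 1" for t using that mem seg by blast
    then have "?y = 0" by (rule int_lattice_segment_zero)
    then show "q - p \<in> range (graph_vec (real_mat D))" unfolding graph_vec_range v_def[symmetric] .
  next
    assume "q - p \<in> range (graph_vec (real_mat D))"
    then have "?y = 0" unfolding graph_vec_range v_def[symmetric] .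
    then show "closed_segment p q \<subseteq> supp L" using mem seg by auto
  qed
qed

lemma mirror_brane_tangent:
  assumes mb: "mirror_brane \<tau> D c L"
  shows "tangent (supp L) = range (graph_vec (real_mat D))"
proof
  show "tangent (supp L) \<subseteq> range (graph_vec (real_mat D))"
  proof
    fix v assume v: "v \<in> tangent (supp L)"
    let ?p = "(0, c)"
    have p: "?p \<in> supp L" by (rule mirror_brane_nonempty[OF mb])
    have "closed_segment ?p (?p + v) \<subseteq> supp L"
    proof
      fix x assume "x \<in> closed_segment ?p (?p + v)"
      then obtain t where "x = (1 - t) *\<^sub>R ?p + t *\<^sub>R (?p + v)" by (auto simp: closed_segment_def)
      then have "x = ?p + t *\<^sub>R v" by (simp add: algebra_simps)
      then show "x \<in> supp L" using v p by (auto simp: tangent_def)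
    qed
    then show "v \<in> range (graph_vec (real_mat D))" using mirror_brane_segment[OF mb p] by simp
  qed
  show "range (graph_vec (real_mat D)) \<subseteq> tangent (supp L)"
  proof
    fix v assume "v \<in> range (graph_vec (real_mat D))"
    then have y: "snd v + real_mat D *v fst v = 0" unfolding graph_vec_range .
    have "snd (t *\<^sub>R v) + real_mat D *v fst (t *\<^sub>R v) = t *\<^sub>R (snd v + real_mat D *v fst v)" for t
      by (simp add: matrix_vector_mult_scaleR scaleR_add_right)
    then show "v \<in> tangent (supp L)"
      unfolding tangent_def using mirror_brane_supp_add[OF mb] y by simp
  qed
qed

lemma mirror_brane_H1:
  assumes mb: "mirror_brane \<tau> D c L"
  shows "H1 L = graph_vec (real_mat D) ` int_lattice"
  unfolding H1_def mirror_brane_tangent[OF mb] by (auto simp: graph_vec_lattice_iff)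

lemma mirror_brane_symmetric:
  assumes "mirror_brane \<tau> D c L"
  shows "transpose (Im_mat \<tau> ** real_mat D) = Im_mat \<tau> ** real_mat D"
  using assms by (simp add: mirror_brane_def)

lemma mirror_brane_calculus:
  assumes mb: "mirror_brane \<tau> D c L"
  shows "brane_calculus L (brane_F (torus_form \<tau>))"
proof
  show "unitary_line_bundle (supp L) (conn L) (mult L)"
    using mb unfolding mirror_brane_def linear_lagrangian_brane_def by blast
  show "curvature (conn L) p u v = - 2 * of_real pi * \<i> * of_real (brane_F (torus_form \<tau>) u v)"
    if "p \<in> supp L" "u \<in> tangent (supp L)" "v \<in> tangent (supp L)" for p u v
    using mb that unfolding mirror_brane_def linear_lagrangian_brane_def by blast
  show "subspace (tangent (supp L))"
    unfolding mirror_brane_tangent[OF mb] by (intro linear_subspace_image linear_graph_vec) auto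
  show "p + \<gamma> \<in> supp L" if "p \<in> supp L" "\<gamma> \<in> int_lattice" for p \<gamma>
    unfolding mirror_brane_supp_add[OF mb that(1)] using that(2)
    by (auto simp: int_lattice_prod_iff real_mat_lattice)
  have "bilinear (\<lambda>u v. - B_form \<tau> u v)"
    using bilinear_B_form[of \<tau>] by (simp add: bilinear_def linear_compose_neg)
  then show "bilinear (brane_F (torus_form \<tau>))" by (simp add: brane_F_eq[abs_def])
  show "brane_F (torus_form \<tau>) u v = - brane_F (torus_form \<tau>) v u" for u v
    using B_form_flip[of \<tau> u v] by (simp add: brane_F_eq)
qed

lemma mirror_signed_brane:
  assumes "mirror_brane \<tau> D c L" "lift_sign (torus_form \<tau>) L \<xi>"
  shows "signed_brane (torus_form \<tau>) L \<xi>"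
  using mirror_brane_calculus[OF assms(1)] assms(2) by (simp add: signed_brane_def signed_brane_axioms_def)

text \<open>The signed holonomy is a character of \<open>H1 L\<close>, so it is given by a vector \<open>\<kappa>\<close>. The lift consists over \<open>x\<close> of the
covectors whose restriction to the brane is congruent to \<open>\<kappa>\<close>.\<close>

lemma lift_restriction:
  assumes mb: "mirror_brane \<tau> D c L" and sg: "lift_sign (torus_form \<tau>) L \<xi>" and x: "x \<in> supp L"
  obtains \<kappa> where "\<And>x'. (x, x') \<in> supp (lift \<xi> L) \<longleftrightarrow> restrict_cov (real_mat D) x' - \<kappa> \<in> int_lattice"
proof -
  interpret signed_brane "torus_form \<tau>" L \<xi> by (rule mirror_signed_brane[OF mb sg])
  let ?g = "graph_vec (real_mat D)"
  define h where "h t = minus_one_pow (\<xi> (?g t)) * hol L x (?g t)" for t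
  have H1: "?g t \<in> H1 L" if "t \<in> int_lattice" for t using that mirror_brane_H1[OF mb] by auto
  obtain \<kappa> where \<kappa>: "\<And>t. t \<in> int_lattice \<Longrightarrow> h t = character \<kappa> t"
  proof (rule character_of_lattice_hom[of h])
    show "h (t + t') = h t * h t'" if "t \<in> int_lattice" "t' \<in> int_lattice" for t t'
      using signed_hol_add[OF x H1[OF that(1)] H1[OF that(2)]] by (simp add: h_def)
    show "norm (h t) = 1" if "t \<in> int_lattice" for t
      by (simp add: h_def norm_mult norm_hol[OF x H1[OF that]])
  qed blast
  show ?thesis
  proof (rule that)
    fix x'
    have "(x, x') \<in> supp (lift \<xi> L) \<longleftrightarrow> (\<forall>t\<in>int_lattice. character x' (?g t) = h t)"
      using x by (simp add: supp_lift mirror_brane_H1[OF mb] h_def)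
    also have "\<dots> \<longleftrightarrow> (\<forall>t\<in>int_lattice. character (restrict_cov (real_mat D) x' - \<kappa>) t = 1)"
      using \<kappa> by (simp add: character_diff) (simp add: character_def inner_graph_vec)
    also have "\<dots> \<longleftrightarrow> restrict_cov (real_mat D) x' - \<kappa> \<in> int_lattice"
      unfolding character_eq_1_iff using inner_lattice_int int_lattice_inner by blast
    finally show "(x, x') \<in> supp (lift \<xi> L) \<longleftrightarrow> restrict_cov (real_mat D) x' - \<kappa> \<in> int_lattice" .
  qed
qed

section \<open>Transverse pairs\<close>

lemma invertible_real_mat_det:
  fixes D :: "int^'n::finite^'n"
  assumes "invertible (real_mat D)"
  shows "det D \<noteq> 0"
proof -
  have "det (real_mat D) = of_int (det D)"
    by (simp add: det_def real_mat_def of_int_sum of_int_prod)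
  then show ?thesis using assms by (auto simp: invertible_det_nz)
qed

lemma real_mat_diff: "real_mat (D' - D) = real_mat D' - real_mat D"
  by (simp add: real_mat_def vec_eq_iff)

lemma invertible_mult_inj: "invertible (A :: real^'n^'n) \<Longrightarrow> A *v x = A *v y \<longleftrightarrow> x = y"
  by (metis invertible_def matrix_vector_mul_assoc matrix_vector_mul_lid)

lemma mult_matrix_inv: "invertible (A :: real^'n^'n) \<Longrightarrow> A *v (matrix_inv A *v x) = x"
  and matrix_inv_mult: "invertible (A :: real^'n^'n) \<Longrightarrow> matrix_inv A *v (A *v x) = x"
proof -
  assume "invertible A"
  then have "A ** matrix_inv A = mat 1 \<and> matrix_inv A ** A = mat 1"
    unfolding matrix_inv_def invertible_def by (rule someI_ex)
  then show "A *v (matrix_inv A *v x) = x" "matrix_inv A *v (A *v x) = x"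
    by (simp_all add: matrix_vector_mul_assoc)
qed

text \<open>The spaces of covectors which vanish on one of two transverse graphs are complementary.\<close>

lemma restrict_cov_pair:
  assumes "invertible (A' - A)"
  obtains x' where "restrict_cov A x' = \<kappa>" "restrict_cov A' x' = \<kappa>'"
proof -
  let ?E = "transpose (A' - A)"
  have E: "invertible ?E" using assms by (simp add: invertible_det_nz det_transpose)
  have d: "?E = transpose A' - transpose A" by (simp add: transpose_def vec_eq_iff)
  define \<eta> where "\<eta> = matrix_inv ?E *v (\<kappa> - \<kappa>')"
  have "transpose A' *v \<eta> - transpose A *v \<eta> = \<kappa> - \<kappa>'"
    using mult_matrix_inv[OF E, of "\<kappa> - \<kappa>'"] by (simp add: \<eta>_def d matrix_vector_mult_diff_rdistrib)
  then have "restrict_cov A (\<kappa> + transpose A *v \<eta>, \<eta>) = \<kappa>" "restrict_cov A' (\<kappa> + transpose A *v \<eta>, \<eta>) = \<kappa>'"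
    by (simp_all add: restrict_cov_def algebra_simps)
  then show ?thesis by (rule that)
qed

lemma restrict_cov_pair_inj:
  assumes "invertible (A' - A)" "restrict_cov A x' = 0" "restrict_cov A' x' = 0"
  shows "x' = 0"
proof -
  let ?E = "transpose (A' - A)"
  have E: "invertible ?E" using assms by (simp add: invertible_det_nz det_transpose)
  have x: "x' = conormal A (snd x')" using assms(2) by (rule restrict_cov_zeroD)
  then have "?E *v snd x' = 0" using assms(3) restrict_conormal[of A' A "snd x'"] by simp
  then have "snd x' = 0" using invertible_mult_inj[OF E, of "snd x'" 0] by simp
  then show ?thesis using x by simp
qed

text \<open>The defining equations of the two branes embed the intersection into a coset of a lattice.\<close>

lemma finite_int_points:
  assumes mb: "mirror_brane \<tau> D c L" and mb': "mirror_brane \<tau> D' c' L'"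
    and inv: "invertible (real_mat D' - real_mat D)"
  shows "finite (int_points L L')"
  unfolding int_points_def
proof (rule finite_tpoint_image)
  define T where "T v = (snd v + real_mat D *v fst v, snd v + real_mat D' *v fst v)" for v :: "'a V"
  show T: "linear T"
    by (rule linearI) (auto simp: T_def matrix_vector_right_distrib matrix_vector_mult_scaleR scaleR_add_right)
  show "inj T"
  proof (subst linear_injective_0[OF T], intro allI impI)
    fix v assume "T v = 0"
    then have 1: "snd v + real_mat D *v fst v = 0" "snd v + real_mat D' *v fst v = 0" by (auto simp: T_def zero_prod_def)
    then have "(real_mat D' - real_mat D) *v fst v = 0"
      by (simp add: matrix_vector_mult_diff_rdistrib) (metis add_left_cancel)
    then have "fst v = 0" using invertible_mult_inj[OF inv, of "fst v" 0] by simp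
    then show "v = 0" using 1 by (simp add: prod_eq_iff)
  qed
  show "T \<gamma> \<in> int_lattice" if "\<gamma> \<in> int_lattice" for \<gamma>
    using that by (auto simp: T_def int_lattice_prod_iff real_mat_lattice)
  fix x y assume x: "x \<in> supp L \<inter> supp L'" and y: "y \<in> supp L \<inter> supp L'"
  have d: "a - b \<in> int_lattice" if "a - k \<in> int_lattice" "b - k \<in> int_lattice" for a b k :: "real^'a"
    using int_lattice_diff[OF that] by simp
  show "T x - T y \<in> int_lattice"
    unfolding T_def diff_Pair int_lattice_Pair_iff
    by (rule conjI[OF d[of _ c] d[of _ c']]) (use x y mirror_brane_supp[OF mb] mirror_brane_supp[OF mb'] in auto)
qed

lemma lift_fibre:
  assumes mb: "mirror_brane \<tau> D c L" and mb': "mirror_brane \<tau> D' c' L'"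
    and sg: "lift_sign (torus_form \<tau>) L \<xi>" and sg': "lift_sign (torus_form \<tau>) L' \<xi>'"
    and inv: "invertible (real_mat D' - real_mat D)" and x: "x \<in> supp L \<inter> supp L'"
  obtains x0 where "\<And>x'. (x, x') \<in> supp (lift \<xi> L) \<inter> supp (lift \<xi>' L') \<longleftrightarrow>
    restrict_cov (real_mat D) (x' - x0) \<in> int_lattice \<and> restrict_cov (real_mat D') (x' - x0) \<in> int_lattice"
proof -
  obtain \<kappa> where \<kappa>: "\<And>x'. (x, x') \<in> supp (lift \<xi> L) \<longleftrightarrow> restrict_cov (real_mat D) x' - \<kappa> \<in> int_lattice"
    using lift_restriction[OF mb sg] x by blast
  obtain \<kappa>' where \<kappa>': "\<And>x'. (x, x') \<in> supp (lift \<xi>' L') \<longleftrightarrow> restrict_cov (real_mat D') x' - \<kappa>' \<in> int_lattice"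
    using lift_restriction[OF mb' sg'] x by blast
  obtain x0 where "restrict_cov (real_mat D) x0 = \<kappa>" "restrict_cov (real_mat D') x0 = \<kappa>'"
    by (rule restrict_cov_pair[OF inv])
  then show ?thesis using that[of x0] \<kappa> \<kappa>' by simp
qed

text \<open>Over a fixed \<open>w\<close> the points are given by covectors, which are embedded into a coset of a lattice by their
restrictions to the two branes.\<close>

lemma finite_points_over:
  assumes mb: "mirror_brane \<tau> D c L" and mb': "mirror_brane \<tau> D' c' L'"
    and sg: "lift_sign (torus_form \<tau>) L \<xi>" and sg': "lift_sign (torus_form \<tau>) L' \<xi>'"
    and inv: "invertible (real_mat D' - real_mat D)"
  shows "finite (points_over (lift \<xi> L) (lift \<xi>' L') X)"
proof (cases "points_over (lift \<xi> L) (lift \<xi>' L') X = {}")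
  case False
  let ?S = "supp (lift \<xi> L) \<inter> supp (lift \<xi>' L')"
  interpret B: brane_calculus L "brane_F (torus_form \<tau>)" by (rule mirror_brane_calculus[OF mb])
  interpret B': brane_calculus L' "brane_F (torus_form \<tau>)" by (rule mirror_brane_calculus[OF mb'])
  obtain z where z: "z \<in> ?S" "fst ` tpoint z = X" using False by (auto simp: points_over_def int_points_def)
  define w where "w = fst z"
  have wx: "(w, snd z) \<in> ?S" and X: "X = tpoint w" using z by (auto simp: w_def fst_tpoint)
  then have w: "w \<in> supp L \<inter> supp L'" by (auto simp: supp_lift)
  obtain x0 where x0: "\<And>x'. (w, x') \<in> ?S \<longleftrightarrow>
    restrict_cov (real_mat D) (x' - x0) \<in> int_lattice \<and> restrict_cov (real_mat D') (x' - x0) \<in> int_lattice"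
    by (rule lift_fibre[OF mb mb' sg sg' inv w]) blast
  define S where "S = {x'. (w, x') \<in> ?S}"
  have "finite (tpoint ` S)"
  proof (rule finite_tpoint_image)
    define T where "T v = (restrict_cov (real_mat D) v, restrict_cov (real_mat D') v)" for v
    show T: "linear T"
      by (rule linearI) (auto simp: T_def linear_scale[OF linear_restrict_cov])
    show "inj T"
    proof (subst linear_injective_0[OF T], intro allI impI)
      fix v assume "T v = 0"
      then show "v = 0" by (intro restrict_cov_pair_inj[OF inv]) (simp_all add: T_def zero_prod_def)
    qed
    show "T \<gamma> \<in> int_lattice" if "\<gamma> \<in> int_lattice" for \<gamma>
      using that by (auto simp: T_def int_lattice_prod_iff restrict_cov_def transpose_real_mat_lattice)
    fix x y assume "x \<in> S" "y \<in> S"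
    have d: "a - b \<in> int_lattice" if "a - k \<in> int_lattice" "b - k \<in> int_lattice" for a b k :: "real^'a"
      using int_lattice_diff[OF that] by simp
    show "T x - T y \<in> int_lattice"
      unfolding T_def diff_Pair int_lattice_Pair_iff
      by (rule conjI[OF d[of _ "restrict_cov (real_mat D) x0"] d[of _ "restrict_cov (real_mat D') x0"]])
        (use \<open>x \<in> S\<close> \<open>y \<in> S\<close> x0 in \<open>auto simp: S_def\<close>)
  qed
  then have "finite ((\<lambda>Z. tpoint (w, SOME x'. tpoint x' = Z)) ` (tpoint ` S))" by (rule finite_imageI)
  moreover have "points_over (lift \<xi> L) (lift \<xi>' L') X \<subseteq> (\<lambda>Z. tpoint (w, SOME x'. tpoint x' = Z)) ` (tpoint ` S)"
  proof
    fix Y assume "Y \<in> points_over (lift \<xi> L) (lift \<xi>' L') X"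
    then obtain y where y: "y \<in> ?S" "Y = tpoint y" "tpoint (fst y) = tpoint w"
      by (auto simp: points_over_def int_points_def fst_tpoint X)
    then have d: "w - fst y \<in> int_lattice" by (simp add: tpoint_eq_iff[symmetric])
    have "y + (w - fst y, 0) \<in> ?S"
      using y(1) d B.supp_lift_lattice B'.supp_lift_lattice by (simp add: int_lattice_Pair_iff)
    moreover have "y + (w - fst y, 0) = (w, snd y)" by (cases y) simp
    ultimately have s: "snd y \<in> S" by (simp add: S_def)
    define s' where "s' = (SOME x'. tpoint x' = tpoint (snd y))"
    have "tpoint s' = tpoint (snd y)" unfolding s'_def by (rule someI) simp
    then have "snd y - s' \<in> int_lattice" by (simp only: tpoint_eq_iff[symmetric])
    moreover have "fst y - w \<in> int_lattice" using d int_lattice_minus[of "w - fst y"] by simp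
    ultimately have "Y = tpoint (w, s')" by (simp add: y(2) tpoint_eq_iff int_lattice_prod_iff)
    then show "Y \<in> (\<lambda>Z. tpoint (w, SOME x'. tpoint x' = Z)) ` (tpoint ` S)" using s unfolding s'_def by blast
  qed
  ultimately show ?thesis by (rule finite_subset[rotated])
qed simp

section \<open>The u-part of Floer cohomology\<close>

lemma sum_fun_apply: "(\<Sum>i\<in>I. f i) x = (\<Sum>i\<in>I. f i x)"
  for f :: "'i \<Rightarrow> 'a \<Rightarrow> 'b::comm_monoid_add"
  by (induction I rule: infinite_finite_induct) auto

text \<open>A point of the fibre over \<open>x\<close> receives the value at \<open>x\<close>; the condition on the support implements the
convention that elements of \<open>HF\<close> vanish outside of the intersection.\<close>

definition pullback :: "('v::euclidean_space \<times> 'v) brane \<Rightarrow> ('v \<times> 'v) brane \<Rightarrow> ('v \<Rightarrow> complex) \<Rightarrow> 'v \<times> 'v \<Rightarrow> complex"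
  where "pullback M M' h = (\<lambda>x. if x \<in> supp M \<inter> supp M' then h (fst x) else 0)"

lemma pullback_add: "pullback M M' (g + h) = pullback M M' g + pullback M M' h"
  and pullback_cscale: "pullback M M' (cscale r h) = cscale r (pullback M M' h)"
  by (auto simp: pullback_def cscale_def fun_eq_iff)

lemma pullback_sum: "pullback M M' (\<Sum>i\<in>I. h i) = (\<Sum>i\<in>I. pullback M M' (h i))"
  by (auto simp: pullback_def fun_eq_iff sum_fun_apply)

lemma HF_add: "g \<in> HF L L' \<Longrightarrow> h \<in> HF L L' \<Longrightarrow> g + h \<in> HF L L'"
  and HF_cscale: "h \<in> HF L L' \<Longrightarrow> cscale r h \<in> HF L L'"
  and HF_zero: "0 \<in> HF L L'"
  by (auto simp: HF_def cscale_def algebra_simps)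

locale lifted_pair =
  fixes \<tau> :: "complex^'n::finite^'n" and D :: "int^'n^'n" and c :: "real^'n" and L :: "'n V brane" and \<xi> :: "'n V \<Rightarrow> int"
    and D' :: "int^'n^'n" and c' :: "real^'n" and L' :: "'n V brane" and \<xi>' :: "'n V \<Rightarrow> int"
  assumes mb: "mirror_brane \<tau> D c L" and mb': "mirror_brane \<tau> D' c' L'"
    and sg: "lift_sign (torus_form \<tau>) L \<xi>" and sg': "lift_sign (torus_form \<tau>) L' \<xi>'"
    and transverse: "invertible (real_mat D' - real_mat D)"
begin

sublocale B: signed_brane "torus_form \<tau>" L \<xi> by (rule mirror_signed_brane[OF mb sg])
sublocale B': signed_brane "torus_form \<tau>" L' \<xi>' by (rule mirror_signed_brane[OF mb' sg'])

abbreviation "M \<equiv> lift \<xi> L"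
abbreviation "M' \<equiv> lift \<xi>' L'"
abbreviation "S \<equiv> supp M \<inter> supp M'"

lemma S_lattice: "z \<in> S \<Longrightarrow> \<gamma> \<in> int_lattice \<Longrightarrow> z + \<gamma> \<in> S"
  by (simp add: B.supp_lift_lattice B'.supp_lift_lattice)

lemma S_lattice': "z \<in> S \<Longrightarrow> y - z \<in> int_lattice \<Longrightarrow> y \<in> S"
  using S_lattice[of z "y - z"] by simp

lemma base_lattice: "p \<in> supp L \<inter> supp L' \<Longrightarrow> q - p \<in> int_lattice \<Longrightarrow> q \<in> supp L \<inter> supp L'"
  using B.supp_lattice[of p "q - p"] B'.supp_lattice[of p "q - p"] by simp

lemma fst_S: "z \<in> S \<Longrightarrow> fst z \<in> supp L \<inter> supp L'"
  by (cases z) (auto simp: supp_lift)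

lemma fibre:
  assumes "x \<in> supp L \<inter> supp L'"
  obtains x0 where "\<And>x'. (x, x') \<in> S \<longleftrightarrow>
    restrict_cov (real_mat D) (x' - x0) \<in> int_lattice \<and> restrict_cov (real_mat D') (x' - x0) \<in> int_lattice"
  by (rule lift_fibre[OF mb mb' sg sg' transverse assms]) blast

lemma fibre_nonempty: "x \<in> supp L \<inter> supp L' \<Longrightarrow> \<exists>x'. (x, x') \<in> S"
proof -
  assume "x \<in> supp L \<inter> supp L'"
  then obtain x0 where "\<And>x'. (x, x') \<in> S \<longleftrightarrow>
    restrict_cov (real_mat D) (x' - x0) \<in> int_lattice \<and> restrict_cov (real_mat D') (x' - x0) \<in> int_lattice"
    using fibre by blast
  from this[of x0] have "(x, x0) \<in> S" by simp
  then show ?thesis by blast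
qed

lemma finite_base: "finite (int_points L L')"
  by (rule finite_int_points[OF mb mb' transverse])

lemma finite_over: "finite (points_over M M' X)"
  by (rule finite_points_over[OF mb mb' sg sg' transverse])

lemma tpoint_S: "tpoint z \<in> int_points M M' \<longleftrightarrow> z \<in> S"
proof
  assume "tpoint z \<in> int_points M M'"
  then obtain y where "y \<in> S" "tpoint z = tpoint y" unfolding int_points_def by blast
  then show "z \<in> S" using S_lattice' tpoint_eq_iff by blast
qed (simp add: int_points_def)

lemma tpoint_base: "tpoint p \<in> int_points L L' \<longleftrightarrow> p \<in> supp L \<inter> supp L'"
proof
  assume "tpoint p \<in> int_points L L'"
  then obtain y where "y \<in> supp L \<inter> supp L'" "tpoint p = tpoint y" unfolding int_points_def by blast
  then show "p \<in> supp L \<inter> supp L'" using base_lattice tpoint_eq_iff by blast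
qed (simp add: int_points_def)

lemma tpoint_over: "tpoint z \<in> points_over M M' X \<longleftrightarrow> z \<in> S \<and> tpoint (fst z) = X"
  unfolding points_over_def mem_Collect_eq tpoint_S fst_tpoint ..

lemma int_points_cases:
  assumes "Y \<in> int_points M M'"
  obtains z where "z \<in> S" "Y = tpoint z"
  using assms by (auto simp: int_points_def)

lemma finite_lift: "finite (int_points M M')"
proof -
  have "int_points M M' \<subseteq> (\<Union>X\<in>int_points L L'. points_over M M' X)"
  proof
    fix Y assume "Y \<in> int_points M M'"
    then obtain z where z: "z \<in> S" "Y = tpoint z" by (rule int_points_cases)
    then have "Y \<in> points_over M M' (tpoint (fst z))" by (simp only: tpoint_over simp_thms)
    moreover have "tpoint (fst z) \<in> int_points L L'" unfolding tpoint_base by (rule fst_S[OF z(1)])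
    ultimately show "Y \<in> (\<Union>X\<in>int_points L L'. points_over M M' X)" by blast
  qed
  then show ?thesis by (rule finite_subset) (intro finite_UN_I finite_base finite_over)
qed

text \<open>The generators \<open>\<Sum>\<^sub>l s\<^sub>k\<^sub>,\<^sub>l\<close> of the u-part are pullbacks.\<close>

lemma sum_gen_at:
  assumes s: "s \<in> HF_at L L' X"
  shows "(\<Sum>Y\<in>points_over M M' X. gen_at Y s) = pullback M M' s"
proof
  fix x
  have "(\<Sum>Y\<in>points_over M M' X. gen_at Y s) x = (if tpoint x \<in> points_over M M' X then s (fst x) else 0)"
    using finite_over by (simp add: sum_fun_apply gen_at_def if_distrib cong: if_cong)
  also have "\<dots> = pullback M M' s x"
  proof -
    have "s (fst x) = 0 \<or> tpoint (fst x) = X" using s unfolding HF_at_def by blast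
    then show ?thesis unfolding tpoint_over pullback_def by auto
  qed
  finally show "(\<Sum>Y\<in>points_over M M' X. gen_at Y s) x = pullback M M' s x" .
qed

definition component :: "('n V \<Rightarrow> complex) \<Rightarrow> 'n V set \<Rightarrow> 'n V \<Rightarrow> complex"
  where "component h X p = (if tpoint p = X then h p else 0)"

lemma component_HF_at: "h \<in> HF L L' \<Longrightarrow> component h X \<in> HF_at L L' X"
proof -
  assume h: "h \<in> HF L L'"
  have "tpoint (p + \<gamma>) = tpoint p" if "\<gamma> \<in> int_lattice" for p \<gamma> :: "'n V"
    using that by (simp add: tpoint_eq_iff)
  with h show ?thesis unfolding HF_at_def HF_def component_def by simp
qed

lemma sum_component:
  assumes "h \<in> HF L L'"
  shows "h = (\<Sum>X\<in>int_points L L'. component h X)"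
proof
  fix p
  have "h p = 0" if "p \<notin> supp L \<inter> supp L'" using that assms unfolding HF_def by blast
  then show "h p = (\<Sum>X\<in>int_points L L'. component h X) p"
    using finite_base tpoint_base[of p] by (auto simp: sum_fun_apply component_def if_distrib cong: if_cong)
qed

text \<open>An element of \<open>HF L L'\<close> is the sum of its components at the finitely many intersection points, and the
pullbacks of these are the generators.\<close>

lemma HF_u_eq: "HF_u L L' M M' = pullback M M' ` HF L L'"
proof
  let ?G = "{\<Sum>Y\<in>points_over M M' X. gen_at Y s | X s. X \<in> int_points L L' \<and> s \<in> HF_at L L' X}"
  have G: "?G = {pullback M M' s | X s. X \<in> int_points L L' \<and> s \<in> HF_at L L' X}"
    using sum_gen_at by (auto; metis)
  show "HF_u L L' M M' \<subseteq> pullback M M' ` HF L L'"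
    unfolding HF_u_def
  proof (rule cfun.span_minimal)
    show "?G \<subseteq> pullback M M' ` HF L L'" unfolding G by (auto simp: HF_at_def)
    show "cfun.subspace (pullback M M' ` HF L L')"
    proof (rule cfun.subspaceI)
      show "0 \<in> pullback M M' ` HF L L'"
        using HF_zero by (rule rev_image_eqI) (simp add: pullback_def fun_eq_iff)
      show "x + y \<in> pullback M M' ` HF L L'"
        if "x \<in> pullback M M' ` HF L L'" "y \<in> pullback M M' ` HF L L'" for x y
        using that by (auto simp: pullback_add[symmetric] intro!: imageI HF_add)
      show "cscale r x \<in> pullback M M' ` HF L L'" if "x \<in> pullback M M' ` HF L L'" for r x
        using that by (auto simp: pullback_cscale[symmetric] intro!: imageI HF_cscale)
    qed
  qed
  show "pullback M M' ` HF L L' \<subseteq> HF_u L L' M M'"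
  proof safe
    fix h assume h: "h \<in> HF L L'"
    have "pullback M M' h = (\<Sum>X\<in>int_points L L'. pullback M M' (component h X))"
      using sum_component[OF h] pullback_sum by metis
    also have "\<dots> \<in> HF_u L L' M M'"
      unfolding HF_u_def
      by (intro cfun.span_sum cfun.span_base) (use component_HF_at[OF h] G in blast)
    finally show "pullback M M' h \<in> HF_u L L' M M'" .
  qed
qed

lemma inj_on_pullback: "inj_on (pullback M M') (HF L L')"
proof (rule inj_onI)
  fix g h assume g: "g \<in> HF L L'" and h: "h \<in> HF L L'" and eq: "pullback M M' g = pullback M M' h"
  show "g = h"
  proof
    fix p
    show "g p = h p"
    proof (cases "p \<in> supp L \<inter> supp L'")
      case True
      then obtain x' where "(p, x') \<in> S" using fibre_nonempty by blast
      then show ?thesis using fun_cong[OF eq, of "(p, x')"] by (simp add: pullback_def)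
    next
      case False
      then have "g p = 0 \<and> h p = 0" using g h unfolding HF_def by blast
      then show ?thesis by simp
    qed
  qed
qed

text \<open>Surjectivity is \<open>HF_u_eq\<close>; injectivity holds because all fibres are nonempty. The factor \<open>r\<close> will be the
theta constant.\<close>

theorem linear_iso_pullback:
  assumes "r \<noteq> 0"
  shows "linear_iso (\<lambda>h. cscale r (pullback M M' h)) (HF L L') (HF_u L L' M M')"
proof -
  have "(\<lambda>h. cscale r (pullback M M' h)) ` HF L L' = HF_u L L' M M'"
  proof
    show "(\<lambda>h. cscale r (pullback M M' h)) ` HF L L' \<subseteq> HF_u L L' M M'"
      unfolding HF_u_eq by (auto simp: pullback_cscale[symmetric] intro!: imageI HF_cscale)
    show "HF_u L L' M M' \<subseteq> (\<lambda>h. cscale r (pullback M M' h)) ` HF L L'"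
    proof
      fix x assume "x \<in> HF_u L L' M M'"
      then obtain h where h: "h \<in> HF L L'" "x = pullback M M' h" unfolding HF_u_eq by blast
      have "x = cscale r (pullback M M' (cscale (1 / r) h))"
        using assms h by (simp add: pullback_def cscale_def fun_eq_iff)
      then show "x \<in> (\<lambda>h. cscale r (pullback M M' h)) ` HF L L'" using HF_cscale[OF h(1)] by blast
    qed
  qed
  moreover have "inj_on (\<lambda>h. cscale r (pullback M M' h)) (HF L L')"
  proof (rule inj_onI)
    fix g h assume gh: "g \<in> HF L L'" "h \<in> HF L L'" and "cscale r (pullback M M' g) = cscale r (pullback M M' h)"
    then have "pullback M M' g = pullback M M' h" using assms by (simp add: cscale_def fun_eq_iff)
    then show "g = h" using inj_on_pullback gh by (simp add: inj_on_def)
  qed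
  ultimately show ?thesis
    unfolding linear_iso_def bij_betw_def
    by (simp add: pullback_add pullback_cscale cfun.scale_right_distrib cfun.scale_left_commute)
qed

text \<open>If \<open>Y\<close> lies over the point represented by \<open>w\<close>, then it contains vectors with first component \<open>w\<close>. Their second
components agree up to integral covectors.\<close>

definition rep :: "'n V \<Rightarrow> ('n V \<times> 'n V) set \<Rightarrow> 'n V"
  where "rep w Y = (SOME x'. (w, x') \<in> Y)"

lemma rep_mem:
  assumes "Y \<in> points_over M M' (tpoint w)"
  shows "(w, rep w Y) \<in> Y" "(w, rep w Y) \<in> S" "tpoint (w, rep w Y) = Y"
proof -
  obtain z where z: "z \<in> S" "Y = tpoint z" "tpoint (fst z) = tpoint w"
    using assms by (auto simp: points_over_def fst_tpoint elim!: int_points_cases)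
  have "w \<in> fst ` Y" using z by (simp add: fst_tpoint)
  then have "\<exists>x'. (w, x') \<in> Y" by force
  then show m: "(w, rep w Y) \<in> Y" unfolding rep_def by (rule someI_ex)
  then have d: "(w, rep w Y) - z \<in> int_lattice" by (simp add: z mem_tpoint_iff)
  then show "(w, rep w Y) \<in> S" using S_lattice'[OF z(1)] by blast
  show "tpoint (w, rep w Y) = Y" using d by (simp add: z tpoint_eq_iff)
qed

text \<open>Only the coefficients at the points of one fibre contribute to the value at \<open>x\<close>, so that \<open>\<Pi>\<^sub>T\<close> is a
multiple of the mean over the fibres.\<close>

lemma Pi_T_apply:
  "Pi_T D D' M M' h x = (if x \<in> S then
    (\<Sum>Y\<in>points_over M M' (tpoint (fst x)). h (fst x, rep (fst x) Y)) / of_int \<bar>det (D' - D)\<bar> else 0)"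
proof -
  let ?r = "1 / of_int \<bar>det (D' - D)\<bar> :: complex"
  have inner: "(\<Sum>Z\<in>points_over M M' (fst ` Y). gen_at Z (coeff_at Y h)) x =
      (if x \<in> S \<and> fst ` Y = tpoint (fst x) then h (fst x, rep (fst x) Y) else 0)" for Y
  proof -
    have "(\<Sum>Z\<in>points_over M M' (fst ` Y). gen_at Z (coeff_at Y h)) x =
        (if tpoint x \<in> points_over M M' (fst ` Y) then coeff_at Y h (fst x) else 0)"
      using finite_over by (simp add: sum_fun_apply gen_at_def if_distrib cong: if_cong)
    moreover have "fst x \<in> fst ` Y" if "fst ` Y = tpoint (fst x)" using that by simp
    ultimately show ?thesis by (auto simp: tpoint_over coeff_at_def rep_def)
  qed
  have "Pi_T D D' M M' h x = (\<Sum>Y\<in>int_points M M'. ?r *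
      (if x \<in> S \<and> fst ` Y = tpoint (fst x) then h (fst x, rep (fst x) Y) else 0))"
    unfolding Pi_T_def sum_fun_apply[of _ "int_points M M'"] by (simp add: cscale_def inner)
  also have "\<dots> = (if x \<in> S then \<Sum>Y\<in>points_over M M' (tpoint (fst x)). ?r * h (fst x, rep (fst x) Y) else 0)"
  proof (cases "x \<in> S")
    case True
    have "(\<Sum>Y\<in>int_points M M'. ?r * (if x \<in> S \<and> fst ` Y = tpoint (fst x) then h (fst x, rep (fst x) Y) else 0)) =
        (\<Sum>Y\<in>points_over M M' (tpoint (fst x)). ?r * h (fst x, rep (fst x) Y))"
      by (rule sum.mono_neutral_cong_right[OF finite_lift]) (use True in \<open>auto simp: points_over_def\<close>)
    then show ?thesis using True by (simp only: if_True)
  next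
    case False
    then show ?thesis by (simp only: simp_thms if_False mult_zero_right sum.neutral_const)
  qed
  also have "\<dots> = (if x \<in> S then
    (\<Sum>Y\<in>points_over M M' (tpoint (fst x)). h (fst x, rep (fst x) Y)) / of_int \<bar>det (D' - D)\<bar> else 0)"
    by (simp add: sum_divide_distrib)
  finally show ?thesis .
qed

end

section \<open>Triangles and their lifts\<close>

abbreviation cov_B :: "complex^'n::finite^'n \<Rightarrow> 'n V \<Rightarrow> 'n V"
  where "cov_B \<tau> \<equiv> contract (B_form \<tau>)"

lemmas cov_B_simps [simp] = linear_0[OF linear_contract[OF bilinear_B_form]] linear_add[OF linear_contract[OF bilinear_B_form]]
  linear_diff[OF linear_contract[OF bilinear_B_form]] linear_neg[OF linear_contract[OF bilinear_B_form]]

text \<open>The connection has the curvature form \<open>F = - B\<close>, so the covector along an edge \<open>u\<close> of a lift restricts to \<open>- \<iota>\<^sub>u B\<close>;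
what remains free is a covector that vanishes on the brane.\<close>

lemma lift_segment:
  assumes mb: "mirror_brane \<tau> D c L" and xx: "(x, x') \<in> supp (lift \<xi> L)"
  shows "closed_segment (x, x') (y, y') \<subseteq> supp (lift \<xi> L) \<longleftrightarrow>
    y - x \<in> range (graph_vec (real_mat D)) \<and> restrict_cov (real_mat D) (y' - x' + cov_B \<tau> (y - x)) = 0"
proof -
  interpret brane_calculus L "brane_F (torus_form \<tau>)" by (rule mirror_brane_calculus[OF mb])
  have x: "x \<in> supp L" using xx by (simp add: supp_lift)
  have e: "(y' - x') \<bullet> graph_vec (real_mat D) t = brane_F (torus_form \<tau>) (y - x) (graph_vec (real_mat D) t) \<longleftrightarrow>
      restrict_cov (real_mat D) (y' - x' + cov_B \<tau> (y - x)) \<bullet> t = 0" for t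
    unfolding inner_graph_vec[symmetric] inner_add_left contract_inner[OF bilinear_B_form] brane_F_eq by linarith
  have "(\<forall>\<gamma>\<in>H1 L. (y' - x') \<bullet> \<gamma> = brane_F (torus_form \<tau>) (y - x) \<gamma>) \<longleftrightarrow>
      (\<forall>t\<in>int_lattice. restrict_cov (real_mat D) (y' - x' + cov_B \<tau> (y - x)) \<bullet> t = 0)"
    unfolding mirror_brane_H1[OF mb] ball_simps by (simp only: e)
  also have "\<dots> \<longleftrightarrow> restrict_cov (real_mat D) (y' - x' + cov_B \<tau> (y - x)) = 0"
    using inner_lattice_ext[of "restrict_cov (real_mat D) (y' - x' + cov_B \<tau> (y - x))" 0] by auto
  finally show ?thesis
    using segment_in_lift_iff[OF xx] mirror_brane_segment[OF mb x] mirror_brane_tangent[OF mb] by metis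
qed

text \<open>Symmetry of \<open>Im \<tau> A\<close> says that the graph of \<open>- A\<close> is Lagrangian, so only \<open>A' - A\<close> contributes.\<close>

lemma \<omega>_form_graph_vec:
  assumes "transpose (Im_mat \<tau> ** A) = Im_mat \<tau> ** A"
  shows "\<omega>_form \<tau> (graph_vec A r) (graph_vec A' t) = - (r \<bullet> ((Im_mat \<tau> ** (A' - A)) *v t))"
proof -
  have "t \<bullet> (Im_mat \<tau> *v (A *v r)) = r \<bullet> (Im_mat \<tau> *v (A *v t))"
    using transpose_inner[of "Im_mat \<tau> ** A" t r] assms
    by (simp add: matrix_vector_mul_assoc inner_commute)
  then show ?thesis
    by (simp add: \<omega>_form_eq graph_vec_def matrix_vector_mul_assoc[symmetric] matrix_vector_mult_diff_rdistrib
        matrix_vector_mult_diff_distrib inner_diff_right linear_neg[OF matrix_vector_mul_linear])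
qed

locale mirror_triple =
  T12: lifted_pair \<tau> D c L \<xi> D' c' L' \<xi>' + T23: lifted_pair \<tau> D' c' L' \<xi>' D'' c'' L'' \<xi>'' +
  T13: lifted_pair \<tau> D c L \<xi> D'' c'' L'' \<xi>''
  for \<tau> :: "complex^'n::finite^'n" and D c L \<xi> D' c' L' \<xi>' D'' c'' L'' \<xi>'' +
  assumes inv_Y: "invertible (Im_mat \<tau>)"
    and pos12: "\<And>x. x \<noteq> 0 \<Longrightarrow> 0 < x \<bullet> ((Im_mat \<tau> ** (real_mat D' - real_mat D)) *v x)"
    and pos23: "\<And>x. x \<noteq> 0 \<Longrightarrow> 0 < x \<bullet> ((Im_mat \<tau> ** (real_mat D'' - real_mat D')) *v x)"
begin

abbreviation "A \<equiv> real_mat D"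
abbreviation "A' \<equiv> real_mat D'"
abbreviation "A'' \<equiv> real_mat D''"
abbreviation "Y \<equiv> Im_mat \<tau>"
abbreviation "E \<equiv> A' - A"
abbreviation "E' \<equiv> A'' - A'"
abbreviation "P \<equiv> Y ** E"
abbreviation "P' \<equiv> Y ** E'"

lemma E_sum: "(A'' - A) *v x = E *v x + E' *v x"
  by (simp add: matrix_vector_mult_diff_rdistrib)

lemma symA: "transpose (Y ** A) = Y ** A" and symA': "transpose (Y ** A') = Y ** A'" and symA'': "transpose (Y ** A'') = Y ** A''"
  using mirror_brane_symmetric T12.mb T12.mb' T23.mb' by blast+

lemma symP: "x \<bullet> (P *v y) = (P *v x) \<bullet> y" and symP': "x \<bullet> (P' *v y) = (P' *v x) \<bullet> y"
proof -
  have "transpose P = P" "transpose P' = P'"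
    using symA symA' symA'' by (simp_all add: matrix_diff_ldistrib) (simp_all add: transpose_def vec_eq_iff)
  then show "x \<bullet> (P *v y) = (P *v x) \<bullet> y" "x \<bullet> (P' *v y) = (P' *v x) \<bullet> y"
    using transpose_inner[of P x y] transpose_inner[of P' x y] by simp_all
qed

lemma inv_P: "invertible P" and inv_P': "invertible P'"
proof -
  have "det P \<noteq> 0" "det P' \<noteq> 0"
    using inv_Y T12.transverse T23.transverse by (simp_all add: det_mul invertible_det_nz)
  then show "invertible P" "invertible P'" by (simp_all add: invertible_det_nz)
qed

lemma P_E: "P *v x = Y *v (E *v x)" and P'_E': "P' *v x = Y *v (E' *v x)"
  by (simp_all add: matrix_vector_mul_assoc)

text \<open>If \<open>P r = y = P' s\<close>, then \<open>r + s = H y\<close>. So \<open>Hi\<close> computes the area of a triangle from \<open>r + s\<close> (\<open>Hi_triangle\<close>),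
and \<open>H\<close> that of its dual part (\<open>dual_area\<close>).\<close>

definition H :: "real^'n \<Rightarrow> real^'n"
  where "H \<zeta> = matrix_inv P *v \<zeta> + matrix_inv P' *v \<zeta>"

definition Hi :: "real^'n \<Rightarrow> real^'n"
  where "Hi = inv H"

lemma linear_H: "linear H"
  by (rule linearI) (simp_all add: H_def matrix_vector_right_distrib matrix_vector_mult_scaleR scaleR_add_right)

lemma inner_inv_P: "x \<bullet> (matrix_inv P *v y) = (matrix_inv P *v x) \<bullet> y" "x \<bullet> (matrix_inv P' *v y) = (matrix_inv P' *v x) \<bullet> y"
  using symP[of "matrix_inv P *v x" "matrix_inv P *v y"] symP'[of "matrix_inv P' *v x" "matrix_inv P' *v y"]
  by (simp_all add: mult_matrix_inv inv_P inv_P')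

lemma inv_P_pos: "x \<noteq> 0 \<Longrightarrow> 0 < x \<bullet> (matrix_inv P *v x)" "x \<noteq> 0 \<Longrightarrow> 0 < x \<bullet> (matrix_inv P' *v x)"
proof -
  assume x: "x \<noteq> 0"
  have "matrix_inv P *v x \<noteq> 0" "matrix_inv P' *v x \<noteq> 0"
    using x mult_matrix_inv[OF inv_P, of x] mult_matrix_inv[OF inv_P', of x] by auto
  then show "0 < x \<bullet> (matrix_inv P *v x)" "0 < x \<bullet> (matrix_inv P' *v x)"
    using pos12[of "matrix_inv P *v x"] pos23[of "matrix_inv P' *v x"]
    by (simp_all add: mult_matrix_inv inv_P inv_P' inner_commute)
qed

lemma H_pos: "x \<noteq> 0 \<Longrightarrow> 0 < x \<bullet> H x"
  using inv_P_pos[of x] by (simp add: H_def inner_add_right)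

lemma H_sym: "x \<bullet> H y = H x \<bullet> y"
  by (simp add: H_def inner_add_left inner_add_right inner_inv_P)

lemma Hi_props: "linear Hi" "H (Hi x) = x" "Hi (H x) = x"
proof -
  have inj: "inj H"
    unfolding linear_injective_0[OF linear_H] using H_pos by fastforce
  then obtain f where f: "linear f" "\<forall>x. f (H x) = x" "\<forall>x. H (f x) = x"
    using linear_injective_isomorphism[OF linear_H] by blast
  have "Hi = f" unfolding Hi_def using f(3) inj by (metis ext inv_f_f)
  then show "linear Hi" "H (Hi x) = x" "Hi (H x) = x" using f by auto
qed

sublocale G: gaussian H Hi
  by (rule gaussian.intro) (rule linear_H Hi_props H_sym H_pos, assumption?)+

lemmas Hi_simps [simp] = linear_0[OF Hi_props(1)] linear_add[OF Hi_props(1)]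
  linear_diff[OF Hi_props(1)] linear_neg[OF Hi_props(1)]

lemma Hi_sym: "x \<bullet> Hi y = Hi x \<bullet> y"
  using H_sym[of "Hi x" "Hi y"] by (simp add: Hi_props)

lemma Hi_triangle:
  assumes "E *v r = E' *v s"
  shows "Hi (r + s) = P *v r" "P' *v s = P *v r"
proof -
  show P: "P' *v s = P *v r" using assms by (simp add: P_E P'_E')
  have "H (P *v r) = r + s"
    using matrix_inv_mult[OF inv_P, of r] matrix_inv_mult[OF inv_P', of s] P by (simp add: H_def)
  then show "Hi (r + s) = P *v r" using Hi_props(3)[of "P *v r"] by simp
qed

subsection \<open>Triangles in the torus\<close>

abbreviation "tri w \<equiv> triangles L L' L'' w"
abbreviation "base \<equiv> supp L \<inter> supp L''"

lemma triangle_closes: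
  "E *v r = E' *v s \<Longrightarrow> graph_vec A r + graph_vec A'' s = graph_vec A' (r + s)"
  by (simp add: graph_vec_def matrix_vector_right_distrib matrix_vector_mult_diff_rdistrib algebra_simps)

lemma triI:
  assumes w: "w \<in> base" and rs: "E *v r = E' *v s" and p: "w + graph_vec A r \<in> supp L'"
  shows "(w + graph_vec A r, w - graph_vec A'' s) \<in> tri w"
proof -
  have "closed_segment w (w + graph_vec A r) \<subseteq> supp L"
    using mirror_brane_segment[OF T12.mb] w by simp
  moreover have "closed_segment (w - graph_vec A'' s) w \<subseteq> supp L''"
    using mirror_brane_segment[OF T23.mb', of w "w - graph_vec A'' s"] w graph_vec_simps(4)[of A'' s]
    unfolding closed_segment_commute[of _ w] by (metis Int_iff add_diff_cancel_left' rangeI uminus_add_conv_diff add.commute)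
  moreover have "w - graph_vec A'' s - (w + graph_vec A r) = graph_vec A' (- (r + s))"
    using triangle_closes[OF rs] by (simp add: algebra_simps)
  then have "closed_segment (w + graph_vec A r) (w - graph_vec A'' s) \<subseteq> supp L'"
    unfolding mirror_brane_segment[OF T12.mb' p] by (rule range_eqI)
  ultimately show ?thesis by (simp add: triangles_def)
qed

text \<open>The three edges are graph vectors; that they sum to \<open>0\<close> gives the third parameter and the equation
\<open>E r = E' s\<close>.\<close>

lemma triE:
  assumes "(p, q) \<in> tri w"
  obtains r s where "E *v r = E' *v s" "p = w + graph_vec A r" "q = w - graph_vec A'' s"
    "q = p - graph_vec A' (r + s)" "w \<in> base" "p \<in> supp L \<inter> supp L'" "q \<in> supp L' \<inter> supp L''"
proof -
  have s: "closed_segment w p \<subseteq> supp L" "closed_segment p q \<subseteq> supp L'" "closed_segment q w \<subseteq> supp L''"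
    using assms by (auto simp: triangles_def)
  then have m: "w \<in> base" "p \<in> supp L \<inter> supp L'" "q \<in> supp L' \<inter> supp L''" by (auto dest: subsetD[OF _ ends_in_segment(1)] subsetD[OF _ ends_in_segment(2)])
  obtain r where r: "p - w = graph_vec A r" using mirror_brane_segment[OF T12.mb, of w p] s m by auto
  obtain t where t: "q - p = graph_vec A' t" using mirror_brane_segment[OF T12.mb', of p q] s m by auto
  obtain s' where s': "w - q = graph_vec A'' s'" using mirror_brane_segment[OF T23.mb', of q w] s m by auto
  have z: "graph_vec A r + graph_vec A' t + graph_vec A'' s' = 0"
    unfolding r[symmetric] t[symmetric] s'[symmetric] by simp
  have t_eq: "t = - (r + s')"
    using arg_cong[OF z, of fst] by (simp add: eq_neg_iff_add_eq_0 algebra_simps)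
  have "A *v r + A' *v t + A'' *v s' = 0"
    using arg_cong[OF z, of snd] by (simp add: graph_vec_def) (simp add: algebra_simps eq_neg_iff_add_eq_0 neg_eq_iff_add_eq_0)
  then have "E *v r = E' *v s'"
    unfolding t_eq by (simp add: matrix_vector_mult_diff_rdistrib matrix_vector_right_distrib linear_neg[OF matrix_vector_mul_linear] algebra_simps)
  moreover have "p = w + graph_vec A r" "q = w - graph_vec A'' s'" unfolding r[symmetric] s'[symmetric] by simp_all
  moreover have "graph_vec A' (r + s') = - (q - p)" unfolding t t_eq by simp
  then have "q = p - graph_vec A' (r + s')" by (simp del: graph_vec_simps)
  ultimately show ?thesis using m by (rule that)
qed

text \<open>With the notation of \<open>triE\<close> this is \<open>r + s\<close>, which determines the triangle.\<close>

definition offset :: "'n V \<Rightarrow> 'n V \<Rightarrow> real^'n"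
  where "offset p q = fst p - fst q"

text \<open>Twice the area is that of the parallelogram spanned by the graph vectors over \<open>r\<close> and \<open>r + s\<close>, which is
\<open>P r \<bullet> (r + s)\<close>; and \<open>P r = Hi (r + s)\<close>.\<close>

lemma area_torus:
  assumes "(p, q) \<in> tri w"
  shows "torus_form \<tau> (q - p) (w - p) = of_real (B_form \<tau> (p - w) (q - p)) + \<i> * of_real (offset p q \<bullet> Hi (offset p q))"
proof -
  obtain r s where rs: "E *v r = E' *v s" "p = w + graph_vec A r" "q = p - graph_vec A' (r + s)"
    using triE[OF assms] by metis
  have o: "offset p q = r + s" by (simp add: offset_def rs(3))
  have u: "p - w = graph_vec A r" "w - p = - graph_vec A r" "q - p = graph_vec A' (- (r + s))"
    by (simp_all add: rs(2,3))
  have "\<omega>_form \<tau> (q - p) (w - p) = \<omega>_form \<tau> (graph_vec A r) (graph_vec A' (- (r + s)))"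
    unfolding u using \<omega>_form_flip[of \<tau> "graph_vec A' (- (r + s))" "- graph_vec A r"]
    by (simp add: bilinear_lneg[OF bilinear_\<omega>_form])
  also have "\<dots> = (P *v r) \<bullet> (r + s)"
    unfolding \<omega>_form_graph_vec[OF symA] symP by (simp add: inner_diff_right inner_add_right)
  also have "\<dots> = (r + s) \<bullet> Hi (r + s)" unfolding Hi_triangle(1)[OF rs(1)] by (rule inner_commute)
  finally have Im: "\<omega>_form \<tau> (q - p) (w - p) = offset p q \<bullet> Hi (offset p q)" by (simp add: o)
  have "w - p = - (p - w)" by simp
  then have "B_form \<tau> (q - p) (w - p) = B_form \<tau> (p - w) (q - p)"
    using B_form_flip[of \<tau> "q - p" "p - w"] by (metis bilinear_rneg[OF bilinear_B_form] minus_minus)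
  then show ?thesis using Im by (simp add: complex_eq_iff B_form_def \<omega>_form_def)
qed

subsection \<open>Triangles in the doubling torus\<close>

text \<open>The covectors along the outer edges of a lifted triangle are \<open>conormal A \<eta>\<close> and \<open>conormal A'' \<eta>''\<close> up to the
terms from \<open>B\<close>. The restriction of their sum to \<open>L'\<close> has to vanish, that is, \<open>E\<^sup>T \<eta>\<close> and \<open>E'\<^sup>T \<eta>''\<close> are
the same vector \<open>\<zeta>\<close>.\<close>

definition eta :: "real^'n \<Rightarrow> real^'n" where "eta \<zeta> = matrix_inv (transpose E) *v \<zeta>"
definition eta'' :: "real^'n \<Rightarrow> real^'n" where "eta'' \<zeta> = matrix_inv (transpose E') *v \<zeta>"

lemma inv_tE: "invertible (transpose E)" "invertible (transpose E')"
  using T12.transverse T23.transverse by (simp_all add: invertible_det_nz det_transpose)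

lemma eta: "transpose E *v eta \<zeta> = \<zeta>" "transpose E' *v eta'' \<zeta> = \<zeta>"
  and eta_unique: "transpose E *v x = \<zeta> \<Longrightarrow> x = eta \<zeta>" "transpose E' *v x = \<zeta> \<Longrightarrow> x = eta'' \<zeta>"
  using inv_tE by (auto simp: eta_def eta''_def mult_matrix_inv matrix_inv_mult)

text \<open>The dual components of the edges over \<open>L\<close> and \<open>L''\<close>, which project to \<open>u\<close>.\<close>

definition edge_cov :: "real^'n \<Rightarrow> 'n V \<Rightarrow> 'n V" where "edge_cov \<zeta> u = conormal A (eta \<zeta>) - cov_B \<tau> u"
definition edge_cov'' :: "real^'n \<Rightarrow> 'n V \<Rightarrow> 'n V" where "edge_cov'' \<zeta> u = conormal A'' (eta'' \<zeta>) - cov_B \<tau> u"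

text \<open>The parameters \<open>\<zeta>\<close> for which the vertex over \<open>p\<close> lies on the lift of \<open>L'\<close>. By \<open>dual_coset_eq\<close>
they form a coset of the integral vectors.\<close>

definition dual_coset :: "'n V \<Rightarrow> 'n V \<Rightarrow> 'n V \<Rightarrow> (real^'n) set"
  where "dual_coset w x' p = {\<zeta>. (p, x' + edge_cov \<zeta> (p - w)) \<in> supp T12.M'}"

abbreviation "tri2 z \<equiv> triangles T12.M T12.M' T23.M' z"

definition lift_tri :: "'n V \<Rightarrow> 'n V \<Rightarrow> ('n V \<times> 'n V) \<times> (real^'n) \<Rightarrow> ('n V \<times> 'n V) \<times> ('n V \<times> 'n V)"
  where "lift_tri w x' = (\<lambda>((p, q), \<zeta>). ((p, x' + edge_cov \<zeta> (p - w)), (q, x' - edge_cov'' \<zeta> (w - q))))"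

lemma restrict_conormal_E: "restrict_cov A' (conormal A \<eta>) = - (transpose E *v \<eta>)"
  and restrict_conormal_E': "restrict_cov A' (conormal A'' \<eta>) = transpose E' *v \<eta>"
  and restrict_conormal_self: "restrict_cov K (conormal K \<eta>) = 0"
proof -
  have "transpose (A' - A'') = 0 - transpose E'" by (simp add: transpose_def vec_eq_iff)
  then show "restrict_cov A' (conormal A'' \<eta>) = transpose E' *v \<eta>"
    by (simp only: restrict_conormal matrix_vector_mult_diff_rdistrib matrix_vector_mult_0) simp
qed (simp_all add: restrict_conormal transpose_def zero_vec_def[symmetric] matrix_vector_mult_def vec_eq_iff)

lemma edge_cov_sum:
  "x' - edge_cov'' \<zeta> (w - q) - (x' + edge_cov \<zeta> (p - w)) + cov_B \<tau> (q - p) = - conormal A'' (eta'' \<zeta>) - conormal A (eta \<zeta>)"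
  by (simp add: edge_cov_def edge_cov''_def)

lemma lift_tri_mem:
  assumes z: "(w, x') \<in> T13.S" and pq: "(p, q) \<in> tri w" and \<zeta>: "\<zeta> \<in> dual_coset w x' p"
  shows "lift_tri w x' ((p, q), \<zeta>) \<in> tri2 (w, x')"
proof -
  obtain r s where rs: "E *v r = E' *v s" "p = w + graph_vec A r" "q = w - graph_vec A'' s" "q = p - graph_vec A' (r + s)"
    using triE[OF pq] by metis
  have p: "(p, x' + edge_cov \<zeta> (p - w)) \<in> supp T12.M'" using \<zeta> by (simp add: dual_coset_def)
  have "p - w = graph_vec A r" using rs(2) by simp
  moreover have "q - w = graph_vec A'' (- s)" using rs(3) by simp
  moreover have "q - p = graph_vec A' (- (r + s))" using rs(4) by simp
  ultimately have rg: "p - w \<in> range (graph_vec A)" "q - w \<in> range (graph_vec A'')" "q - p \<in> range (graph_vec A')"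
    by (blast intro: range_eqI)+
  have "closed_segment (w, x') (p, x' + edge_cov \<zeta> (p - w)) \<subseteq> supp T12.M"
    using z rg by (subst lift_segment[OF T12.mb]) (simp_all add: edge_cov_def restrict_conormal_self)
  moreover have "closed_segment (w, x') (q, x' - edge_cov'' \<zeta> (w - q)) \<subseteq> supp T23.M'"
    using z rg by (subst lift_segment[OF T23.mb']) (simp_all add: edge_cov''_def restrict_conormal_self)
  moreover have "closed_segment (p, x' + edge_cov \<zeta> (p - w)) (q, x' - edge_cov'' \<zeta> (w - q)) \<subseteq> supp T12.M'"
    unfolding lift_segment[OF T12.mb' p] edge_cov_sum
    using rg by (simp add: restrict_conormal_E restrict_conormal_E' eta)
  ultimately show ?thesis by (simp add: triangles_def lift_tri_def closed_segment_commute)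
qed

text \<open>The first and the last edge have the dual components \<open>edge_cov\<close> and \<open>edge_cov''\<close> by \<open>lift_segment\<close>, for some
\<open>\<eta>\<close> and \<open>\<eta>''\<close>. The same lemma for the middle edge says that both come from one \<open>\<zeta>\<close>.\<close>

lemma lift_tri_bij:
  assumes z: "(w, x') \<in> T13.S"
  shows "bij_betw (lift_tri w x') (Sigma (tri w) (\<lambda>(p, q). dual_coset w x' p)) (tri2 (w, x'))"
proof (rule bij_betwI')
  fix P1 P2 assume "P1 \<in> Sigma (tri w) (\<lambda>(p, q). dual_coset w x' p)" "P2 \<in> Sigma (tri w) (\<lambda>(p, q). dual_coset w x' p)"
  obtain p q \<zeta> where P1: "P1 = ((p, q), \<zeta>)" by (metis prod.exhaust)
  obtain p2 q2 \<zeta>2 where P2: "P2 = ((p2, q2), \<zeta>2)" by (metis prod.exhaust)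
  show "(lift_tri w x' P1 = lift_tri w x' P2) = (P1 = P2)"
  proof
    assume "lift_tri w x' P1 = lift_tri w x' P2"
    then have 1: "p = p2" "q = q2" and "conormal A (eta \<zeta>) = conormal A (eta \<zeta>2)"
      by (auto simp: P1 P2 lift_tri_def edge_cov_def)
    then have "eta \<zeta> = eta \<zeta>2" by (metis snd_conormal)
    then have "\<zeta> = \<zeta>2" using eta(1) by metis
    then show "P1 = P2" using 1 by (simp add: P1 P2)
  qed simp
next
  fix P1 assume "P1 \<in> Sigma (tri w) (\<lambda>(p, q). dual_coset w x' p)"
  then show "lift_tri w x' P1 \<in> tri2 (w, x')" using lift_tri_mem[OF z] by auto
next
  fix Q assume Q: "Q \<in> tri2 (w, x')"
  obtain p p' q q' where Q': "Q = ((p, p'), (q, q'))" by (metis prod.exhaust)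
  have s: "closed_segment (w, x') (p, p') \<subseteq> supp T12.M" "closed_segment (p, p') (q, q') \<subseteq> supp T12.M'"
    "closed_segment (w, x') (q, q') \<subseteq> supp T23.M'"
    using Q unfolding Q' triangles_def by (auto simp: closed_segment_commute)
  have pM: "(p, p') \<in> supp T12.M'" using s(2) by (auto dest: subsetD[OF _ ends_in_segment(1)])
  have w: "(w, x') \<in> supp T12.M" "(w, x') \<in> supp T23.M'" using z by auto
  have 1: "p - w \<in> range (graph_vec A)" "restrict_cov A (p' - x' + cov_B \<tau> (p - w)) = 0"
    using s(1) unfolding lift_segment[OF T12.mb w(1)] by blast+
  have 2: "q - p \<in> range (graph_vec A')" "restrict_cov A' (q' - p' + cov_B \<tau> (q - p)) = 0"
    using s(2) unfolding lift_segment[OF T12.mb' pM] by blast+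
  have 3: "q - w \<in> range (graph_vec A'')" "restrict_cov A'' (q' - x' + cov_B \<tau> (q - w)) = 0"
    using s(3) unfolding lift_segment[OF T23.mb' w(2)] by blast+
  have wb: "w \<in> supp L" "w \<in> supp L''" "p \<in> supp L'" using w pM by (auto simp: supp_lift)
  have pq: "(p, q) \<in> tri w"
    using mirror_brane_segment[OF T12.mb wb(1)] mirror_brane_segment[OF T12.mb' wb(3)]
      mirror_brane_segment[OF T23.mb' wb(2)] 1(1) 2(1) 3(1)
    by (simp add: triangles_def closed_segment_commute[of q w])
  define \<eta> where "\<eta> = snd (p' - x' + cov_B \<tau> (p - w))"
  define \<theta> where "\<theta> = - snd (q' - x' + cov_B \<tau> (q - w))"
  define \<zeta> where "\<zeta> = transpose E *v \<eta>"
  have a: "p' - x' + cov_B \<tau> (p - w) = conormal A \<eta>" unfolding \<eta>_def by (rule restrict_cov_zeroD[OF 1(2)])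
  have b: "q' - x' + cov_B \<tau> (q - w) = - conormal A'' \<theta>"
    unfolding \<theta>_def conormal_simps(4) minus_minus by (rule restrict_cov_zeroD[OF 3(2)])
  have "q' - p' + cov_B \<tau> (q - p) = (q' - x' + cov_B \<tau> (q - w)) - (p' - x' + cov_B \<tau> (p - w))" by simp
  then have "restrict_cov A' (- conormal A'' \<theta> - conormal A \<eta>) = 0" using 2(2) unfolding a b by metis
  then have "transpose E' *v \<theta> = \<zeta>" by (simp add: restrict_conormal_E restrict_conormal_E' \<zeta>_def)
  then have \<theta>: "\<theta> = eta'' \<zeta>" by (rule eta_unique)
  have \<eta>: "\<eta> = eta \<zeta>" by (rule eta_unique) (simp add: \<zeta>_def)
  have p': "p' = x' + edge_cov \<zeta> (p - w)" using a \<eta> by (simp add: edge_cov_def algebra_simps)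
  have q': "q' = x' - edge_cov'' \<zeta> (w - q)" using b \<theta> by (simp add: edge_cov''_def algebra_simps)
  have "\<zeta> \<in> dual_coset w x' p" using pM by (simp add: dual_coset_def p')
  then show "\<exists>P1\<in>Sigma (tri w) (\<lambda>(p, q). dual_coset w x' p). Q = lift_tri w x' P1"
    using pq by (intro bexI[of _ "((p, q), \<zeta>)"]) (auto simp: Q' lift_tri_def p' q')
qed

end

section \<open>The product on the u-part\<close>

lemma quadratic_coset_sum:
  fixes K :: "'w::euclidean_space \<Rightarrow> 'w"
  assumes K: "linear K" "\<And>x. x \<noteq> 0 \<Longrightarrow> 0 < x \<bullet> K x" and c: "0 < (c::real)"
  obtains C where "\<And>x. (\<lambda>z. exp (- c * ((x + z) \<bullet> K (x + z)))) summable_on int_lattice"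
    "\<And>x. (\<Sum>\<^sub>\<infinity>z\<in>int_lattice. exp (- c * ((x + z) \<bullet> K (x + z)))) \<le> C"
proof -
  obtain \<delta> where \<delta>: "0 < \<delta>" "\<And>x. \<delta> * (norm x)\<^sup>2 \<le> x \<bullet> K x" using positive_definite_bound[OF K] by blast
  have cd: "0 < c * \<delta>" using c \<delta> by simp
  obtain C where C: "\<And>x::'w. (\<Sum>\<^sub>\<infinity>g\<in>int_lattice. exp (- (c * \<delta>) * (norm (x + g))\<^sup>2)) \<le> C"
    using gaussian_coset_sum_bounded[OF cd] by blast
  have le: "exp (- c * (y \<bullet> K y)) \<le> exp (- (c * \<delta>) * (norm y)\<^sup>2)" for y
    using mult_left_mono[OF \<delta>(2)[of y], of c] c by (simp add: mult.assoc)
  have s: "(\<lambda>z. exp (- (c * \<delta>) * (norm (x + z))\<^sup>2)) summable_on int_lattice" for x :: 'w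
    using gaussian_summable_on_coset[OF cd, of "\<lambda>z. x + z" int_lattice "\<lambda>z. exp (- (c * \<delta>) * (norm (x + z))\<^sup>2)" 1]
    by (auto simp: inj_on_def)
  have s2: "(\<lambda>z. exp (- c * ((x + z) \<bullet> K (x + z)))) summable_on int_lattice" for x
    by (rule abs_summable_summable, rule Infinite_Sum.abs_summable_on_comparison_test'[OF s]) (use le in auto)
  show ?thesis
  proof (rule that[OF s2])
    show "(\<Sum>\<^sub>\<infinity>z\<in>int_lattice. exp (- c * ((x + z) \<bullet> K (x + z)))) \<le> C" for x
      using infsum_mono[OF s2[of x] s[of x] le] C[of x] by linarith
  qed
qed

context brane_calculus
begin

text \<open>The next three lemmas translate endpoints of an edge by lattice vectors. Transport changes by the
identification of the fibres, by a holonomy, and by the curvature of the triangle spanned by the edge and the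
lattice vector.\<close>

lemma transport_to_translate:
  assumes w: "w \<in> supp L" and u: "u \<in> tangent (supp L)" and g: "\<gamma> \<in> H1 L"
  shows "transport L w (w + u + \<gamma>) =
    transport L w (w + u) * hol L w \<gamma> * mult L \<gamma> (w + u) * exp (of_real pi * \<i> * of_real (F u \<gamma>))"
proof -
  let ?e = "exp (of_real pi * \<i> * of_real (F u \<gamma>))"
  have wu: "w + u \<in> supp L" by (rule supp_add[OF w u])
  have "transport L w (w + u + \<gamma>) = transport L w (w + u) * (hol L (w + u) \<gamma> * mult L \<gamma> (w + u)) * inverse ?e"
    using transport_triangle[OF w u H1_D(2)[OF g]] transport_loop[OF wu g] by (simp add: exp_minus)
  also have "hol L (w + u) \<gamma> = hol L w \<gamma> * (?e * ?e)"
    unfolding hol_move[OF w u g] by (simp add: exp_add[symmetric] mult_ac)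
  finally show ?thesis by (simp add: field_simps)
qed

lemma transport_from_translate:
  assumes w: "w \<in> supp L" and u: "u \<in> tangent (supp L)" and g: "\<gamma> \<in> H1 L"
  shows "transport L (w + u + \<gamma>) w * mult L \<gamma> (w + u) =
    transport L (w + u) w * inverse (hol L w \<gamma>) * exp (- of_real pi * \<i> * of_real (F u \<gamma>))"
proof -
  let ?e = "exp (of_real pi * \<i> * of_real (F u \<gamma>))"
  have ug: "u + \<gamma> \<in> tangent (supp L)" by (intro tangent_add u H1_D g)
  have 1: "transport L w (w + u + \<gamma>) * transport L (w + u + \<gamma>) w = 1"
    using transport_back[OF w ug] by (simp add: add.assoc)
  have 2: "transport L w (w + u) * transport L (w + u) w = 1" by (rule transport_back[OF w u])
  have gen: "x * m = y * inverse h * inverse e" if "t * h * m * e * x = 1" "t * y = 1" "h \<noteq> 0" "e \<noteq> 0" for t h m e x y :: complex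
  proof -
    have "y = h * m * e * x" using that(1,2) by algebra
    then show ?thesis using that(3,4) by (simp add: field_simps)
  qed
  have "exp (- of_real pi * \<i> * of_real (F u \<gamma>)) = inverse ?e" by (simp add: exp_minus)
  then show ?thesis
    using gen[OF 1[unfolded transport_to_translate[OF w u g]] 2 hol_nonzero[OF w g]] by simp
qed

lemma transport_translate_both:
  assumes p: "p \<in> supp L" and u: "u \<in> tangent (supp L)" and d: "\<delta> \<in> int_lattice" and g: "\<gamma> \<in> H1 L"
  shows "transport L (p + \<delta>) (p + u + \<delta> + \<gamma>) * mult L \<delta> p =
    transport L p (p + u) * mult L (\<delta> + \<gamma>) (p + u) * hol L p \<gamma> * exp (of_real pi * \<i> * of_real (F u \<gamma>))"
proof -
  have pd: "p + \<delta> \<in> supp L" by (rule supp_lattice[OF p d])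
  have e: "p + u + \<delta> + \<gamma> = p + \<delta> + u + \<gamma>" "p + \<delta> + u = p + u + \<delta>" by simp_all
  have 1: "transport L (p + \<delta>) (p + \<delta> + u + \<gamma>) =
    transport L (p + \<delta>) (p + \<delta> + u) * hol L p \<gamma> * mult L \<gamma> (p + u + \<delta>) * exp (of_real pi * \<i> * of_real (F u \<gamma>))"
    using transport_to_translate[OF pd u g] hol_lattice[OF p d g] by (simp only: e(2))
  have 2: "transport L (p + \<delta>) (p + \<delta> + u) * mult L \<delta> p = mult L \<delta> (p + u) * transport L p (p + u)"
    by (rule transport_parallel[OF p u d])
  have 3: "mult L (\<delta> + \<gamma>) (p + u) = mult L \<gamma> (p + u + \<delta>) * mult L \<delta> (p + u)"
    using mult_cocycle[OF H1_D(1)[OF g] d supp_add[OF p u]] by (simp add: add.commute)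
  have gen: "t * h * m * e * k = t2 * (m * k2) * h * e" if "t * k = k2 * t2" for t h m e k t2 k2 :: complex
    using that by (simp add: mult_ac)
  show ?thesis unfolding e(1) 1 3 by (rule gen[OF 2])
qed

end

lemma minus_one_pow_square: "minus_one_pow k * minus_one_pow k = 1"
  using minus_one_pow_double[of k] by (simp only: mult_2 minus_one_pow_add)

lemma minus_one_pow_inverse: "inverse (minus_one_pow k) = minus_one_pow k"
  using minus_one_pow_square[of k] by (metis inverse_unique)

lemma HF_equivariant:
  assumes "a \<in> HF L L'" "p \<in> supp L \<inter> supp L'" "\<gamma> \<in> int_lattice"
  shows "a (p + \<gamma>) * mult L \<gamma> p = mult L' \<gamma> p * a p"
  using assms unfolding HF_def by blast

text \<open>The absolute value is a function on the finite set of intersection points, as the bundles are unitary.\<close>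

lemma (in lifted_pair) HF_bounded:
  assumes a: "a \<in> HF L L'"
  obtains K where "0 \<le> K" "\<And>p. norm (a p) \<le> K"
proof -
  have inv: "norm (a q) = norm (a p)" if p: "p \<in> supp L \<inter> supp L'" and q: "tpoint q = tpoint p" for p q
  proof -
    have g: "q - p \<in> int_lattice" using q by (simp add: tpoint_eq_iff)
    have "norm (a (p + (q - p))) * norm (mult L (q - p) p) = norm (mult L' (q - p) p) * norm (a p)"
      using HF_equivariant[OF a p g] by (metis norm_mult)
    then show ?thesis using B.norm_mult_eq_1[OF g] B'.norm_mult_eq_1[OF g] p by simp
  qed
  define r where "r X = norm (a (SOME p. p \<in> X))" for X
  have r: "norm (a p) = r (tpoint p)" if p: "p \<in> supp L \<inter> supp L'" for p
  proof -
    have "(SOME q. q \<in> tpoint p) \<in> tpoint p" by (rule someI[of _ p]) simp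
    then have "tpoint (SOME q. q \<in> tpoint p) = tpoint p" by (simp add: tpoint_eq_iff mem_tpoint_iff)
    from inv[OF p this] show ?thesis by (simp add: r_def)
  qed
  define K where "K = Max (insert 0 (r ` int_points L L'))"
  have fin: "finite (insert 0 (r ` int_points L L'))" using finite_base by simp
  show ?thesis
  proof (rule that)
    show K0: "0 \<le> K" unfolding K_def using fin by (intro Max_ge) auto
    show "norm (a p) \<le> K" for p
    proof (cases "p \<in> supp L \<inter> supp L'")
      case True
      then have "r (tpoint p) \<in> insert 0 (r ` int_points L L')" using tpoint_base[of p] by blast
      then show ?thesis unfolding r[OF True] K_def using fin by (intro Max_ge)
    next
      case False
      then have "a p = 0" using a unfolding HF_def by blast
      then show ?thesis using K0 by simp
    qed
  qed
qed

text \<open>The next three lemmas express that the fibres are torsors under one group, the covectors whose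
restrictions to both branes are integral.\<close>

lemma (in lifted_pair) fibre_translate:
  assumes 1: "(w, x) \<in> S" and 2: "(v, z) \<in> S" and 3: "(w, y) \<in> S"
  shows "(v, z + (y - x)) \<in> S"
proof -
  obtain x0 where x0: "\<And>x'. (w, x') \<in> S \<longleftrightarrow>
    restrict_cov (real_mat D) (x' - x0) \<in> int_lattice \<and> restrict_cov (real_mat D') (x' - x0) \<in> int_lattice"
    by (rule fibre[of w]) (use fst_S[OF 1] in auto)
  obtain z0 where z0: "\<And>x'. (v, x') \<in> S \<longleftrightarrow>
    restrict_cov (real_mat D) (x' - z0) \<in> int_lattice \<and> restrict_cov (real_mat D') (x' - z0) \<in> int_lattice"
    by (rule fibre[of v]) (use fst_S[OF 2] in auto)
  have e: "restrict_cov K (z + (y - x) - z0) = restrict_cov K (z - z0) + (restrict_cov K (y - x0) - restrict_cov K (x - x0))" for K by simp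
  show ?thesis unfolding z0 e
    using 1[unfolded x0] 2[unfolded z0] 3[unfolded x0] by (intro conjI int_lattice_add int_lattice_diff) blast+
qed

lemma (in lifted_pair) fibre_shift:
  assumes 1: "(w, x) \<in> S" and k: "restrict_cov (real_mat D) k \<in> int_lattice" "restrict_cov (real_mat D') k \<in> int_lattice"
  shows "(w, x + k) \<in> S"
proof -
  obtain x0 where x0: "\<And>x'. (w, x') \<in> S \<longleftrightarrow>
    restrict_cov (real_mat D) (x' - x0) \<in> int_lattice \<and> restrict_cov (real_mat D') (x' - x0) \<in> int_lattice"
    by (rule fibre[of w]) (use fst_S[OF 1] in auto)
  have e: "restrict_cov K (x + k - x0) = restrict_cov K (x - x0) + restrict_cov K k" for K by simp
  show ?thesis unfolding x0 e using 1[unfolded x0] k by (intro conjI int_lattice_add) blast+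
qed

lemma (in lifted_pair) fibre_difference:
  assumes 1: "(w, x) \<in> S" and 2: "(w, y) \<in> S"
  shows "restrict_cov (real_mat D) (y - x) \<in> int_lattice" "restrict_cov (real_mat D') (y - x) \<in> int_lattice"
proof -
  obtain x0 where x0: "\<And>x'. (w, x') \<in> S \<longleftrightarrow>
    restrict_cov (real_mat D) (x' - x0) \<in> int_lattice \<and> restrict_cov (real_mat D') (x' - x0) \<in> int_lattice"
    by (rule fibre[of w]) (use fst_S[OF 1] in auto)
  have e: "restrict_cov K (y - x) = restrict_cov K (y - x0) - restrict_cov K (x - x0)" for K by simp
  show "restrict_cov (real_mat D) (y - x) \<in> int_lattice" "restrict_cov (real_mat D') (y - x) \<in> int_lattice"
    unfolding e using 1[unfolded x0] 2[unfolded x0] by (blast intro: int_lattice_diff)+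
qed

lemma (in lifted_pair) point_over_mem:
  "(w, x) \<in> S \<Longrightarrow> tpoint (w, x) \<in> points_over M M' (tpoint w)"
  unfolding tpoint_over by simp

lemma (in lifted_pair) rep_tpoint:
  assumes "(w, x) \<in> S"
  shows "rep w (tpoint (w, x)) - x \<in> int_lattice"
proof -
  have "(w, rep w (tpoint (w, x))) \<in> tpoint (w, x)" by (rule rep_mem(1)[OF point_over_mem[OF assms]])
  then show ?thesis by (simp add: mem_tpoint_iff int_lattice_prod_iff)
qed

lemma (in lifted_pair) card_points_over:
  assumes "v \<in> supp L \<inter> supp L'" "w \<in> supp L \<inter> supp L'"
  shows "card (points_over M M' (tpoint v)) = card (points_over M M' (tpoint w))"
    and "0 < card (points_over M M' (tpoint v))"
proof -
  have le: "card (points_over M M' (tpoint v)) \<le> card (points_over M M' (tpoint w))"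
    if v: "v \<in> supp L \<inter> supp L'" and w: "w \<in> supp L \<inter> supp L'" for v w
  proof -
    obtain x where x: "(v, x) \<in> S" using fibre_nonempty[OF v] by blast
    obtain z where z: "(w, z) \<in> S" using fibre_nonempty[OF w] by blast
    let ?f = "\<lambda>Y. tpoint (w, z + (rep v Y - x))"
    show ?thesis
    proof (rule card_inj_on_le[of ?f, OF _ _ finite_over])
      show "inj_on ?f (points_over M M' (tpoint v))"
      proof (rule inj_onI)
        fix Y1 Y2 assume Y: "Y1 \<in> points_over M M' (tpoint v)" "Y2 \<in> points_over M M' (tpoint v)" and "?f Y1 = ?f Y2"
        then have "rep v Y1 - rep v Y2 \<in> int_lattice" by (simp add: tpoint_eq_iff int_lattice_prod_iff)
        then have "tpoint (v, rep v Y1) = tpoint (v, rep v Y2)" by (simp add: tpoint_eq_iff int_lattice_prod_iff)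
        then show "Y1 = Y2" using rep_mem(3) Y by metis
      qed
      show "?f ` points_over M M' (tpoint v) \<subseteq> points_over M M' (tpoint w)"
        using point_over_mem[OF fibre_translate[OF x z rep_mem(2)]] by blast
    qed
  qed
  show "card (points_over M M' (tpoint v)) = card (points_over M M' (tpoint w))"
    using le assms by (meson le_antisym)
  obtain x where "(v, x) \<in> S" using fibre_nonempty[OF assms(1)] by blast
  then show "0 < card (points_over M M' (tpoint v))"
    using point_over_mem finite_over by (metis card_gt_0_iff empty_iff)
qed

context mirror_triple
begin

text \<open>On a Lagrangian, \<open>\<omega>\<close> maps tangent vectors to covectors that vanish on it.\<close>

lemma inv_contract_\<omega>:
  "inv (contract (\<omega>_form \<tau>)) (conormal A (transpose Y *v s)) = graph_vec A s"
proof (rule inv_f_eq)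
  have inj: "transpose Y *v x = 0 \<Longrightarrow> x = 0" "Y *v x = 0 \<Longrightarrow> x = 0" for x
    using invertible_mult_inj[OF inv_Y, of x 0] invertible_mult_inj[of "transpose Y" x 0] inv_Y
    by (simp_all add: invertible_det_nz det_transpose)
  show "inj (contract (\<omega>_form \<tau>))"
  proof (subst linear_injective_0[OF linear_contract[OF bilinear_\<omega>_form]], intro allI impI)
    fix u assume "contract (\<omega>_form \<tau>) u = 0"
    then have "fst u = 0" "snd u = 0"
      unfolding contract_\<omega>_form by (auto simp: zero_prod_def intro: inj)
    then show "u = 0" by (simp add: prod_eq_iff)
  qed
  have "transpose A *v (transpose Y *v s) = Y *v (A *v s)"
    using symA by (simp add: matrix_vector_mul_assoc matrix_transpose_mul)
  then show "contract (\<omega>_form \<tau>) (graph_vec A s) = conormal A (transpose Y *v s)"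
    by (simp add: contract_\<omega>_form graph_vec_def conormal_def linear_neg[OF matrix_vector_mul_linear])
qed

text \<open>The dual part of the area is the analogue of \<open>area_torus\<close> for covectors: \<open>\<omega>\<^sup>-\<^sup>1\<close> turns \<open>\<eta>\<close> and \<open>\<eta>''\<close> into \<open>r\<close> and
\<open>s\<close> with \<open>P r = \<zeta> = P' s\<close>, and pairs \<open>\<zeta>\<close> with \<open>r + s = H \<zeta>\<close>.\<close>

lemma dual_area:
  "(- conormal A'' (eta'' \<zeta>) - conormal A (eta \<zeta>)) \<bullet> inv (contract (\<omega>_form \<tau>)) (- conormal A (eta \<zeta>)) = \<zeta> \<bullet> H \<zeta>"
proof -
  define s where "s = matrix_inv P *v \<zeta>"
  define t where "t = matrix_inv P' *v \<zeta>"
  have s: "P *v s = \<zeta>" and t: "P' *v t = \<zeta>" by (simp_all add: s_def t_def mult_matrix_inv inv_P inv_P')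
  have "transpose E *v (transpose Y *v s) = \<zeta>"
  proof (rule inner_lattice_ext)
    fix k show "(transpose E *v (transpose Y *v s)) \<bullet> k = \<zeta> \<bullet> k"
      using symP[of s k] by (simp add: transpose_inner P_E[symmetric] s)
  qed
  then have es: "eta \<zeta> = transpose Y *v s" by (rule eta_unique(1)[symmetric])
  have "transpose E' *v (transpose Y *v t) = \<zeta>"
  proof (rule inner_lattice_ext)
    fix k show "(transpose E' *v (transpose Y *v t)) \<bullet> k = \<zeta> \<bullet> k"
      using symP'[of t k] by (simp add: transpose_inner P'_E'[symmetric] t)
  qed
  then have et: "eta'' \<zeta> = transpose Y *v t" by (rule eta_unique(2)[symmetric])
  have i: "inv (contract (\<omega>_form \<tau>)) (- conormal A (eta \<zeta>)) = graph_vec A (- s)"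
    using inv_contract_\<omega>[of "- s"] by (simp add: es linear_neg[OF matrix_vector_mul_linear])
  have 1: "conormal A (eta \<zeta>) \<bullet> graph_vec A (- s) = 0" by (simp add: conormal_graph_vec del: graph_vec_simps)
  have "conormal A'' (eta'' \<zeta>) \<bullet> graph_vec A (- s) = - (eta'' \<zeta> \<bullet> ((A'' - A) *v s))"
    by (simp add: conormal_graph_vec matrix_vector_mult_diff_rdistrib linear_neg[OF matrix_vector_mul_linear]
        inner_diff_right inner_add_right del: graph_vec_simps)
  also have "(A'' - A) *v s = E *v s + E' *v s" by (rule E_sum)
  also have "eta'' \<zeta> \<bullet> (E *v s + E' *v s) = t \<bullet> (P *v s) + (transpose E' *v eta'' \<zeta>) \<bullet> s"
    by (simp add: inner_add_right et transpose_inner P_E)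
  finally have 2: "conormal A'' (eta'' \<zeta>) \<bullet> graph_vec A (- s) = - (t \<bullet> \<zeta> + \<zeta> \<bullet> s)" by (simp only: s eta(2))
  show ?thesis
    unfolding i inner_diff_left inner_minus_left 1 2
    by (simp add: H_def s_def[symmetric] t_def[symmetric] inner_add_right inner_commute)
qed

text \<open>By \<open>edge_cov_sum\<close>, the terms from \<open>B\<close> in the edges are those that \<open>\<Omega>\<close> compensates, so that its value is
the mean of \<open>area_torus\<close> and \<open>dual_area\<close>. The term \<open>\<zeta> \<bullet> \<rho>\<close> comes from pairing edges with dual edges in
\<open>\<sigma>\<^sub>0\<close>.\<close>

lemma area_doubled:
  assumes pq: "(p, q) \<in> tri w"
  shows "doubled_form \<tau> ((q, x' - edge_cov'' \<zeta> (w - q)) - (p, x' + edge_cov \<zeta> (p - w))) ((w, x') - (p, x' + edge_cov \<zeta> (p - w))) =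
    of_real (B_form \<tau> (p - w) (q - p) - \<zeta> \<bullet> offset p q) +
    \<i> * of_real ((offset p q \<bullet> Hi (offset p q) + \<zeta> \<bullet> H \<zeta>) / 2)"
proof -
  obtain r s where rs: "E *v r = E' *v s" "p = w + graph_vec A r" "q = p - graph_vec A' (r + s)"
    using triE[OF pq] by metis
  have o: "offset p q = r + s" by (simp add: offset_def rs(3))
  define u where "u = p - w"
  define u' where "u' = q - p"
  define f where "f = edge_cov \<zeta> u"
  define f' where "f' = x' - edge_cov'' \<zeta> (w - q) - (x' + edge_cov \<zeta> (p - w))"
  have u: "u = graph_vec A r" "u' = - graph_vec A' (r + s)" unfolding u_def u'_def by (simp_all add: rs(2,3) del: graph_vec_simps)
  have d: "(q, x' - edge_cov'' \<zeta> (w - q)) - (p, x' + edge_cov \<zeta> (p - w)) = (u', f')" "(w, x') - (p, x' + edge_cov \<zeta> (p - w)) = (- u, - f)"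
    by (simp_all add: u_def u'_def f'_def f_def)
  have f'B: "f' + cov_B \<tau> u' = - conormal A'' (eta'' \<zeta>) - conormal A (eta \<zeta>)"
    unfolding f'_def u'_def by (rule edge_cov_sum)
  have fB: "- f + cov_B \<tau> (- u) = - conormal A (eta \<zeta>)" by (simp add: f_def edge_cov_def)
  have area: "\<omega>_form \<tau> u' (- u) = offset p q \<bullet> Hi (offset p q)"
    using arg_cong[OF area_torus[OF pq], of Im] by (simp add: \<omega>_form_def u_def u'_def)
  have O: "doubled_Omega \<tau> (u', f') (- u, - f) = (offset p q \<bullet> Hi (offset p q) + \<zeta> \<bullet> H \<zeta>) / 2"
    unfolding doubled_Omega_def Let_def B_form_def[symmetric, abs_def] \<omega>_form_def[symmetric, abs_def] fst_conv snd_conv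
      f'B fB area dual_area ..
  have 1: "u \<bullet> f' = B_form \<tau> u u' - \<zeta> \<bullet> (r + s)"
  proof -
    have f': "f' = - conormal A'' (eta'' \<zeta>) - conormal A (eta \<zeta>) - cov_B \<tau> u'" using f'B by (simp add: algebra_simps)
    have "conormal A'' (eta'' \<zeta>) \<bullet> u = eta'' \<zeta> \<bullet> ((A'' - A) *v r)"
      unfolding u conormal_graph_vec by (simp add: matrix_vector_mult_diff_rdistrib inner_diff_right)
    also have "\<dots> = eta'' \<zeta> \<bullet> (E' *v (s + r))" unfolding E_sum rs(1) by (simp add: matrix_vector_right_distrib)
    also have "\<dots> = \<zeta> \<bullet> (s + r)" by (simp only: transpose_inner[symmetric] eta)
    finally have a: "conormal A'' (eta'' \<zeta>) \<bullet> u = \<zeta> \<bullet> (r + s)" by (simp add: add.commute)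
    have b: "conormal A (eta \<zeta>) \<bullet> u = 0" unfolding u by (simp add: conormal_graph_vec)
    show ?thesis unfolding inner_commute[of u] f' inner_diff_left inner_minus_left a b contract_inner[OF bilinear_B_form]
      using B_form_flip[of \<tau> u' u] by simp
  qed
  have 2: "u' \<bullet> f = \<zeta> \<bullet> (r + s) - B_form \<tau> u u'"
  proof -
    have "conormal A (eta \<zeta>) \<bullet> u' = eta \<zeta> \<bullet> (E *v (r + s))"
      unfolding u inner_minus_right conormal_graph_vec by simp
    also have "\<dots> = \<zeta> \<bullet> (r + s)" by (simp only: transpose_inner[symmetric] eta)
    finally show ?thesis
      unfolding inner_commute[of u'] f_def edge_cov_def inner_diff_left contract_inner[OF bilinear_B_form] by simp
  qed
  have s0: "sigma0 (u', f') (- u, - f) = B_form \<tau> u u' - \<zeta> \<bullet> offset p q"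
    unfolding sigma0_def fst_conv snd_conv inner_minus_right inner_minus_left 1 2 o by simp
  show ?thesis unfolding doubled_form_def d O s0 by (simp add: u_def u'_def)
qed

abbreviation "torus_product b a \<equiv> mu2 (torus_form \<tau>) L L' L'' b a"
abbreviation "doubled_product b a \<equiv>
  mu2 (doubled_form \<tau>) T12.M T12.M' T23.M' (pullback T23.M T23.M' b) (pullback T12.M T12.M' a)"
abbreviation "u_product b a \<equiv>
  mu2_u \<tau> D D'' T12.M T12.M' T23.M' (pullback T23.M T23.M' b) (pullback T12.M T12.M' a)"

definition holonomies :: "('n V \<Rightarrow> complex) \<Rightarrow> ('n V \<Rightarrow> complex) \<Rightarrow> 'n V \<Rightarrow> 'n V \<times> 'n V \<Rightarrow> complex"
  where "holonomies b a w = (\<lambda>(p, q). transport L'' q w * b q * transport L' p q * a p * transport L w p)"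

definition rho :: "'n V \<times> 'n V \<Rightarrow> real^'n" where "rho = (\<lambda>(p, q). offset p q)"

definition phase :: "'n V \<Rightarrow> 'n V \<times> 'n V \<Rightarrow> complex"
  where "phase w = (\<lambda>(p, q). exp (of_real pi * \<i> * of_real (B_form \<tau> (p - w) (q - p))))"

text \<open>The contribution of a triangle to the product in \<open>T\<close>.\<close>

definition torus_term :: "('n V \<Rightarrow> complex) \<Rightarrow> ('n V \<Rightarrow> complex) \<Rightarrow> 'n V \<Rightarrow> 'n V \<times> 'n V \<Rightarrow> complex"
  where "torus_term b a w t = phase w t * exp (- of_real (pi * (rho t \<bullet> Hi (rho t)))) * holonomies b a w t"

text \<open>The contribution of the lift of a triangle with parameter \<open>\<zeta>\<close> to the product of two pullbacks.\<close>

definition doubled_term :: "('n V \<Rightarrow> complex) \<Rightarrow> ('n V \<Rightarrow> complex) \<Rightarrow> 'n V \<Rightarrow> ('n V \<times> 'n V) \<Rightarrow> real^'n \<Rightarrow> complex"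
  where "doubled_term b a w t \<zeta> = phase w t * exp (- of_real (pi / 2 * (rho t \<bullet> Hi (rho t)))) * holonomies b a w t *
    exp (- of_real (pi / 2 * (\<zeta> \<bullet> H \<zeta>)) - \<i> * of_real (pi * (\<zeta> \<bullet> rho t)))"

text \<open>The summand of \<open>m\<close> after Poisson summation over \<open>\<zeta>\<close>, without the character, in a form which exhibits the
weight of a triangle with parameter \<open>\<rho> + m\<close>; see \<open>dual_term_eq\<close>.\<close>

definition dual_term :: "('n V \<Rightarrow> complex) \<Rightarrow> ('n V \<Rightarrow> complex) \<Rightarrow> 'n V \<Rightarrow> ('n V \<times> 'n V) \<Rightarrow> real^'n \<Rightarrow> complex"
  where "dual_term b a w t m = phase w t * exp (- of_real (pi * ((rho t + m) \<bullet> Hi (rho t + m)) + pi * (m \<bullet> Hi m))) * holonomies b a w t"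

lemma norm_phase [simp]: "norm (phase w t) = 1"
  by (cases t) (simp add: phase_def norm_exp_eq_Re)

lemma mu2_torus: "torus_product b a w = (\<Sum>\<^sub>\<infinity>t\<in>tri w. torus_term b a w t)"
  unfolding mu2_def
proof (rule infsum_cong)
  fix t assume t: "t \<in> tri w"
  obtain p q where pq: "t = (p, q)" by (metis prod.exhaust)
  have "exp (2 * of_real pi * \<i> * (torus_form \<tau> (q - p) (w - p) / 2)) =
      phase w t * exp (- of_real (pi * (rho t \<bullet> Hi (rho t))))"
    using area_torus[of p q w] t unfolding pq phase_def rho_def prod.case exp_add[symmetric]
    by (intro arg_cong[of _ _ exp]) (simp add: field_simps)
  then show "(case t of (p, q) \<Rightarrow> exp (2 * of_real pi * \<i> * (torus_form \<tau> (q - p) (w - p) / 2)) *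
      transport L'' q w * b q * transport L' p q * a p * transport L w p) = torus_term b a w t"
    unfolding pq by (simp add: torus_term_def holonomies_def mult.assoc)
qed

text \<open>The sum over lifted triangles is reindexed by \<open>lift_tri_bij\<close>. As the bundles are pulled back from \<open>T\<close>, a
lifted triangle has the holonomies of its projection.\<close>

lemma mu2_doubled:
  assumes z: "(w, x') \<in> T13.S"
  shows "doubled_product b a (w, x') =
    (\<Sum>\<^sub>\<infinity>(t, \<zeta>)\<in>Sigma (tri w) (\<lambda>t. dual_coset w x' (fst t)). doubled_term b a w t \<zeta>)"
proof -
  let ?Z = "Sigma (tri w) (\<lambda>t. dual_coset w x' (fst t))"
  have bij: "bij_betw (lift_tri w x') ?Z (tri2 (w, x'))"
    using lift_tri_bij[OF z] by (simp add: case_prod_unfold)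
  show ?thesis
    unfolding mu2_def infsum_reindex_bij_betw[OF bij, symmetric]
  proof (rule infsum_cong)
    fix x assume x: "x \<in> ?Z"
    obtain p q \<zeta> where pq: "x = ((p, q), \<zeta>)" by (metis prod.exhaust)
    have t: "(p, q) \<in> tri w" and \<zeta>: "\<zeta> \<in> dual_coset w x' p" using x by (auto simp: pq)
    let ?P = "(p, x' + edge_cov \<zeta> (p - w))" and ?Q = "(q, x' - edge_cov'' \<zeta> (w - q))"
    have "(?P, ?Q) \<in> tri2 (w, x')" using lift_tri_mem[OF z t \<zeta>] by (simp add: lift_tri_def)
    then have mem: "?P \<in> T12.S" "?Q \<in> T23.S"
      by (auto simp: triangles_def dest: subsetD[OF _ ends_in_segment(1)] subsetD[OF _ ends_in_segment(2)])
    have "exp (2 * of_real pi * \<i> * (doubled_form \<tau> (?Q - ?P) ((w, x') - ?P) / 2)) =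
      phase w (p, q) * exp (- of_real (pi / 2 * (rho (p, q) \<bullet> Hi (rho (p, q))))) *
      exp (- of_real (pi / 2 * (\<zeta> \<bullet> H \<zeta>)) - \<i> * of_real (pi * (\<zeta> \<bullet> rho (p, q))))"
      unfolding area_doubled[OF t] phase_def rho_def prod.case exp_add[symmetric]
      by (intro arg_cong[of _ _ exp]) (simp add: field_simps)
    then show "(case lift_tri w x' x of (p, q) \<Rightarrow> exp (2 * of_real pi * \<i> * (doubled_form \<tau> (q - p) ((w, x') - p) / 2)) *
        transport T23.M' q (w, x') * pullback T23.M T23.M' b q * transport T12.M' p q * pullback T12.M T12.M' a p * transport T12.M (w, x') p)
        = (case x of (t, \<zeta>) \<Rightarrow> doubled_term b a w t \<zeta>)"
      using mem unfolding pq lift_tri_def prod.case transport_lift fst_conv pullback_def if_True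
      by (simp add: doubled_term_def holonomies_def)
  qed
qed

lemma holonomies_bounded:
  assumes a: "a \<in> HF L L'" and b: "b \<in> HF L' L''"
  obtains K where "0 \<le> K" "\<And>w t. t \<in> tri w \<Longrightarrow> norm (holonomies b a w t) \<le> K"
proof -
  obtain Ka where Ka: "0 \<le> Ka" "\<And>p. norm (a p) \<le> Ka" using T12.HF_bounded[OF a] by blast
  obtain Kb where Kb: "0 \<le> Kb" "\<And>p. norm (b p) \<le> Kb" using T23.HF_bounded[OF b] by blast
  show ?thesis
  proof (rule that)
    show "0 \<le> Kb * Ka" using Ka Kb by simp
    fix w t assume t: "t \<in> tri w"
    obtain p q where pq: "t = (p, q)" by (metis prod.exhaust)
    obtain r s where rs: "p = w + graph_vec A r" "q = w - graph_vec A'' s" "q = p - graph_vec A' (r + s)"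
      "w \<in> base" "p \<in> supp L \<inter> supp L'" "q \<in> supp L' \<inter> supp L''"
      using triE t pq by metis
    have 1: "norm (transport L w p) = 1"
      using T12.B.norm_transport[of w "graph_vec A r"] rs(4) mirror_brane_tangent[OF T12.mb] by (simp add: rs(1))
    have "p + graph_vec A' (- (r + s)) = q" unfolding rs(3) by simp
    then have 2: "norm (transport L' p q) = 1"
      using T12.B'.norm_transport[of p "graph_vec A' (- (r + s))"] rs(5) mirror_brane_tangent[OF T12.mb']
      by (metis Int_iff rangeI)
    have "q + graph_vec A'' s = w" unfolding rs(2) by simp
    then have 3: "norm (transport L'' q w) = 1"
      using T23.B'.norm_transport[of q "graph_vec A'' s"] rs(6) mirror_brane_tangent[OF T23.mb']
      by (metis Int_iff rangeI)
    show "norm (holonomies b a w t) \<le> Kb * Ka"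
      unfolding pq holonomies_def by (simp add: norm_mult 1 2 3 mult_mono Ka Kb)
  qed
qed

subsection \<open>Convergence\<close>

lemma rho_determines_triangle:
  assumes "(p, q) \<in> tri w" "(p2, q2) \<in> tri w" "rho (p, q) = rho (p2, q2)"
  shows "p = p2 \<and> q = q2"
proof -
  obtain r s where rs: "E *v r = E' *v s" "p = w + graph_vec A r" "q = w - graph_vec A'' s" "q = p - graph_vec A' (r + s)"
    using triE[OF assms(1)] by metis
  obtain r2 s2 where rs2: "E *v r2 = E' *v s2" "p2 = w + graph_vec A r2" "q2 = w - graph_vec A'' s2" "q2 = p2 - graph_vec A' (r2 + s2)"
    using triE[OF assms(2)] by metis
  have o: "r + s = r2 + s2" using assms(3) by (simp add: rho_def offset_def rs(4) rs2(4))
  have "P *v r = P *v r2" using Hi_triangle(1)[OF rs(1)] Hi_triangle(1)[OF rs2(1)] o by simp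
  then have "r = r2" using invertible_mult_inj[OF inv_P] by blast
  moreover from this o have "s = s2" by simp
  ultimately show ?thesis by (simp add: rs(2,3) rs2(2,3))
qed

text \<open>The triangles with last vertex \<open>w\<close> are embedded by \<open>E r\<close> into a coset of the integral vectors, and the area
bounds a positive definite form in \<open>E r\<close>.\<close>

lemma summable_tri_gaussian:
  assumes \<epsilon>: "0 < (\<epsilon>::real)"
  shows "(\<lambda>t. exp (- \<epsilon> * (rho t \<bullet> Hi (rho t)))) summable_on tri w"
proof -
  obtain \<delta> where \<delta>: "0 < \<delta>" "\<And>x. \<delta> * (norm x)\<^sup>2 \<le> x \<bullet> Hi x"
    using positive_definite_bound[OF Hi_props(1) G.inv_pos] by blast
  define h where "h t = E *v (matrix_inv P *v Hi (rho t))" for t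
  have hrs: "h (p, q) = E *v r" if "E *v r = E' *v s" "q = p - graph_vec A' (r + s)" for p q r s
    using Hi_triangle(1)[OF that(1)] that(2) by (simp add: h_def rho_def offset_def matrix_inv_mult[OF inv_P])
  have lin: "bounded_linear (\<lambda>x. E *v (matrix_inv P *v Hi x))"
    using linear_compose[OF Hi_props(1) matrix_vector_mul_linear[of "E ** matrix_inv P"]]
    by (simp add: linear_conv_bounded_linear o_def matrix_vector_mul_assoc)
  obtain K where K: "0 < K" "\<And>x. norm (E *v (matrix_inv P *v Hi x)) \<le> norm x * K"
    using bounded_linear.pos_bounded[OF lin] by blast
  have "(\<lambda>t. norm (exp (- \<epsilon> * (rho t \<bullet> Hi (rho t))))) summable_on tri w"
  proof (rule gaussian_summable_on_coset[of "\<epsilon> * \<delta> / K\<^sup>2" h _ _ 1])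
    show "0 < \<epsilon> * \<delta> / K\<^sup>2" using \<epsilon> \<delta> K by simp
    show "inj_on h (tri w)"
    proof (rule inj_onI)
      fix t t2 assume t: "t \<in> tri w" "t2 \<in> tri w" and eq: "h t = h t2"
      obtain p q p2 q2 where pq: "t = (p, q)" "t2 = (p2, q2)" by (metis prod.exhaust)
      have "matrix_inv P *v Hi (rho t) = matrix_inv P *v Hi (rho t2)"
        using eq invertible_mult_inj[OF T12.transverse] unfolding h_def by blast
      then have "P *v (matrix_inv P *v Hi (rho t)) = P *v (matrix_inv P *v Hi (rho t2))" by simp
      then have "Hi (rho t) = Hi (rho t2)" unfolding mult_matrix_inv[OF inv_P] .
      then have "rho t = rho t2" using Hi_props(2) by metis
      then show "t = t2" using rho_determines_triangle t unfolding pq by blast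
    qed
    show "h t - h t2 \<in> int_lattice" if t: "t \<in> tri w" "t2 \<in> tri w" for t t2
    proof -
      obtain p q p2 q2 where pq: "t = (p, q)" "t2 = (p2, q2)" by (metis prod.exhaust)
      obtain r s where rs: "E *v r = E' *v s" "p = w + graph_vec A r" "q = p - graph_vec A' (r + s)" "p \<in> supp L'"
        using triE t pq by (metis Int_iff)
      obtain r2 s2 where rs2: "E *v r2 = E' *v s2" "p2 = w + graph_vec A r2" "q2 = p2 - graph_vec A' (r2 + s2)" "p2 \<in> supp L'"
        using triE t pq by (metis Int_iff)
      have "p = p2 + graph_vec A (r - r2)" by (simp add: rs(2) rs2(2))
      then have "snd (graph_vec A (r - r2)) + A' *v fst (graph_vec A (r - r2)) \<in> int_lattice"
        using mirror_brane_supp_add[OF T12.mb' rs2(4)] rs(4) by metis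
      then have "E *v (r - r2) \<in> int_lattice"
        by (simp add: graph_vec_def matrix_vector_mult_diff_rdistrib del: graph_vec_simps)
      then show ?thesis
        unfolding pq hrs[OF rs(1,3)] hrs[OF rs2(1,3)] by (simp add: matrix_vector_mult_diff_distrib)
    qed
    show "norm (exp (- \<epsilon> * (rho t \<bullet> Hi (rho t)))) \<le> 1 * exp (- (\<epsilon> * \<delta> / K\<^sup>2) * (norm (h t))\<^sup>2)" for t
    proof -
      have "(norm (h t))\<^sup>2 \<le> (norm (rho t) * K)\<^sup>2"
        unfolding h_def by (intro power_mono K) simp
      then have "\<delta> / K\<^sup>2 * (norm (h t))\<^sup>2 \<le> \<delta> / K\<^sup>2 * (norm (rho t) * K)\<^sup>2"
        using \<delta> by (intro mult_left_mono) auto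
      also have "\<dots> = \<delta> * (norm (rho t))\<^sup>2" using K by (simp add: power_mult_distrib)
      also have "\<dots> \<le> rho t \<bullet> Hi (rho t)" by (rule \<delta>)
      finally have "\<epsilon> * (\<delta> / K\<^sup>2 * (norm (h t))\<^sup>2) \<le> \<epsilon> * (rho t \<bullet> Hi (rho t))"
        by (rule mult_left_mono) (use \<epsilon> in simp)
      then show ?thesis by simp
    qed
  qed
  then show ?thesis by simp
qed

text \<open>The restriction of \<open>edge_cov \<zeta> u\<close> to \<open>L'\<close> is \<open>- \<zeta>\<close> up to the term from \<open>B\<close>, and \<open>lift_restriction\<close> prescribes this
restriction modulo integral vectors.\<close>

lemma dual_coset_offset:
  assumes "p \<in> supp L'"
  shows "\<exists>\<kappa>. \<forall>w x'. dual_coset w x' p = (\<lambda>z. restrict_cov A' (x' - cov_B \<tau> (p - w)) - \<kappa> + z) ` int_lattice"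
proof -
  obtain \<kappa> where \<kappa>: "\<And>y. (p, y) \<in> supp T12.M' \<longleftrightarrow> restrict_cov A' y - \<kappa> \<in> int_lattice"
    using lift_restriction[OF T12.mb' T12.sg' assms] by blast
  show ?thesis
  proof (intro exI allI)
    fix w x'
    let ?z = "restrict_cov A' (x' - cov_B \<tau> (p - w)) - \<kappa>"
    have "\<zeta> \<in> dual_coset w x' p \<longleftrightarrow> \<zeta> - ?z \<in> int_lattice" for \<zeta>
    proof -
      have "restrict_cov A' (x' + edge_cov \<zeta> (p - w)) - \<kappa> = - (\<zeta> - ?z)"
        by (simp add: edge_cov_def restrict_conormal_E eta)
      then show ?thesis unfolding dual_coset_def mem_Collect_eq \<kappa> by (metis int_lattice_minus)
    qed
    moreover have "\<zeta> \<in> (\<lambda>z. ?z + z) ` int_lattice \<longleftrightarrow> \<zeta> - ?z \<in> int_lattice" for \<zeta>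
    proof
      assume "\<zeta> - ?z \<in> int_lattice"
      then show "\<zeta> \<in> (\<lambda>z. ?z + z) ` int_lattice" by (rule rev_image_eqI) simp
    next
      assume "\<zeta> \<in> (\<lambda>z. ?z + z) ` int_lattice"
      then obtain z where "z \<in> int_lattice" "\<zeta> = ?z + z" by blast
      then show "\<zeta> - ?z \<in> int_lattice" by simp
    qed
    ultimately show "dual_coset w x' p = (\<lambda>z. ?z + z) ` int_lattice" by blast
  qed
qed

text \<open>The choice is made independently of \<open>w\<close> and \<open>x'\<close>, so that \<open>zeta0\<close> depends on the point \<open>x'\<close> of the fibre by a
restriction to \<open>L'\<close> only.\<close>

definition lift_offset :: "'n V \<Rightarrow> real^'n"
  where "lift_offset p = (SOME \<kappa>. \<forall>w x'. dual_coset w x' p = (\<lambda>z. restrict_cov A' (x' - cov_B \<tau> (p - w)) - \<kappa> + z) ` int_lattice)"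

definition zeta0 :: "'n V \<Rightarrow> 'n V \<Rightarrow> 'n V \<Rightarrow> real^'n"
  where "zeta0 w x' p = restrict_cov A' (x' - cov_B \<tau> (p - w)) - lift_offset p"

lemma dual_coset_eq:
  assumes "p \<in> supp L'"
  shows "dual_coset w x' p = (\<lambda>z. zeta0 w x' p + z) ` int_lattice"
proof -
  from someI_ex[OF dual_coset_offset[OF assms]] show ?thesis unfolding lift_offset_def[symmetric] zeta0_def by (elim allE)
qed

lemma zeta0_mem: "p \<in> supp L' \<Longrightarrow> zeta0 w x' p \<in> dual_coset w x' p"
  unfolding dual_coset_eq by (rule image_eqI[of _ _ 0]) auto

lemma tri_supp: "t \<in> tri w \<Longrightarrow> fst t \<in> supp L'"
  by (cases t) (auto elim!: triE)

text \<open>The sums over the cosets have a common bound, so the areas of the triangles in \<open>T\<close> make the sum over all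
lifted triangles converge.\<close>

lemma doubled_term_summable:
  assumes a: "a \<in> HF L L'" and b: "b \<in> HF L' L''"
  shows "(\<lambda>x. norm (doubled_term b a w (fst x) (snd x))) summable_on Sigma (tri w) (\<lambda>t. dual_coset w x' (fst t))"
proof -
  obtain K where K: "0 \<le> K" "\<And>t. t \<in> tri w \<Longrightarrow> norm (holonomies b a w t) \<le> K" using holonomies_bounded[OF a b] by metis
  obtain C where C: "\<And>x. (\<lambda>z. exp (- (pi / 2) * ((x + z) \<bullet> H (x + z)))) summable_on int_lattice"
    "\<And>x. (\<Sum>\<^sub>\<infinity>z\<in>int_lattice. exp (- (pi / 2) * ((x + z) \<bullet> H (x + z)))) \<le> C"
    using quadratic_coset_sum[OF linear_H H_pos, of "pi / 2"] by auto
  define g where "g t = exp (- (pi / 2) * (rho t \<bullet> Hi (rho t))) * norm (holonomies b a w t)" for t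
  have n: "norm (doubled_term b a w t \<zeta>) = g t * exp (- (pi / 2) * (\<zeta> \<bullet> H \<zeta>))" for t \<zeta>
    by (simp add: doubled_term_def g_def norm_mult norm_exp_eq_Re)
  have inj: "inj_on (\<lambda>z. x + z) int_lattice" for x :: "real^'n" by (auto simp: inj_on_def)
  show ?thesis
  proof (rule norm_summable_on_Sigma[where h = "\<lambda>t. exp (- (pi / 2) * (rho t \<bullet> Hi (rho t))) * (K * C)"])
    fix t assume t: "t \<in> tri w"
    note Z = dual_coset_eq[OF tri_supp[OF t], of w x']
    have s: "(\<lambda>\<zeta>. exp (- (pi / 2) * (\<zeta> \<bullet> H \<zeta>))) summable_on dual_coset w x' (fst t)"
      unfolding Z summable_on_reindex[OF inj] o_def by (rule C)
    show "(\<lambda>\<zeta>. norm (doubled_term b a w (fst (t, \<zeta>)) (snd (t, \<zeta>)))) summable_on dual_coset w x' (fst t)"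
      unfolding fst_conv snd_conv n by (rule summable_on_cmult_right[OF s])
    have "(\<Sum>\<^sub>\<infinity>\<zeta>\<in>dual_coset w x' (fst t). exp (- (pi / 2) * (\<zeta> \<bullet> H \<zeta>))) \<le> C"
      unfolding Z infsum_reindex[OF inj] o_def by (rule C)
    then have "g t * (\<Sum>\<^sub>\<infinity>\<zeta>\<in>dual_coset w x' (fst t). exp (- (pi / 2) * (\<zeta> \<bullet> H \<zeta>))) \<le> (exp (- (pi / 2) * (rho t \<bullet> Hi (rho t))) * K) * C"
      using K t unfolding g_def by (intro mult_mono) (auto intro!: infsum_nonneg)
    then show "(\<Sum>\<^sub>\<infinity>\<zeta>\<in>dual_coset w x' (fst t). norm (doubled_term b a w (fst (t, \<zeta>)) (snd (t, \<zeta>)))) \<le>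
        exp (- (pi / 2) * (rho t \<bullet> Hi (rho t))) * (K * C)"
      unfolding fst_conv snd_conv n infsum_cmult_right' by (simp only: mult.assoc)
  next
    show "(\<lambda>t. exp (- (pi / 2) * (rho t \<bullet> Hi (rho t))) * (K * C)) summable_on tri w"
      using summable_tri_gaussian[of "pi / 2" w] by (intro summable_on_cmult_left) auto
  qed
qed

text \<open>The parallelogram law for the vectors \<open>x + m\<close> and \<open>m\<close>, with sum \<open>x + 2 m\<close> and difference \<open>x\<close>.\<close>

lemma parallelogram_Hi:
  "pi * ((x + m) \<bullet> Hi (x + m)) + pi * (m \<bullet> Hi m) = pi / 2 * (x \<bullet> Hi x) + pi / 2 * ((x + 2 *\<^sub>R m) \<bullet> Hi (x + 2 *\<^sub>R m))"
proof -
  have "(x + m) \<bullet> Hi (x + m) + m \<bullet> Hi m = (x \<bullet> Hi x + (x + 2 *\<^sub>R m) \<bullet> Hi (x + 2 *\<^sub>R m)) / 2"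
    using Hi_sym[of x m]
    by (simp add: linear_scale[OF Hi_props(1)] inner_add_left inner_add_right inner_commute[of m x] inner_commute[of m "Hi x"] field_simps)
  then have "pi * ((x + m) \<bullet> Hi (x + m) + m \<bullet> Hi m) = pi * ((x \<bullet> Hi x + (x + 2 *\<^sub>R m) \<bullet> Hi (x + 2 *\<^sub>R m)) / 2)" by simp
  then show ?thesis by (simp only: distrib_left times_divide_eq_right times_divide_eq_left add_divide_distrib)
qed

lemma dual_term_eq: "dual_term b a w t m = phase w t * exp (- of_real (pi / 2 * (rho t \<bullet> Hi (rho t)))) * holonomies b a w t *
    exp (- of_real (pi / 2 * ((rho t + 2 *\<^sub>R m) \<bullet> Hi (rho t + 2 *\<^sub>R m))))"
  unfolding dual_term_def parallelogram_Hi of_real_add minus_add_distrib exp_add by (simp only: mult_ac)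

lemma dual_term_summable:
  assumes a: "a \<in> HF L L'" and b: "b \<in> HF L' L''"
  shows "(\<lambda>x. norm (dual_term b a w (fst x) (snd x))) summable_on tri w \<times> int_lattice"
proof -
  obtain K where K: "0 \<le> K" "\<And>t. t \<in> tri w \<Longrightarrow> norm (holonomies b a w t) \<le> K" using holonomies_bounded[OF a b] by metis
  obtain C where C: "\<And>x. (\<lambda>z. exp (- (2 * pi) * ((x + z) \<bullet> Hi (x + z)))) summable_on int_lattice"
    "\<And>x. (\<Sum>\<^sub>\<infinity>z\<in>int_lattice. exp (- (2 * pi) * ((x + z) \<bullet> Hi (x + z)))) \<le> C"
    using quadratic_coset_sum[OF Hi_props(1) G.inv_pos, of "2 * pi"] by auto
  define g where "g t = exp (- (pi / 2) * (rho t \<bullet> Hi (rho t))) * norm (holonomies b a w t)" for t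
  have d: "x + 2 *\<^sub>R m = 2 *\<^sub>R (x /\<^sub>R 2 + m)" for x m :: "real^'n" by (simp add: scaleR_add_right)
  have n: "norm (dual_term b a w t m) = g t * exp (- (2 * pi) * ((rho t /\<^sub>R 2 + m) \<bullet> Hi (rho t /\<^sub>R 2 + m)))" for t m
    unfolding dual_term_eq d linear_scale[OF Hi_props(1)] by (simp add: g_def norm_mult norm_exp_eq_Re)
  show ?thesis
  proof (rule norm_summable_on_Sigma[where h = "\<lambda>t. exp (- (pi / 2) * (rho t \<bullet> Hi (rho t))) * (K * C)"])
    fix t assume t: "t \<in> tri w"
    show "(\<lambda>m. norm (dual_term b a w (fst (t, m)) (snd (t, m)))) summable_on int_lattice"
      unfolding fst_conv snd_conv n by (rule summable_on_cmult_right[OF C(1)])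
    have "g t * (\<Sum>\<^sub>\<infinity>m\<in>int_lattice. exp (- (2 * pi) * ((rho t /\<^sub>R 2 + m) \<bullet> Hi (rho t /\<^sub>R 2 + m)))) \<le> (exp (- (pi / 2) * (rho t \<bullet> Hi (rho t))) * K) * C"
      using K t unfolding g_def by (intro mult_mono C) (auto intro!: infsum_nonneg)
    then show "(\<Sum>\<^sub>\<infinity>m\<in>int_lattice. norm (dual_term b a w (fst (t, m)) (snd (t, m)))) \<le>
        exp (- (pi / 2) * (rho t \<bullet> Hi (rho t))) * (K * C)"
      unfolding fst_conv snd_conv n infsum_cmult_right' by (simp only: mult.assoc)
  next
    show "(\<lambda>t. exp (- (pi / 2) * (rho t \<bullet> Hi (rho t))) * (K * C)) summable_on tri w"
      using summable_tri_gaussian[of "pi / 2" w] by (intro summable_on_cmult_left) auto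
  qed
qed

text \<open>Poisson summation over the coset of admissible \<open>\<zeta>\<close>, for each triangle in \<open>T\<close> separately.\<close>

lemma mu2_doubled_poisson:
  obtains \<kappa> where "\<kappa> \<noteq> 0"
    "\<And>a b w x'. a \<in> HF L L' \<Longrightarrow> b \<in> HF L' L'' \<Longrightarrow> (w, x') \<in> T13.S \<Longrightarrow>
      doubled_product b a (w, x') =
      \<kappa> * (\<Sum>\<^sub>\<infinity>t\<in>tri w. \<Sum>\<^sub>\<infinity>m\<in>int_lattice. character m (zeta0 w x' (fst t)) * dual_term b a w t m)"
proof -
  obtain \<kappa> where \<kappa>: "\<kappa> \<noteq> 0"
    "\<And>x \<rho>. (\<Sum>\<^sub>\<infinity>z\<in>int_lattice. exp (- of_real (pi / 2 * ((x + z) \<bullet> H (x + z))) - \<i> * of_real (pi * ((x + z) \<bullet> \<rho>)))) =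
      \<kappa> * (\<Sum>\<^sub>\<infinity>m\<in>int_lattice. character m x * exp (- of_real (pi / 2 * ((\<rho> + 2 *\<^sub>R m) \<bullet> Hi (\<rho> + 2 *\<^sub>R m)))))"
    by (rule G.poisson_summation) (erule that, simp only:)
  show ?thesis
  proof (rule that[OF \<kappa>(1)])
    fix a b w x' assume a: "a \<in> HF L L'" and b: "b \<in> HF L' L''" and z: "(w, x') \<in> T13.S"
    have s: "(\<lambda>(t, \<zeta>). doubled_term b a w t \<zeta>) summable_on Sigma (tri w) (\<lambda>t. dual_coset w x' (fst t))"
      using abs_summable_summable[OF doubled_term_summable[OF a b]] by (simp add: case_prod_unfold)
    have inner: "(\<Sum>\<^sub>\<infinity>\<zeta>\<in>dual_coset w x' (fst t). doubled_term b a w t \<zeta>) =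
        \<kappa> * (\<Sum>\<^sub>\<infinity>m\<in>int_lattice. character m (zeta0 w x' (fst t)) * dual_term b a w t m)" if t: "t \<in> tri w" for t
    proof -
      let ?G = "phase w t * exp (- of_real (pi / 2 * (rho t \<bullet> Hi (rho t)))) * holonomies b a w t"
      let ?z = "zeta0 w x' (fst t)"
      have inj: "inj_on (\<lambda>z. ?z + z) int_lattice" by (auto simp: inj_on_def)
      have "(\<Sum>\<^sub>\<infinity>\<zeta>\<in>dual_coset w x' (fst t). doubled_term b a w t \<zeta>) = (\<Sum>\<^sub>\<infinity>z\<in>int_lattice. doubled_term b a w t (?z + z))"
        unfolding dual_coset_eq[OF tri_supp[OF t]] infsum_reindex[OF inj] o_def ..
      also have "\<dots> = ?G * (\<kappa> * (\<Sum>\<^sub>\<infinity>m\<in>int_lattice. character m ?z * exp (- of_real (pi / 2 * ((rho t + 2 *\<^sub>R m) \<bullet> Hi (rho t + 2 *\<^sub>R m))))))"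
        unfolding doubled_term_def infsum_cmult_right' \<kappa>(2) ..
      also have "\<dots> = \<kappa> * (?G * (\<Sum>\<^sub>\<infinity>m\<in>int_lattice. character m ?z * exp (- of_real (pi / 2 * ((rho t + 2 *\<^sub>R m) \<bullet> Hi (rho t + 2 *\<^sub>R m))))))"
        by (simp only: mult_ac)
      also have "\<dots> = \<kappa> * (\<Sum>\<^sub>\<infinity>m\<in>int_lattice. character m ?z * dual_term b a w t m)"
        unfolding infsum_cmult_right'[symmetric] dual_term_eq by (simp only: mult_ac)
      finally show ?thesis .
    qed
    have "(\<Sum>\<^sub>\<infinity>(t, \<zeta>)\<in>Sigma (tri w) (\<lambda>t. dual_coset w x' (fst t)). doubled_term b a w t \<zeta>) =
        (\<Sum>\<^sub>\<infinity>t\<in>tri w. \<Sum>\<^sub>\<infinity>\<zeta>\<in>dual_coset w x' (fst t). doubled_term b a w t \<zeta>)"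
      by (rule infsum_Sigma'_banach[OF s, symmetric])
    also have "\<dots> = (\<Sum>\<^sub>\<infinity>t\<in>tri w. \<kappa> * (\<Sum>\<^sub>\<infinity>m\<in>int_lattice. character m (zeta0 w x' (fst t)) * dual_term b a w t m))"
      by (rule infsum_cong) (rule inner)
    finally show "doubled_product b a (w, x') =
      \<kappa> * (\<Sum>\<^sub>\<infinity>t\<in>tri w. \<Sum>\<^sub>\<infinity>m\<in>int_lattice. character m (zeta0 w x' (fst t)) * dual_term b a w t m)"
      unfolding mu2_doubled[OF z] infsum_cmult_right' .
  qed
qed

end

lemma sum_infsum_swap:
  fixes f :: "'i \<Rightarrow> 'a \<Rightarrow> complex"
  assumes "finite I" "\<And>i. i \<in> I \<Longrightarrow> f i summable_on A"
  shows "(\<Sum>i\<in>I. \<Sum>\<^sub>\<infinity>x\<in>A. f i x) = (\<Sum>\<^sub>\<infinity>x\<in>A. \<Sum>i\<in>I. f i x)"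
    and "(\<lambda>x. \<Sum>i\<in>I. f i x) summable_on A"
proof -
  have "(\<lambda>x. \<Sum>i\<in>I. f i x) summable_on A \<and> (\<Sum>i\<in>I. \<Sum>\<^sub>\<infinity>x\<in>A. f i x) = (\<Sum>\<^sub>\<infinity>x\<in>A. \<Sum>i\<in>I. f i x)"
    using assms
  proof (induction I)
    case (insert i I)
    then have IH: "(\<lambda>x. \<Sum>i\<in>I. f i x) summable_on A" "(\<Sum>i\<in>I. \<Sum>\<^sub>\<infinity>x\<in>A. f i x) = (\<Sum>\<^sub>\<infinity>x\<in>A. \<Sum>i\<in>I. f i x)" by auto
    have fi: "f i summable_on A" using insert by auto
    show ?case
      using insert(1,2) summable_on_add[OF fi IH(1)] infsum_add[OF fi IH(1)] IH(2) by simp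
  qed simp
  then show "(\<Sum>i\<in>I. \<Sum>\<^sub>\<infinity>x\<in>A. f i x) = (\<Sum>\<^sub>\<infinity>x\<in>A. \<Sum>i\<in>I. f i x)" "(\<lambda>x. \<Sum>i\<in>I. f i x) summable_on A" by auto
qed

context mirror_triple
begin

text \<open>Pairs \<open>(g, s)\<close> which describe triangles with integral edges. These edges can be added to those of any
triangle.\<close>

definition int_triangles :: "'n V set"
  where "int_triangles = {(g, s). g \<in> int_lattice \<and> s \<in> int_lattice \<and> E *v g = E' *v s}"

\<comment> \<open>The edges of the integral triangle, with the sign of \<open>g3\<close> such that \<open>g3 k = g1 k + g2 k\<close>. Adding them
  moves \<open>p\<close> by \<open>g1 k\<close> and \<open>q\<close> by \<open>g3 k\<close>, and fixes \<open>w\<close>.\<close>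
abbreviation "g1 k \<equiv> graph_vec A (fst k)"
abbreviation "g2 k \<equiv> graph_vec A' (- (fst k + snd k))"
abbreviation "g3 k \<equiv> graph_vec A'' (- snd k)"

definition shift :: "'n V \<Rightarrow> 'n V \<times> 'n V \<Rightarrow> 'n V \<times> 'n V"
  where "shift k = (\<lambda>(p, q). (p + g1 k, q + g3 k))"

definition sign_product :: "'n V \<Rightarrow> complex"
  where "sign_product k = minus_one_pow (\<xi> (g1 k)) * minus_one_pow (\<xi>' (g2 k)) * minus_one_pow (\<xi>'' (g3 k))"

definition gauss :: "'n V \<Rightarrow> complex"
  where "gauss k = exp (- of_real pi * \<i> * of_real (B_form \<tau> (g1 k) (g2 k)) - of_real (pi * ((fst k + snd k) \<bullet> Hi (fst k + snd k))))"

text \<open>The summands of the theta constant: by \<open>shift_term\<close>, the quotient of a summand after Poisson summation and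
the contribution of the translated triangle. The exponent of \<open>gauss\<close> is a quadratic form.\<close>

definition shift_factor :: "'n V \<Rightarrow> complex"
  where "shift_factor k = sign_product k * gauss k"

lemma int_triangles_D: "k \<in> int_triangles \<Longrightarrow> fst k \<in> int_lattice" "k \<in> int_triangles \<Longrightarrow> snd k \<in> int_lattice" "k \<in> int_triangles \<Longrightarrow> E *v fst k = E' *v snd k"
  by (auto simp: int_triangles_def)

lemma int_triangles_H1: "k \<in> int_triangles \<Longrightarrow> g1 k \<in> H1 L" "k \<in> int_triangles \<Longrightarrow> g2 k \<in> H1 L'" "k \<in> int_triangles \<Longrightarrow> g3 k \<in> H1 L''"
proof -
  assume k: "k \<in> int_triangles"
  have "fst k \<in> int_lattice" "- (fst k + snd k) \<in> int_lattice" "- snd k \<in> int_lattice"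
    using int_triangles_D(1,2)[OF k] by (simp_all only: int_lattice_minus int_lattice_add)
  then show "g1 k \<in> H1 L" "g2 k \<in> H1 L'" "g3 k \<in> H1 L''"
    unfolding mirror_brane_H1[OF T12.mb] mirror_brane_H1[OF T12.mb'] mirror_brane_H1[OF T23.mb'] by blast+
qed

lemma g_sum: "k \<in> int_triangles \<Longrightarrow> g3 k = g1 k + g2 k"
  using triangle_closes[OF int_triangles_D(3)] by (simp add: algebra_simps)

lemma shift_mem:
  assumes k: "k \<in> int_triangles" and t: "t \<in> tri w"
  shows "shift k t \<in> tri w"
proof -
  obtain p q where pq: "t = (p, q)" by (metis prod.exhaust)
  obtain r s where rs: "E *v r = E' *v s" "p = w + graph_vec A r" "q = w - graph_vec A'' s" "w \<in> base" "p \<in> supp L \<inter> supp L'"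
    using triE t pq by metis
  have "E *v (r + fst k) = E' *v (s + snd k)" using rs(1) int_triangles_D(3)[OF k] by (simp add: matrix_vector_right_distrib)
  moreover have "w + graph_vec A (r + fst k) \<in> supp L'"
    using T12.B'.supp_lattice[of p "g1 k"] rs(5) T12.B.H1_D(1)[OF int_triangles_H1(1)[OF k]] by (simp add: rs(2) add.assoc)
  ultimately have "(w + graph_vec A (r + fst k), w - graph_vec A'' (s + snd k)) \<in> tri w" by (rule triI[OF rs(4)])
  then show ?thesis by (simp add: pq shift_def rs(2,3) algebra_simps)
qed

lemma int_triangles_minus: "k \<in> int_triangles \<Longrightarrow> - k \<in> int_triangles"
  by (auto simp: int_triangles_def linear_neg[OF matrix_vector_mul_linear])

lemma shift_minus: "shift (- k) (shift k t) = t" "shift k (shift (- k) t) = t"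
  by (cases t; simp add: shift_def add.assoc)+

lemma shift_bij: "k \<in> int_triangles \<Longrightarrow> bij_betw (shift k) (tri w) (tri w)"
  by (rule bij_betw_byWitness[where f' = "shift (- k)"]) (auto simp: shift_minus shift_mem int_triangles_minus)

text \<open>The three transports change by holonomies, by curvature terms and by identifications of the fibres. The
last ones cancel against the equivariance of \<open>a\<close> and \<open>b\<close>.\<close>

lemma holonomies_shift:
  assumes a: "a \<in> HF L L'" and b: "b \<in> HF L' L''" and k: "k \<in> int_triangles" and t: "(p, q) \<in> tri w"
  shows "holonomies b a w (shift k (p, q)) = holonomies b a w (p, q) *
    (hol L w (g1 k) * hol L' p (g2 k) * inverse (hol L'' w (g3 k))) *
    exp (of_real pi * \<i> * of_real (B_form \<tau> (q - w) (g3 k) - B_form \<tau> (p - w) (g1 k) - B_form \<tau> (q - p) (g2 k)))"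
proof -
  obtain r s where rs: "E *v r = E' *v s" "p = w + graph_vec A r" "q = w - graph_vec A'' s" "q = p - graph_vec A' (r + s)"
    "w \<in> base" "p \<in> supp L \<inter> supp L'" "q \<in> supp L' \<inter> supp L''"
    using triE[OF t] by metis
  have u: "p - w \<in> tangent (supp L)" using rs(2) mirror_brane_tangent[OF T12.mb] by simp
  have "q - p = graph_vec A' (- (r + s))" using rs(4) by simp
  then have u': "q - p \<in> tangent (supp L')" unfolding mirror_brane_tangent[OF T12.mb'] by (rule range_eqI)
  have "q - w = graph_vec A'' (- s)" using rs(3) by simp
  then have u'': "q - w \<in> tangent (supp L'')" unfolding mirror_brane_tangent[OF T23.mb'] by (rule range_eqI)
  note H = int_triangles_H1[OF k]
  have int: "g1 k \<in> int_lattice" "g3 k \<in> int_lattice"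
    using T12.B.H1_D(1)[OF H(1)] T23.B'.H1_D(1)[OF H(3)] by auto
  let ?e1 = "exp (of_real pi * \<i> * of_real (brane_F (torus_form \<tau>) (p - w) (g1 k)))"
  let ?e2 = "exp (of_real pi * \<i> * of_real (brane_F (torus_form \<tau>) (q - p) (g2 k)))"
  let ?e3 = "exp (- of_real pi * \<i> * of_real (brane_F (torus_form \<tau>) (q - w) (g3 k)))"
  have w: "w \<in> supp L" "w \<in> supp L''" "p \<in> supp L'" using rs by auto
  have 1: "transport L w (p + g1 k) = transport L w p * hol L w (g1 k) * mult L (g1 k) p * ?e1"
    using T12.B.transport_to_translate[OF w(1) u H(1)] by simp
  have 2: "transport L' (p + g1 k) (q + g3 k) * mult L' (g1 k) p = transport L' p q * mult L' (g3 k) q * hol L' p (g2 k) * ?e2"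
    using T12.B'.transport_translate_both[OF w(3) u' int(1) H(2)] unfolding g_sum[OF k] by (simp del: graph_vec_simps add: add.assoc)
  have 3: "transport L'' (q + g3 k) w * mult L'' (g3 k) q = transport L'' q w * inverse (hol L'' w (g3 k)) * ?e3"
    using T23.B'.transport_from_translate[OF w(2) u'' H(3)] by simp
  have 4: "a (p + g1 k) * mult L (g1 k) p = mult L' (g1 k) p * a p" by (rule HF_equivariant[OF a rs(6) int(1)])
  have 5: "b (q + g3 k) * mult L' (g3 k) q = mult L'' (g3 k) q * b q" by (rule HF_equivariant[OF b rs(7) int(2)])
  have nz: "mult L (g1 k) p \<noteq> 0" "mult L' (g1 k) p \<noteq> 0" "mult L' (g3 k) q \<noteq> 0" "mult L'' (g3 k) q \<noteq> 0"
    using T12.B.mult_nonzero[OF int(1), of p] T12.B'.mult_nonzero[OF int(1), of p]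
      T12.B'.mult_nonzero[OF int(2), of q] T23.B'.mult_nonzero[OF int(2), of q] rs(6,7) by auto
  have gen: "t3' * b' * t2' * a' * t1' = t3 * b * t2 * a * t1 * (h1 * h2 * h3) * (e1 * e2 * e3)"
    if "t1' = t1 * h1 * m1 * e1" "t2' * m2 = t2 * m3 * h2 * e2" "t3' * m4 = t3 * h3 * e3"
      "a' * m1 = m2 * a" "b' * m3 = m4 * b" "m2 \<noteq> 0" "m4 \<noteq> 0" "m3 \<noteq> 0"
    for t3' b' t2' a' t1' t3 b t2 a t1 h1 h2 h3 e1 e2 e3 m1 m2 m3 m4 :: complex
  proof -
    have "(t3' * b' * t2' * a' * t1') * (m2 * m3 * m4) = (t3' * m4) * (b' * m3) * (t2' * m2) * (a' * m1) * (t1 * h1 * e1)"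
      unfolding that(1) by (simp only: mult_ac)
    also have "\<dots> = (t3 * b * t2 * a * t1 * (h1 * h2 * h3) * (e1 * e2 * e3)) * (m2 * m3 * m4)"
      unfolding that(2-5) by (simp only: mult_ac)
    finally show ?thesis using that(6-8) by simp
  qed
  have ee: "?e1 * ?e2 * ?e3 = exp (of_real pi * \<i> * of_real (B_form \<tau> (q - w) (g3 k) - B_form \<tau> (p - w) (g1 k) - B_form \<tau> (q - p) (g2 k)))"
    unfolding brane_F_eq exp_add[symmetric] by (intro arg_cong[of _ _ exp]) (simp add: algebra_simps)
  show ?thesis
    unfolding holonomies_def shift_def prod.case ee[symmetric] by (rule gen[OF 1 2 3 4 5 nz(2,4,3)])
qed

lemma lift_hol:
  assumes "(x, x') \<in> supp (lift \<xi>1 L1)" "\<gamma> \<in> H1 L1"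
  shows "hol L1 x \<gamma> = minus_one_pow (\<xi>1 \<gamma>) * character x' \<gamma>"
proof -
  have "character x' \<gamma> = minus_one_pow (\<xi>1 \<gamma>) * hol L1 x \<gamma>" using assms by (simp add: supp_lift)
  then show ?thesis using minus_one_pow_square[of "\<xi>1 \<gamma>"] by (simp add: mult.assoc[symmetric])
qed

text \<open>On the lifts, holonomies are values of characters up to the signs \<open>\<xi>\<close> (\<open>lift_hol\<close>). At the vertices \<open>(w, x')\<close> and
\<open>(p, x' + f)\<close>, where \<open>f\<close> is the dual edge, they combine to the value of \<open>f\<close> on \<open>g2 k\<close>, because
\<open>g3 k = g1 k + g2 k\<close>. This value is \<open>\<zeta> \<bullet> m\<close> up to a term in \<open>B\<close>, so it produces the character in Poisson summation.
All terms in \<open>B\<close> that involve the triangle add up to its phase.\<close>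

lemma shift_term:
  assumes a: "a \<in> HF L L'" and b: "b \<in> HF L' L''" and z: "(w, x') \<in> T13.S" and k: "k \<in> int_triangles" and t: "t \<in> tri w"
  shows "character (fst k + snd k) (zeta0 w x' (fst t)) * dual_term b a w t (fst k + snd k) = shift_factor k * torus_term b a w (shift k t)"
proof -
  obtain p q where pq: "t = (p, q)" by (metis prod.exhaust)
  obtain r s where rs: "E *v r = E' *v s" "p = w + graph_vec A r" "q = w - graph_vec A'' s" "q = p - graph_vec A' (r + s)"
    "w \<in> base" "p \<in> supp L \<inter> supp L'" "q \<in> supp L' \<inter> supp L''"
    using triE t pq by metis
  define m where "m = fst k + snd k"
  define \<zeta> where "\<zeta> = zeta0 w x' p"
  note H = int_triangles_H1[OF k]
  let ?u = "p - w" and ?u' = "q - p"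
  have "\<zeta> \<in> dual_coset w x' p" unfolding \<zeta>_def using rs(6) by (intro zeta0_mem) auto
  then have "(p, x' + edge_cov \<zeta> ?u) \<in> supp T12.M'" by (simp add: dual_coset_def)
  then have h2: "hol L' p (g2 k) = minus_one_pow (\<xi>' (g2 k)) * character (x' + edge_cov \<zeta> ?u) (g2 k)" using H(2) by (rule lift_hol)
  have h1: "hol L w (g1 k) = minus_one_pow (\<xi> (g1 k)) * character x' (g1 k)" using z H(1) by (intro lift_hol) auto
  have h3: "hol L'' w (g3 k) = minus_one_pow (\<xi>'' (g3 k)) * character x' (g3 k)" using z H(3) by (intro lift_hol) auto
  have g3: "g3 k = g1 k + g2 k" by (rule g_sum[OF k])
  have "edge_cov \<zeta> ?u \<bullet> g2 k = \<zeta> \<bullet> m - B_form \<tau> ?u (g2 k)"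
  proof -
    have "conormal A (eta \<zeta>) \<bullet> g2 k = eta \<zeta> \<bullet> (E *v m)"
      unfolding conormal_graph_vec m_def[symmetric] by (simp add: linear_neg[OF matrix_vector_mul_linear])
    also have "\<dots> = \<zeta> \<bullet> m" by (simp only: transpose_inner[symmetric] eta)
    finally show ?thesis by (simp only: edge_cov_def inner_diff_left contract_inner[OF bilinear_B_form])
  qed
  then have ch: "character (edge_cov \<zeta> ?u) (g2 k) = exp (of_real pi * \<i> * of_real (2 * (\<zeta> \<bullet> m) - 2 * B_form \<tau> ?u (g2 k)))"
    by (simp add: character_def algebra_simps)
  have cx: "character x' (g3 k) = character x' (g1 k) * character x' (g2 k)"
    unfolding g3 by (rule character_add(2))
  have gen: "s1 * x1 * (s2 * (x2 * l)) * (s3 * (inverse x1 * inverse x2)) = s1 * s2 * s3 * l"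
    if "x1 \<noteq> 0" "x2 \<noteq> 0" for s1 s2 s3 x1 x2 l :: complex
    using that by (simp add: field_simps)
  have "hol L w (g1 k) * hol L' p (g2 k) * inverse (hol L'' w (g3 k)) = sign_product k * character (edge_cov \<zeta> ?u) (g2 k)"
    unfolding h1 h2 h3 inverse_mult_distrib minus_one_pow_inverse sign_product_def cx character_add(1)
    by (rule gen[OF character_nz character_nz])
  then have hf: "holonomies b a w (shift k t) = holonomies b a w t * sign_product k *
      exp (of_real pi * \<i> * of_real (2 * (\<zeta> \<bullet> m) - 2 * B_form \<tau> ?u (g2 k) + (B_form \<tau> (q - w) (g3 k) - B_form \<tau> ?u (g1 k) - B_form \<tau> ?u' (g2 k))))"
    unfolding pq holonomies_shift[OF a b k t[unfolded pq]] ch of_real_add distrib_left exp_add by simp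
  have ph: "phase w (shift k t) = exp (of_real pi * \<i> * of_real (B_form \<tau> (?u + g1 k) (?u' + g2 k)))"
    unfolding pq phase_def shift_def prod.case g3 by (simp add: algebra_simps del: graph_vec_simps)
  have rh: "rho (shift k t) = rho t + m"
    by (simp add: pq rho_def shift_def offset_def m_def)
  have B: "2 * (\<zeta> \<bullet> m) - 2 * B_form \<tau> ?u (g2 k) + (B_form \<tau> (q - w) (g3 k) - B_form \<tau> ?u (g1 k) - B_form \<tau> ?u' (g2 k)) + B_form \<tau> (?u + g1 k) (?u' + g2 k)
      = 2 * (\<zeta> \<bullet> m) + B_form \<tau> ?u ?u' + B_form \<tau> (g1 k) (g2 k)"
  proof -
    have "q - w = ?u + ?u'" by simp
    then show ?thesis unfolding g3
      using B_form_flip[of \<tau> "g1 k" ?u'] by (simp only: bilinear_ladd[OF bilinear_B_form] bilinear_radd[OF bilinear_B_form])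
  qed
  have sq: "sign_product k * sign_product k = 1"
  proof -
    have "sign_product k * sign_product k = (minus_one_pow (\<xi> (g1 k)) * minus_one_pow (\<xi> (g1 k))) *
      (minus_one_pow (\<xi>' (g2 k)) * minus_one_pow (\<xi>' (g2 k))) * (minus_one_pow (\<xi>'' (g3 k)) * minus_one_pow (\<xi>'' (g3 k)))"
      unfolding sign_product_def by (simp only: mult_ac)
    then show ?thesis by (simp only: minus_one_pow_square mult_1_right)
  qed
  have tt: "torus_term b a w (shift k t) = sign_product k * holonomies b a w t *
      exp (of_real pi * \<i> * of_real (2 * (\<zeta> \<bullet> m) + B_form \<tau> ?u ?u' + B_form \<tau> (g1 k) (g2 k)) - of_real (pi * ((rho t + m) \<bullet> Hi (rho t + m))))"
    unfolding torus_term_def ph hf rh B[symmetric] of_real_add distrib_left exp_add exp_diff exp_minus by (simp add: field_simps)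
  have "shift_factor k * torus_term b a w (shift k t) = (sign_product k * sign_product k) * holonomies b a w t * (gauss k *
      exp (of_real pi * \<i> * of_real (2 * (\<zeta> \<bullet> m) + B_form \<tau> ?u ?u' + B_form \<tau> (g1 k) (g2 k)) - of_real (pi * ((rho t + m) \<bullet> Hi (rho t + m)))))"
    unfolding tt shift_factor_def by (simp only: mult_ac)
  also have "\<dots> = holonomies b a w t * (character m \<zeta> * (phase w t * exp (- of_real (pi * ((rho t + m) \<bullet> Hi (rho t + m)) + pi * (m \<bullet> Hi m)))))"
    unfolding sq mult_1_left gauss_def m_def[symmetric] phase_def pq prod.case character_def exp_add[symmetric]
    by (intro arg_cong2[where f = "(*)"] arg_cong[of _ _ exp] refl) (simp add: algebra_simps inner_commute)
  finally show ?thesis unfolding dual_term_def m_def[symmetric] \<zeta>_def[symmetric] pq fst_conv by (simp only: mult_ac)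
qed

subsection \<open>Averaging over the fibre\<close>

text \<open>The real form of \<open>int_triangles\<close>: \<open>r\<close> and \<open>s\<close> are recovered from \<open>r + s\<close> as in \<open>Hi_triangle\<close>.\<close>

lemma split_middle:
  obtains g s where "E *v g = E' *v s" "g + s = m"
proof -
  define g where "g = matrix_inv P *v Hi m"
  define s where "s = matrix_inv P' *v Hi m"
  have "Y *v (E *v g) = Y *v (E' *v s)"
    unfolding P_E[symmetric] P'_E'[symmetric] g_def s_def by (simp add: mult_matrix_inv inv_P inv_P')
  then have "E *v g = E' *v s" using invertible_mult_inj[OF inv_Y] by blast
  moreover have "g + s = m" using Hi_props(2)[of m] by (simp add: H_def g_def s_def)
  ultimately show ?thesis by (rule that)
qed

lemma restrict_middle:
  assumes "E *v g = E' *v s"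
  shows "(g + s) \<bullet> restrict_cov A' k = restrict_cov A k \<bullet> g + restrict_cov A'' k \<bullet> s"
  unfolding inner_commute[of "g + s"] inner_graph_vec[symmetric] triangle_closes[OF assms, symmetric] by (rule inner_add_right)

lemma inj_int_triangles_sum: "inj_on (\<lambda>k. fst k + snd k) int_triangles"
proof (rule inj_onI)
  fix k l assume kl: "k \<in> int_triangles" "l \<in> int_triangles" "fst k + snd k = fst l + snd l"
  have "P *v fst k = P *v fst l"
    using Hi_triangle(1)[OF int_triangles_D(3)[OF kl(1)]] Hi_triangle(1)[OF int_triangles_D(3)[OF kl(2)]] kl(3) by simp
  then have "fst k = fst l" using invertible_mult_inj[OF inv_P] by blast
  then show "k = l" using kl(3) by (simp add: prod_eq_iff)
qed

lemma int_triangles_sum_int: "(\<lambda>k. fst k + snd k) ` int_triangles \<subseteq> int_lattice"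
  by (auto simp: int_triangles_def)

abbreviation "over w \<equiv> points_over T13.M T13.M' (tpoint w)"

text \<open>By \<open>restrict_middle\<close>, translating the fibre by a covector \<open>k\<close> multiplies the summands by the character of
\<open>k\<close> given by pairing its restrictions to \<open>L\<close> and \<open>L''\<close> with \<open>g\<close> and \<open>s\<close>. These restrictions can be any two integral
vectors. So either \<open>g\<close> and \<open>s\<close> are integral and the summand is constant, or the sum is
multiplied by a number other than \<open>1\<close> under a permutation of the fibre.\<close>

lemma character_sum_over_fibre:
  assumes m: "m \<in> int_lattice" and z: "(w, x1) \<in> T13.S"
  shows "(\<Sum>Y\<in>over w. character m (restrict_cov A' (T13.rep w Y))) =
    (if m \<in> (\<lambda>k. fst k + snd k) ` int_triangles then of_nat (card (over w)) * character m (restrict_cov A' x1) else 0)"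
proof -
  obtain g s where gs: "E *v g = E' *v s" "g + s = m" by (rule split_middle)
  have mid: "m \<bullet> restrict_cov A' k = restrict_cov A k \<bullet> g + restrict_cov A'' k \<bullet> s" for k
    using restrict_middle[OF gs(1)] gs(2) by simp
  show ?thesis
  proof (cases "m \<in> (\<lambda>k. fst k + snd k) ` int_triangles")
    case True
    then obtain k where k: "k \<in> int_triangles" "m = fst k + snd k" by blast
    have "character m (restrict_cov A' (T13.rep w Y)) = character m (restrict_cov A' x1)" if Y: "Y \<in> over w" for Y
    proof -
      have d: "restrict_cov A (T13.rep w Y - x1) \<in> int_lattice" "restrict_cov A'' (T13.rep w Y - x1) \<in> int_lattice"
        using T13.fibre_difference[OF z T13.rep_mem(2)[OF Y]] by blast+
      have "m \<bullet> restrict_cov A' (T13.rep w Y - x1) =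
          restrict_cov A (T13.rep w Y - x1) \<bullet> fst k + restrict_cov A'' (T13.rep w Y - x1) \<bullet> snd k"
        unfolding k(2) by (rule restrict_middle[OF int_triangles_D(3)[OF k(1)]])
      also have "\<dots> \<in> \<int>" using d int_triangles_D[OF k(1)] by (intro Ints_add int_lattice_inner)
      finally have "character m (restrict_cov A' (T13.rep w Y - x1)) = 1" unfolding character_eq_1_iff .
      then show ?thesis by (simp add: character_diff)
    qed
    then show ?thesis using True by simp
  next
    case False
    define \<Sigma> where "\<Sigma> = (\<Sum>Y\<in>over w. character m (restrict_cov A' (T13.rep w Y)))"
    have inv: "\<Sigma> = character m (restrict_cov A' k) * \<Sigma>"
      if k: "restrict_cov A k \<in> int_lattice" "restrict_cov A'' k \<in> int_lattice" for k
    proof -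
      have nk: "restrict_cov A (- k) \<in> int_lattice" "restrict_cov A'' (- k) \<in> int_lattice" using k by auto
      \<comment> \<open>translation by \<open>l\<close> is a permutation of the points over \<open>w\<close>; representatives change by integral covectors\<close>
      have tr: "tpoint (w, T13.rep w (tpoint (w, T13.rep w Y + l)) - l) = Y \<and> tpoint (w, T13.rep w Y + l) \<in> over w \<and>
          T13.rep w (tpoint (w, T13.rep w Y + l)) - (T13.rep w Y + l) \<in> int_lattice"
        if Y: "Y \<in> over w" and l: "restrict_cov A l \<in> int_lattice" "restrict_cov A'' l \<in> int_lattice" for Y l
      proof -
        have S: "(w, T13.rep w Y + l) \<in> T13.S" by (rule T13.fibre_shift[OF T13.rep_mem(2)[OF Y] l])
        have d: "T13.rep w (tpoint (w, T13.rep w Y + l)) - (T13.rep w Y + l) \<in> int_lattice" by (rule T13.rep_tpoint[OF S])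
        have "tpoint (w, T13.rep w (tpoint (w, T13.rep w Y + l)) - l) = tpoint (w, T13.rep w Y)"
          unfolding tpoint_eq_iff diff_Pair int_lattice_Pair_iff using d by (simp add: diff_diff_eq add.commute)
        then show ?thesis using d T13.point_over_mem[OF S] T13.rep_mem(3)[OF Y] by simp
      qed
      have "\<Sigma> = (\<Sum>Y\<in>over w. character m (restrict_cov A' (T13.rep w (tpoint (w, T13.rep w Y + k)))))"
        unfolding \<Sigma>_def
      proof (rule sum.reindex_bij_witness[of _ "\<lambda>Y. tpoint (w, T13.rep w Y + k)" "\<lambda>Y. tpoint (w, T13.rep w Y + (- k))"])
        fix Y assume Y: "Y \<in> over w"
        show "tpoint (w, T13.rep w Y + (- k)) \<in> over w" using tr[OF Y nk] by blast
        show "tpoint (w, T13.rep w Y + k) \<in> over w" using tr[OF Y k] by blast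
        show 1: "tpoint (w, T13.rep w (tpoint (w, T13.rep w Y + (- k))) + k) = Y" using tr[OF Y nk] by simp
        show "tpoint (w, T13.rep w (tpoint (w, T13.rep w Y + k)) + (- k)) = Y" using tr[OF Y k] by simp
        show "character m (restrict_cov A' (T13.rep w (tpoint (w, T13.rep w (tpoint (w, T13.rep w Y + - k)) + k)))) =
            character m (restrict_cov A' (T13.rep w Y))" by (simp only: 1)
      qed
      also have "\<dots> = (\<Sum>Y\<in>over w. character m (restrict_cov A' k) * character m (restrict_cov A' (T13.rep w Y)))"
      proof (rule sum.cong)
        fix Y assume Y: "Y \<in> over w"
        define d where "d = T13.rep w (tpoint (w, T13.rep w Y + k)) - (T13.rep w Y + k)"
        have d: "d \<in> int_lattice" using tr[OF Y k] by (simp add: d_def)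
        have e: "T13.rep w (tpoint (w, T13.rep w Y + k)) = d + T13.rep w Y + k" by (simp add: d_def)
        have "restrict_cov A' d \<in> int_lattice"
          using d by (auto simp: restrict_cov_def int_lattice_prod_iff transpose_real_mat_lattice)
        then have "character m (restrict_cov A' d) = 1" using m by simp
        then show "character m (restrict_cov A' (T13.rep w (tpoint (w, T13.rep w Y + k)))) =
            character m (restrict_cov A' k) * character m (restrict_cov A' (T13.rep w Y))"
          unfolding e by (simp add: character_add)
      qed simp
      finally show ?thesis unfolding sum_distrib_left[symmetric] \<Sigma>_def[symmetric] .
    qed
    have "\<Sigma> = 0"
    proof (rule ccontr)
      assume "\<Sigma> \<noteq> 0"
      then have int: "restrict_cov A k \<bullet> g + restrict_cov A'' k \<bullet> s \<in> \<int>"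
        if "restrict_cov A k \<in> int_lattice" "restrict_cov A'' k \<in> int_lattice" for k
        using inv[OF that] mid[of k] by (simp add: character_eq_1_iff)
      have "g \<in> int_lattice"
      proof (rule inner_lattice_int)
        fix t :: "real^'n" assume t: "t \<in> int_lattice"
        obtain k where "restrict_cov A k = t" "restrict_cov A'' k = 0" by (rule restrict_cov_pair[OF T13.transverse])
        then show "g \<bullet> t \<in> \<int>" using int[of k] t by (simp add: inner_commute)
      qed
      moreover have "s \<in> int_lattice"
      proof (rule inner_lattice_int)
        fix t :: "real^'n" assume t: "t \<in> int_lattice"
        obtain k where "restrict_cov A k = 0" "restrict_cov A'' k = t" by (rule restrict_cov_pair[OF T13.transverse])
        then show "s \<bullet> t \<in> \<int>" using int[of k] t by (simp add: inner_commute)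
      qed
      ultimately have "(g, s) \<in> int_triangles" using gs(1) by (simp add: int_triangles_def)
      then show False using False gs(2) by force
    qed
    then show ?thesis using False by (simp add: \<Sigma>_def)
  qed
qed

text \<open>Apply \<open>mu2_doubled_poisson\<close> and sum over the fibre. Only the integral triangles \<open>k\<close> survive; each turns the
sum over the triangles \<open>t\<close> into the sum of the contributions of the translated triangles, which is the product
in \<open>T\<close> again, as translation by \<open>k\<close> permutes the triangles.\<close>

theorem product_identity:
  obtains C where "C \<noteq> 0"
    "\<And>a b. a \<in> HF L L' \<Longrightarrow> b \<in> HF L' L'' \<Longrightarrow>
      u_product b a =
      cscale (C * (\<Sum>\<^sub>\<infinity>k\<in>int_triangles. shift_factor k)) (pullback T13.M T13.M' (torus_product b a))"
proof -
  obtain \<kappa> where \<kappa>: "\<kappa> \<noteq> 0"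
    "\<And>a b w x'. a \<in> HF L L' \<Longrightarrow> b \<in> HF L' L'' \<Longrightarrow> (w, x') \<in> T13.S \<Longrightarrow>
      doubled_product b a (w, x') =
      \<kappa> * (\<Sum>\<^sub>\<infinity>t\<in>tri w. \<Sum>\<^sub>\<infinity>m\<in>int_lattice. character m (zeta0 w x' (fst t)) * dual_term b a w t m)"
    by (rule mu2_doubled_poisson) (erule that, simp only:)
  \<comment> \<open>all fibres have the same cardinality; without intersection points any positive number will do\<close>
  define N where "N = (if base = {} then 1 else card (over (SOME w. w \<in> base)))"
  have N: "card (over w) = N" if "w \<in> base" for w
  proof -
    have "(SOME w. w \<in> base) \<in> base" using that by (rule someI)
    then show ?thesis using T13.card_points_over(1)[OF that] that by (auto simp: N_def)
  qed
  have N0: "N > 0"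
  proof (cases "base = {}")
    case False
    then obtain w where "w \<in> base" by blast
    then show ?thesis using N T13.card_points_over(2) by metis
  qed (simp add: N_def)
  define d :: complex where "d = of_int \<bar>det (D'' - D)\<bar>"
  have "det (D'' - D) \<noteq> 0"
    by (rule invertible_real_mat_det) (use T13.transverse in \<open>simp add: real_mat_diff\<close>)
  then have d0: "d \<noteq> 0" by (simp add: d_def)
  show ?thesis
  proof (rule that)
    show "\<kappa> * of_nat N / d \<noteq> 0" using \<kappa> N0 d0 by simp
    fix a b assume a: "a \<in> HF L L'" and b: "b \<in> HF L' L''"
    let ?\<mu> = "doubled_product b a"
    have sum: "(\<Sum>Y\<in>over w. ?\<mu> (w, T13.rep w Y)) = \<kappa> * of_nat N * ((\<Sum>\<^sub>\<infinity>k\<in>int_triangles. shift_factor k) * torus_product b a w)"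
      if z: "(w, x1) \<in> T13.S" for w x1
    proof -
      have wb: "w \<in> base" using T13.fst_S[OF z] by simp
      define f where "f x t m = character m (zeta0 w x (fst t)) * dual_term b a w t m" for x t m
      have fs: "(\<lambda>(t, m). f x t m) summable_on tri w \<times> int_lattice" for x
      proof (rule abs_summable_summable)
        show "(\<lambda>y. norm (case y of (t, m) \<Rightarrow> f x t m)) summable_on tri w \<times> int_lattice"
          using dual_term_summable[OF a b, of w] by (simp add: f_def norm_mult case_prod_unfold)
      qed
      have fs1: "f x t summable_on int_lattice" if "t \<in> tri w" for x t
        using summable_on_SigmaD1[OF fs that] by simp
      have fs2: "(\<lambda>t. \<Sum>\<^sub>\<infinity>m\<in>int_lattice. f x t m) summable_on tri w" for x
        using summable_on_Sigma_banach[OF fs] .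
      have fY: "(\<Sum>Y\<in>over w. f (T13.rep w Y) t m) =
          (if m \<in> (\<lambda>k. fst k + snd k) ` int_triangles then of_nat N * f x1 t m else 0)" if m: "m \<in> int_lattice" for t m
      proof -
        have c: "character m (zeta0 w x (fst t)) = character m (restrict_cov A' x) *
            (inverse (character m (restrict_cov A' (cov_B \<tau> (fst t - w)))) * inverse (character m (lift_offset (fst t))))" for x
          unfolding zeta0_def restrict_cov_simps(3) character_diff(2) divide_inverse by (rule mult.assoc)
        have "(\<Sum>Y\<in>over w. f (T13.rep w Y) t m) = (\<Sum>Y\<in>over w. character m (restrict_cov A' (T13.rep w Y))) *
            (inverse (character m (restrict_cov A' (cov_B \<tau> (fst t - w)))) * inverse (character m (lift_offset (fst t))) * dual_term b a w t m)"
          unfolding f_def c sum_distrib_right by (simp only: mult.assoc)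
        then show ?thesis
          unfolding character_sum_over_fibre[OF m z] N[OF wb] f_def c by simp
      qed
      have "(\<Sum>Y\<in>over w. ?\<mu> (w, T13.rep w Y)) = (\<Sum>Y\<in>over w. \<kappa> * (\<Sum>\<^sub>\<infinity>t\<in>tri w. \<Sum>\<^sub>\<infinity>m\<in>int_lattice. f (T13.rep w Y) t m))"
        using \<kappa>(2)[OF a b T13.rep_mem(2)] by (intro sum.cong refl) (simp add: f_def)
      also have "\<dots> = \<kappa> * (\<Sum>Y\<in>over w. \<Sum>\<^sub>\<infinity>t\<in>tri w. \<Sum>\<^sub>\<infinity>m\<in>int_lattice. f (T13.rep w Y) t m)"
        by (rule sum_distrib_left[symmetric])
      also have "(\<Sum>Y\<in>over w. \<Sum>\<^sub>\<infinity>t\<in>tri w. \<Sum>\<^sub>\<infinity>m\<in>int_lattice. f (T13.rep w Y) t m) =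
          (\<Sum>\<^sub>\<infinity>t\<in>tri w. \<Sum>Y\<in>over w. \<Sum>\<^sub>\<infinity>m\<in>int_lattice. f (T13.rep w Y) t m)"
        by (rule sum_infsum_swap(1)[OF T13.finite_over fs2])
      also have "\<dots> = (\<Sum>\<^sub>\<infinity>t\<in>tri w. of_nat N * (\<Sum>\<^sub>\<infinity>k\<in>int_triangles. shift_factor k * torus_term b a w (shift k t)))"
      proof (rule infsum_cong)
        fix t assume t: "t \<in> tri w"
        have "(\<Sum>Y\<in>over w. \<Sum>\<^sub>\<infinity>m\<in>int_lattice. f (T13.rep w Y) t m) = (\<Sum>\<^sub>\<infinity>m\<in>int_lattice. \<Sum>Y\<in>over w. f (T13.rep w Y) t m)"
          by (rule sum_infsum_swap(1)[OF T13.finite_over fs1[OF t]])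
        also have "\<dots> = (\<Sum>\<^sub>\<infinity>m\<in>(\<lambda>k. fst k + snd k) ` int_triangles. of_nat N * f x1 t m)"
          by (rule infsum_cong_neutral) (use int_triangles_sum_int fY in auto)
        also have "\<dots> = (\<Sum>\<^sub>\<infinity>k\<in>int_triangles. of_nat N * (shift_factor k * torus_term b a w (shift k t)))"
          unfolding infsum_reindex[OF inj_int_triangles_sum] o_def
          by (rule infsum_cong) (simp add: f_def shift_term[OF a b z _ t])
        also have "\<dots> = of_nat N * (\<Sum>\<^sub>\<infinity>k\<in>int_triangles. shift_factor k * torus_term b a w (shift k t))" by (rule infsum_cmult_right')
        finally show "(\<Sum>Y\<in>over w. \<Sum>\<^sub>\<infinity>m\<in>int_lattice. f (T13.rep w Y) t m) = of_nat N * (\<Sum>\<^sub>\<infinity>k\<in>int_triangles. shift_factor k * torus_term b a w (shift k t))" .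
      qed
      also have "\<dots> = of_nat N * (\<Sum>\<^sub>\<infinity>t\<in>tri w. \<Sum>\<^sub>\<infinity>k\<in>int_triangles. shift_factor k * torus_term b a w (shift k t))" by (rule infsum_cmult_right')
      also have "(\<Sum>\<^sub>\<infinity>t\<in>tri w. \<Sum>\<^sub>\<infinity>k\<in>int_triangles. shift_factor k * torus_term b a w (shift k t)) = (\<Sum>\<^sub>\<infinity>k\<in>int_triangles. \<Sum>\<^sub>\<infinity>t\<in>tri w. shift_factor k * torus_term b a w (shift k t))"
      proof (rule infsum_swap_banach)
        have eq: "((\<lambda>(t, m). f x1 t m) \<circ> (\<lambda>(t, k). (t, fst k + snd k))) y = (\<lambda>(t, k). shift_factor k * torus_term b a w (shift k t)) y"
          if "y \<in> tri w \<times> int_triangles" for y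
          using shift_term[OF a b z, of "snd y" "fst y"] that by (simp add: f_def case_prod_unfold mem_Times_iff)
        have inj: "inj_on (\<lambda>(t, k). (t, fst k + snd k)) (tri w \<times> int_triangles)"
          using inj_int_triangles_sum by (auto simp: inj_on_def)
        have "(\<lambda>(t, m). f x1 t m) summable_on (\<lambda>(t, k). (t, fst k + snd k)) ` (tri w \<times> int_triangles)"
          by (rule summable_on_subset_banach[OF fs]) (use int_triangles_sum_int in auto)
        then have "((\<lambda>(t, m). f x1 t m) \<circ> (\<lambda>(t, k). (t, fst k + snd k))) summable_on tri w \<times> int_triangles"
          by (simp only: summable_on_reindex[OF inj])
        then show "(\<lambda>(t, k). shift_factor k * torus_term b a w (shift k t)) summable_on tri w \<times> int_triangles"
          by (rule summable_on_cong[THEN iffD1, rotated]) (rule eq)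
      qed
      also have "\<dots> = (\<Sum>\<^sub>\<infinity>k\<in>int_triangles. shift_factor k * torus_product b a w)"
      proof (rule infsum_cong)
        fix k assume k: "k \<in> int_triangles"
        show "(\<Sum>\<^sub>\<infinity>t\<in>tri w. shift_factor k * torus_term b a w (shift k t)) = shift_factor k * torus_product b a w"
          unfolding infsum_cmult_right' mu2_torus infsum_reindex_bij_betw[OF shift_bij[OF k]] ..
      qed
      also have "\<dots> = (\<Sum>\<^sub>\<infinity>k\<in>int_triangles. shift_factor k) * torus_product b a w" by (rule infsum_cmult_left')
      finally show ?thesis by (simp only: mult.assoc)
    qed
    show "u_product b a =
      cscale (\<kappa> * of_nat N / d * (\<Sum>\<^sub>\<infinity>k\<in>int_triangles. shift_factor k)) (pullback T13.M T13.M' (torus_product b a))"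
    proof
      fix x :: "'n V \<times> 'n V"
      show "u_product b a x =
        cscale (\<kappa> * of_nat N / d * (\<Sum>\<^sub>\<infinity>k\<in>int_triangles. shift_factor k)) (pullback T13.M T13.M' (torus_product b a)) x"
      proof (cases "x \<in> T13.S")
        case True
        then have "(fst x, snd x) \<in> T13.S" by simp
        from sum[OF this] True show ?thesis
          unfolding mu2_u_def T13.Pi_T_apply cscale_def pullback_def d_def[symmetric] by simp
      next
        case False
        then show ?thesis unfolding mu2_u_def T13.Pi_T_apply cscale_def pullback_def by (simp only: if_False mult_zero_right)
      qed
    qed
  qed
qed

end

section \<open>The theta constant\<close>

context signed_brane
begin

text \<open>A quadratic function modulo \<open>2\<close> satisfies the parallelogram law, whose right hand side is even.\<close>

lemma sign_parallelogram:
  assumes g: "\<gamma> \<in> H1 L" and g': "\<gamma>' \<in> H1 L"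
  shows "minus_one_pow (\<xi> (\<gamma> + \<gamma>')) * minus_one_pow (\<xi> (\<gamma> - \<gamma>')) = 1"
proof -
  have n: "- \<gamma>' \<in> H1 L" using g' by (simp add: H1_def tangent_minus)
  have z: "0 \<in> H1 L" using H1_add[OF g' n] by simp
  have "minus_one_pow (\<xi> 0) = minus_one_pow (\<xi> 0) * minus_one_pow (\<xi> 0)"
    using sign_add[OF z z] by simp
  then have 0: "minus_one_pow (\<xi> 0) = 1" by (simp only: minus_one_pow_square)
  have Fn: "brane_F \<Phi> \<gamma> (- \<gamma>') = - brane_F \<Phi> \<gamma> \<gamma>'" "brane_F \<Phi> \<gamma>' (- \<gamma>') = 0"
    by (simp_all add: bilinear_rneg[OF bilinear_F])
  have 1: "minus_one_pow (\<xi> \<gamma>') * minus_one_pow (\<xi> (- \<gamma>')) = 1"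
    using sign_add[OF g' n] 0 Fn by simp
  have "minus_one_pow (\<xi> (\<gamma> + \<gamma>')) * minus_one_pow (\<xi> (\<gamma> - \<gamma>')) =
    (minus_one_pow (\<xi> \<gamma>) * minus_one_pow (\<xi> \<gamma>)) * (minus_one_pow (\<xi> \<gamma>') * minus_one_pow (\<xi> (- \<gamma>')))"
  proof -
    have gen: "a * b * e * (a * n * inverse e) = (a * a) * (b * n)" if "e \<noteq> 0" for a b n e :: complex
      using that by (simp add: field_simps)
    have "minus_one_pow (\<xi> (\<gamma> - \<gamma>')) =
      minus_one_pow (\<xi> \<gamma>) * minus_one_pow (\<xi> (- \<gamma>')) * inverse (exp (of_real pi * \<i> * of_real (brane_F \<Phi> \<gamma> \<gamma>')))"
      using sign_add[OF g n] Fn by (simp add: exp_minus)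
    then show ?thesis unfolding sign_add[OF g g'] by (simp only: gen[OF exp_not_eq_zero])
  qed
  then show ?thesis by (simp only: 1 minus_one_pow_square mult_1_right)
qed

end

text \<open>On \<open>H1 L\<close> the form \<open>F\<close> is given by an integral antisymmetric matrix \<open>N\<close>. Its strictly upper triangular part \<open>q\<close>,
with respect to some linear order of the indices, satisfies \<open>F g h = q g h - q h g\<close>, so that \<open>q g g\<close> is a quadratic
refinement of \<open>F\<close> modulo \<open>2\<close>.\<close>

lemma exists_lift_sign:
  assumes mb: "mirror_brane \<tau> D c (L :: 'n::finite V brane)"
  shows "\<exists>\<xi>. lift_sign (torus_form \<tau>) L \<xi>"
proof -
  let ?X = "Re_mat \<tau>" and ?A = "real_mat D"
  define N where "N = ?X ** ?A - transpose ?A ** transpose ?X"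
  have N: "N $ i $ j \<in> \<int>" for i j using mb unfolding mirror_brane_def N_def by blast
  have anti: "N $ i $ j = - N $ j $ i" for i j
    by (simp add: N_def transpose_def matrix_matrix_mult_def mult.commute)
  then have diag: "N $ i $ i = 0" for i by (metis equal_neg_zero)
  \<comment> \<open>the order of the indices\<close>
  obtain f :: "'n \<Rightarrow> nat" where f: "inj f" using finite_imp_inj_to_nat_seg[of "UNIV :: 'n set"] by auto
  define q where "q g h = (\<Sum>i\<in>UNIV. \<Sum>j\<in>UNIV. (if f i < f j then N $ i $ j * g $ i * h $ j else 0))" for g h :: "real^'n"
  have q_add: "q (g + h) k = q g k + q h k" "q k (g + h) = q k g + q k h" for g h k
    by (simp_all add: q_def sum.distrib[symmetric] algebra_simps if_distrib cong: sum.cong if_cong)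
  have q_int: "q g h \<in> \<int>" if "g \<in> int_lattice" "h \<in> int_lattice" for g h
    unfolding q_def using that N by (intro Ints_sum) (auto simp: int_lattice_vec_iff)
  have F: "brane_F (torus_form \<tau>) (graph_vec ?A g) (graph_vec ?A h) = q g h - q h g" for g h
  proof -
    have "brane_F (torus_form \<tau>) (graph_vec ?A g) (graph_vec ?A h) = g \<bullet> (N *v h)"
    proof -
      have "h \<bullet> (?X *v (?A *v g)) = g \<bullet> (transpose ?A *v (transpose ?X *v h))"
        by (simp only: inner_commute[of g] transpose_inner)
      then show ?thesis
        by (simp add: brane_F_eq B_form_eq graph_vec_def N_def matrix_vector_mult_diff_rdistrib inner_diff_right
            matrix_vector_mul_assoc[symmetric] linear_neg[OF matrix_vector_mul_linear])
    qed
    also have "\<dots> = (\<Sum>i\<in>UNIV. \<Sum>j\<in>UNIV. N $ i $ j * g $ i * h $ j)"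
      by (simp add: inner_vec_def matrix_vector_mult_def sum_distrib_left mult_ac)
    also have "\<dots> = (\<Sum>i\<in>UNIV. \<Sum>j\<in>UNIV. (if f i < f j then N $ i $ j * g $ i * h $ j else 0) -
        (if f j < f i then N $ j $ i * h $ j * g $ i else 0))"
    proof (intro sum.cong refl)
      fix i j :: 'n
      show "N $ i $ j * g $ i * h $ j = (if f i < f j then N $ i $ j * g $ i * h $ j else 0) -
        (if f j < f i then N $ j $ i * h $ j * g $ i else 0)"
      proof (cases "i = j")
        case True
        then show ?thesis using diag by simp
      next
        case False
        then have "f i \<noteq> f j" using f by (auto dest: injD)
        then show ?thesis using anti[of i j] by (cases "f i < f j") auto
      qed
    qed
    also have "\<dots> = q g h - (\<Sum>i\<in>UNIV. \<Sum>j\<in>UNIV. if f j < f i then N $ j $ i * h $ j * g $ i else 0)"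
      by (simp only: q_def sum_subtractf)
    also have "(\<Sum>i\<in>UNIV. \<Sum>j\<in>UNIV. if f j < f i then N $ j $ i * h $ j * g $ i else 0) = q h g"
      unfolding q_def by (rule sum.swap)
    finally show ?thesis .
  qed
  define \<xi> where "\<xi> \<gamma> = \<lfloor>q (fst \<gamma>) (fst \<gamma>)\<rfloor>" for \<gamma> :: "'n V"
  have "lift_sign (torus_form \<tau>) L \<xi>"
    unfolding lift_sign_def mirror_brane_H1[OF mb]
  proof (intro ballI)
    fix \<gamma> \<gamma>' assume "\<gamma> \<in> graph_vec ?A ` int_lattice" "\<gamma>' \<in> graph_vec ?A ` int_lattice"
    then obtain g h where gh: "\<gamma> = graph_vec ?A g" "\<gamma>' = graph_vec ?A h" and g: "g \<in> int_lattice" and h: "h \<in> int_lattice"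
      by blast
    have fl: "of_int \<lfloor>q x y\<rfloor> = q x y" if "x \<in> int_lattice" "y \<in> int_lattice" for x y
      using q_int[OF that] by (auto elim: Ints_cases)
    have "of_int (\<xi> (graph_vec ?A g + graph_vec ?A h) - \<xi> (graph_vec ?A g) - \<xi> (graph_vec ?A h)) = q (g + h) (g + h) - q g g - q h h"
      unfolding \<xi>_def fst_add fst_graph_vec of_int_diff by (simp only: fl g h int_lattice_add)
    also have "\<dots> = (q g h - q h g) + 2 * q h g" by (simp add: q_add)
    also have "\<dots> = brane_F (torus_form \<tau>) (graph_vec ?A g) (graph_vec ?A h) + 2 * of_int \<lfloor>q h g\<rfloor>"
      by (simp only: F fl g h)
    finally show "\<exists>k. of_int (\<xi> (\<gamma> + \<gamma>') - \<xi> \<gamma> - \<xi> \<gamma>') = brane_F (torus_form \<tau>) \<gamma> \<gamma>' + 2 * of_int k"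
      unfolding gh by (rule exI)
  qed
  then show ?thesis by blast
qed

text \<open>Adding a homomorphism from \<open>H1 L\<close> to the integers leaves the difference \<open>\<xi> (\<gamma> + \<gamma>') - \<xi> \<gamma> - \<xi> \<gamma>'\<close> unchanged.\<close>

lemma lift_sign_twist:
  assumes mb: "mirror_brane \<tau> D c L" and sg: "lift_sign (torus_form \<tau>) L \<xi>" and e: "\<epsilon> \<in> int_lattice"
  shows "lift_sign (torus_form \<tau>) L (\<lambda>\<gamma>. \<xi> \<gamma> + \<lfloor>\<epsilon> \<bullet> fst \<gamma>\<rfloor>)"
  unfolding lift_sign_def
proof (intro ballI)
  fix \<gamma> \<gamma>' assume g: "\<gamma> \<in> H1 L" "\<gamma>' \<in> H1 L"
  have "\<epsilon> \<bullet> fst \<gamma> \<in> \<int>" "\<epsilon> \<bullet> fst \<gamma>' \<in> \<int>"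
    using g e by (auto simp: H1_def int_lattice_prod_iff intro!: int_lattice_inner)
  then have "\<lfloor>\<epsilon> \<bullet> fst (\<gamma> + \<gamma>')\<rfloor> = \<lfloor>\<epsilon> \<bullet> fst \<gamma>\<rfloor> + \<lfloor>\<epsilon> \<bullet> fst \<gamma>'\<rfloor>"
    by (auto simp: inner_add_right elim!: Ints_cases)
  then have e: "\<xi> (\<gamma> + \<gamma>') + \<lfloor>\<epsilon> \<bullet> fst (\<gamma> + \<gamma>')\<rfloor> - (\<xi> \<gamma> + \<lfloor>\<epsilon> \<bullet> fst \<gamma>\<rfloor>) - (\<xi> \<gamma>' + \<lfloor>\<epsilon> \<bullet> fst \<gamma>'\<rfloor>) =
      \<xi> (\<gamma> + \<gamma>') - \<xi> \<gamma> - \<xi> \<gamma>'" by simp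
  show "\<exists>k. of_int (\<xi> (\<gamma> + \<gamma>') + \<lfloor>\<epsilon> \<bullet> fst (\<gamma> + \<gamma>')\<rfloor> - (\<xi> \<gamma> + \<lfloor>\<epsilon> \<bullet> fst \<gamma>\<rfloor>) - (\<xi> \<gamma>' + \<lfloor>\<epsilon> \<bullet> fst \<gamma>'\<rfloor>)) =
      brane_F (torus_form \<tau>) \<gamma> \<gamma>' + 2 * of_int k"
    unfolding e using sg g unfolding lift_sign_def by blast
qed

context mirror_triple
begin

lemma norm_gauss: "norm (gauss k) = exp (- (pi * ((fst k + snd k) \<bullet> Hi (fst k + snd k))))"
  by (simp add: gauss_def norm_exp_eq_Re)

lemma gauss_summable:
  assumes "0 < n"
  shows "(\<lambda>k. norm (gauss k ^ n)) summable_on int_triangles"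
proof -
  obtain \<delta> where \<delta>: "0 < \<delta>" "\<And>x. \<delta> * (norm x)\<^sup>2 \<le> x \<bullet> Hi x"
    using positive_definite_bound[OF Hi_props(1) G.inv_pos] by blast
  show ?thesis
  proof (rule gaussian_summable_on_coset[of "real n * (pi * \<delta>)" "\<lambda>k. fst k + snd k" _ _ 1])
    show "norm (gauss k ^ n) \<le> 1 * exp (- (real n * (pi * \<delta>)) * (norm (fst k + snd k))\<^sup>2)" for k
    proof -
      have "real n * (pi * (\<delta> * (norm (fst k + snd k))\<^sup>2)) \<le> real n * (pi * ((fst k + snd k) \<bullet> Hi (fst k + snd k)))"
        by (intro mult_left_mono \<delta>) auto
      then show ?thesis by (simp only: norm_power norm_gauss exp_of_nat_mult[symmetric] exp_le_cancel_iff mult_1_left) (simp add: mult.assoc)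
    qed
    show "(fst k + snd k) - (fst l + snd l) \<in> int_lattice" if "k \<in> int_triangles" "l \<in> int_triangles" for k l
      using int_triangles_sum_int that by (intro int_lattice_diff) blast+
  qed (use \<delta> assms inj_int_triangles_sum in auto)
qed

text \<open>The exponent of \<open>gauss\<close> is a quadratic form.\<close>

lemma gauss_parallelogram: "gauss (k + l) * gauss (k - l) = gauss k ^ 2 * gauss l ^ 2"
proof -
  define Q where "Q k = (fst k + snd k) \<bullet> Hi (fst k + snd k)" for k :: "'n V"
  have Q: "Q (k + l) + Q (k - l) = 2 * Q k + 2 * Q l" for k l
    unfolding Q_def by (simp add: inner_add_left inner_add_right inner_diff_left inner_diff_right)
  define R where "R k = B_form \<tau> (g1 k) (g2 k)" for k
  have R: "R (k + l) + R (k - l) = 2 * R k + 2 * R l" for k l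
    unfolding R_def by (simp add: bilinear_ladd[OF bilinear_B_form] bilinear_radd[OF bilinear_B_form] bilinear_lsub[OF bilinear_B_form]
        bilinear_rsub[OF bilinear_B_form] bilinear_rneg[OF bilinear_B_form])
  have g: "gauss k = exp (- of_real pi * \<i> * of_real (R k) - of_real (pi * Q k))" for k
    by (simp only: gauss_def R_def Q_def)
  have "gauss (k + l) * gauss (k - l) = exp (- of_real pi * \<i> * of_real (R (k + l) + R (k - l)) - of_real (pi * (Q (k + l) + Q (k - l))))"
    unfolding g exp_add[symmetric] by (simp add: algebra_simps)
  also have "\<dots> = gauss k ^ 2 * gauss l ^ 2"
    unfolding Q R g exp_double[symmetric] exp_add[symmetric] by (simp add: algebra_simps)
  finally show ?thesis .
qed

text \<open>The signs cancel in \<open>c (k + l) c (k - l)\<close> by \<open>sign_parallelogram\<close>, which leaves the Gaussians.\<close>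

lemma theta_constant_twist:
  "\<exists>\<epsilon>\<in>int_lattice. (\<Sum>\<^sub>\<infinity>k\<in>int_triangles. character (\<epsilon> /\<^sub>R 2) k * shift_factor k) \<noteq> 0"
proof (rule theta_constant_nonzero[where d = "\<lambda>k. gauss k ^ 2"])
  show "int_triangles \<subseteq> int_lattice" by (auto simp: int_triangles_def int_lattice_Pair_iff)
  show "0 \<in> int_triangles" by (simp add: int_triangles_def zero_prod_def)
  show "k + l \<in> int_triangles" "k - l \<in> int_triangles" if "k \<in> int_triangles" "l \<in> int_triangles" for k l
    using that by (auto simp: int_triangles_def matrix_vector_right_distrib matrix_vector_mult_diff_distrib)
  show "l \<in> int_triangles" if "l \<in> int_lattice" "2 *\<^sub>R l \<in> int_triangles" for l
    using that by (auto simp: int_triangles_def int_lattice_prod_iff case_prod_unfold matrix_vector_mult_scaleR)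
  have "norm (sign_product k) = 1" for k by (simp add: sign_product_def norm_mult)
  then show "(\<lambda>k. norm (shift_factor k)) summable_on int_triangles"
    using gauss_summable[of 1] by (simp add: shift_factor_def norm_mult)
  show "(\<lambda>k. norm (gauss k ^ 2)) summable_on int_triangles" by (rule gauss_summable) simp
  show "shift_factor (k + l) * shift_factor (k - l) = gauss k ^ 2 * gauss l ^ 2" if kl: "k \<in> int_triangles" "l \<in> int_triangles" for k l
  proof -
    have g: "g1 (k + l) = g1 k + g1 l" "g1 (k - l) = g1 k - g1 l" "g2 (k + l) = g2 k + g2 l" "g2 (k - l) = g2 k - g2 l"
      "g3 (k + l) = g3 k + g3 l" "g3 (k - l) = g3 k - g3 l" by simp_all
    have "sign_product (k + l) * sign_product (k - l) =
      (minus_one_pow (\<xi> (g1 k + g1 l)) * minus_one_pow (\<xi> (g1 k - g1 l))) *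
      (minus_one_pow (\<xi>' (g2 k + g2 l)) * minus_one_pow (\<xi>' (g2 k - g2 l))) *
      (minus_one_pow (\<xi>'' (g3 k + g3 l)) * minus_one_pow (\<xi>'' (g3 k - g3 l)))"
      unfolding sign_product_def g by (simp only: mult_ac)
    also have "\<dots> = 1"
      by (simp only: T12.B.sign_parallelogram[OF int_triangles_H1(1)[OF kl(1)] int_triangles_H1(1)[OF kl(2)]]
          T12.B'.sign_parallelogram[OF int_triangles_H1(2)[OF kl(1)] int_triangles_H1(2)[OF kl(2)]]
          T23.B'.sign_parallelogram[OF int_triangles_H1(3)[OF kl(1)] int_triangles_H1(3)[OF kl(2)]] mult_1_right)
    finally have s: "sign_product (k + l) * sign_product (k - l) = 1" .
    have "shift_factor (k + l) * shift_factor (k - l) = (sign_product (k + l) * sign_product (k - l)) * (gauss (k + l) * gauss (k - l))"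
      unfolding shift_factor_def by (simp only: mult_ac)
    then show ?thesis by (simp only: s gauss_parallelogram mult_1_left)
  qed
  show "gauss 0 ^ 2 \<noteq> 0" by (simp add: gauss_def)
qed

text \<open>The vertical maps are the pullbacks, the third one multiplied by the constant of \<open>product_identity\<close>.\<close>

lemma products_correspond_if:
  assumes "(\<Sum>\<^sub>\<infinity>k\<in>int_triangles. shift_factor k) \<noteq> 0"
  shows "products_correspond \<tau> D D'' L L' L'' T12.M T12.M' T23.M'"
proof -
  obtain C where C: "C \<noteq> 0"
    "\<And>a b. a \<in> HF L L' \<Longrightarrow> b \<in> HF L' L'' \<Longrightarrow>
      u_product b a =
      cscale (C * (\<Sum>\<^sub>\<infinity>k\<in>int_triangles. shift_factor k)) (pullback T13.M T13.M' (torus_product b a))"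
    by (rule product_identity) (erule that, simp only:)
  have "C * (\<Sum>\<^sub>\<infinity>k\<in>int_triangles. shift_factor k) \<noteq> 0" using C(1) assms by simp
  from T13.linear_iso_pullback[OF this] T12.linear_iso_pullback[of 1] T23.linear_iso_pullback[of 1] C(2)
  show ?thesis
    unfolding products_correspond_def by (simp only: cfun.scale_one one_neq_zero simp_thms not_False_eq_True) (metis (no_types, lifting))
qed

lemma theta_constant_nonzero_if:
  assumes "x \<in> HF_u L' L'' T12.M' T23.M'" "y \<in> HF_u L L' T12.M T12.M'"
    and "mu2_u \<tau> D D'' T12.M T12.M' T23.M' x y \<noteq> 0"
  shows "(\<Sum>\<^sub>\<infinity>k\<in>int_triangles. shift_factor k) \<noteq> 0"
proof
  assume z: "(\<Sum>\<^sub>\<infinity>k\<in>int_triangles. shift_factor k) = 0"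
  obtain C where C: "C \<noteq> 0"
    "\<And>a b. a \<in> HF L L' \<Longrightarrow> b \<in> HF L' L'' \<Longrightarrow>
      u_product b a =
      cscale (C * (\<Sum>\<^sub>\<infinity>k\<in>int_triangles. shift_factor k)) (pullback T13.M T13.M' (torus_product b a))"
    by (rule product_identity) (erule that, simp only:)
  obtain a where a: "a \<in> HF L L'" "y = pullback T12.M T12.M' a" using assms(2) unfolding T12.HF_u_eq by blast
  obtain b where b: "b \<in> HF L' L''" "x = pullback T23.M T23.M' b" using assms(1) unfolding T23.HF_u_eq by blast
  have "mu2_u \<tau> D D'' T12.M T12.M' T23.M' x y = 0"
    unfolding a(2) b(2) C(2)[OF a(1) b(1)] z by (simp add: cscale_def fun_eq_iff)
  then show False using assms(3) by simp
qed

end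

lemma positive_imp_invertible:
  fixes K :: "real^'n^'n"
  assumes "\<And>x. x \<noteq> 0 \<Longrightarrow> 0 < x \<bullet> ((Y ** K) *v x)"
  shows "invertible K"
proof -
  have "inj ((*v) K)"
  proof (subst linear_injective_0[OF matrix_vector_mul_linear], intro allI impI)
    fix x assume "K *v x = 0"
    then have "x \<bullet> ((Y ** K) *v x) = 0" by (simp add: matrix_vector_mul_assoc[symmetric])
    then show "x = 0" using assms[of x] by fastforce
  qed
  then show ?thesis using matrix_left_invertible_injective invertible_left_inverse by blast
qed

lemma ample_positive:
  assumes "invertible (Im_mat \<tau>)" "mirror_brane \<tau> D c L" "mirror_brane \<tau> D' c' L'" "ample_quotient \<tau> D D'" "x \<noteq> 0"
  shows "0 < x \<bullet> ((Im_mat \<tau> ** (real_mat D' - real_mat D)) *v x)"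
  using ample_quotient_iff[OF assms(1) mirror_brane_symmetric[OF assms(2)] mirror_brane_symmetric[OF assms(3)]] assms(4,5) by blast

lemma lifted_pairI:
  assumes "invertible (Im_mat \<tau>)" "mirror_brane \<tau> D c L" "mirror_brane \<tau> D' c' L'" "ample_quotient \<tau> D D'"
    "lift_sign (torus_form \<tau>) L \<xi>" "lift_sign (torus_form \<tau>) L' \<xi>'"
  shows "lifted_pair \<tau> D c L \<xi> D' c' L' \<xi>'"
  using assms positive_imp_invertible[OF ample_positive[OF assms(1-4)]] by (simp add: lifted_pair_def)

lemma mirror_tripleI:
  assumes Y: "invertible (Im_mat \<tau>)" and mb: "mirror_brane \<tau> D c L" "mirror_brane \<tau> D' c' L'" "mirror_brane \<tau> D'' c'' L''"
    and am: "ample_quotient \<tau> D D'" "ample_quotient \<tau> D' D''"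
    and sg: "lift_sign (torus_form \<tau>) L \<xi>" "lift_sign (torus_form \<tau>) L' \<xi>'" "lift_sign (torus_form \<tau>) L'' \<xi>''"
  shows "mirror_triple \<tau> D c L \<xi> D' c' L' \<xi>' D'' c'' L'' \<xi>''"
proof -
  note p = ample_positive[OF Y mb(1,2) am(1)] ample_positive[OF Y mb(2,3) am(2)]
  have "0 < x \<bullet> ((Im_mat \<tau> ** (real_mat D'' - real_mat D)) *v x)" if "x \<noteq> 0" for x
  proof -
    have "(real_mat D'' - real_mat D) *v x = (real_mat D' - real_mat D) *v x + (real_mat D'' - real_mat D') *v x"
      by (simp add: matrix_vector_mult_diff_rdistrib)
    then have "x \<bullet> ((Im_mat \<tau> ** (real_mat D'' - real_mat D)) *v x) =
      x \<bullet> ((Im_mat \<tau> ** (real_mat D' - real_mat D)) *v x) + x \<bullet> ((Im_mat \<tau> ** (real_mat D'' - real_mat D')) *v x)"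
      by (simp only: matrix_vector_mul_assoc[symmetric] matrix_vector_right_distrib inner_add_right)
    then show ?thesis using p[OF that] by simp
  qed
  then have "invertible (real_mat D'' - real_mat D)" by (rule positive_imp_invertible)
  then have "lifted_pair \<tau> D c L \<xi> D'' c'' L'' \<xi>''"
    using mb sg by (simp add: lifted_pair_def)
  then show ?thesis
    using lifted_pairI[OF Y mb(1,2) am(1) sg(1,2)] lifted_pairI[OF Y mb(2,3) am(2) sg(2,3)] Y p
    by (simp add: mirror_triple_def mirror_triple_axioms_def)
qed

text \<open>Half-integral characters of \<open>(g, s)\<close> are products of signs depending on \<open>g\<close> and on \<open>s\<close>. The first ones are
absorbed by a change of \<open>\<xi>\<close>, the second ones by a change of \<open>\<xi>''\<close>.\<close>

lemma exists_signs_products_correspond: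
  assumes Y: "invertible (Im_mat \<tau>)" and mb: "mirror_brane \<tau> D c L" "mirror_brane \<tau> D' c' L'" "mirror_brane \<tau> D'' c'' L''"
    and am: "ample_quotient \<tau> D D'" "ample_quotient \<tau> D' D''"
  shows "\<exists>\<xi> \<xi>' \<xi>''. lift_sign (torus_form \<tau>) L \<xi> \<and> lift_sign (torus_form \<tau>) L' \<xi>' \<and> lift_sign (torus_form \<tau>) L'' \<xi>'' \<and>
    products_correspond \<tau> D D'' L L' L'' (lift \<xi> L) (lift \<xi>' L') (lift \<xi>'' L'')"
proof -
  obtain \<xi> \<xi>' \<xi>'' where sg: "lift_sign (torus_form \<tau>) L \<xi>" "lift_sign (torus_form \<tau>) L' \<xi>'" "lift_sign (torus_form \<tau>) L'' \<xi>''"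
    using exists_lift_sign mb by metis
  interpret T: mirror_triple \<tau> D c L \<xi> D' c' L' \<xi>' D'' c'' L'' \<xi>'' by (rule mirror_tripleI[OF Y mb am sg])
  obtain \<epsilon> where e: "\<epsilon> \<in> int_lattice" "(\<Sum>\<^sub>\<infinity>k\<in>T.int_triangles. character (\<epsilon> /\<^sub>R 2) k * T.shift_factor k) \<noteq> 0"
    using T.theta_constant_twist by blast
  define \<xi>1 where "\<xi>1 \<gamma> = \<xi> \<gamma> + \<lfloor>fst \<epsilon> \<bullet> fst \<gamma>\<rfloor>" for \<gamma>
  \<comment> \<open>the edge over \<open>L''\<close> is the graph vector over \<open>- s\<close>, hence the minus sign\<close>
  define \<xi>3 where "\<xi>3 \<gamma> = \<xi>'' \<gamma> + \<lfloor>(- snd \<epsilon>) \<bullet> fst \<gamma>\<rfloor>" for \<gamma>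
  have e12: "fst \<epsilon> \<in> int_lattice" "- snd \<epsilon> \<in> int_lattice" using e(1) by (auto simp: int_lattice_prod_iff)
  have sg1: "lift_sign (torus_form \<tau>) L \<xi>1" unfolding \<xi>1_def[abs_def] by (rule lift_sign_twist[OF mb(1) sg(1) e12(1)])
  have sg3: "lift_sign (torus_form \<tau>) L'' \<xi>3" unfolding \<xi>3_def[abs_def] by (rule lift_sign_twist[OF mb(3) sg(3) e12(2)])
  interpret T': mirror_triple \<tau> D c L \<xi>1 D' c' L' \<xi>' D'' c'' L'' \<xi>3 by (rule mirror_tripleI[OF Y mb am sg1 sg(2) sg3])
  have "T'.shift_factor k = character (\<epsilon> /\<^sub>R 2) k * T.shift_factor k" if k: "k \<in> T.int_triangles" for k
  proof -
    have "fst \<epsilon> \<bullet> fst k \<in> \<int>" "snd \<epsilon> \<bullet> snd k \<in> \<int>"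
      using T.int_triangles_D(1,2)[OF k] e(1) by (auto simp: int_lattice_prod_iff intro!: int_lattice_inner)
    then obtain i j :: int where ij: "fst \<epsilon> \<bullet> fst k = of_int i" "snd \<epsilon> \<bullet> snd k = of_int j" by (auto elim!: Ints_cases)
    have "\<xi>1 (T.g1 k) = \<xi> (T.g1 k) + i" "\<xi>3 (T.g3 k) = \<xi>'' (T.g3 k) + j"
      unfolding \<xi>1_def \<xi>3_def fst_graph_vec by (simp_all add: ij del: graph_vec_simps)
    then have "T'.sign_product k = minus_one_pow (i + j) * T.sign_product k"
      unfolding T.sign_product_def T'.sign_product_def minus_one_pow_add by (simp only: minus_one_pow_add mult_ac)
    moreover have "minus_one_pow (i + j) = character (\<epsilon> /\<^sub>R 2) k"
      unfolding minus_one_pow_eq_exp character_def inner_scaleR_left inner_prod_def ij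
      by (intro arg_cong[of _ _ exp]) (simp add: ij)
    ultimately show ?thesis by (simp only: T.shift_factor_def T'.shift_factor_def mult.assoc)
  qed
  then have "(\<Sum>\<^sub>\<infinity>k\<in>T.int_triangles. T'.shift_factor k) = (\<Sum>\<^sub>\<infinity>k\<in>T.int_triangles. character (\<epsilon> /\<^sub>R 2) k * T.shift_factor k)" by (rule infsum_cong)
  then have "(\<Sum>\<^sub>\<infinity>k\<in>T.int_triangles. T'.shift_factor k) \<noteq> 0" using e(2) by (simp only: not_False_eq_True)
  from T'.products_correspond_if[OF this] show ?thesis using sg1 sg(2) sg3 by blast
qed

section \<open>The isomorphisms and the products\<close>

theorem theorem1p3:
  fixes \<tau> :: "complex^'n::finite^'n"
  assumes "invertible \<tau>" and "invertible (Im_mat \<tau>)"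
  shows
    "(\<forall>D D' c c' L L' \<xi> \<xi>'.
        mirror_brane \<tau> D c L \<and> mirror_brane \<tau> D' c' L' \<and> ample_quotient \<tau> D D' \<and>
        lift_sign (torus_form \<tau>) L \<xi> \<and> lift_sign (torus_form \<tau>) L' \<xi>' \<longrightarrow>
        (\<exists>f. linear_iso f (HF L L') (HF_u L L' (lift \<xi> L) (lift \<xi>' L')))) \<and>
     (\<forall>D D' D'' c c' c'' L L' L''.
        mirror_brane \<tau> D c L \<and> mirror_brane \<tau> D' c' L' \<and> mirror_brane \<tau> D'' c'' L'' \<and>
        ample_quotient \<tau> D D' \<and> ample_quotient \<tau> D' D'' \<longrightarrow>
        (\<forall>\<xi> \<xi>' \<xi>''.
          lift_sign (torus_form \<tau>) L \<xi> \<and> lift_sign (torus_form \<tau>) L' \<xi>' \<and>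
          lift_sign (torus_form \<tau>) L'' \<xi>'' \<and>
          (\<exists>x\<in>HF_u L' L'' (lift \<xi>' L') (lift \<xi>'' L''). \<exists>y\<in>HF_u L L' (lift \<xi> L) (lift \<xi>' L').
            mu2_u \<tau> D D'' (lift \<xi> L) (lift \<xi>' L') (lift \<xi>'' L'') x y \<noteq> 0) \<longrightarrow>
          products_correspond \<tau> D D'' L L' L'' (lift \<xi> L) (lift \<xi>' L') (lift \<xi>'' L'')) \<and>
        (\<exists>\<xi> \<xi>' \<xi>''.
          lift_sign (torus_form \<tau>) L \<xi> \<and> lift_sign (torus_form \<tau>) L' \<xi>' \<and>
          lift_sign (torus_form \<tau>) L'' \<xi>'' \<and>
          products_correspond \<tau> D D'' L L' L'' (lift \<xi> L) (lift \<xi>' L') (lift \<xi>'' L'')))"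
proof (intro conjI allI impI; elim conjE bexE)
  fix D D' c c' L L' \<xi> \<xi>'
  assume "mirror_brane \<tau> D c L" "mirror_brane \<tau> D' c' L'" "ample_quotient \<tau> D D'"
    "lift_sign (torus_form \<tau>) L \<xi>" "lift_sign (torus_form \<tau>) L' \<xi>'"
  then interpret lifted_pair \<tau> D c L \<xi> D' c' L' \<xi>' by (rule lifted_pairI[OF assms(2)])
  show "\<exists>f. linear_iso f (HF L L') (HF_u L L' (lift \<xi> L) (lift \<xi>' L'))"
    using linear_iso_pullback[of 1] by auto
next
  fix D D' D'' c c' c'' L L' L'' \<xi> \<xi>' \<xi>'' x y
  assume h: "mirror_brane \<tau> D c L" "mirror_brane \<tau> D' c' L'" "mirror_brane \<tau> D'' c'' L''"
    "ample_quotient \<tau> D D'" "ample_quotient \<tau> D' D''"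
    "lift_sign (torus_form \<tau>) L \<xi>" "lift_sign (torus_form \<tau>) L' \<xi>'" "lift_sign (torus_form \<tau>) L'' \<xi>''"
    and xy: "x \<in> HF_u L' L'' (lift \<xi>' L') (lift \<xi>'' L'')" "y \<in> HF_u L L' (lift \<xi> L) (lift \<xi>' L')"
    "mu2_u \<tau> D D'' (lift \<xi> L) (lift \<xi>' L') (lift \<xi>'' L'') x y \<noteq> 0"
  interpret mirror_triple \<tau> D c L \<xi> D' c' L' \<xi>' D'' c'' L'' \<xi>'' by (rule mirror_tripleI[OF assms(2) h])
  show "products_correspond \<tau> D D'' L L' L'' (lift \<xi> L) (lift \<xi>' L') (lift \<xi>'' L'')"
    by (rule products_correspond_if[OF theta_constant_nonzero_if[OF xy]])
next
  fix D D' D'' c c' c'' L L' L''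
  assume "mirror_brane \<tau> D c L" "mirror_brane \<tau> D' c' L'" "mirror_brane \<tau> D'' c'' L''"
    "ample_quotient \<tau> D D'" "ample_quotient \<tau> D' D''"
  then show "\<exists>\<xi> \<xi>' \<xi>''. lift_sign (torus_form \<tau>) L \<xi> \<and> lift_sign (torus_form \<tau>) L' \<xi>' \<and>
      lift_sign (torus_form \<tau>) L'' \<xi>'' \<and>
      products_correspond \<tau> D D'' L L' L'' (lift \<xi> L) (lift \<xi>' L') (lift \<xi>'' L'')"
    by (rule exists_signs_products_correspond[OF assms(2)])
qed

end
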